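(* Let $\psi:\mathbb Z\curvearrowright Y$ be a minimal action on a Cantor set $Y$ and let \[0\longrightarrow H_0(Y\rtimes_\psi\mathbb Z)\xrightarrow{\ i\ }G\xrightarrow{\ q\ }Q\longrightarrow0\] be a short exact sequence of abelian groups with $Q\neq0$ countable and torsion-free. Suppose that $G$ is a simple dimension group, that $i$ is an order embedding, and that $i(H_0(Y\rtimes_\psi\mathbb Z))$ is order dense in $G$. Let $\phi:\mathbb Z\curvearrowright X$ be a minimal action on a Cantor set $X$, let $\pi:X\to Y$ be an almost one-to-one equivariant continuous map, and let $\alpha:H_0(X\rtimes_\phi\mathbb Z)\to G$ be an order isomorphism such that $\alpha\circ H_0^*(\pi)=i$ and such that the induced factor map $\pi:X\rtimes_\phi\mathbb Z\to Y\rtimes_\psi\mathbb Z$ is prime and at most two-to-one. Then the following hold. (1) The group $\pi^*(\mathsf F(Y\rtimes_\psi\mathbb Z))$ is maximal in $\mathsf F(X\rtimes_\phi\mathbb Z)$ if and only if $Q\otimes\mathbb Z/2=0$. (2) The group $\pi^*(\mathsf D(Y\rtimes_\psi\mathbb Z))$ is maximal in $\mathsf D(X\rtimes_\phi\mathbb Z)$.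
   Context: Groupoids. An étale groupoid is a second countable locally compact Hausdorff topological groupoid whose range map is a local homeomorphism; it is ample if its unit space is totally disconnected. $s(g)=g^{-1}g$, $r(g)=gg^{-1}$. A bisection is a subset on which $r$ and $s$ are injective. Effective means the interior of $\{g\mid r(g)=s(g)\}$ is the unit space; ample groupoids are assumed effective throughout. For a minimal $\mathbb Z$-action generated by a homeomorphism $\phi$ of a Cantor set $X$ (all orbits dense), the transformation groupoid $X\rtimes_\phi\mathbb Z$ is $X\times\mathbb Z$ with the product topology, $r(x,n)=x$, $s(x,n)=\phi^{-n}(x)$, $(x,n)(\phi^{-n}(x),m)=(x,n+m)$, and unit space $X$; it is a minimal, principal ample groupoid. Full groups. A full bisection of an ample groupoid $\mathcal G$ with compact unit space is a compact open bisection $U$ with $r(U)=s(U)=\mathcal G^{(0)}$; $\theta_U:=r\circ(s|_U)^{-1}$. $\mathsf F(\mathcal G)$ is the group of all such homeomorphisms $\theta_U$ of $\mathcal G^{(0)}$ and $\mathsf D(\mathcal G)$ is its commutator subgroup. Factor maps. A factor map $\pi:\mathcal G\to\mathcal H$ between ample groupoids is a surjective proper continuous homomorphism restricting to a bijection $r^{-1}(x)\to r^{-1}(\pi(x))$ for each $x\in\mathcal G^{(0)}$. It induces an injective homomorphism $\pi^*:\mathsf F(\mathcal H)\to\mathsf F(\mathcal G)$, $\pi^*(\theta_V)=\theta_{\pi^{-1}(V)}$. An equivariant continuous map $\pi:X\to Y$ between minimal $\mathbb Z$-actions induces the factor map $(x,n)\mapsto(\pi(x),n)$ of transformation groupoids.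 A factor map is at most two-to-one if all fibers of its restriction to unit spaces have at most two points; it is prime if it is not an isomorphism and, whenever $\pi=\pi_2\circ\pi_1$ with factor maps $\pi_1:\mathcal G\to\mathcal K$, $\pi_2:\mathcal K\to\mathcal H$, $\mathcal K$ ample, either $\pi_1$ or $\pi_2$ is an isomorphism. Dimension groups. $H_0(X\rtimes_\phi\mathbb Z)=C(X,\mathbb Z)/\{f\circ\phi-f\mid f\in C(X,\mathbb Z)\}$, ordered by the cone of classes of nonnegative functions; $H_0^*(\pi)$ is $[f]\mapsto[f\circ\pi]$. A dimension group is a countable, directed, unperforated ordered abelian group with the Riesz interpolation property; it is simple if every nonzero positive element is an order unit. An order embedding is an injective homomorphism $i$ with $i(a)\ge0\iff a\ge0$. A subgroup $K\subset G$ is order dense if whenever $g_1<g_2$ in $G$ there is $k\in K$ with $g_1<k<g_2$. An equivariant map $\pi:X\to Y$ is almost one-to-one if $\{y\in Y\mid\#\pi^{-1}(y)=1\}$ is dense in $Y$. *)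

theory Defs
  imports "HOL-Analysis.Analysis" "HOL-Algebra.Bij" "HOL-Algebra.Generated_Groups"
    "HOL-Algebra.Elementary_Groups" "HOL-Algebra.Free_Abelian_Groups"
begin

section \<open>Topological groupoids\<close>

text \<open>
  The product \<open>gmul\<close> and the inverse \<open>ginv\<close> are total functions in the logic; only the values of
  \<open>gmul\<close> on composable pairs of arrows, and of \<open>ginv\<close> on arrows, are meaningful.
  The arrows are the points of \<open>gtop\<close>, and the unit space is a subset of the arrows.
\<close>

record 'g groupoid =
  gtop :: "'g topology"
  gmul :: "'g \<Rightarrow> 'g \<Rightarrow> 'g"
  ginv :: "'g \<Rightarrow> 'g"

definition arr :: "'g groupoid \<Rightarrow> 'g set" where
  "arr G = topspace (gtop G)"

definition src :: "'g groupoid \<Rightarrow> 'g \<Rightarrow> 'g" where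
  "src G g = gmul G (ginv G g) g"

definition rng :: "'g groupoid \<Rightarrow> 'g \<Rightarrow> 'g" where
  "rng G g = gmul G g (ginv G g)"

definition units :: "'g groupoid \<Rightarrow> 'g set" where
  "units G = rng G ` arr G"

definition composable :: "'g groupoid \<Rightarrow> ('g \<times> 'g) set" where
  "composable G = {(g, h). g \<in> arr G \<and> h \<in> arr G \<and> src G g = rng G h}"

definition unit_space :: "'g groupoid \<Rightarrow> 'g topology" where
  "unit_space G = subtopology (gtop G) (units G)"

definition algebraic_groupoid :: "'g groupoid \<Rightarrow> bool" where
  "algebraic_groupoid G \<longleftrightarrow>
     (\<forall>g\<in>arr G. ginv G g \<in> arr G \<and> ginv G (ginv G g) = g) \<and>
     (\<forall>(g, h)\<in>composable G. gmul G g h \<in> arr G \<and>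
        src G (gmul G g h) = src G h \<and> rng G (gmul G g h) = rng G g \<and>
        gmul G (ginv G g) (gmul G g h) = h \<and> gmul G (gmul G g h) (ginv G h) = g) \<and>
     (\<forall>g h k. (g, h) \<in> composable G \<longrightarrow> (h, k) \<in> composable G \<longrightarrow>
        gmul G (gmul G g h) k = gmul G g (gmul G h k))"

definition topological_groupoid :: "'g groupoid \<Rightarrow> bool" where
  "topological_groupoid G \<longleftrightarrow> algebraic_groupoid G \<and>
     continuous_map (gtop G) (gtop G) (ginv G) \<and>
     continuous_map (subtopology (prod_topology (gtop G) (gtop G)) (composable G)) (gtop G)
       (\<lambda>(g, h). gmul G g h)"

definition local_homeomorphism :: "'a topology \<Rightarrow> 'b topology \<Rightarrow> ('a \<Rightarrow> 'b) \<Rightarrow> bool" where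
  "local_homeomorphism X Y f \<longleftrightarrow>
     (\<forall>x\<in>topspace X. \<exists>U. openin X U \<and> x \<in> U \<and> openin Y (f ` U) \<and>
        homeomorphic_map (subtopology X U) (subtopology Y (f ` U)) f)"

definition etale_groupoid :: "'g groupoid \<Rightarrow> bool" where
  "etale_groupoid G \<longleftrightarrow> topological_groupoid G \<and> second_countable (gtop G) \<and>
     locally_compact_space (gtop G) \<and> Hausdorff_space (gtop G) \<and>
     local_homeomorphism (gtop G) (unit_space G) (rng G)"

definition effective :: "'g groupoid \<Rightarrow> bool" where
  "effective G \<longleftrightarrow> gtop G interior_of {g \<in> arr G. rng G g = src G g} = units G"

definition totally_disconnected :: "'a topology \<Rightarrow> bool" where
  "totally_disconnected X \<longleftrightarrow> (\<forall>C. connectedin X C \<longrightarrow> (\<exists>a. C \<subseteq> {a}))"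

text \<open>Ample groupoids are effective by convention.\<close>

definition ample_groupoid :: "'g groupoid \<Rightarrow> bool" where
  "ample_groupoid G \<longleftrightarrow>
     etale_groupoid G \<and> totally_disconnected (unit_space G) \<and> effective G"

section \<open>Factor maps\<close>

definition groupoid_hom :: "'g groupoid \<Rightarrow> 'h groupoid \<Rightarrow> ('g \<Rightarrow> 'h) \<Rightarrow> bool" where
  "groupoid_hom G H \<pi> \<longleftrightarrow> \<pi> \<in> arr G \<rightarrow> arr H \<and>
     (\<forall>(g, h)\<in>composable G.
        (\<pi> g, \<pi> h) \<in> composable H \<and> \<pi> (gmul G g h) = gmul H (\<pi> g) (\<pi> h))"

definition groupoid_iso :: "'g groupoid \<Rightarrow> 'h groupoid \<Rightarrow> ('g \<Rightarrow> 'h) \<Rightarrow> bool" where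
  "groupoid_iso G H \<pi> \<longleftrightarrow> groupoid_hom G H \<pi> \<and> homeomorphic_map (gtop G) (gtop H) \<pi>"

definition factor_map :: "'g groupoid \<Rightarrow> 'h groupoid \<Rightarrow> ('g \<Rightarrow> 'h) \<Rightarrow> bool" where
  "factor_map G H \<pi> \<longleftrightarrow> groupoid_hom G H \<pi> \<and> continuous_map (gtop G) (gtop H) \<pi> \<and>
     proper_map (gtop G) (gtop H) \<pi> \<and> \<pi> ` arr G = arr H \<and>
     (\<forall>x\<in>units G. bij_betw \<pi> {g \<in> arr G. rng G g = x} {h \<in> arr H. rng H h = \<pi> x})"

text \<open>
  The intermediate groupoid \<open>K\<close> ranges over groupoids with arrows in the type of \<open>G\<close>. This is no
  restriction: \<open>\<pi>\<^sub>1\<close> maps \<open>arr G\<close> onto \<open>arr K\<close>, so every ample \<open>K\<close> occurring in a factorization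
  is isomorphic to one whose arrows form a subset of \<open>arr G\<close> (choose preimages and transport the
  structure).
\<close>

definition prime_factor_map :: "'g groupoid \<Rightarrow> 'h groupoid \<Rightarrow> ('g \<Rightarrow> 'h) \<Rightarrow> bool" where
  "prime_factor_map G H \<pi> \<longleftrightarrow> factor_map G H \<pi> \<and> \<not> groupoid_iso G H \<pi> \<and>
     (\<forall>(K :: 'g groupoid) \<pi>\<^sub>1 \<pi>\<^sub>2. ample_groupoid K \<longrightarrow>
        factor_map G K \<pi>\<^sub>1 \<longrightarrow> factor_map K H \<pi>\<^sub>2 \<longrightarrow>
        (\<forall>g\<in>arr G. \<pi> g = \<pi>\<^sub>2 (\<pi>\<^sub>1 g)) \<longrightarrow>
        groupoid_iso G K \<pi>\<^sub>1 \<or> groupoid_iso K H \<pi>\<^sub>2)"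

definition at_most_two_to_one :: "'g groupoid \<Rightarrow> 'h groupoid \<Rightarrow> ('g \<Rightarrow> 'h) \<Rightarrow> bool" where
  "at_most_two_to_one G H \<pi> \<longleftrightarrow>
     (\<forall>y\<in>units H. finite {x \<in> units G. \<pi> x = y} \<and> card {x \<in> units G. \<pi> x = y} \<le> 2)"

section \<open>Full groups\<close>

definition full_bisection :: "'g groupoid \<Rightarrow> 'g set \<Rightarrow> bool" where
  "full_bisection G U \<longleftrightarrow> compactin (gtop G) U \<and> openin (gtop G) U \<and>
     inj_on (rng G) U \<and> inj_on (src G) U \<and> rng G ` U = units G \<and> src G ` U = units G"

definition theta :: "'g groupoid \<Rightarrow> 'g set \<Rightarrow> 'g \<Rightarrow> 'g" where
  "theta G U = (\<lambda>x\<in>units G. rng G (inv_into U (src G) x))"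

definition full_group :: "'g groupoid \<Rightarrow> ('g \<Rightarrow> 'g) monoid" where
  "full_group G = (BijGroup (units G))\<lparr>carrier := {theta G U | U. full_bisection G U}\<rparr>"

definition commutator_full_group :: "'g groupoid \<Rightarrow> ('g \<Rightarrow> 'g) monoid" where
  "commutator_full_group G =
     (full_group G)\<lparr>carrier := derived (full_group G) (carrier (full_group G))\<rparr>"

text \<open>
  The induced homomorphism \<open>\<theta>\<^sub>V \<mapsto> \<theta>\<^bsub>\<pi>\<^sup>-\<^sup>1(V)\<^esub>\<close> between full groups; the full bisection \<open>V\<close>
  is determined by \<open>\<theta>\<^sub>V\<close> because ample groupoids are effective.
\<close>

definition full_group_pull ::
    "'g groupoid \<Rightarrow> 'h groupoid \<Rightarrow> ('g \<Rightarrow> 'h) \<Rightarrow> ('h \<Rightarrow> 'h) \<Rightarrow> ('g \<Rightarrow> 'g)" where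
  "full_group_pull G H \<pi> f =
     theta G {g \<in> arr G. \<pi> g \<in> (THE V. full_bisection H V \<and> theta H V = f)}"

definition maximal_subgroup :: "'a set \<Rightarrow> ('a, 'm) monoid_scheme \<Rightarrow> bool" where
  "maximal_subgroup M \<Gamma> \<longleftrightarrow> subgroup M \<Gamma> \<and> M \<noteq> carrier \<Gamma> \<and>
     (\<forall>H. subgroup H \<Gamma> \<longrightarrow> M \<subseteq> H \<longrightarrow> H = M \<or> H = carrier \<Gamma>)"

section \<open>Minimal actions of the integers on Cantor sets\<close>

definition cantor_set :: "'a topology \<Rightarrow> bool" where
  "cantor_set X \<longleftrightarrow>
     X homeomorphic_space
       product_topology (\<lambda>_ :: nat. discrete_topology (UNIV :: bool set)) UNIV"

definition iter :: "'a topology \<Rightarrow> ('a \<Rightarrow> 'a) \<Rightarrow> int \<Rightarrow> 'a \<Rightarrow> 'a" where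
  "iter X \<phi> n =
     (if n \<ge> 0 then \<phi> ^^ nat n else inv_into (topspace X) \<phi> ^^ nat (- n))"

definition minimal_action :: "'a topology \<Rightarrow> ('a \<Rightarrow> 'a) \<Rightarrow> bool" where
  "minimal_action X \<phi> \<longleftrightarrow> homeomorphic_map X X \<phi> \<and>
     (\<forall>x\<in>topspace X. X closure_of (range (\<lambda>n. iter X \<phi> n x)) = topspace X)"

definition equivariant_map ::
    "'a topology \<Rightarrow> ('a \<Rightarrow> 'a) \<Rightarrow> 'b topology \<Rightarrow> ('b \<Rightarrow> 'b) \<Rightarrow> ('a \<Rightarrow> 'b) \<Rightarrow> bool" where
  "equivariant_map X \<phi> Y \<psi> \<pi> \<longleftrightarrow>
     continuous_map X Y \<pi> \<and> (\<forall>x\<in>topspace X. \<pi> (\<phi> x) = \<psi> (\<pi> x))"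

definition almost_one_to_one :: "'a topology \<Rightarrow> 'b topology \<Rightarrow> ('a \<Rightarrow> 'b) \<Rightarrow> bool" where
  "almost_one_to_one X Y \<pi> \<longleftrightarrow>
     Y closure_of {y \<in> topspace Y. card {x \<in> topspace X. \<pi> x = y} = 1} = topspace Y"

text \<open>
  In the transformation groupoid, \<open>r(x,n) = (x,0)\<close> and \<open>s(x,n) = (\<phi>\<^sup>-\<^sup>n(x),0)\<close>: a point \<open>x\<close>
  of the space is identified with the unit \<open>(x,0)\<close>.
\<close>

definition transformation_groupoid :: "'a topology \<Rightarrow> ('a \<Rightarrow> 'a) \<Rightarrow> ('a \<times> int) groupoid" where
  "transformation_groupoid X \<phi> =
     \<lparr>gtop = prod_topology X (discrete_topology UNIV),
      gmul = (\<lambda>(x, n) (y, m). (x, n + m)),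
      ginv = (\<lambda>(x, n). (iter X \<phi> (- n) x, - n))\<rparr>"

lemma rng_transformation_groupoid:
  "rng (transformation_groupoid X \<phi>) (x, n) = (x, 0)"
  by (simp add: rng_def transformation_groupoid_def)

lemma src_transformation_groupoid:
  "src (transformation_groupoid X \<phi>) (x, n) = (iter X \<phi> (- n) x, 0)"
  by (simp add: src_def transformation_groupoid_def)

lemma units_transformation_groupoid:
  "units (transformation_groupoid X \<phi>) = topspace X \<times> {0}"
  unfolding units_def
  by (force simp: arr_def rng_transformation_groupoid image_iff transformation_groupoid_def rng_def)

definition induced_factor_map :: "('a \<Rightarrow> 'b) \<Rightarrow> 'a \<times> int \<Rightarrow> 'b \<times> int" where
  "induced_factor_map \<pi> = (\<lambda>(x, n). (\<pi> x, n))"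

section \<open>Ordered abelian groups\<close>

text \<open>
  Groups are written multiplicatively, as in \<open>HOL-Algebra\<close>; \<open>pos\<close> is the cone of elements that
  are \<open>\<ge> 0\<close> in additive notation.
\<close>

record 'a ordered_group = "'a monoid" +
  pos :: "'a set"

definition ole :: "('a, 'm) ordered_group_scheme \<Rightarrow> 'a \<Rightarrow> 'a \<Rightarrow> bool" where
  "ole G a b \<longleftrightarrow> b \<otimes>\<^bsub>G\<^esub> inv\<^bsub>G\<^esub> a \<in> pos G"

definition oless :: "('a, 'm) ordered_group_scheme \<Rightarrow> 'a \<Rightarrow> 'a \<Rightarrow> bool" where
  "oless G a b \<longleftrightarrow> ole G a b \<and> a \<noteq> b"

definition ordered_abelian_group :: "('a, 'm) ordered_group_scheme \<Rightarrow> bool" where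
  "ordered_abelian_group G \<longleftrightarrow> comm_group G \<and> pos G \<subseteq> carrier G \<and>
     (\<forall>a\<in>pos G. \<forall>b\<in>pos G. a \<otimes>\<^bsub>G\<^esub> b \<in> pos G) \<and>
     {a \<in> pos G. inv\<^bsub>G\<^esub> a \<in> pos G} = {\<one>\<^bsub>G\<^esub>}"

definition dimension_group :: "('a, 'm) ordered_group_scheme \<Rightarrow> bool" where
  "dimension_group G \<longleftrightarrow> ordered_abelian_group G \<and> countable (carrier G) \<and>
     (\<forall>a\<in>carrier G. \<forall>b\<in>carrier G. \<exists>c\<in>carrier G. ole G a c \<and> ole G b c) \<and>
     (\<forall>a\<in>carrier G. \<forall>n::nat. n > 0 \<longrightarrow> a [^]\<^bsub>G\<^esub> n \<in> pos G \<longrightarrow> a \<in> pos G) \<and>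
     (\<forall>a\<^sub>1\<in>carrier G. \<forall>a\<^sub>2\<in>carrier G. \<forall>b\<^sub>1\<in>carrier G. \<forall>b\<^sub>2\<in>carrier G.
        ole G a\<^sub>1 b\<^sub>1 \<longrightarrow> ole G a\<^sub>1 b\<^sub>2 \<longrightarrow> ole G a\<^sub>2 b\<^sub>1 \<longrightarrow> ole G a\<^sub>2 b\<^sub>2 \<longrightarrow>
        (\<exists>c\<in>carrier G. ole G a\<^sub>1 c \<and> ole G a\<^sub>2 c \<and> ole G c b\<^sub>1 \<and> ole G c b\<^sub>2))"

definition order_unit :: "('a, 'm) ordered_group_scheme \<Rightarrow> 'a \<Rightarrow> bool" where
  "order_unit G u \<longleftrightarrow> u \<in> pos G \<and> (\<forall>a\<in>carrier G. \<exists>n::nat. ole G a (u [^]\<^bsub>G\<^esub> n))"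

definition simple_dimension_group :: "('a, 'm) ordered_group_scheme \<Rightarrow> bool" where
  "simple_dimension_group G \<longleftrightarrow> dimension_group G \<and>
     (\<forall>u\<in>pos G. u \<noteq> \<one>\<^bsub>G\<^esub> \<longrightarrow> order_unit G u)"

definition order_embedding ::
    "('a, 'm) ordered_group_scheme \<Rightarrow> ('b, 'n) ordered_group_scheme \<Rightarrow> ('a \<Rightarrow> 'b) \<Rightarrow> bool" where
  "order_embedding G H i \<longleftrightarrow>
     i \<in> mon G H \<and> (\<forall>a\<in>carrier G. i a \<in> pos H \<longleftrightarrow> a \<in> pos G)"

definition order_isomorphism ::
    "('a, 'm) ordered_group_scheme \<Rightarrow> ('b, 'n) ordered_group_scheme \<Rightarrow> ('a \<Rightarrow> 'b) \<Rightarrow> bool" where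
  "order_isomorphism G H \<alpha> \<longleftrightarrow>
     \<alpha> \<in> iso G H \<and> (\<forall>a\<in>carrier G. \<alpha> a \<in> pos H \<longleftrightarrow> a \<in> pos G)"

definition order_dense :: "('a, 'm) ordered_group_scheme \<Rightarrow> 'a set \<Rightarrow> bool" where
  "order_dense G K \<longleftrightarrow>
     (\<forall>a\<in>carrier G. \<forall>b\<in>carrier G. oless G a b \<longrightarrow> (\<exists>k\<in>K. oless G a k \<and> oless G k b))"

definition torsion_free_group :: "('a, 'm) monoid_scheme \<Rightarrow> bool" where
  "torsion_free_group A \<longleftrightarrow>
     (\<forall>a\<in>carrier A. \<forall>n::nat. n > 0 \<longrightarrow> a [^]\<^bsub>A\<^esub> n = \<one>\<^bsub>A\<^esub> \<longrightarrow> a = \<one>\<^bsub>A\<^esub>)"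

text \<open>The short exact sequence \<open>0 \<rightarrow> A \<rightarrow> B \<rightarrow> C \<rightarrow> 0\<close>; the library's
  \<open>short_exact_sequence\<close> needs all groups to live in one type.\<close>

definition exact_sequence ::
    "('a, 'm) monoid_scheme \<Rightarrow> ('b, 'n) monoid_scheme \<Rightarrow> ('c, 'p) monoid_scheme \<Rightarrow>
     ('a \<Rightarrow> 'b) \<Rightarrow> ('b \<Rightarrow> 'c) \<Rightarrow> bool" where
  "exact_sequence A B C i q \<longleftrightarrow>
     comm_group A \<and> comm_group B \<and> comm_group C \<and>
     i \<in> mon A B \<and> q \<in> epi B C \<and> i ` carrier A = kernel B C q"

section \<open>Tensor product of abelian groups\<close>

definition tensor_relations ::
    "('a, 'm) monoid_scheme \<Rightarrow> ('b, 'n) monoid_scheme \<Rightarrow> ('a \<times> 'b \<Rightarrow>\<^sub>0 int) set" where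
  "tensor_relations A B =
     {frag_of (a \<otimes>\<^bsub>A\<^esub> a', b) - frag_of (a, b) - frag_of (a', b) | a a' b.
        a \<in> carrier A \<and> a' \<in> carrier A \<and> b \<in> carrier B} \<union>
     {frag_of (a, b \<otimes>\<^bsub>B\<^esub> b') - frag_of (a, b) - frag_of (a, b') | a b b'.
        a \<in> carrier A \<and> b \<in> carrier B \<and> b' \<in> carrier B}"

definition tensor_group ::
    "('a, 'm) monoid_scheme \<Rightarrow> ('b, 'n) monoid_scheme \<Rightarrow> ('a \<times> 'b \<Rightarrow>\<^sub>0 int) set monoid" where
  "tensor_group A B =
     (let F = free_Abelian_group (carrier A \<times> carrier B)
      in F Mod generate F (tensor_relations A B))"

section \<open>The ordered group \<open>H\<^sub>0\<close>\<close>

text \<open>The group \<open>C(X,\<int>)\<close>; functions are represented extensionally, so that equality on \<open>X\<close> is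
  equality.\<close>

definition CXZ :: "'a topology \<Rightarrow> ('a \<Rightarrow> int) monoid" where
  "CXZ X =
     \<lparr>carrier = {f \<in> extensional (topspace X). continuous_map X (discrete_topology UNIV) f},
      mult = (\<lambda>f g. \<lambda>x\<in>topspace X. f x + g x),
      one = (\<lambda>x\<in>topspace X. 0)\<rparr>"

definition coboundaries :: "'a topology \<Rightarrow> ('a \<Rightarrow> 'a) \<Rightarrow> ('a \<Rightarrow> int) set" where
  "coboundaries X \<phi> = (\<lambda>f. \<lambda>x\<in>topspace X. f (\<phi> x) - f x) ` carrier (CXZ X)"

definition H0_class :: "'a topology \<Rightarrow> ('a \<Rightarrow> 'a) \<Rightarrow> ('a \<Rightarrow> int) \<Rightarrow> ('a \<Rightarrow> int) set" where
  "H0_class X \<phi> f = coboundaries X \<phi> #>\<^bsub>CXZ X\<^esub> f"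

definition H0 :: "'a topology \<Rightarrow> ('a \<Rightarrow> 'a) \<Rightarrow> ('a \<Rightarrow> int) set ordered_group" where
  "H0 X \<phi> = monoid.extend (CXZ X Mod coboundaries X \<phi>)
     (ordered_group.fields {H0_class X \<phi> f | f. f \<in> carrier (CXZ X) \<and> (\<forall>x\<in>topspace X. f x \<ge> 0)})"

lemma H0_simps:
  "carrier (H0 X \<phi>) = rcosets\<^bsub>CXZ X\<^esub> coboundaries X \<phi>"
  "mult (H0 X \<phi>) = set_mult (CXZ X)"
  "one (H0 X \<phi>) = coboundaries X \<phi>"
  "pos (H0 X \<phi>) =
     {H0_class X \<phi> f | f. f \<in> carrier (CXZ X) \<and> (\<forall>x\<in>topspace X. f x \<ge> 0)}"
  by (simp_all add: H0_def FactGroup_def monoid.defs ordered_group.defs)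

text \<open>The map \<open>[f] \<mapsto> [f \<circ> \<pi>]\<close>. All members of the union are equal when \<open>\<pi>\<close> is equivariant, so the
  union over the representatives of a class is the well-defined value of the induced map.\<close>

definition H0_pull ::
    "'a topology \<Rightarrow> ('a \<Rightarrow> 'a) \<Rightarrow> ('a \<Rightarrow> 'b) \<Rightarrow> ('b \<Rightarrow> int) set \<Rightarrow> ('a \<Rightarrow> int) set" where
  "H0_pull X \<phi> \<pi> c = (\<Union>f\<in>c. H0_class X \<phi> (\<lambda>x\<in>topspace X. f (\<pi> x)))"

end

theory Submission imports Defs "HOL-Combinatorics.Permutations" begin

text \<open>Only the clopen algebra of a Cantor system matters. An element of the full group \<open>F\<close> moves each point along
  its orbit by a locally constant displacement. Removing descents one by one, as in bubble sort, writes it as a power of the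
  generator times transpositions of clopen sets \<open>A\<close> with their translates, so modulo commutators it is determined by
  its mean displacement and by the class modulo 2 of the sum of the sets \<open>A\<close>; the latter is read off from the
  inversion count. Hence the commutator subgroup \<open>D\<close> is the kernel of these two invariants, and it is generated by
  three-cycles of clopen sets. Since \<open>H\<^sub>0(Y)\<close> embeds in \<open>H\<^sub>0(X)\<close> with torsion-free quotient \<open>Q\<close>, both
  invariants are reflected by \<open>\<pi>\<close>: lifts from \<open>F(Y)\<close> that lie in \<open>D(X)\<close> come from \<open>D(Y)\<close>.

  Let a subgroup \<open>K\<close> contain the lift of \<open>D(Y)\<close> and some \<open>g\<close> that is not a lift. Then \<open>g\<close> displaces the
  two points of some fibre differently, and commutators of conjugates by \<open>g\<close> of lifted three-cycles with lifted three-cycles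
  give a three-cycle in \<open>K\<close> on a clopen set separating that fibre. The clopen sets all of whose small three-cycles lie
  in \<open>K\<close> form an invariant Boolean algebra containing the preimages of the clopen sets of \<open>Y\<close>, which is everything by
  primeness. So \<open>K\<close> contains \<open>D(X)\<close>. This proves (2), and reduces (1) to whether every class of \<open>H\<^sub>0(X)\<close> is
  modulo 2 the image of a class of \<open>H\<^sub>0(Y)\<close>, that is, whether \<open>Q = 2Q\<close>.\<close>

text \<open>Three-cycles that share exactly one level have as commutator a three-cycle over the
  intersection of their bases. This turns membership in a subgroup into a Boolean algebra of bases,
  the form in which primeness can be applied. Lifted elements can cut a base only along preimages
  from \<open>Y\<close>, so a non-lifted element has to supply the cut inside a fibre; fibres of at
  most two points matter because a neighbourhood of the fibre then splits into just two pieces, one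
  of which can be kept clear of a suitable lifted cycle. Inversions measure the sign because an
  orbit is ordered like the integers and an element of the full group permutes it with bounded
  displacement. The total count along an orbit is infinite in general, so inversions are counted by
  their left end, and only the class of the resulting clopen set modulo coboundaries is additive.
  Torsion-freeness of \<open>Q\<close> is what controls the class modulo 2: if a pulled back class
  is twice some class, its half gives an element of \<open>Q\<close> killed by 2, and this half must
  come from \<open>Y\<close> before the class can be divided downstairs.\<close>

abbreviation iv :: "('a \<Rightarrow> 'a) \<Rightarrow> 'a \<Rightarrow> 'a" where
  "iv f \<equiv> inv_into UNIV f"

definition commutator :: "('a \<Rightarrow> 'a) \<Rightarrow> ('a \<Rightarrow> 'a) \<Rightarrow> 'a \<Rightarrow> 'a" where
  "commutator f g = f \<circ> g \<circ> iv f \<circ> iv g"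

lemma iv_simps:
  assumes "bij f"
  shows "f (iv f x) = x" "iv f (f x) = x" "f \<circ> iv f = id" "iv f \<circ> f = id"
    "bij (iv f)" "iv (iv f) = f"
  using assms
  by (auto simp: bij_is_surj surj_f_inv_f bij_is_inj inv_f_f fun_eq_iff bij_imp_bij_inv inv_inv_eq)

lemma iv_comp: "bij f \<Longrightarrow> bij g \<Longrightarrow> iv (f \<circ> g) = iv g \<circ> iv f"
  by (rule o_inv_distrib)

lemma iv_eqI: "bij f \<Longrightarrow> f \<circ> g = id \<Longrightarrow> iv f = g"
  by (metis comp_id fun.map_comp inv_o_cancel bij_is_inj id_comp)

lemma disjoint_support_commute:
  assumes "bij f" "bij g" "\<And>x. f x = x \<or> g x = x"
  shows "f \<circ> g = g \<circ> f"
proof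
  fix x
  have inj: "f x = f y \<longleftrightarrow> x = y" "g x = g y \<longleftrightarrow> x = y" for x y
    using assms(1,2) by (auto simp: bij_def inj_eq)
  show "(f \<circ> g) x = (g \<circ> f) x"
    using assms(3)[of x] assms(3)[of "f x"] assms(3)[of "g x"] inj by (metis comp_apply)
qed

section \<open>Minimal actions on clopen algebras\<close>

text \<open>\<open>B\<close> is the algebra of clopen subsets of a Cantor set \<open>S\<close>. The action is extended by the identity outside
  \<open>S\<close>, so that the full group consists of permutations of the whole type.\<close>

locale clopen_system =
  fixes S :: "'a set" and T :: "int \<Rightarrow> 'a \<Rightarrow> 'a" and B :: "'a set set"
  assumes B_sub: "C \<in> B \<Longrightarrow> C \<subseteq> S" and S_B: "S \<in> B"
    and B_Int: "C \<in> B \<Longrightarrow> D \<in> B \<Longrightarrow> C \<inter> D \<in> B"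
    and B_Diff: "C \<in> B \<Longrightarrow> D \<in> B \<Longrightarrow> C - D \<in> B"
    and T_B: "C \<in> B \<Longrightarrow> T n ` C \<in> B"
    and T_add: "T m (T n x) = T (m + n) x"
    and T_0: "T 0 x = x"
    and T_S: "x \<in> S \<Longrightarrow> T n x \<in> S"
    and T_out: "x \<notin> S \<Longrightarrow> T n x = x"
    and sep: "x \<in> S \<Longrightarrow> y \<in> S \<Longrightarrow> x \<noteq> y \<Longrightarrow> \<exists>C\<in>B. x \<in> C \<and> y \<notin> C"
    and cpt: "U \<subseteq> B \<Longrightarrow> S \<subseteq> \<Union>U \<Longrightarrow> \<exists>V\<subseteq>U. finite V \<and> S \<subseteq> \<Union>V"
    and free: "x \<in> S \<Longrightarrow> T n x = x \<Longrightarrow> n = 0"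
    and minimal: "C \<in> B \<Longrightarrow> C \<noteq> {} \<Longrightarrow> x \<in> S \<Longrightarrow> \<exists>n. T n x \<in> C"
    and perfect: "C \<in> B \<Longrightarrow> finite C \<Longrightarrow> C = {}"
begin

lemma B_empty: "{} \<in> B" using B_Diff[OF S_B S_B] by simp

lemma B_Un: assumes "C \<in> B" "D \<in> B" shows "C \<union> D \<in> B"
proof -
  have "C \<union> D = S - ((S - C) \<inter> (S - D))" using B_sub assms by blast
  then show ?thesis using assms B_Diff B_Int S_B by metis
qed

lemma T_eq_iff: "T n x = T n y \<longleftrightarrow> x = y"
  by (metis T_add T_0 add.left_inverse)

lemma T_in_iff: "T n x \<in> S \<longleftrightarrow> x \<in> S"
  by (metis T_out T_S)

lemma T_inj: "x \<in> S \<Longrightarrow> T m x = T n x \<longleftrightarrow> m = n"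
proof
  assume x: "x \<in> S" "T m x = T n x"
  then have "T (m - n) x = x" using T_add[of "-n" m x] T_add[of "-n" n x] by (simp add: T_0)
  then show "m = n" using free x by fastforce
qed simp

lemma T_mem_iff: "x \<in> T n ` C \<longleftrightarrow> T (- n) x \<in> C"
proof -
  have "x = T n (T (-n) x)" by (simp add: T_add T_0)
  then show ?thesis by (metis T_add T_0 add.left_inverse image_iff)
qed

lemma T_comp: "T m \<circ> T n = T (m + n)" by (auto simp: T_add)

lemma T_bij: "bij (T n)"
  by (rule o_bij[of "T (-n)"]) (auto simp: T_add T_0)

lemma iv_T: "iv (T n) = T (- n)"
  by (rule iv_eqI[OF T_bij]) (auto simp: T_add T_0)

lemma T_image_image: "T m ` T n ` C = T (m + n) ` C"
  by (auto simp: image_image T_add)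

lemma image_T_subset_iff: "T n ` D \<subseteq> C \<longleftrightarrow> D \<subseteq> T (- n) ` C"
proof -
  have "x \<in> T (- n) ` C \<longleftrightarrow> T n x \<in> C" for x using T_mem_iff[of x "- n" C] by simp
  then show ?thesis by blast
qed

lemma T_0_image: "T 0 ` C = C" by (auto simp: T_0)

text \<open>As \<open>C\<close> has no finite nonempty clopen subset, it can be shrunk to a nonempty
  clopen set that avoids the finitely many points \<open>T n x\<close> with \<open>n\<close> in
  \<open>N\<close>; minimality then produces a visit at another time.\<close>

lemma nonempty_open_infinitely_often:
  assumes "C \<in> B" "C \<noteq> {}" "x \<in> S" "finite N" shows "\<exists>n. n \<notin> N \<and> T n x \<in> C"
proof -
  have 1: "\<exists>D\<in>B. D \<subseteq> C \<and> D \<noteq> {} \<and> (\<forall>n\<in>N. T n x \<notin> D)"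
    using assms(4)
  proof induction
    case (insert n N)
    then obtain D where D: "D \<in> B" "D \<subseteq> C" "D \<noteq> {}" "\<forall>n\<in>N. T n x \<notin> D" by auto
    have "infinite D" using D perfect by blast
    then obtain z where z: "z \<in> D" "z \<noteq> T n x"
      by (metis finite.emptyI finite.insertI finite_subset insertI1 subsetI)
    then obtain E where E: "E \<in> B" "z \<in> E" "T n x \<notin> E"
      using sep[of z "T n x"] D B_sub assms(3) T_S by blast
    have "D \<inter> E \<in> B" "z \<in> D \<inter> E" using B_Int D E z by auto
    then show ?case using D E by (intro bexI[of _ "D \<inter> E"]) auto
  qed (use assms in auto)
  then obtain D where D: "D \<in> B" "D \<subseteq> C" "D \<noteq> {}" "\<forall>n\<in>N. T n x \<notin> D" by auto
  then show ?thesis using minimal[OF D(1,3) assms(3)] by blast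
qed

text \<open>\<open>P\<close> holds for all sufficiently small clopen sets near \<open>x\<close>, including those that do not contain \<open>x\<close>.\<close>

definition near :: "'a \<Rightarrow> ('a set \<Rightarrow> bool) \<Rightarrow> bool" where
  "near x P \<longleftrightarrow> (\<exists>C\<in>B. x \<in> C \<and> (\<forall>D\<in>B. D \<subseteq> C \<longrightarrow> P D))"

lemma near_conj: "near x P \<Longrightarrow> near x Q \<Longrightarrow> near x (\<lambda>C. P C \<and> Q C)"
  unfolding near_def by (metis B_Int Int_iff le_inf_iff)

lemma near_mono: "near x P \<Longrightarrow> (\<And>C. C \<in> B \<Longrightarrow> P C \<Longrightarrow> Q C) \<Longrightarrow> near x Q"
  unfolding near_def by metis

lemma near_True: "x \<in> S \<Longrightarrow> P \<Longrightarrow> near x (\<lambda>_. P)"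
  unfolding near_def using S_B by auto

lemma near_ball: "finite I \<Longrightarrow> x \<in> S \<Longrightarrow> (\<And>i. i \<in> I \<Longrightarrow> near x (P i)) \<Longrightarrow> near x (\<lambda>C. \<forall>i\<in>I. P i C)"
proof (induction rule: finite_induct)
  case (insert i I)
  then have "near x (\<lambda>C. P i C \<and> (\<forall>i\<in>I. P i C))" by (intro near_conj) auto
  then show ?case by (rule near_mono) auto
qed (simp add: near_True)

lemma near_subset: "D \<in> B \<Longrightarrow> x \<in> D \<Longrightarrow> near x (\<lambda>C. C \<subseteq> D)"
  unfolding near_def by auto

lemma near_ex: "near x P \<Longrightarrow> \<exists>C\<in>B. x \<in> C \<and> P C"
  unfolding near_def by auto

lemma near_T: assumes "near (T n x) P" shows "near x (\<lambda>C. P (T n ` C))"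
proof -
  obtain C where C: "C \<in> B" "T n x \<in> C" "\<forall>D\<in>B. D \<subseteq> C \<longrightarrow> P D"
    using assms unfolding near_def by auto
  have "T (-n) ` C \<in> B" using C T_B by auto
  moreover have "x \<in> T (-n) ` C" using C by (simp add: T_mem_iff)
  moreover have "P (T n ` D)" if D: "D \<in> B" "D \<subseteq> T (-n) ` C" for D
  proof -
    have "T n ` D \<subseteq> C" using D by (simp add: image_T_subset_iff)
    then show ?thesis using D C T_B by auto
  qed
  ultimately show ?thesis unfolding near_def by auto
qed

lemma near_sep: assumes "x \<in> S" "y \<in> S" "x \<noteq> y" shows "near x (\<lambda>C. y \<notin> C)"
  using sep[OF assms] unfolding near_def by auto

section \<open>Towers of disjoint translates, and induction over small clopen pieces\<close>

definition tower :: "'a set \<Rightarrow> int set \<Rightarrow> bool" where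
  "tower C J \<longleftrightarrow> (\<forall>i\<in>J. \<forall>j\<in>J. i \<noteq> j \<longrightarrow> T i ` C \<inter> T j ` C = {})"

lemma tower_mono: "tower C J \<Longrightarrow> D \<subseteq> C \<Longrightarrow> I \<subseteq> J \<Longrightarrow> tower D I"
  unfolding tower_def by blast

lemma tower_eqD: "tower C J \<Longrightarrow> i \<in> J \<Longrightarrow> j \<in> J \<Longrightarrow> c \<in> C \<Longrightarrow> d \<in> C \<Longrightarrow> T i c = T j d \<Longrightarrow> i = j \<and> c = d"
  unfolding tower_def by (metis T_eq_iff disjoint_iff image_eqI)

lemma tower_T: "tower (T n ` C) J \<longleftrightarrow> tower C ((+) n ` J)"
  by (auto simp: tower_def T_image_image add.commute)

lemma near_disj:
  assumes "x \<in> S" "i \<noteq> j" shows "near x (\<lambda>C. T i ` C \<inter> T j ` C = {})"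
proof -
  have "T i x \<noteq> T j x" using assms T_inj by auto
  then obtain C where C: "C \<in> B" "T i x \<in> C" "T j x \<notin> C" using sep assms T_S by blast
  define D where "D = T (-i) ` C \<inter> T (-j) ` (S - C)"
  have "D \<in> B" unfolding D_def using C B_Int B_Diff S_B T_B by auto
  moreover have "x \<in> D" unfolding D_def using C assms T_S by (simp add: T_mem_iff)
  moreover have "T i ` E \<inter> T j ` E = {}" if "E \<subseteq> D" for E
  proof -
    have "T i ` E \<subseteq> C" "T j ` E \<subseteq> S - C" using that unfolding D_def by (auto simp only: image_T_subset_iff)
    then show ?thesis by auto
  qed
  ultimately show ?thesis unfolding near_def by blast
qed

lemma near_tower: assumes "x \<in> S" "finite J" shows "near x (\<lambda>C. tower C J)"
proof -
  have "near x (\<lambda>C. \<forall>i\<in>J. \<forall>j\<in>J. i \<noteq> j \<longrightarrow> T i ` C \<inter> T j ` C = {})"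
  proof (intro near_ball assms)
    fix i j assume "i \<in> J" "j \<in> J"
    show "near x (\<lambda>C. i \<noteq> j \<longrightarrow> T i ` C \<inter> T j ` C = {})"
      by (cases "i = j") (use near_disj[OF assms(1)] near_True[OF assms(1)] in simp_all)
  qed
  then show ?thesis unfolding tower_def .
qed

text \<open>Compactness gives a finite cover by sets all of whose clopen subsets satisfy
  \<open>P\<close> after intersection with \<open>D\<close>. The cover is made disjoint by
  subtracting the union of the members already treated. This is why \<open>near\<close> quantifies
  over all smaller clopen sets: a difference need not contain the point around which its set was
  chosen.\<close>

lemma local_induct:
  assumes D: "D \<in> B" and e: "P {}"
    and U: "\<And>C1 C2. C1 \<in> B \<Longrightarrow> C2 \<in> B \<Longrightarrow> C1 \<inter> C2 = {} \<Longrightarrow> C1 \<subseteq> D \<Longrightarrow> C2 \<subseteq> D \<Longrightarrow> P C1 \<Longrightarrow> P C2 \<Longrightarrow> P (C1 \<union> C2)"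
    and L: "\<And>x. x \<in> D \<Longrightarrow> near x (\<lambda>C. C \<subseteq> D \<longrightarrow> P C)"
  shows "P D"
proof -
  have L': "near x (\<lambda>C. P (C \<inter> D))" if x: "x \<in> S" for x
  proof (cases "x \<in> D")
    case True
    from L[OF this] obtain C where C: "C \<in> B" "x \<in> C" "\<forall>E\<in>B. E \<subseteq> C \<longrightarrow> E \<subseteq> D \<longrightarrow> P E"
      unfolding near_def by auto
    then show ?thesis unfolding near_def
      by (meson B_Int D Int_lower1 Int_lower2 order_trans)
  next
    case False
    then have "near x (\<lambda>C. C \<subseteq> S - D)" using near_subset[of "S - D" x] B_Diff S_B D x by auto
    then show ?thesis
    proof (rule near_mono)
      fix C assume "C \<subseteq> S - D" then have "C \<inter> D = {}" by auto
      then show "P (C \<inter> D)" using e by simp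
    qed
  qed
  define U where "U = {C\<in>B. \<forall>E\<in>B. E \<subseteq> C \<longrightarrow> P (E \<inter> D)}"
  have "U \<subseteq> B" "S \<subseteq> \<Union>U" using L' unfolding near_def U_def by blast+
  then obtain V where V: "V \<subseteq> U" "finite V" "S \<subseteq> \<Union>V" using cpt by meson
  have "P (\<Union>V \<inter> D) \<and> \<Union>V \<in> B" using V(2,1)
  proof (induction rule: finite_induct)
    case empty
    then show ?case using e B_empty by simp
  next
    case (insert C V)
    then have V: "\<Union>V \<in> B" "P (\<Union>V \<inter> D)" and C: "C \<in> U" "C \<in> B" by (auto simp: U_def)
    have "C - \<Union>V \<in> B" using C V B_Diff by auto
    then have 1: "P ((C - \<Union>V) \<inter> D)" using C by (auto simp: U_def)
    have "P ((\<Union>V \<inter> D) \<union> ((C - \<Union>V) \<inter> D))"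
      using 1 V(2) \<open>C - \<Union>V \<in> B\<close> V(1) D B_Int by (intro assms(3)) auto
    moreover have "(\<Union>V \<inter> D) \<union> ((C - \<Union>V) \<inter> D) = \<Union>(insert C V) \<inter> D" by auto
    moreover have "\<Union>(insert C V) \<in> B" using B_Un[OF C(2) V(1)] by simp
    ultimately show ?case by simp
  qed
  moreover have "\<Union>V \<inter> D = D" using V(3) B_sub[OF D] by auto
  ultimately show ?thesis by simp
qed

section \<open>The topological full group and its displacement cocycle\<close>

text \<open>Each point of \<open>S\<close> has a neighbourhood on which \<open>f\<close> is a single
  power of the action. As the action is free the exponent is unique, which makes \<open>disp\<close>
  well defined and locally constant on \<open>S\<close>.\<close>

definition F :: "('a \<Rightarrow> 'a) set" where
  "F = {f. bij f \<and> (\<forall>x. x \<notin> S \<longrightarrow> f x = x) \<and> (\<forall>x\<in>S. \<exists>n. near x (\<lambda>C. \<forall>z\<in>C. f z = T n z))}"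

definition disp :: "('a \<Rightarrow> 'a) \<Rightarrow> 'a \<Rightarrow> int" where
  "disp f x = (THE n. f x = T n x)"

lemma disp_eqI: "x \<in> S \<Longrightarrow> f x = T n x \<Longrightarrow> disp f x = n"
  unfolding disp_def using T_inj by auto

lemma F_bij: "f \<in> F \<Longrightarrow> bij f" by (simp add: F_def)
lemma F_out: "f \<in> F \<Longrightarrow> x \<notin> S \<Longrightarrow> f x = x" by (simp add: F_def)

lemma F_near: assumes "f \<in> F" "x \<in> S" shows "near x (\<lambda>C. \<forall>z\<in>C. f z = T (disp f x) z)"
proof -
  obtain n where n: "near x (\<lambda>C. \<forall>z\<in>C. f z = T n z)" using assms by (auto simp: F_def)
  then have "f x = T n x" using near_ex by blast
  then have "disp f x = n" using disp_eqI assms by auto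
  then show ?thesis using n by simp
qed

lemma F_disp: "f \<in> F \<Longrightarrow> x \<in> S \<Longrightarrow> f x = T (disp f x) x"
  using F_near near_ex by blast

lemma F_near_disp: assumes "f \<in> F" "x \<in> S" shows "near x (\<lambda>C. \<forall>z\<in>C. disp f z = disp f x)"
  by (rule near_mono[OF F_near[OF assms]]) (meson B_sub disp_eqI subsetD)

lemma F_S: "f \<in> F \<Longrightarrow> x \<in> S \<Longrightarrow> f x \<in> S"
  using F_disp T_S by metis

lemma F_S_iff: "f \<in> F \<Longrightarrow> f x \<in> S \<longleftrightarrow> x \<in> S"
  by (metis F_S F_out)

lemma T_F: "T n \<in> F"
proof -
  have "near x (\<lambda>C. \<forall>z\<in>C. T n z = T n z)" if "x \<in> S" for x using near_True[OF that] by simp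
  then show ?thesis unfolding F_def using T_bij T_out by blast
qed

lemma id_F: "id \<in> F" 
proof -
  have "T 0 = id" by (auto simp: T_0)
  then show ?thesis using T_F[of 0] by simp
qed

lemma F_comp: assumes "f \<in> F" "g \<in> F" shows "f \<circ> g \<in> F"
proof -
  have "\<exists>n. near x (\<lambda>C. \<forall>z\<in>C. (f \<circ> g) z = T n z)" if x: "x \<in> S" for x
  proof -
    have "near (T (disp g x) x) (\<lambda>C. \<forall>z\<in>C. f z = T (disp f (g x)) z)"
      using F_near[OF assms(1) F_S[OF assms(2) x]] F_disp[OF assms(2) x] by simp
    from near_conj[OF F_near[OF assms(2) x] near_T[OF this]] show ?thesis
      by (intro exI[of _ "disp f (g x) + disp g x"], elim near_mono) (auto simp: T_add)
  qed
  then show ?thesis using assms by (auto simp: F_def bij_comp)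
qed

lemma F_inv: assumes "f \<in> F" shows "iv f \<in> F"
proof -
  note b = iv_simps[OF F_bij[OF assms]]
  have "\<exists>n. near x (\<lambda>C. \<forall>z\<in>C. iv f z = T n z)" if x: "x \<in> S" for x
  proof -
    define y where "y = iv f x"
    have fy: "f y = x" by (simp add: y_def b)
    have y: "y \<in> S" using F_S_iff[OF assms, of y] fy x by simp
    define n where "n = disp f y"
    have "x = T n y" using F_disp[OF assms y] fy n_def by simp
    then have "T (-n) x = y" by (simp add: T_add T_0)
    then have "near x (\<lambda>C. \<forall>z\<in>T (-n) ` C. f z = T n z)"
      using F_near[OF assms y] n_def by (intro near_T) simp
    then have "near x (\<lambda>C. \<forall>z\<in>C. iv f z = T (-n) z)"
      by (rule near_mono) (auto simp: T_add T_0, metis b(2))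
    then show ?thesis by blast
  qed
  moreover have "iv f x = x" if "x \<notin> S" for x using b(2)[of x] F_out[OF assms that] by simp
  ultimately show ?thesis using b by (auto simp: F_def)
qed

text \<open>The cocycle identity. It makes the displacement additive modulo coboundaries, because
  \<open>disp f (g x)\<close> and \<open>disp f x\<close> turn out to be cohomologous.\<close>

lemma disp_comp: assumes "f \<in> F" "g \<in> F" "x \<in> S" shows "disp (f \<circ> g) x = disp g x + disp f (g x)"
proof (rule disp_eqI[OF assms(3)])
  have "f (g x) = T (disp f (g x)) (T (disp g x) x)"
    using F_disp[OF assms(1) F_S[OF assms(2,3)]] F_disp[OF assms(2,3)] by simp
  then show "(f \<circ> g) x = T (disp g x + disp f (g x)) x" by (simp add: T_add add.commute)
qed

lemma disp_T: "x \<in> S \<Longrightarrow> disp (T n) x = n" by (rule disp_eqI) auto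

lemma F_image_B: assumes "f \<in> F" "C \<in> B" shows "f ` C \<in> B"
proof (rule local_induct[OF assms(2), of "\<lambda>C. f ` C \<in> B"])
  fix x assume x: "x \<in> C"
  then have "x \<in> S" using B_sub assms by auto
  from F_near[OF assms(1) this] show "near x (\<lambda>C'. C' \<subseteq> C \<longrightarrow> f ` C' \<in> B)"
    by (rule near_mono) (metis T_B image_cong)
qed (use B_empty B_Un in \<open>auto simp: image_Un\<close>)

lemma commutator_F: "f \<in> F \<Longrightarrow> g \<in> F \<Longrightarrow> commutator f g \<in> F"
  unfolding commutator_def using F_comp F_inv by simp

text \<open>Maps the level \<open>T j C\<close> of a tower onto the level \<open>T (s j) C\<close>; meaningful only if the levels \<open>T j C\<close> with
  \<open>s j \<noteq> j\<close> are disjoint.\<close>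

definition level_perm :: "'a set \<Rightarrow> (int \<Rightarrow> int) \<Rightarrow> 'a \<Rightarrow> 'a" where
  "level_perm C s x = (if \<exists>j. s j \<noteq> j \<and> x \<in> T j ` C
     then T (s (THE j. s j \<noteq> j \<and> x \<in> T j ` C) - (THE j. s j \<noteq> j \<and> x \<in> T j ` C)) x else x)"

lemma level_perm_in:
  assumes "s permutes J" "tower C J" "j \<in> J" "c \<in> C"
  shows "level_perm C s (T j c) = T (s j) c"
proof -
  have J: "i \<in> J" if "s i \<noteq> i" for i using assms(1) that by (metis permutes_not_in)
  have u: "i = j" if "s i \<noteq> i" "T j c \<in> T i ` C" for i
    using that tower_eqD[OF assms(2) J[OF that(1)] assms(3)] assms(4) by fastforce
  show ?thesis
  proof (cases "s j = j")
    case True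
    then show ?thesis using u unfolding level_perm_def by fastforce
  next
    case False
    have "(THE i. s i \<noteq> i \<and> T j c \<in> T i ` C) = j" using False u assms(4) by blast
    then show ?thesis using False assms(4) unfolding level_perm_def by (auto simp: T_add)
  qed
qed

lemma level_perm_out:
  assumes "s permutes J" "\<And>j. j \<in> J \<Longrightarrow> x \<notin> T j ` C"
  shows "level_perm C s x = x"
  using assms unfolding level_perm_def by (metis permutes_not_in)

text \<open>Bases are compared inside one common tower over \<open>A\<close>: a level permutation
  over the smaller base \<open>C\<close> fixes the other points of \<open>A\<close> at every level.
  Permutations over different bases can thus be multiplied point by point.\<close>

lemma level_perm_in_subset:
  assumes "s permutes J" "tower A J" "C \<subseteq> A" "j \<in> J" "a \<in> A"
  shows "level_perm C s (T j a) = T (if a \<in> C then s j else j) a"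
proof (cases "a \<in> C")
  case True
  then show ?thesis using level_perm_in[OF assms(1) _ assms(4), of C a] assms tower_mono by auto
next
  case False
  have "T j a \<notin> T i ` C" if "i \<in> J" for i
    using False tower_eqD[OF assms(2,4) that] assms(3,5) by blast
  then show ?thesis using False level_perm_out[OF assms(1), of "T j a" C] by auto
qed

lemma level_perm_eqI:
  assumes "s permutes J" "tower C J"
    and "\<And>j c. j \<in> J \<Longrightarrow> c \<in> C \<Longrightarrow> f (T j c) = T (s j) c"
    and "\<And>x. (\<And>j. j \<in> J \<Longrightarrow> x \<notin> T j ` C) \<Longrightarrow> f x = x"
  shows "f = level_perm C s"
proof
  fix x show "f x = level_perm C s x"
  proof (cases "\<exists>j\<in>J. x \<in> T j ` C")
    case True
    then show ?thesis using assms(3) level_perm_in[OF assms(1,2)] by auto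
  next
    case False
    then show ?thesis using assms(4) level_perm_out[OF assms(1)] by metis
  qed
qed

lemma level_perm_comp:
  assumes "s permutes J" "t permutes J" "tower C J"
  shows "level_perm C s \<circ> level_perm C t = level_perm C (s \<circ> t)"
proof (rule level_perm_eqI[of _ J])
  show "(s \<circ> t) permutes J" using assms permutes_compose by auto
qed (use assms in \<open>auto simp: level_perm_in level_perm_out permutes_in_image\<close>)

lemma level_perm_id: "level_perm C id = id" by (auto simp: level_perm_def)

lemma level_perm_empty: "level_perm {} s = id" by (auto simp: level_perm_def)

lemma level_perm_inv_o:
  assumes "s permutes J" "tower C J"
  shows "level_perm C s \<circ> level_perm C (inv_into UNIV s) = id" "level_perm C (inv_into UNIV s) \<circ> level_perm C s = id"
  using level_perm_comp[OF assms(1) permutes_inv[OF assms(1)] assms(2)]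
    level_perm_comp[OF permutes_inv[OF assms(1)] assms(1) assms(2)]
  by (simp_all add: permutes_inv_o[OF assms(1)] level_perm_id)

lemma level_perm_bij: "s permutes J \<Longrightarrow> tower C J \<Longrightarrow> bij (level_perm C s)"
  using level_perm_inv_o o_bij by metis

lemma level_perm_F:
  assumes "s permutes J" "tower C J" "finite J" "C \<in> B" shows "level_perm C s \<in> F"
proof -
  have "\<exists>n. near x (\<lambda>D. \<forall>z\<in>D. level_perm C s z = T n z)" if x: "x \<in> S" for x
  proof (cases "\<exists>j\<in>J. x \<in> T j ` C")
    case True
    then obtain j where j: "j \<in> J" "x \<in> T j ` C" by auto
    have "near x (\<lambda>D. D \<subseteq> T j ` C)" using j near_subset T_B assms by auto
    then have "near x (\<lambda>D. \<forall>z\<in>D. level_perm C s z = T (s j - j) z)"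
    proof (rule near_mono)
      fix D assume "D \<subseteq> T j ` C"
      then show "\<forall>z\<in>D. level_perm C s z = T (s j - j) z"
        using level_perm_in[OF assms(1,2) j(1)] by (auto simp: T_add)
    qed
    then show ?thesis by blast
  next
    case False
    have "near x (\<lambda>D. \<forall>j\<in>J. D \<subseteq> S - T j ` C)"
      using False assms x by (intro near_ball near_subset) (auto simp: B_Diff S_B T_B)
    then have "near x (\<lambda>D. \<forall>z\<in>D. level_perm C s z = T 0 z)"
    proof (rule near_mono)
      fix D assume D: "\<forall>j\<in>J. D \<subseteq> S - T j ` C"
      have "level_perm C s z = z" if "z \<in> D" for z
        using D that by (intro level_perm_out[OF assms(1)]) blast
      then show "\<forall>z\<in>D. level_perm C s z = T 0 z" by (simp add: T_0)
    qed
    then show ?thesis by blast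
  qed
  moreover have "level_perm C s x = x" if "x \<notin> S" for x
    using level_perm_out[OF assms(1), of x C] that T_B[OF assms(4)] B_sub by blast
  ultimately show ?thesis using level_perm_bij[OF assms(1,2)] by (auto simp: F_def)
qed

lemma level_perm_Un:
  assumes "s permutes J" "tower (C \<union> D) J" "C \<inter> D = {}"
  shows "level_perm (C \<union> D) s = level_perm C s \<circ> level_perm D s"
proof (rule level_perm_eqI[OF assms(1,2), symmetric])
  fix j c assume j: "j \<in> J" "c \<in> C \<union> D"
  have j': "s j \<in> J" using assms(1) j by (simp add: permutes_in_image)
  show "(level_perm C s \<circ> level_perm D s) (T j c) = T (s j) c"
    using level_perm_in_subset[OF assms(1,2), of C] level_perm_in_subset[OF assms(1,2), of D] j j' assms(3) by auto
next
  fix x assume "\<And>j. j \<in> J \<Longrightarrow> x \<notin> T j ` (C \<union> D)"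
  then show "(level_perm C s \<circ> level_perm D s) x = x" using level_perm_out[OF assms(1)] by (simp add: image_Un)
qed

text \<open>\<open>f\<close> carries level \<open>j\<close> of the tower to level
  \<open>r j\<close>, so conjugation only relabels the levels. Disjointness of the new levels comes
  from the injectivity of \<open>f\<close>.\<close>

lemma level_perm_conj:
  assumes "s permutes J" "tower C J" "s' permutes J'" "r ` J = J'" "\<And>j. j \<in> J \<Longrightarrow> s' (r j) = r (s j)"
    and "bij f" "\<And>j c. j \<in> J \<Longrightarrow> c \<in> C \<Longrightarrow> f (T j c) = T (r j) c"
  shows "tower C J'" "f \<circ> level_perm C s \<circ> iv f = level_perm C s'"
proof -
  note b = iv_simps[OF assms(6)]
  have inj: "f x = f y \<longleftrightarrow> x = y" for x y using assms(6) by (auto simp: bij_def inj_eq)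
  show tower: "tower C J'" unfolding tower_def
  proof (intro ballI impI)
    fix i' j' assume "i' \<in> J'" "j' \<in> J'" "i' \<noteq> j'"
    then obtain i j where ij: "i \<in> J" "j \<in> J" "i' = r i" "j' = r j" "i \<noteq> j" using assms(4) by auto
    have False if "c \<in> C" "d \<in> C" "T i' c = T j' d" for c d
      using that ij assms(7)[of i c] assms(7)[of j d] inj tower_eqD[OF assms(2)] by metis
    then show "T i' ` C \<inter> T j' ` C = {}" by auto
  qed
  show "f \<circ> level_perm C s \<circ> iv f = level_perm C s'"
  proof (rule level_perm_eqI[OF assms(3) tower])
    fix j' c assume "j' \<in> J'" "c \<in> C"
    then obtain j where j: "j \<in> J" "j' = r j" using assms(4) by auto
    have "iv f (T j' c) = T j c" using b(2) assms(7)[OF j(1) \<open>c \<in> C\<close>] j by metis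
    then show "(f \<circ> level_perm C s \<circ> iv f) (T j' c) = T (s' j') c"
      using level_perm_in[OF assms(1,2) j(1) \<open>c \<in> C\<close>] assms(5)[OF j(1)] assms(7)[OF _ \<open>c \<in> C\<close>, of "s j"] j
        permutes_in_image[OF assms(1)] by simp
  next
    fix x assume x: "\<And>j. j \<in> J' \<Longrightarrow> x \<notin> T j ` C"
    have "iv f x \<notin> T j ` C" if j: "j \<in> J" for j
    proof
      assume "iv f x \<in> T j ` C"
      then obtain c where c: "c \<in> C" "iv f x = T j c" by auto
      then have "x = T (r j) c" using b(1)[of x] assms(7)[OF j c(1)] by simp
      moreover have "r j \<in> J'" using j assms(4) by auto
      ultimately show False using x c(1) by blast
    qed
    then show "(f \<circ> level_perm C s \<circ> iv f) x = x" using level_perm_out[OF assms(1)] b(1) by simp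
  qed
qed

section \<open>Transpositions and three-cycles of levels\<close>

definition level_swap :: "'a set \<Rightarrow> int \<Rightarrow> int \<Rightarrow> 'a \<Rightarrow> 'a" where
  "level_swap C p q = level_perm C (Transposition.transpose p q)"

text \<open>Composites are read from right to left, so the levels go from \<open>p\<close> to
  \<open>q\<close>, from \<open>q\<close> to \<open>r\<close> and from \<open>r\<close> back to
  \<open>p\<close>.\<close>

definition level_cycle :: "'a set \<Rightarrow> int \<Rightarrow> int \<Rightarrow> int \<Rightarrow> 'a \<Rightarrow> 'a" where
  "level_cycle C p q r = level_perm C (Transposition.transpose p q \<circ> Transposition.transpose q r)"

lemma transpose_permutes: "p \<in> J \<Longrightarrow> q \<in> J \<Longrightarrow> Transposition.transpose p q permutes J"
  by (rule permutes_swap_id)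

lemma cyc_permutes:
  "p \<in> J \<Longrightarrow> q \<in> J \<Longrightarrow> r \<in> J \<Longrightarrow> (Transposition.transpose p q \<circ> Transposition.transpose q r) permutes J"
  by (intro permutes_compose transpose_permutes)

lemma cyc_apply:
  assumes "distinct [p, q, r]"
  shows "(Transposition.transpose p q \<circ> Transposition.transpose q r) p = q"
    "(Transposition.transpose p q \<circ> Transposition.transpose q r) q = r"
    "(Transposition.transpose p q \<circ> Transposition.transpose q r) r = p"
    "x \<noteq> p \<Longrightarrow> x \<noteq> q \<Longrightarrow> x \<noteq> r \<Longrightarrow> (Transposition.transpose p q \<circ> Transposition.transpose q r) x = x"
  using assms by (auto simp: Transposition.transpose_def)

section \<open>Three-cycles of clopen sets\<close>

lemma level_cycle_in:
  assumes "distinct [p, q, r]" "tower A {p, q, r}" "C \<subseteq> A" "a \<in> A"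
  shows "level_cycle C p q r (T p a) = T (if a \<in> C then q else p) a"
    "level_cycle C p q r (T q a) = T (if a \<in> C then r else q) a"
    "level_cycle C p q r (T r a) = T (if a \<in> C then p else r) a"
  unfolding level_cycle_def
  using level_perm_in_subset[OF cyc_permutes[of p "{p,q,r}" q r] assms(2,3) _ assms(4)] cyc_apply[OF assms(1)]
  by simp_all

lemma level_cycle_out:
  assumes "x \<notin> T p ` C" "x \<notin> T q ` C" "x \<notin> T r ` C"
  shows "level_cycle C p q r x = x"
  unfolding level_cycle_def using assms by (intro level_perm_out[OF cyc_permutes[of p "{p,q,r}" q r]]) auto

lemma level_cycle_eqI:
  assumes "distinct [p, q, r]" "tower A {p, q, r}" "C \<subseteq> A"
    "\<And>a. a \<in> A \<Longrightarrow> f (T p a) = T (if a \<in> C then q else p) a"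
    "\<And>a. a \<in> A \<Longrightarrow> f (T q a) = T (if a \<in> C then r else q) a"
    "\<And>a. a \<in> A \<Longrightarrow> f (T r a) = T (if a \<in> C then p else r) a"
    "\<And>x. x \<notin> T p ` A \<Longrightarrow> x \<notin> T q ` A \<Longrightarrow> x \<notin> T r ` A \<Longrightarrow> f x = x"
  shows "f = level_cycle C p q r"
proof
  fix x show "f x = level_cycle C p q r x"
  proof (cases "x \<in> T p ` A \<or> x \<in> T q ` A \<or> x \<in> T r ` A")
    case True
    then show ?thesis using level_cycle_in[OF assms(1-3)] assms(4-6) by auto
  next
    case False
    then have "x \<notin> T p ` C" "x \<notin> T q ` C" "x \<notin> T r ` C" using assms(3) by auto
    then show ?thesis using level_cycle_out assms(7) False by metis
  qed
qed

lemma level_swap_in: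
  assumes "p \<noteq> q" "tower A {p, q}" "C \<subseteq> A" "a \<in> A"
  shows "level_swap C p q (T p a) = T (if a \<in> C then q else p) a"
    "level_swap C p q (T q a) = T (if a \<in> C then p else q) a"
  unfolding level_swap_def
  using level_perm_in_subset[OF transpose_permutes[of p "{p,q}" q] assms(2,3) _ assms(4)] by simp_all

lemma level_swap_out:
  assumes "x \<notin> T p ` C" "x \<notin> T q ` C"
  shows "level_swap C p q x = x"
  unfolding level_swap_def using assms by (intro level_perm_out[OF transpose_permutes[of p "{p,q}" q]]) auto

lemma level_swap_eqI:
  assumes "p \<noteq> q" "tower A {p, q}" "C \<subseteq> A"
    "\<And>a. a \<in> A \<Longrightarrow> f (T p a) = T (if a \<in> C then q else p) a"
    "\<And>a. a \<in> A \<Longrightarrow> f (T q a) = T (if a \<in> C then p else q) a"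
    "\<And>x. x \<notin> T p ` A \<Longrightarrow> x \<notin> T q ` A \<Longrightarrow> f x = x"
  shows "f = level_swap C p q"
proof
  fix x show "f x = level_swap C p q x"
  proof (cases "x \<in> T p ` A \<or> x \<in> T q ` A")
    case True
    then show ?thesis using level_swap_in[OF assms(1-3)] assms(4-5) by auto
  next
    case False
    then have "x \<notin> T p ` C" "x \<notin> T q ` C" using assms(3) by auto
    then show ?thesis using level_swap_out assms(6) False by metis
  qed
qed

lemma level_cycle_bij: "tower C {p,q,r} \<Longrightarrow> bij (level_cycle C p q r)"
  unfolding level_cycle_def by (rule level_perm_bij[OF cyc_permutes[of p "{p,q,r}" q r]]) auto

lemma level_swap_bij: "tower C {p,q} \<Longrightarrow> bij (level_swap C p q)"
  unfolding level_swap_def by (rule level_perm_bij[OF transpose_permutes[of p "{p,q}" q]]) auto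

lemma level_cycle_F: "C \<in> B \<Longrightarrow> tower C {p,q,r} \<Longrightarrow> level_cycle C p q r \<in> F"
  unfolding level_cycle_def by (rule level_perm_F[OF cyc_permutes[of p "{p,q,r}" q r]]) auto

lemma level_swap_F: "C \<in> B \<Longrightarrow> tower C {p,q} \<Longrightarrow> level_swap C p q \<in> F"
  unfolding level_swap_def by (rule level_perm_F[OF transpose_permutes[of p "{p,q}" q]]) auto

lemma level_cycle_empty: "level_cycle {} p q r = id" by (simp add: level_cycle_def level_perm_empty)
lemma level_swap_empty: "level_swap {} p q = id" by (simp add: level_swap_def level_perm_empty)

lemma level_cycle_Un:
  "tower (C \<union> D) {p,q,r} \<Longrightarrow> C \<inter> D = {} \<Longrightarrow> level_cycle (C \<union> D) p q r = level_cycle C p q r \<circ> level_cycle D p q r"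
  unfolding level_cycle_def by (rule level_perm_Un[OF cyc_permutes[of p "{p,q,r}" q r]]) auto

lemma level_swap_Un:
  "tower (C \<union> D) {p,q} \<Longrightarrow> C \<inter> D = {} \<Longrightarrow> level_swap (C \<union> D) p q = level_swap C p q \<circ> level_swap D p q"
  unfolding level_swap_def by (rule level_perm_Un[OF transpose_permutes[of p "{p,q}" q]]) auto

lemma level_swap_level_swap: assumes "tower C {p,q}" shows "level_swap C p q \<circ> level_swap C p q = id"
  unfolding level_swap_def using assms
  by (subst level_perm_comp[OF transpose_permutes[of p "{p,q}" q] transpose_permutes[of p "{p,q}" q]]) (auto simp: level_perm_id)

lemma level_swap_iv: assumes "tower C {p,q}" shows "iv (level_swap C p q) = level_swap C p q"
  using iv_eqI[OF level_swap_bij level_swap_level_swap] assms by auto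

lemma level_cycle_level_swap: assumes "tower C {p,q,r}" shows "level_cycle C p q r = level_swap C p q \<circ> level_swap C q r"
  unfolding level_swap_def level_cycle_def using assms
  by (subst level_perm_comp[OF transpose_permutes[of p "{p,q,r}" q] transpose_permutes[of q "{p,q,r}" r]]) auto

lemma level_swap_sym: "level_swap C p q = level_swap C q p"
  unfolding level_swap_def by (simp add: transpose_commute)

lemma level_cycle_iv: assumes "tower C {p,q,r}" shows "iv (level_cycle C p q r) = level_cycle C r q p"
proof -
  have c: "tower C {p,q}" "tower C {q,r}" "tower C {r,q,p}"
    using assms by (auto intro: tower_mono[OF assms])
  show ?thesis
    unfolding level_cycle_level_swap[OF assms] level_cycle_level_swap[OF c(3)]
    by (subst iv_comp) (auto intro: level_swap_bij c simp: level_swap_iv c level_swap_sym)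
qed

lemma level_cycle_rot: "distinct [p,q,r] \<Longrightarrow> level_cycle C p q r = level_cycle C q r p"
  unfolding level_cycle_def by (rule arg_cong[where f = "level_perm C"]) (auto simp: fun_eq_iff Transposition.transpose_def)

text \<open>The commutator of two transpositions with one common letter is the square of their
  product, that is, the inverse of a three-cycle. So three-cycles are commutators.\<close>

lemma commutator_level_swap:
  assumes "distinct [p,q,r]" "tower C {p,q,r}"
  shows "commutator (level_swap C p q) (level_swap C q r) = level_cycle C p r q"
proof -
  have c: "tower C {p,q}" "tower C {q,r}" using assms by (auto intro: tower_mono[OF assms(2)])
  have "commutator (level_swap C p q) (level_swap C q r) = level_cycle C p q r \<circ> level_cycle C p q r"
    unfolding commutator_def level_swap_iv[OF c(1)] level_swap_iv[OF c(2)] level_cycle_level_swap[OF assms(2)] by (simp add: comp_assoc)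
  also have "\<dots> = level_cycle C p r q"
  proof (rule level_cycle_eqI[of _ _ _ C])
    show "tower C {p,r,q}" using assms(2) by (simp add: insert_commute)
  qed (use assms(1) level_cycle_in[OF assms, of C, OF subset_refl] level_cycle_out in auto)
  finally show ?thesis .
qed

text \<open>Two three-cycles whose only common letter is \<open>a\<close> have a three-cycle as
  commutator. Over a point of \<open>A\<close> that lies in at most one of \<open>C\<close> and
  \<open>D\<close>, one of the two factors acts trivially and the commutator is the identity, so the
  result lives on the intersection.\<close>

lemma commutator_level_cycle:
  assumes d: "distinct [a,b,c,d,e]" and A: "tower A {a,b,c,d,e}" and C: "C \<subseteq> A" "D \<subseteq> A"
  shows "commutator (level_cycle C a b c) (level_cycle D a d e) = level_cycle (C \<inter> D) a b d"
proof -
  have 1: "tower A {a,b,c}" "tower A {a,d,e}" "tower A {a,b,d}" "tower A {c,b,a}" "tower A {e,d,a}"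
    by (auto intro: tower_mono[OF A])
  have d1: "distinct [a,b,c]" "distinct [a,d,e]" "distinct [a,b,d]" "distinct [c,b,a]" "distinct [e,d,a]"
    using d by auto
  have iv: "iv (level_cycle C a b c) = level_cycle C c b a" "iv (level_cycle D a d e) = level_cycle D e d a"
    using tower_mono[OF 1(1) C(1) subset_refl] tower_mono[OF 1(2) C(2) subset_refl] level_cycle_iv by auto
  have out1: "level_cycle C a b c (T j x) = T j x" "level_cycle C c b a (T j x) = T j x"
    if "x \<in> A" "j = d \<or> j = e" for j x
  proof -
    have *: "T j x \<notin> T i ` C" if "i \<in> {a,b,c}" for i
      using that \<open>x \<in> A\<close> \<open>j = d \<or> j = e\<close> d C tower_eqD[OF A, of j i x] by fastforce
    then show "level_cycle C a b c (T j x) = T j x" "level_cycle C c b a (T j x) = T j x" by (auto intro!: level_cycle_out)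
  qed
  have out2: "level_cycle D a d e (T j x) = T j x" "level_cycle D e d a (T j x) = T j x"
    if "x \<in> A" "j = b \<or> j = c" for j x
  proof -
    have *: "T j x \<notin> T i ` D" if "i \<in> {a,d,e}" for i
      using that \<open>x \<in> A\<close> \<open>j = b \<or> j = c\<close> d C tower_eqD[OF A, of j i x] by fastforce
    then show "level_cycle D a d e (T j x) = T j x" "level_cycle D e d a (T j x) = T j x" by (auto intro!: level_cycle_out)
  qed
  note ev = level_cycle_in[OF d1(1) 1(1) C(1)] level_cycle_in[OF d1(2) 1(2) C(2)] level_cycle_in[OF d1(4) 1(4) C(1)]
    level_cycle_in[OF d1(5) 1(5) C(2)] out1 out2
  \<comment> \<open>One computation for all five levels, with a case distinction on the position of
    the base point relative to \<open>C\<close> and \<open>D\<close>.\<close>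
  have f: "(level_cycle C a b c \<circ> level_cycle D a d e \<circ> level_cycle C c b a \<circ> level_cycle D e d a) (T j x) =
      T (if x \<in> C \<inter> D then (if j = a then b else if j = b then d else if j = d then a else j) else j) x"
    if "x \<in> A" "j \<in> {a,b,c,d,e}" for j x
    using that d by (cases "x \<in> C"; cases "x \<in> D") (auto simp: ev)
  have "commutator (level_cycle C a b c) (level_cycle D a d e) = level_cycle C a b c \<circ> level_cycle D a d e \<circ> level_cycle C c b a \<circ> level_cycle D e d a"
    unfolding commutator_def iv ..
  also have "\<dots> = level_cycle (C \<inter> D) a b d"
  proof (rule level_cycle_eqI[OF d1(3) 1(3)])
    fix x assume x: "x \<notin> T a ` A" "x \<notin> T b ` A" "x \<notin> T d ` A"
    show "(level_cycle C a b c \<circ> level_cycle D a d e \<circ> level_cycle C c b a \<circ> level_cycle D e d a) x = x"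
    proof (cases "x \<in> T c ` A \<or> x \<in> T e ` A")
      case True
      then show ?thesis using f d by auto
    next
      case False
      then have "x \<notin> T j ` C" "x \<notin> T j ` D" if "j \<in> {a,b,c,d,e}" for j using x C that by auto
      then show ?thesis by (simp add: level_cycle_out)
    qed
  next
    fix x assume x: "x \<in> A"
    show "(level_cycle C a b c \<circ> level_cycle D a d e \<circ> level_cycle C c b a \<circ> level_cycle D e d a) (T a x) = T (if x \<in> C \<inter> D then b else a) x"
      using f[OF x, of a] d by fastforce
    show "(level_cycle C a b c \<circ> level_cycle D a d e \<circ> level_cycle C c b a \<circ> level_cycle D e d a) (T b x) = T (if x \<in> C \<inter> D then d else b) x"
      using f[OF x, of b] d by fastforce
    show "(level_cycle C a b c \<circ> level_cycle D a d e \<circ> level_cycle C c b a \<circ> level_cycle D e d a) (T d x) = T (if x \<in> C \<inter> D then a else d) x"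
      using f[OF x, of d] d by fastforce
  qed (use C in auto)
  finally show ?thesis .
qed

lemma level_cycle_conj:
  assumes "distinct [p,q,r]" "tower C {p,q,r}" "distinct [p',q',r']" "bij f"
    "\<And>c. c \<in> C \<Longrightarrow> f (T p c) = T p' c" "\<And>c. c \<in> C \<Longrightarrow> f (T q c) = T q' c" "\<And>c. c \<in> C \<Longrightarrow> f (T r c) = T r' c"
  shows "tower C {p',q',r'}" "f \<circ> level_cycle C p q r \<circ> iv f = level_cycle C p' q' r'"
proof -
  define u where "u j = (if j = p then p' else if j = q then q' else r')" for j
  have u: "u p = p'" "u q = q'" "u r = r'" using assms(1) by (auto simp: u_def)
  have "u ` {p,q,r} = {p',q',r'}" using u by simp
  moreover have "(Transposition.transpose p' q' \<circ> Transposition.transpose q' r') (u j) =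
      u ((Transposition.transpose p q \<circ> Transposition.transpose q r) j)" if "j \<in> {p,q,r}" for j
    using that u cyc_apply[OF assms(1)] cyc_apply[OF assms(3)] by fastforce
  moreover have "f (T j c) = T (u j) c" if "j \<in> {p,q,r}" "c \<in> C" for j c using that u assms(5-7) by auto
  ultimately show "tower C {p',q',r'}" "f \<circ> level_cycle C p q r \<circ> iv f = level_cycle C p' q' r'"
    unfolding level_cycle_def
    using level_perm_conj[OF cyc_permutes[of p "{p,q,r}" q r] assms(2) cyc_permutes[of p' "{p',q',r'}" q' r'] _ _ assms(4), of u]
    by simp_all
qed

lemma level_swap_conj:
  assumes "p \<noteq> q" "tower C {p,q}" "p' \<noteq> q'" "bij f"
    "\<And>c. c \<in> C \<Longrightarrow> f (T p c) = T p' c" "\<And>c. c \<in> C \<Longrightarrow> f (T q c) = T q' c"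
  shows "tower C {p',q'}" "f \<circ> level_swap C p q \<circ> iv f = level_swap C p' q'"
proof -
  define r where "r j = (if j = p then p' else q')" for j
  have r: "r p = p'" "r q = q'" using assms(1) by (auto simp: r_def)
  have "r ` {p,q} = {p',q'}" using r by simp
  moreover have "Transposition.transpose p' q' (r j) = r (Transposition.transpose p q j)" if "j \<in> {p,q}" for j
    using that r by auto
  moreover have "f (T j c) = T (r j) c" if "j \<in> {p,q}" "c \<in> C" for j c using that r assms(5,6) by auto
  ultimately show "tower C {p',q'}" "f \<circ> level_swap C p q \<circ> iv f = level_swap C p' q'"
    unfolding level_swap_def
    using level_perm_conj[OF transpose_permutes[of p "{p,q}" q] assms(2) transpose_permutes[of p' "{p',q'}" q'] _ _ assms(4), of r]
    by simp_all
qed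

lemma level_cycle_shift:
  assumes "distinct [p,q,r]" "tower (T n ` C) {p,q,r}"
  shows "level_cycle (T n ` C) p q r = level_cycle C (p + n) (q + n) (r + n)"
proof (rule level_cycle_eqI[of _ _ _ C])
  show "tower C {p + n, q + n, r + n}" using assms(2) by (simp add: tower_T add.commute)
qed (use assms(1) level_cycle_in[OF assms subset_refl] level_cycle_out in \<open>auto simp: T_image_image T_add[symmetric]\<close>)

lemma level_swap_shift:
  assumes "p \<noteq> q" "tower (T n ` C) {p,q}"
  shows "level_swap (T n ` C) p q = level_swap C (p + n) (q + n)"
proof (rule level_swap_eqI[of _ _ C])
  show "tower C {p + n, q + n}" using assms(2) by (simp add: tower_T add.commute)
qed (use assms(1) level_swap_in[OF assms subset_refl] level_swap_out in \<open>auto simp: T_image_image T_add[symmetric]\<close>)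

section \<open>Subgroups of the full group and congruence modulo a normal subgroup\<close>

definition subgp :: "('a \<Rightarrow> 'a) set \<Rightarrow> bool" where
  "subgp K \<longleftrightarrow> K \<subseteq> F \<and> id \<in> K \<and> (\<forall>f\<in>K. \<forall>g\<in>K. f \<circ> g \<in> K) \<and> (\<forall>f\<in>K. iv f \<in> K)"

lemma subgp_F: "subgp F" by (auto simp: subgp_def id_F F_comp F_inv)

lemma subD:
  assumes "subgp K"
  shows "K \<subseteq> F" "id \<in> K" "f \<in> K \<Longrightarrow> g \<in> K \<Longrightarrow> f \<circ> g \<in> K" "f \<in> K \<Longrightarrow> iv f \<in> K"
    "f \<in> K \<Longrightarrow> g \<in> K \<Longrightarrow> commutator f g \<in> K"
  using assms by (auto simp: subgp_def commutator_def)

lemma subgp_cancel: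
  assumes "subgp K" "f \<circ> g \<in> K" "f \<in> F" "g \<in> F"
  shows "f \<in> K \<Longrightarrow> g \<in> K" "g \<in> K \<Longrightarrow> f \<in> K"
proof -
  show "g \<in> K" if "f \<in> K"
    using subD(3)[OF assms(1) subD(4)[OF assms(1) that] assms(2)] iv_simps(4)[OF F_bij[OF assms(3)]]
    by (simp add: comp_assoc[symmetric])
  show "f \<in> K" if "g \<in> K"
    using subD(3)[OF assms(1,2) subD(4)[OF assms(1) that]] iv_simps(3)[OF F_bij[OF assms(4)]]
    by (simp add: comp_assoc)
qed

definition normal_subgp :: "('a \<Rightarrow> 'a) set \<Rightarrow> bool" where
  "normal_subgp N \<longleftrightarrow> subgp N \<and> (\<forall>f\<in>F. \<forall>d\<in>N. f \<circ> d \<circ> iv f \<in> N)"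

definition eq_mod :: "('a \<Rightarrow> 'a) set \<Rightarrow> ('a \<Rightarrow> 'a) \<Rightarrow> ('a \<Rightarrow> 'a) \<Rightarrow> bool" where
  "eq_mod N f g \<longleftrightarrow> f \<in> F \<and> g \<in> F \<and> f \<circ> iv g \<in> N"

lemma comp_cancel:
  "bij f \<Longrightarrow> f \<circ> (iv f \<circ> g) = g" "bij f \<Longrightarrow> iv f \<circ> (f \<circ> g) = g"
  by (simp_all add: comp_assoc[symmetric] iv_simps)

lemma eq_mod_refl: "normal_subgp N \<Longrightarrow> f \<in> F \<Longrightarrow> eq_mod N f f"
  using iv_simps(3)[OF F_bij] by (simp add: eq_mod_def normal_subgp_def subgp_def)

lemma eq_mod_sym: assumes "normal_subgp N" "eq_mod N f g" shows "eq_mod N g f"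
proof -
  have "bij f" "bij g" "f \<circ> iv g \<in> N" using assms(2) F_bij by (auto simp: eq_mod_def)
  moreover from this have "iv (f \<circ> iv g) = g \<circ> iv f" by (simp add: iv_comp iv_simps)
  ultimately show ?thesis using assms by (metis eq_mod_def normal_subgp_def subgp_def)
qed

lemma eq_mod_trans: assumes "normal_subgp N" "eq_mod N f g" "eq_mod N g h" shows "eq_mod N f h"
proof -
  have "bij g" "f \<circ> iv g \<in> N" "g \<circ> iv h \<in> N" using assms(2,3) F_bij by (auto simp: eq_mod_def)
  moreover from this have "(f \<circ> iv g) \<circ> (g \<circ> iv h) = f \<circ> iv h" by (simp add: comp_assoc comp_cancel)
  ultimately show ?thesis using assms by (metis eq_mod_def normal_subgp_def subgp_def)
qed

lemma eq_mod_comp: assumes "normal_subgp N" "eq_mod N f f'" "eq_mod N g g'" shows "eq_mod N (f \<circ> g) (f' \<circ> g')"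
proof -
  have b: "bij f" "bij f'" "bij g" "bij g'" "f \<in> F" "f \<circ> iv f' \<in> N" "g \<circ> iv g' \<in> N"
    using assms(2,3) F_bij by (auto simp: eq_mod_def)
  \<comment> \<open>Conjugating the error of the second factors by \<open>f\<close> and multiplying
    by the error of the first factors gives the error of the products.\<close>
  then have "f \<circ> (g \<circ> iv g') \<circ> iv f \<circ> (f \<circ> iv f') = (f \<circ> g) \<circ> iv (f' \<circ> g')"
    by (simp add: comp_assoc comp_cancel iv_comp)
  moreover have "f \<circ> (g \<circ> iv g') \<circ> iv f \<circ> (f \<circ> iv f') \<in> N"
    using assms(1) b by (simp add: normal_subgp_def subgp_def)
  ultimately show ?thesis using assms(2,3) by (auto simp: eq_mod_def F_comp)
qed

lemma eq_mod_id_iff: "f \<in> F \<Longrightarrow> eq_mod N f id \<longleftrightarrow> f \<in> N"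
  by (simp add: eq_mod_def id_F)

section \<open>The commutator subgroup and the subgroup generated by three-cycles\<close>

text \<open>Inverses are not generated separately: the inverse of a commutator is the commutator of
  the exchanged pair, so products of commutators already form a group.\<close>

inductive_set D :: "('a \<Rightarrow> 'a) set" where
  D_id: "id \<in> D"
| D_step: "f \<in> F \<Longrightarrow> g \<in> F \<Longrightarrow> h \<in> D \<Longrightarrow> commutator f g \<circ> h \<in> D"

lemma D_commutator: "f \<in> F \<Longrightarrow> g \<in> F \<Longrightarrow> commutator f g \<in> D"
  using D_step[OF _ _ D_id] by simp

lemma D_F: "f \<in> D \<Longrightarrow> f \<in> F"
proof (induction rule: D.induct)
  case D_id then show ?case by (rule id_F)
next
  case (D_step f g h) then show ?case by (intro F_comp commutator_F)
qed

lemma D_comp: "f \<in> D \<Longrightarrow> g \<in> D \<Longrightarrow> f \<circ> g \<in> D"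
  by (induction rule: D.induct) (auto simp: comp_assoc D_step)

lemma commutator_iv: "f \<in> F \<Longrightarrow> g \<in> F \<Longrightarrow> iv (commutator f g) = commutator g f"
  unfolding commutator_def by (simp add: iv_comp bij_comp F_bij iv_simps comp_assoc)

lemma D_iv: "f \<in> D \<Longrightarrow> iv f \<in> D"
proof (induction rule: D.induct)
  case D_id
  show ?case unfolding inv_id by (rule D.D_id)
next
  case (D_step f g h)
  then have "iv (commutator f g \<circ> h) = iv h \<circ> commutator g f" by (simp add: iv_comp F_bij commutator_F D_F commutator_iv)
  then show ?case using D_comp[OF D_step.IH D_commutator[OF D_step(2,1)]] by (simp only:)
qed

lemma subgp_D: "subgp D" using D_F D_comp D_iv D_id by (auto simp: subgp_def)

lemma normal_subgp_D: "normal_subgp D"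
proof -
  have "f \<circ> d \<circ> iv f \<in> D" if "f \<in> F" "d \<in> D" for f d
  proof -
    have "commutator f d \<circ> d = f \<circ> d \<circ> iv f"
      unfolding commutator_def using iv_simps(4)[OF F_bij[OF D_F[OF that(2)]]] by (simp add: comp_assoc)
    then show ?thesis using D_comp[OF D_commutator[OF that(1) D_F[OF that(2)]] that(2)] by simp
  qed
  then show ?thesis using subgp_D by (simp add: normal_subgp_def)
qed

lemma D_least: "subgp K \<Longrightarrow> (\<And>f g. f \<in> F \<Longrightarrow> g \<in> F \<Longrightarrow> commutator f g \<in> K) \<Longrightarrow> D \<subseteq> K"
proof
  fix h assume K: "subgp K" "\<And>f g. f \<in> F \<Longrightarrow> g \<in> F \<Longrightarrow> commutator f g \<in> K" and "h \<in> D"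
  from this(3) show "h \<in> K"
  proof (induction rule: D.induct)
    case D_id then show ?case by (rule subD(2)[OF K(1)])
  next
    case (D_step f g h) then show ?case by (intro subD(3)[OF K(1)] K(2))
  qed
qed

lemma eq_mod_D_comm: assumes "f \<in> F" "g \<in> F" shows "eq_mod D (f \<circ> g) (g \<circ> f)"
proof -
  have "f \<circ> g \<circ> iv (g \<circ> f) = commutator f g" unfolding commutator_def using assms by (simp add: iv_comp F_bij comp_assoc)
  then show ?thesis using assms D_commutator by (auto simp: eq_mod_def F_comp)
qed

lemma eq_mod_D_conj: assumes "f \<in> F" "g \<in> F" shows "eq_mod D (f \<circ> g \<circ> iv f) g"
proof -
  have "f \<circ> g \<circ> iv f \<circ> iv g = commutator f g" unfolding commutator_def ..
  then show ?thesis using assms D_commutator F_inv by (auto simp: eq_mod_def F_comp)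
qed

lemma level_cycle_D: assumes "C \<in> B" "distinct [p,q,r]" "tower C {p,q,r}" shows "level_cycle C p q r \<in> D"
proof -
  have "tower C {p,r,q}" "tower C {p,r}" "tower C {r,q}" using tower_mono[OF assms(3)] by auto
  then have "commutator (level_swap C p r) (level_swap C r q) = level_cycle C p q r" "level_swap C p r \<in> F" "level_swap C r q \<in> F"
    using commutator_level_swap[of p r q C] assms level_swap_F by auto
  then show ?thesis using D_commutator by metis
qed

text \<open>The analogue of an alternating group. Products alone suffice here too, since reversing a
  triple inverts its cycle.\<close>

inductive_set Alt :: "('a \<Rightarrow> 'a) set" where
  Alt_id: "id \<in> Alt"
| Alt_step: "C \<in> B \<Longrightarrow> distinct [p,q,r] \<Longrightarrow> tower C {p,q,r} \<Longrightarrow> h \<in> Alt \<Longrightarrow> level_cycle C p q r \<circ> h \<in> Alt"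

lemma Alt_F: "f \<in> Alt \<Longrightarrow> f \<in> F"
proof (induction rule: Alt.induct)
  case Alt_id then show ?case by (rule id_F)
next
  case (Alt_step C p q r h) then show ?case by (intro F_comp level_cycle_F)
qed

lemma Alt_level_cycle: "C \<in> B \<Longrightarrow> distinct [p,q,r] \<Longrightarrow> tower C {p,q,r} \<Longrightarrow> level_cycle C p q r \<in> Alt"
  using Alt_step[OF _ _ _ Alt_id] by simp

lemma Alt_comp: "f \<in> Alt \<Longrightarrow> g \<in> Alt \<Longrightarrow> f \<circ> g \<in> Alt"
  by (induction rule: Alt.induct) (simp_all add: comp_assoc Alt_step)

lemma Alt_iv: "f \<in> Alt \<Longrightarrow> iv f \<in> Alt"
proof (induction rule: Alt.induct)
  case Alt_id
  show ?case unfolding inv_id by (rule Alt.Alt_id)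
next
  case (Alt_step C p q r h)
  have c: "tower C {r,q,p}" using Alt_step(3) by (simp add: insert_commute)
  have "iv (level_cycle C p q r \<circ> h) = iv h \<circ> level_cycle C r q p"
    using Alt_step by (simp add: iv_comp F_bij level_cycle_bij Alt_F level_cycle_iv)
  moreover have "level_cycle C r q p \<in> Alt" using Alt_step(1,2) c by (intro Alt_level_cycle) auto
  ultimately show ?case using Alt_comp[OF Alt_step.IH] by (simp only:)
qed

lemma subgp_Alt: "subgp Alt" using Alt_F Alt_comp Alt_iv Alt_id by (auto simp: subgp_def)

lemma Alt_least:
  "subgp K \<Longrightarrow> (\<And>C p q r. C \<in> B \<Longrightarrow> distinct [p,q,r] \<Longrightarrow> tower C {p,q,r} \<Longrightarrow> level_cycle C p q r \<in> K) \<Longrightarrow> Alt \<subseteq> K"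
proof
  fix h assume K: "subgp K" "\<And>C p q r. C \<in> B \<Longrightarrow> distinct [p,q,r] \<Longrightarrow> tower C {p,q,r} \<Longrightarrow> level_cycle C p q r \<in> K"
    and "h \<in> Alt"
  from this(3) show "h \<in> K"
  proof (induction rule: Alt.induct)
    case Alt_id then show ?case by (rule subD(2)[OF K(1)])
  next
    case (Alt_step C p q r h) then show ?case by (intro subD(3)[OF K(1)] K(2))
  qed
qed

lemma conj_comp: "bij f \<Longrightarrow> f \<circ> (g \<circ> h) \<circ> iv f = (f \<circ> g \<circ> iv f) \<circ> (f \<circ> h \<circ> iv f)"
  by (simp add: comp_assoc comp_cancel)

text \<open>On a small piece of \<open>C\<close> the element \<open>f\<close> acts on each of the
  three levels as one power of the action, so conjugation moves the cycle of the piece to three new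
  levels. The whole cycle is a product over finitely many such pieces.\<close>

lemma Alt_conj_level_cycle:
  assumes "f \<in> F" "C \<in> B" "distinct [p,q,r]" "tower C {p,q,r}"
  shows "f \<circ> level_cycle C p q r \<circ> iv f \<in> Alt"
proof (rule local_induct[OF assms(2), of "\<lambda>C. f \<circ> level_cycle C p q r \<circ> iv f \<in> Alt"])
  show "f \<circ> level_cycle {} p q r \<circ> iv f \<in> Alt" using iv_simps(3)[OF F_bij[OF assms(1)]] Alt_id by (simp add: level_cycle_empty)
next
  fix C1 C2 assume C: "C1 \<in> B" "C2 \<in> B" "C1 \<inter> C2 = {}" "C1 \<subseteq> C" "C2 \<subseteq> C"
    "f \<circ> level_cycle C1 p q r \<circ> iv f \<in> Alt" "f \<circ> level_cycle C2 p q r \<circ> iv f \<in> Alt"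
  have "level_cycle (C1 \<union> C2) p q r = level_cycle C1 p q r \<circ> level_cycle C2 p q r"
    using C by (intro level_cycle_Un tower_mono[OF assms(4)]) auto
  then show "f \<circ> level_cycle (C1 \<union> C2) p q r \<circ> iv f \<in> Alt"
    using Alt_comp[OF C(6,7)] conj_comp[OF F_bij[OF assms(1)]] by simp
next
  fix x assume x: "x \<in> C"
  then have xS: "x \<in> S" using assms B_sub by auto
  define n where "n j = disp f (T j x)" for j
  have "near x (\<lambda>D. \<forall>j\<in>{p,q,r}. \<forall>z\<in>T j ` D. f z = T (n j) z)"
    unfolding n_def by (intro near_ball near_T F_near assms(1) T_S xS) auto
  then show "near x (\<lambda>D. D \<subseteq> C \<longrightarrow> f \<circ> level_cycle D p q r \<circ> iv f \<in> Alt)"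
  proof (rule near_mono, intro impI)
    fix D assume D: "D \<in> B" "\<forall>j\<in>{p,q,r}. \<forall>z\<in>T j ` D. f z = T (n j) z" "D \<subseteq> C"
    have tower: "tower D {p,q,r}" using tower_mono[OF assms(4) D(3)] by simp
    have f: "f (T j c) = T (n j + j) c" if "j \<in> {p,q,r}" "c \<in> D" for j c using D(2) that by (auto simp: T_add)
    have inj: "inj f" using F_bij[OF assms(1)] bij_is_inj by auto
    \<comment> \<open>Distinctness of the new levels is tested at \<open>x\<close> itself, because
      \<open>D\<close> may be empty or miss \<open>x\<close>.\<close>
    have ne: "n i + i \<noteq> n j + j" if "i \<in> {p,q,r}" "j \<in> {p,q,r}" "i \<noteq> j" for i j
    proof
      assume "n i + i = n j + j"
      moreover have "f (T j x) = T (n j + j) x" for j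
        using F_disp[OF assms(1) T_S[OF xS]] n_def by (simp add: T_add)
      ultimately have "f (T i x) = f (T j x)" by simp
      then show False using inj that(3) T_inj[OF xS] by (auto dest: injD)
    qed
    have dist: "distinct [n p + p, n q + q, n r + r]" using ne[of p q] ne[of p r] ne[of q r] assms(3) by auto
    from level_cycle_conj[OF assms(3) tower dist F_bij[OF assms(1)] f f f] Alt_level_cycle[OF D(1) dist]
    show "f \<circ> level_cycle D p q r \<circ> iv f \<in> Alt" by simp
  qed
qed

lemma normal_subgp_Alt: "normal_subgp Alt"
proof -
  have "f \<circ> d \<circ> iv f \<in> Alt" if f: "f \<in> F" and "d \<in> Alt" for f d
    using that(2)
  proof (induction rule: Alt.induct)
    case Alt_id show ?case unfolding comp_id iv_simps(3)[OF F_bij[OF f]] by (rule Alt.Alt_id)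
  next
    case (Alt_step C p q r h)
    show ?case unfolding conj_comp[OF F_bij[OF f]] by (rule Alt_comp[OF Alt_conj_level_cycle[OF f Alt_step(1-3)] Alt_step(5)])
  qed
  then show ?thesis using subgp_Alt by (simp add: normal_subgp_def)
qed

section \<open>Generators and commutators\<close>

definition lconst :: "('a \<Rightarrow> 'c) \<Rightarrow> bool" where
  "lconst u \<longleftrightarrow> (\<forall>x\<in>S. near x (\<lambda>C. \<forall>z\<in>C. u z = u x))"

lemma lconst_const: "lconst (\<lambda>_. c)" by (simp add: lconst_def near_True)

lemma lconst_comp2: "lconst u \<Longrightarrow> lconst v \<Longrightarrow> lconst (\<lambda>x. h (u x) (v x))"
  unfolding lconst_def
proof
  fix x assume "\<forall>x\<in>S. near x (\<lambda>C. \<forall>z\<in>C. u z = u x)" "\<forall>x\<in>S. near x (\<lambda>C. \<forall>z\<in>C. v z = v x)" "x \<in> S"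
  then have "near x (\<lambda>C. (\<forall>z\<in>C. u z = u x) \<and> (\<forall>z\<in>C. v z = v x))" using near_conj by blast
  then show "near x (\<lambda>C. \<forall>z\<in>C. h (u z) (v z) = h (u x) (v x))" by (rule near_mono) simp
qed

lemma lconst_comp1: "lconst u \<Longrightarrow> lconst (\<lambda>x. h (u x))"
  using lconst_comp2[of u u "\<lambda>a b. h a"] by simp

lemma lconst_cong: "lconst u \<Longrightarrow> (\<And>x. x \<in> S \<Longrightarrow> u x = v x) \<Longrightarrow> lconst v"
  unfolding lconst_def
proof
  fix x assume u: "\<forall>x\<in>S. near x (\<lambda>C. \<forall>z\<in>C. u z = u x)" "\<And>x. x \<in> S \<Longrightarrow> u x = v x" "x \<in> S"
  then have "near x (\<lambda>C. \<forall>z\<in>C. u z = u x)" by blast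
  then show "near x (\<lambda>C. \<forall>z\<in>C. v z = v x)"
    by (rule near_mono) (use u(2,3) B_sub in \<open>metis subsetD\<close>)
qed

lemma lconst_T: "lconst u \<Longrightarrow> lconst (\<lambda>x. u (T n x))"
  unfolding lconst_def
proof
  fix x assume "\<forall>x\<in>S. near x (\<lambda>C. \<forall>z\<in>C. u z = u x)" "x \<in> S"
  then have "near (T n x) (\<lambda>C. \<forall>z\<in>C. u z = u (T n x))" using T_S by blast
  from near_T[OF this] show "near x (\<lambda>C. \<forall>z\<in>C. u (T n z) = u (T n x))" by (rule near_mono) auto
qed

lemma lconst_sum: "finite I \<Longrightarrow> (\<And>i. i \<in> I \<Longrightarrow> lconst (u i)) \<Longrightarrow> lconst (\<lambda>x. \<Sum>i\<in>I. (u i x :: 'c :: comm_monoid_add))"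
proof (induction rule: finite_induct)
  case (insert i I)
  then have "lconst (\<lambda>x. u i x + (\<Sum>i\<in>I. u i x))" by (intro lconst_comp2[where h = "(+)"]) auto
  then show ?case using insert by simp
qed (simp add: lconst_const)

lemma lconst_disp: "f \<in> F \<Longrightarrow> lconst (disp f)"
  by (simp add: lconst_def F_near_disp)

lemma lconst_mem: assumes "C \<in> B" shows "lconst (\<lambda>x. x \<in> C)"
  unfolding lconst_def
proof
  fix x assume x: "x \<in> S"
  show "near x (\<lambda>D. \<forall>z\<in>D. (z \<in> C) = (x \<in> C))"
  proof (cases "x \<in> C")
    case True
    then show ?thesis using near_subset[OF assms True] by (elim near_mono) auto
  next
    case False
    then have "near x (\<lambda>D. D \<subseteq> S - C)" using x assms B_Diff S_B by (intro near_subset) auto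
    then show ?thesis using False by (elim near_mono) auto
  qed
qed

lemma lconst_Collect: assumes "lconst P" shows "{x\<in>S. P x} \<in> B"
proof -
  have "{x\<in>S. x \<in> S \<and> P x} \<in> B"
  proof (rule local_induct[OF S_B, of "\<lambda>C. {x\<in>S. x \<in> C \<and> P x} \<in> B"])
    fix C1 C2 assume "{x \<in> S. x \<in> C1 \<and> P x} \<in> B" "{x \<in> S. x \<in> C2 \<and> P x} \<in> B"
    moreover have "{x \<in> S. x \<in> C1 \<union> C2 \<and> P x} = {x \<in> S. x \<in> C1 \<and> P x} \<union> {x \<in> S. x \<in> C2 \<and> P x}" by auto
    ultimately show "{x \<in> S. x \<in> C1 \<union> C2 \<and> P x} \<in> B" using B_Un by simp
  next
    fix x assume x: "x \<in> S"
    then have "near x (\<lambda>C. \<forall>z\<in>C. P z = P x)" using assms by (simp add: lconst_def)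
    then show "near x (\<lambda>C. C \<subseteq> S \<longrightarrow> {z \<in> S. z \<in> C \<and> P z} \<in> B)"
    proof (rule near_mono, intro impI)
      fix C assume C: "C \<in> B" "\<forall>z\<in>C. P z = P x" "C \<subseteq> S"
      have "{z \<in> S. z \<in> C \<and> P z} = (if P x then C else {})" using C by auto
      then show "{z \<in> S. z \<in> C \<and> P z} \<in> B" using C B_empty by simp
    qed
  qed (simp add: B_empty)
  moreover have "{x\<in>S. x \<in> S \<and> P x} = {x\<in>S. P x}" by auto
  ultimately show ?thesis by simp
qed

lemma lconst_bounded: assumes "lconst (u :: 'a \<Rightarrow> int)" shows "\<exists>M. \<forall>x\<in>S. \<bar>u x\<bar> \<le> M"
proof (rule local_induct[OF S_B, of "\<lambda>C. \<exists>M. \<forall>x\<in>C. \<bar>u x\<bar> \<le> M"])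
  fix C1 C2 assume "\<exists>M. \<forall>x\<in>C1. \<bar>u x\<bar> \<le> M" "\<exists>M. \<forall>x\<in>C2. \<bar>u x\<bar> \<le> M"
  then obtain M1 M2 where "\<forall>x\<in>C1. \<bar>u x\<bar> \<le> M1" "\<forall>x\<in>C2. \<bar>u x\<bar> \<le> M2" by auto
  then have "\<forall>x\<in>C1 \<union> C2. \<bar>u x\<bar> \<le> max M1 M2" by fastforce
  then show "\<exists>M. \<forall>x\<in>C1 \<union> C2. \<bar>u x\<bar> \<le> M" by blast
next
  fix x assume "x \<in> S"
  then have "near x (\<lambda>C. \<forall>z\<in>C. u z = u x)" using assms by (simp add: lconst_def)
  then show "near x (\<lambda>C. C \<subseteq> S \<longrightarrow> (\<exists>M. \<forall>x\<in>C. \<bar>u x\<bar> \<le> M))"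
    by (rule near_mono) (metis order_refl)
qed simp

section \<open>Transpositions of a clopen set with its translate, and generation of the full
  group\<close>

definition swappable :: "'a set \<Rightarrow> bool" where "swappable A \<longleftrightarrow> A \<in> B \<and> A \<inter> T 1 ` A = {}"

lemma swappable_tower: "swappable A \<Longrightarrow> tower A {0, 1}"
  by (auto simp: swappable_def tower_def T_0_image)

lemma swappable_mono: "swappable A \<Longrightarrow> C \<subseteq> A \<Longrightarrow> C \<in> B \<Longrightarrow> swappable C"
  unfolding swappable_def by blast

abbreviation swap1 :: "'a set \<Rightarrow> 'a \<Rightarrow> 'a" where "swap1 A \<equiv> level_swap A 0 1"

lemma swap1_F: "swappable A \<Longrightarrow> swap1 A \<in> F" using level_swap_F swappable_tower by (simp add: swappable_def)
lemma swap1_involutive: "swappable A \<Longrightarrow> swap1 A \<circ> swap1 A = id" using level_swap_level_swap swappable_tower by simp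
lemma swap1_iv: "swappable A \<Longrightarrow> iv (swap1 A) = swap1 A" using level_swap_iv swappable_tower by simp

lemma swap1_in: assumes "swappable A" "a \<in> A" shows "swap1 A a = T 1 a" "swap1 A (T 1 a) = a"
  using level_swap_in[OF zero_neq_one swappable_tower[OF assms(1)] subset_refl assms(2)] assms(2) by (simp_all add: T_0)

lemma swap1_out: assumes "x \<notin> A" "T (-1) x \<notin> A" shows "swap1 A x = x"
  using assms level_swap_out[of x 0 A 1] by (simp add: T_0_image T_mem_iff)

lemma swappable_T1: "swappable A \<Longrightarrow> x \<in> A \<Longrightarrow> T 1 x \<notin> A"
  unfolding swappable_def by blast

lemma swappable_T1': "swappable A \<Longrightarrow> x \<in> A \<Longrightarrow> T (-1) x \<notin> A"
  using swappable_T1[of A "T (-1) x"] by (auto simp: T_add T_0)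

lemma swappable_S: "swappable A \<Longrightarrow> x \<in> A \<Longrightarrow> x \<in> S" using B_sub by (auto simp: swappable_def)

lemma disp_swap1: assumes "swappable A" "x \<in> S"
  shows "disp (swap1 A) x = (if x \<in> A then 1 else if T (-1) x \<in> A then -1 else 0)"
proof (rule disp_eqI[OF assms(2)])
  show "swap1 A x = T (if x \<in> A then 1 else if T (- 1) x \<in> A then - 1 else 0) x"
    using swap1_in[OF assms(1), of x] swap1_in[OF assms(1), of "T (-1) x"] swap1_out[of x A]
    by (auto simp: T_add T_0)
qed

lemma near_swappable: "x \<in> S \<Longrightarrow> near x swappable"
  by (rule near_mono[OF near_tower[of x "{0,1}"]]) (auto simp: swappable_def tower_def T_0_image)

text \<open>A normal form: one power of the action on the left, swaps on the right. Only right
  multiplication by swaps is built in, because the sorting argument cancels swaps on the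
  right.\<close>

inductive_set generated :: "('a \<Rightarrow> 'a) set" where
  generated_T: "T c \<in> generated"
| generated_swap1: "f \<in> generated \<Longrightarrow> swappable A \<Longrightarrow> f \<circ> swap1 A \<in> generated"

lemma generated_F: "f \<in> generated \<Longrightarrow> f \<in> F"
proof (induction rule: generated.induct)
  case (generated_T c) then show ?case by (rule T_F)
next
  case (generated_swap1 f A) then show ?case by (intro F_comp swap1_F)
qed

lemma generated_cancel: assumes "f \<circ> swap1 A \<in> generated" "swappable A" shows "f \<in> generated"
proof -
  have "f \<circ> swap1 A \<circ> swap1 A = f" using swap1_involutive[OF assms(2)] by (simp add: comp_assoc)
  then show ?thesis using generated_swap1[OF assms] by simp
qed

text \<open>By minimality the translates of the complement of \<open>E\<close> cover the space, and
  by compactness finitely many suffice, so every point leaves \<open>E\<close> within a bounded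
  time.\<close>

lemma proper_clopen_runs:
  assumes "E \<in> B" "E \<noteq> S" shows "\<exists>L::nat. \<forall>x\<in>S. \<exists>k\<in>{0..int L}. T k x \<notin> E"
proof -
  define C where "C = S - E"
  have C: "C \<in> B" "C \<noteq> {}" using assms B_sub S_B B_Diff unfolding C_def by auto
  define U where "U = range (\<lambda>n. T n ` C)"
  have "S \<subseteq> \<Union>U"
  proof
    fix x assume "x \<in> S"
    then obtain n where "T n x \<in> C" using minimal C by blast
    then have "x \<in> T (-n) ` C" by (simp add: T_mem_iff)
    then show "x \<in> \<Union>U" unfolding U_def by blast
  qed
  moreover have "U \<subseteq> B" unfolding U_def using T_B C by auto
  ultimately obtain V where V: "V \<subseteq> U" "finite V" "S \<subseteq> \<Union>V" using cpt by meson
  then obtain N where N: "finite N" "V = (\<lambda>n. T n ` C) ` N" unfolding U_def by (meson finite_subset_image)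
  define M where "M = Max (insert 0 (abs ` N))"
  have M: "\<bar>n\<bar> \<le> M" if "n \<in> N" for n unfolding M_def using N(1) that by (intro Max_ge) auto
  have M0: "0 \<le> M" unfolding M_def using N(1) by (intro Max_ge) auto
  show ?thesis
  \<comment> \<open>The exponents of the finite cover lie between \<open>- M\<close> and
    \<open>M\<close>. Starting from \<open>T M x\<close> instead of \<open>x\<close> makes the exit
    time \<open>M - n\<close> nonnegative, at the price of the bound \<open>2 * M\<close>.\<close>
  proof (intro exI[of _ "nat (2 * M)"] ballI)
    fix x assume x: "x \<in> S"
    then have "T M x \<in> \<Union>V" using V(3) T_S by blast
    then obtain n where n: "n \<in> N" "T M x \<in> T n ` C" using N(2) by auto
    then have "T (M - n) x \<in> C" by (simp add: T_mem_iff T_add)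
    then have "T (M - n) x \<notin> E" by (simp add: C_def)
    moreover have "M - n \<in> {0..int (nat (2 * M))}" using M[OF n(1)] M0 by auto
    ultimately show "\<exists>k\<in>{0..int (nat (2 * M))}. T k x \<notin> E" by blast
  qed
qed

text \<open>Swapping the last point of every maximal run of points of displacement \<open>b\<close> with its successor
  shortens all these runs.\<close>

lemma lower_max_displacement:
  assumes IH: "\<And>f. f \<in> F \<Longrightarrow> \<forall>x\<in>S. a \<le> disp f x \<and> disp f x \<le> b - 1 \<Longrightarrow> f \<in> generated" and ab: "a < b"
  shows "f \<in> F \<Longrightarrow> \<forall>x\<in>S. a \<le> disp f x \<and> disp f x \<le> b \<Longrightarrow> \<forall>x\<in>S. \<exists>k\<in>{0..int L}. disp f (T k x) \<noteq> b \<Longrightarrow> f \<in> generated"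
proof (induction L arbitrary: f)
  case 0
  then have "disp f x \<noteq> b" if "x \<in> S" for x using that by (simp add: T_0)
  then have "\<forall>x\<in>S. a \<le> disp f x \<and> disp f x \<le> b - 1" using 0(2) by (smt (verit))
  then show ?case using IH 0 by blast
next
  case (Suc L)
  define A where "A = {x\<in>S. disp f x = b \<and> disp f (T 1 x) \<noteq> b}"
  have "lconst (\<lambda>x. disp f x = b \<and> disp f (T 1 x) \<noteq> b)"
    by (rule lconst_comp2[OF lconst_disp[OF Suc(2)] lconst_T[OF lconst_disp[OF Suc(2)], of 1], of "\<lambda>m n. m = b \<and> n \<noteq> b"])
  then have "A \<in> B" unfolding A_def by (rule lconst_Collect)
  then have A: "swappable A" unfolding swappable_def by (auto simp: A_def)
  define f' where "f' = f \<circ> swap1 A"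
  have f': "f' \<in> F" unfolding f'_def by (intro F_comp Suc(2) swap1_F A)
  have inj: "inj f" using F_bij[OF Suc(2)] bij_is_inj by blast
  have cc1: "disp f' x = (if x \<in> A then disp f (T 1 x) + 1 else if T (-1) x \<in> A then b - 1 else disp f x)"
    if x: "x \<in> S" for x
  proof -
    have "disp f' x = disp (swap1 A) x + disp f (swap1 A x)" unfolding f'_def using disp_comp[OF Suc(2) swap1_F[OF A] x] .
    moreover have "disp f (T (-1) x) = b" if "T (-1) x \<in> A" using that by (simp add: A_def)
    ultimately show ?thesis
      using disp_swap1[OF A x] swap1_in[OF A, of x] swap1_in[OF A, of "T (-1) x"] swap1_out[of x A]
      by (auto simp: T_add T_0)
  qed
  \<comment> \<open>The value \<open>b - 1\<close> is excluded by injectivity: \<open>f\<close>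
    would send \<open>x\<close> and its successor to the same point. Hence after the swap the
    displacement on \<open>A\<close> is at most \<open>b - 1\<close>.\<close>
  have lt: "disp f (T 1 x) \<le> b - 2" if "x \<in> A" for x
  proof -
    have x: "x \<in> S" "disp f x = b" "disp f (T 1 x) \<noteq> b" using that by (auto simp: A_def)
    have "disp f (T 1 x) \<noteq> b - 1"
    proof
      assume "disp f (T 1 x) = b - 1"
      then have "f (T 1 x) = T b x" using F_disp[OF Suc(2) T_S[OF x(1)], of 1] by (simp add: T_add)
      also have "\<dots> = f x" using F_disp[OF Suc(2) x(1)] x(2) by simp
      finally have "T 1 x = T 0 x" using inj by (simp add: inj_eq T_0)
      then show False using T_inj[OF x(1)] by simp
    qed
    then show ?thesis using Suc(3) T_S[OF x(1)] x(3) by (smt (verit))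
  qed
  have "f' \<in> generated"
  proof (rule Suc.IH[OF f'])
    show "\<forall>x\<in>S. a \<le> disp f' x \<and> disp f' x \<le> b"
    proof
      fix x assume x: "x \<in> S"
      have "a \<le> disp f x" "disp f x \<le> b" "a \<le> disp f (T 1 x)" using Suc(3) x T_S by auto
      then show "a \<le> disp f' x \<and> disp f' x \<le> b" using cc1[OF x] lt[of x] ab by auto
    qed
    show "\<forall>x\<in>S. \<exists>k\<in>{0..int L}. disp f' (T k x) \<noteq> b"
    proof (rule ccontr)
      assume "\<not> ?thesis"
      then obtain x where x: "x \<in> S" "\<forall>k\<in>{0..int L}. disp f' (T k x) = b" by auto
      \<comment> \<open>A point of displacement \<open>b\<close> under \<open>f'\<close> had it
        under \<open>f\<close> and does not end a run, so its successor has it under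
        \<open>f\<close> as well. A run of \<open>L + 1\<close> points for \<open>f'\<close> would
        give a run of \<open>L + 2\<close> points for \<open>f\<close>.\<close>
      have 1: "disp f (T k x) = b \<and> disp f (T (k + 1) x) = b" if k: "k \<in> {0..int L}" for k
      proof -
        have z: "T k x \<in> S" "disp f' (T k x) = b" using x T_S k by auto
        then have "T k x \<notin> A" "disp f (T k x) = b" using cc1[OF z(1)] lt[of "T k x"] by (auto split: if_splits)
        then show ?thesis using z(1) by (simp add: A_def T_add add.commute)
      qed
      have "disp f (T k x) = b" if k: "k \<in> {0..int (Suc L)}" for k
      proof (cases "k = int (Suc L)")
        case True
        then show ?thesis using 1[of "int L"] by (simp add: add.commute)
      next
        case False
        then show ?thesis using 1[of k] k by simp
      qed
      then show False using Suc(4) x(1) by blast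
    qed
  qed
  then show ?case using generated_cancel A unfolding f'_def by blast
qed

text \<open>Induction on the width \<open>n\<close> of an interval that contains all displacements.
  If the maximal value is taken everywhere, the element is a power of the action; this case is
  separate because the runs of the maximal value are then infinite.\<close>

lemma F_generated: assumes "f \<in> F" shows "f \<in> generated"
proof -
  have "f \<in> F \<Longrightarrow> \<forall>x\<in>S. a \<le> disp f x \<and> disp f x \<le> a + int n \<Longrightarrow> f \<in> generated" for a n f
  proof (induction n arbitrary: f)
    case 0
    then have "disp f x = a" if "x \<in> S" for x using that by fastforce
    then have "f x = T a x" if "x \<in> S" for x using F_disp[OF 0(1) that] that by simp
    then have "f = T a" using F_out[OF 0(1)] T_out by (metis ext)
    then show ?case using generated_T by simp
  next
    case (Suc n)
    show ?case
    proof (cases "\<forall>x\<in>S. disp f x = a + int (Suc n)")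
      case True
      then have "f x = T (a + int (Suc n)) x" if "x \<in> S" for x using F_disp[OF Suc(2) that] that by simp
      then have "f = T (a + int (Suc n))" using F_out[OF Suc(2)] T_out by (metis ext)
      then show ?thesis using generated_T by simp
    next
      case False
      define E where "E = {x\<in>S. disp f x = a + int (Suc n)}"
      have "E \<in> B" unfolding E_def using lconst_comp1[OF lconst_disp[OF Suc(2)], of "\<lambda>k. k = a + int (Suc n)"] by (rule lconst_Collect)
      moreover have "E \<noteq> S" using False by (auto simp: E_def)
      ultimately obtain L :: nat where L: "\<forall>x\<in>S. \<exists>k\<in>{0..int L}. T k x \<notin> E" using proper_clopen_runs by blast
      have L': "\<forall>x\<in>S. \<exists>k\<in>{0..int L}. disp f (T k x) \<noteq> a + int (Suc n)"
      proof
        fix x assume "x \<in> S"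
        then obtain k where "k \<in> {0..int L}" "T k x \<notin> E" using L by blast
        then show "\<exists>k\<in>{0..int L}. disp f (T k x) \<noteq> a + int (Suc n)" using T_S[OF \<open>x \<in> S\<close>] by (auto simp: E_def)
      qed
      show ?thesis
      proof (rule lower_max_displacement[of a "a + int (Suc n)" f L])
        fix g assume "g \<in> F" "\<forall>x\<in>S. a \<le> disp g x \<and> disp g x \<le> a + int (Suc n) - 1"
        then show "g \<in> generated" using Suc.IH[of g] by simp
      qed (use Suc L' in auto)
    qed
  qed
  moreover obtain M where M: "\<forall>x\<in>S. \<bar>disp f x\<bar> \<le> M" using lconst_bounded[OF lconst_disp[OF assms]] by blast
  have "\<forall>x\<in>S. - \<bar>M\<bar> \<le> disp f x \<and> disp f x \<le> - \<bar>M\<bar> + int (nat (2 * \<bar>M\<bar>))"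
    using M by (smt (verit) nat_0_le)
  ultimately show ?thesis using assms by blast
qed

lemma generated_subset: assumes "subgp K" "T 1 \<in> K" "\<And>A. swappable A \<Longrightarrow> swap1 A \<in> K" shows "F \<subseteq> K"
proof
  fix f assume "f \<in> F"
  then have "f \<in> generated" by (rule F_generated)
  have nat: "T (int n) \<in> K" for n
  proof (induction n)
    case 0
    have "T 0 = id" by (auto simp: T_0)
    then show ?case using subD(2)[OF assms(1)] by (simp only: of_nat_0)
  next
    case (Suc n)
    have "T (int (Suc n)) = T 1 \<circ> T (int n)" by (simp add: T_comp add.commute)
    then show ?case using subD(3)[OF assms(1,2) Suc] by (simp only:)
  qed
  have T: "T c \<in> K" for c
  proof (cases "c \<ge> 0")
    case True then show ?thesis using nat[of "nat c"] by simp
  next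
    case False
    then have "T c = iv (T (int (nat (- c))))" by (simp add: iv_T)
    then show ?thesis using subD(4)[OF assms(1) nat] by (simp only:)
  qed
  show "f \<in> K" using \<open>f \<in> generated\<close>
  proof (induction rule: generated.induct)
    case (generated_T c) then show ?case by (rule T)
  next
    case (generated_swap1 f A) then show ?case by (intro subD(3)[OF assms(1)] assms(3))
  qed
qed

section \<open>Commutativity of the full group modulo three-cycles\<close>

lemma swap1_Un: "swappable (C1 \<union> C2) \<Longrightarrow> C1 \<inter> C2 = {} \<Longrightarrow> swap1 (C1 \<union> C2) = swap1 C1 \<circ> swap1 C2"
  by (rule level_swap_Un[OF swappable_tower])

lemma swappable_shift: "swappable A \<Longrightarrow> swappable (T n ` A)"
proof -
  have "T 1 ` T n ` A = T n ` T 1 ` A" by (simp add: T_image_image add.commute)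
  moreover have "T n ` A \<inter> T n ` T 1 ` A = T n ` (A \<inter> T 1 ` A)"
    by (rule image_Int[symmetric]) (rule bij_is_inj[OF T_bij])
  ultimately show "swappable A \<Longrightarrow> swappable (T n ` A)" unfolding swappable_def using T_B by simp
qed

lemma T_conj_swap1: assumes "swappable A" shows "T n \<circ> swap1 A \<circ> iv (T n) = swap1 (T n ` A)"
proof -
  have "T n \<circ> level_swap A 0 1 \<circ> iv (T n) = level_swap A n (1 + n)"
    by (rule level_swap_conj(2)[OF _ swappable_tower[OF assms] _ T_bij]) (auto simp: T_add add.commute)
  also have "\<dots> = swap1 (T n ` A)" using level_swap_shift[of 0 1 n A] swappable_tower[OF swappable_shift[OF assms]] by simp
  finally show ?thesis .
qed

text \<open>For a small base the two swaps act on levels 1, 2 and on levels 0, 1 of one tower, and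
  their quotient is a three-cycle. A general base is a disjoint union of small ones.\<close>

lemma swap1_T1_eq_mod_Alt: assumes "swappable A" shows "eq_mod Alt (swap1 (T 1 ` A)) (swap1 A)"
proof (rule local_induct[of A "\<lambda>C. eq_mod Alt (swap1 (T 1 ` C)) (swap1 C)"])
  show "A \<in> B" using assms by (simp add: swappable_def)
  show "eq_mod Alt (swap1 (T 1 ` {})) (swap1 {})" using eq_mod_refl[OF normal_subgp_Alt id_F] by (simp add: level_swap_empty)
next
  fix C1 C2 assume C: "C1 \<in> B" "C2 \<in> B" "C1 \<inter> C2 = {}" "C1 \<subseteq> A" "C2 \<subseteq> A"
    "eq_mod Alt (swap1 (T 1 ` C1)) (swap1 C1)" "eq_mod Alt (swap1 (T 1 ` C2)) (swap1 C2)"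
  have g: "swappable (C1 \<union> C2)" using C B_Un swappable_mono[OF assms] by simp
  have "T 1 ` C1 \<inter> T 1 ` C2 = {}" using C(3) by (auto simp: T_eq_iff)
  then have "swap1 (T 1 ` (C1 \<union> C2)) = swap1 (T 1 ` C1) \<circ> swap1 (T 1 ` C2)"
    using swappable_shift[OF g, of 1] by (simp add: image_Un swap1_Un)
  then show "eq_mod Alt (swap1 (T 1 ` (C1 \<union> C2))) (swap1 (C1 \<union> C2))"
    using eq_mod_comp[OF normal_subgp_Alt C(6,7)] swap1_Un[OF g C(3)] by simp
next
  fix x assume "x \<in> A"
  then have "x \<in> S" using swappable_S assms by auto
  then have "near x (\<lambda>C. tower C {0,1,2} \<and> swappable C)" by (intro near_conj near_tower near_swappable) auto
  then show "near x (\<lambda>C. C \<subseteq> A \<longrightarrow> eq_mod Alt (swap1 (T 1 ` C)) (swap1 C))"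
  proof (rule near_mono, intro impI)
    fix C assume C: "C \<in> B" "tower C {0,1,2} \<and> swappable C"
    have "swap1 (T 1 ` C) = level_swap C 1 2" using level_swap_shift[of 0 1 1 C] swappable_tower[OF swappable_shift, of C 1] C(2) by simp
    then have "swap1 (T 1 ` C) \<circ> iv (swap1 C) = level_swap C 2 1 \<circ> level_swap C 1 0" using C(2) swap1_iv level_swap_sym by metis
    also have "\<dots> = level_cycle C 2 1 0" using C(2) level_cycle_level_swap[of C 2 1 0] by (simp add: insert_commute)
    also have "\<dots> \<in> Alt" using C by (intro Alt_level_cycle) (auto simp: insert_commute)
    finally show "eq_mod Alt (swap1 (T 1 ` C)) (swap1 C)" using C(2) swap1_F swappable_shift by (auto simp: eq_mod_def)
  qed
qed

text \<open>To see that \<open>F\<close> is commutative modulo three-cycles, it suffices that the generators \<open>T 1\<close> and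
  \<open>swap1 A\<close> commute; for two swaps, one of them is first moved away by a power of \<open>T 1\<close>.\<close>

definition centralizer :: "('a \<Rightarrow> 'a) set \<Rightarrow> ('a \<Rightarrow> 'a) \<Rightarrow> ('a \<Rightarrow> 'a) set" where
  "centralizer N h = {g\<in>F. eq_mod N (g \<circ> h) (h \<circ> g)}"

lemma centralizer_iff: assumes "h \<in> F" shows "g \<in> centralizer N h \<longleftrightarrow> g \<in> F \<and> commutator g h \<in> N"
proof -
  have "g \<circ> h \<circ> iv (h \<circ> g) = commutator g h" if "g \<in> F" unfolding commutator_def using assms that by (simp add: iv_comp F_bij comp_assoc)
  then show ?thesis using assms F_comp by (auto simp: centralizer_def eq_mod_def)
qed

lemma subgp_centralizer: assumes N: "normal_subgp N" and h: "h \<in> F" shows "subgp (centralizer N h)"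
  unfolding subgp_def
proof (intro conjI ballI)
  show "centralizer N h \<subseteq> F" "id \<in> centralizer N h" using h id_F eq_mod_refl[OF N h] by (auto simp: centralizer_def)
  fix f assume f: "f \<in> centralizer N h"
  then have fF: "f \<in> F" "eq_mod N (f \<circ> h) (h \<circ> f)" by (auto simp: centralizer_def)
  have i: "iv f \<in> F" using F_inv fF by simp
  have "eq_mod N (iv f \<circ> (h \<circ> f) \<circ> iv f) (iv f \<circ> (f \<circ> h) \<circ> iv f)"
    by (intro eq_mod_comp[OF N] eq_mod_refl[OF N i] eq_mod_sym[OF N fF(2)])
  moreover have "iv f \<circ> (h \<circ> f) \<circ> iv f = iv f \<circ> h" "iv f \<circ> (f \<circ> h) \<circ> iv f = h \<circ> iv f"
    by (simp_all only: comp_assoc iv_simps(3)[OF F_bij[OF fF(1)]] comp_id comp_cancel(2)[OF F_bij[OF fF(1)]])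
  ultimately have "eq_mod N (iv f \<circ> h) (h \<circ> iv f)" by (simp only:)
  then show "iv f \<in> centralizer N h" using i by (simp add: centralizer_def)
  fix g assume g: "g \<in> centralizer N h"
  then have gF: "g \<in> F" "eq_mod N (g \<circ> h) (h \<circ> g)" by (auto simp: centralizer_def)
  have "eq_mod N (f \<circ> (g \<circ> h)) (f \<circ> (h \<circ> g))" by (intro eq_mod_comp[OF N] eq_mod_refl[OF N] fF gF)
  moreover have "eq_mod N ((f \<circ> h) \<circ> g) ((h \<circ> f) \<circ> g)" by (intro eq_mod_comp[OF N] eq_mod_refl[OF N] fF gF)
  ultimately have "eq_mod N (f \<circ> g \<circ> h) (h \<circ> (f \<circ> g))" using eq_mod_trans[OF N] by (simp add: comp_assoc)
  then show "f \<circ> g \<in> centralizer N h" using fF gF F_comp by (simp add: centralizer_def)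
qed

lemma centralizer_sym: assumes "normal_subgp N" "g \<in> F" "h \<in> F" shows "g \<in> centralizer N h \<longleftrightarrow> h \<in> centralizer N g"
  using assms eq_mod_sym[OF assms(1)] by (auto simp: centralizer_def)

lemma T1_centralizer_swap1: assumes "swappable A" shows "T 1 \<in> centralizer Alt (swap1 A)"
proof -
  have "eq_mod Alt (T 1 \<circ> swap1 A \<circ> iv (T 1) \<circ> T 1) (swap1 A \<circ> T 1)"
    unfolding T_conj_swap1[OF assms] by (intro eq_mod_comp[OF normal_subgp_Alt] eq_mod_refl[OF normal_subgp_Alt] swap1_T1_eq_mod_Alt assms T_F)
  then show ?thesis using iv_simps(4)[OF T_bij[of 1]] by (simp add: centralizer_def T_F comp_assoc)
qed

lemma T_centralizer_swap1: assumes "swappable A" shows "T n \<in> centralizer Alt (swap1 A)"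
proof -
  have s: "subgp (centralizer Alt (swap1 A))" by (rule subgp_centralizer[OF normal_subgp_Alt swap1_F[OF assms]])
  have nat: "T (int n) \<in> centralizer Alt (swap1 A)" for n
  proof (induction n)
    case 0
    have "T 0 = id" by (auto simp: T_0)
    then show ?case using subD(2)[OF s] by (simp only: of_nat_0)
  next
    case (Suc n)
    have "T (int (Suc n)) = T 1 \<circ> T (int n)" by (simp add: T_comp add.commute)
    then show ?case using subD(3)[OF s T1_centralizer_swap1[OF assms] Suc] by (simp only:)
  qed
  show ?thesis
  proof (cases "n \<ge> 0")
    case True then show ?thesis using nat[of "nat n"] by simp
  next
    case False
    then have "T n = iv (T (int (nat (- n))))" by (simp add: iv_T)
    then show ?thesis using subD(4)[OF s nat] by (simp only:)
  qed
qed

lemma swap1_shift_eq_mod_Alt: assumes "swappable A" shows "eq_mod Alt (swap1 (T n ` A)) (swap1 A)"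
proof -
  have "commutator (T n) (swap1 A) \<in> Alt" using T_centralizer_swap1[OF assms] centralizer_iff[OF swap1_F[OF assms]] by simp
  then have "swap1 (T n ` A) \<circ> iv (swap1 A) \<in> Alt" unfolding commutator_def T_conj_swap1[OF assms] .
  then show ?thesis using swap1_F[OF assms] swap1_F[OF swappable_shift[OF assms]] by (simp add: eq_mod_def)
qed

lemma swap1_commute_far:
  assumes "swappable A" "swappable C" "\<And>i j. i \<in> {0,1} \<Longrightarrow> j \<in> {0,1} \<Longrightarrow> T i ` A \<inter> T j ` C = {}"
  shows "swap1 A \<circ> swap1 C = swap1 C \<circ> swap1 A"
proof (rule disjoint_support_commute)
  show "bij (swap1 A)" "bij (swap1 C)" using assms swap1_F F_bij by auto
  fix x show "swap1 A x = x \<or> swap1 C x = x"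
    using level_swap_out[of x 0 A 1] level_swap_out[of x 0 C 1] assms(3) by blast
qed

lemma centralizer_Un:
  assumes "swappable (C1 \<union> C2)" "C1 \<inter> C2 = {}" "subgp K" "swap1 C1 \<in> K" "swap1 C2 \<in> K"
  shows "swap1 (C1 \<union> C2) \<in> K"
  using swap1_Un[OF assms(1,2)] subD(3)[OF assms(3-5)] by simp

lemma swap1_centralizer_swap1: assumes "swappable A" "swappable C" shows "swap1 A \<in> centralizer Alt (swap1 C)"
proof (rule local_induct[of A "\<lambda>A. swap1 A \<in> centralizer Alt (swap1 C)"])
  note s = subgp_centralizer[OF normal_subgp_Alt swap1_F[OF assms(2)]]
  show "A \<in> B" using assms by (simp add: swappable_def)
  show "swap1 {} \<in> centralizer Alt (swap1 C)" using subD(2)[OF s] by (simp add: level_swap_empty)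
  fix C1 C2 assume C: "C1 \<in> B" "C2 \<in> B" "C1 \<inter> C2 = {}" "C1 \<subseteq> A" "C2 \<subseteq> A"
    "swap1 C1 \<in> centralizer Alt (swap1 C)" "swap1 C2 \<in> centralizer Alt (swap1 C)"
  show "swap1 (C1 \<union> C2) \<in> centralizer Alt (swap1 C)"
    using C B_Un swappable_mono[OF assms(1)] by (intro centralizer_Un s) auto
next
  fix x assume "x \<in> A"
  then have "x \<in> S" using swappable_S assms by auto
  \<comment> \<open>Levels 0 and 1 carry \<open>swap1 E\<close>; levels 3 and 4 are the room into
    which the other swap will be moved.\<close>
  then have "near x (\<lambda>C. tower C {0..4} \<and> swappable C)" by (intro near_conj near_tower near_swappable) auto
  then show "near x (\<lambda>E. E \<subseteq> A \<longrightarrow> swap1 E \<in> centralizer Alt (swap1 C))"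
  proof (rule near_mono, intro impI)
    fix E assume E: "E \<in> B" "tower E {0..4} \<and> swappable E"
    show "swap1 E \<in> centralizer Alt (swap1 C)"
    proof (cases "E = {}")
      case True
      then show ?thesis using subD(2)[OF subgp_centralizer[OF normal_subgp_Alt swap1_F[OF assms(2)]]] by (simp add: level_swap_empty)
    next
      case False
      have tE: "swap1 E \<in> F" using swap1_F E by blast
      note s = subgp_centralizer[OF normal_subgp_Alt tE]
      have "swap1 C \<in> centralizer Alt (swap1 E)"
      proof (rule local_induct[of C "\<lambda>C. swap1 C \<in> centralizer Alt (swap1 E)"])
        show "C \<in> B" using assms by (simp add: swappable_def)
        show "swap1 {} \<in> centralizer Alt (swap1 E)" using subD(2)[OF s] by (simp add: level_swap_empty)
        fix C1 C2 assume C: "C1 \<in> B" "C2 \<in> B" "C1 \<inter> C2 = {}" "C1 \<subseteq> C" "C2 \<subseteq> C"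
          "swap1 C1 \<in> centralizer Alt (swap1 E)" "swap1 C2 \<in> centralizer Alt (swap1 E)"
        show "swap1 (C1 \<union> C2) \<in> centralizer Alt (swap1 E)"
          using C B_Un swappable_mono[OF assms(2)] by (intro centralizer_Un s) auto
      next
        fix y assume y: "y \<in> C"
        then have yS: "y \<in> S" using swappable_S assms by auto
        have "T 3 ` E \<in> B" "T 3 ` E \<noteq> {}" using E T_B False by auto
        \<comment> \<open>Minimality supplies the power of the action that brings \<open>y\<close>
          into level 3.\<close>
        then obtain n where n: "T n y \<in> T 3 ` E" using minimal yS by blast
        have "near y (\<lambda>D. T n ` D \<subseteq> T 3 ` E)" by (rule near_T[OF near_subset[OF \<open>T 3 ` E \<in> B\<close> n]])
        then show "near y (\<lambda>D. D \<subseteq> C \<longrightarrow> swap1 D \<in> centralizer Alt (swap1 E))"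
        proof (rule near_mono, intro impI)
          fix D assume D: "D \<in> B" "T n ` D \<subseteq> T 3 ` E" "D \<subseteq> C"
          have gD: "swappable D" using swappable_mono[OF assms(2) D(3,1)] .
          have gTD: "swappable (T n ` D)" using swappable_shift[OF gD] .
          have "swap1 (T n ` D) \<circ> swap1 E = swap1 E \<circ> swap1 (T n ` D)"
          proof (rule swap1_commute_far[OF gTD])
            show "swappable E" using E by simp
            fix i j :: int assume ij: "i \<in> {0,1}" "j \<in> {0,1}"
            have "T i ` T n ` D \<subseteq> T i ` T 3 ` E" using D(2) by (rule image_mono)
            also have "\<dots> = T (i + 3) ` E" by (rule T_image_image)
            finally have "T i ` T n ` D \<subseteq> T (i + 3) ` E" .
            moreover have "T (i + 3) ` E \<inter> T j ` E = {}"
            proof -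
              have "i + 3 \<in> {0..4}" "j \<in> {0..4}" "i + 3 \<noteq> j" using ij by auto
              then show ?thesis using E(2) unfolding tower_def by blast
            qed
            ultimately show "T i ` T n ` D \<inter> T j ` E = {}" by blast
          qed
          then have "swap1 (T n ` D) \<in> centralizer Alt (swap1 E)"
            using eq_mod_refl[OF normal_subgp_Alt F_comp[OF tE swap1_F[OF gTD]]] swap1_F[OF gTD] by (simp add: centralizer_def)
          then have 1: "eq_mod Alt (swap1 (T n ` D) \<circ> swap1 E) (swap1 E \<circ> swap1 (T n ` D))" by (simp add: centralizer_def)
          have 2: "eq_mod Alt (swap1 D) (swap1 (T n ` D))" using eq_mod_sym[OF normal_subgp_Alt swap1_shift_eq_mod_Alt[OF gD]] .
          have "eq_mod Alt (swap1 D \<circ> swap1 E) (swap1 (T n ` D) \<circ> swap1 E)" "eq_mod Alt (swap1 E \<circ> swap1 (T n ` D)) (swap1 E \<circ> swap1 D)"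
            by (intro eq_mod_comp[OF normal_subgp_Alt] eq_mod_refl[OF normal_subgp_Alt] 2 tE eq_mod_sym[OF normal_subgp_Alt 2])+
          then have "eq_mod Alt (swap1 D \<circ> swap1 E) (swap1 E \<circ> swap1 D)" using 1 eq_mod_trans[OF normal_subgp_Alt] by blast
          then show "swap1 D \<in> centralizer Alt (swap1 E)" using swap1_F[OF gD] by (simp add: centralizer_def)
        qed
      qed
      then show ?thesis using centralizer_sym[OF normal_subgp_Alt tE swap1_F[OF assms(2)]] by simp
    qed
  qed
qed

text \<open>A centralizer modulo \<open>Alt\<close> is a subgroup, so it is all of \<open>F\<close>
  once it contains the generators. By the symmetry of commuting this is used twice: for the
  centralizer of a generator, then for that of an arbitrary element.\<close>

lemma D_subset_Alt: "D \<subseteq> Alt"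
proof -
  have swap1: "F \<subseteq> centralizer Alt (swap1 A)" if "swappable A" for A
    using that by (intro generated_subset subgp_centralizer[OF normal_subgp_Alt] swap1_F T1_centralizer_swap1 swap1_centralizer_swap1)
  have T: "F \<subseteq> centralizer Alt (T 1)"
  proof (intro generated_subset subgp_centralizer[OF normal_subgp_Alt] T_F)
    show "T 1 \<in> centralizer Alt (T 1)" using eq_mod_refl[OF normal_subgp_Alt F_comp[OF T_F T_F]] T_F by (auto simp: centralizer_def)
    show "swap1 A \<in> centralizer Alt (T 1)" if "swappable A" for A
      using swap1[OF that] centralizer_sym[OF normal_subgp_Alt T_F swap1_F[OF that], of 1] T_F by blast
  qed
  have "F \<subseteq> centralizer Alt f" if f: "f \<in> F" for f
    using f swap1 T by (intro generated_subset subgp_centralizer[OF normal_subgp_Alt]) (use centralizer_sym[OF normal_subgp_Alt _ f] T_F swap1_F in blast)+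
  then show ?thesis using centralizer_iff by (intro D_least subgp_Alt) blast
qed

lemma D_eq_Alt: "D = Alt"
  using D_subset_Alt Alt_least[OF subgp_D level_cycle_D] by blast

end

section \<open>Symmetric difference as addition of indicator functions modulo 2\<close>

definition symdiff :: "'a set \<Rightarrow> 'a set \<Rightarrow> 'a set" where "symdiff A B = (A - B) \<union> (B - A)"

lemma symdiff_mem: "x \<in> symdiff A B \<longleftrightarrow> (x \<in> A) \<noteq> (x \<in> B)" by (auto simp: symdiff_def)
lemma symdiff_commute: "symdiff A B = symdiff B A" by (auto simp: symdiff_def)
lemma symdiff_assoc: "symdiff (symdiff A B) C = symdiff A (symdiff B C)" by (auto simp: symdiff_mem set_eq_iff)
lemma symdiff_left_commute: "symdiff A (symdiff B C) = symdiff B (symdiff A C)" by (auto simp: symdiff_mem set_eq_iff)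
lemma symdiff_self: "symdiff A A = {}" by (auto simp: symdiff_def)
lemma symdiff_self2: "symdiff A (symdiff A B) = B" by (auto simp: symdiff_mem set_eq_iff)
lemma symdiff_empty: "symdiff A {} = A" "symdiff {} A = A" by (auto simp: symdiff_def)
lemma symdiff_disjoint: "A \<inter> B = {} \<Longrightarrow> symdiff A B = A \<union> B" by (auto simp: symdiff_def)
lemmas sd_ac = symdiff_commute symdiff_assoc symdiff_left_commute symdiff_self symdiff_self2 symdiff_empty

lemma image_symdiff: "inj f \<Longrightarrow> f ` symdiff A B = symdiff (f ` A) (f ` B)"
  unfolding symdiff_def by (simp add: image_Un image_set_diff)

context clopen_system begin

lemma symdiff_B: "C \<in> B \<Longrightarrow> E \<in> B \<Longrightarrow> symdiff C E \<in> B"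
  unfolding symdiff_def by (intro B_Un B_Diff)

section \<open>The sign and the mean displacement\<close>

text \<open>Coboundaries and cohomology of functions with values in \<open>\<int>/2\<close>, identified with their supports.\<close>

definition cobound2 :: "'a set \<Rightarrow> bool" where
  "cobound2 C \<longleftrightarrow> (\<exists>V\<in>B. C = symdiff (T 1 ` V) V)"

lemma T_inj_on: "inj (T n)" by (rule bij_is_inj[OF T_bij])

lemma cobound2_empty: "cobound2 {}" unfolding cobound2_def using B_empty by (auto simp: symdiff_empty intro!: bexI[of _ "{}"])

lemma cobound2_symdiff: assumes "cobound2 C" "cobound2 C'" shows "cobound2 (symdiff C C')"
proof -
  obtain V V' where "V \<in> B" "C = symdiff (T 1 ` V) V" "V' \<in> B" "C' = symdiff (T 1 ` V') V'"
    using assms by (auto simp: cobound2_def)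
  moreover from this have "symdiff C C' = symdiff (T 1 ` symdiff V V') (symdiff V V')"
    by (simp add: image_symdiff[OF T_inj_on] sd_ac)
  ultimately show ?thesis unfolding cobound2_def using symdiff_B by blast
qed

definition cohom2 :: "'a set \<Rightarrow> 'a set \<Rightarrow> bool" where "cohom2 C C' \<longleftrightarrow> cobound2 (symdiff C C')"

lemma cohom2_refl: "cohom2 C C" by (simp add: cohom2_def symdiff_self cobound2_empty)
lemma cohom2_sym: "cohom2 C C' \<Longrightarrow> cohom2 C' C" by (simp add: cohom2_def symdiff_commute)
lemma cohom2_trans: "cohom2 C C' \<Longrightarrow> cohom2 C' C'' \<Longrightarrow> cohom2 C C''"
  unfolding cohom2_def by (drule (1) cobound2_symdiff) (simp add: sd_ac)
lemma cohom2_symdiff: "cohom2 C C' \<Longrightarrow> cohom2 E E' \<Longrightarrow> cohom2 (symdiff C E) (symdiff C' E')"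
  unfolding cohom2_def by (drule (1) cobound2_symdiff) (simp add: sd_ac)
lemma cohom2_empty: "cohom2 C {} \<longleftrightarrow> cobound2 C" by (simp add: cohom2_def symdiff_empty)
lemma cohom2_cobound2: "cohom2 C C' \<Longrightarrow> cobound2 C \<longleftrightarrow> cobound2 C'"
  using cohom2_trans cohom2_sym cohom2_empty by blast

lemma cohom2_T: assumes "C \<in> B" shows "cohom2 (T n ` C) C"
proof -
  have nat: "cohom2 (T (int k) ` C) C" if "C \<in> B" for k C
  proof (induction k)
    case 0 then show ?case by (simp add: T_0_image cohom2_refl)
  next
    case (Suc k)
    have "cohom2 (T 1 ` T (int k) ` C) (T (int k) ` C)"
      unfolding cohom2_def cobound2_def using T_B[OF that] by blast
    then show ?case using Suc cohom2_trans by (auto simp: T_image_image)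
  qed
  show ?thesis
  proof (cases "n \<ge> 0")
    case True then show ?thesis using nat[OF assms, of "nat n"] by simp
  next
    case False
    then have "cohom2 (T (- n) ` T n ` C) (T n ` C)" using nat[OF T_B[OF assms], of "nat (- n)"] by simp
    then show ?thesis by (simp add: T_image_image T_0_image cohom2_sym)
  qed
qed

lemma cohom2_F: assumes f: "f \<in> F" and C: "C \<in> B" shows "cohom2 (f ` C) C"
proof (rule local_induct[OF C, of "\<lambda>C. cohom2 (f ` C) C"])
  have inj: "inj f" using F_bij[OF f] bij_is_inj by blast
  fix C1 C2 assume C: "C1 \<inter> C2 = {}" "cohom2 (f ` C1) C1" "cohom2 (f ` C2) C2"
  have "f ` C1 \<inter> f ` C2 = {}" using C(1) inj by (auto simp: inj_eq)
  then show "cohom2 (f ` (C1 \<union> C2)) (C1 \<union> C2)"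
    using cohom2_symdiff[OF C(2,3)] C(1) by (simp add: symdiff_disjoint image_Un)
next
  fix x assume "x \<in> C"
  then have "x \<in> S" using C B_sub by auto
  from F_near[OF f this] show "near x (\<lambda>C'. C' \<subseteq> C \<longrightarrow> cohom2 (f ` C') C')"
  proof (rule near_mono, intro impI)
    fix C' assume "C' \<in> B" "\<forall>z\<in>C'. f z = T (disp f x) z"
    then show "cohom2 (f ` C') C'" using cohom2_T[of C' "disp f x"] by (simp cong: image_cong)
  qed
qed (simp add: cohom2_refl)

section \<open>Integer coboundaries\<close>

definition cobound :: "('a \<Rightarrow> int) \<Rightarrow> bool" where
  "cobound u \<longleftrightarrow> (\<exists>v. lconst v \<and> (\<forall>x\<in>S. u x = v (T 1 x) - v x))"

lemma cobound_cong: "cobound u \<Longrightarrow> (\<And>x. x \<in> S \<Longrightarrow> u x = w x) \<Longrightarrow> cobound w"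
  unfolding cobound_def by auto

lemma cobound_add: assumes "cobound u" "cobound w" shows "cobound (\<lambda>x. u x + w x)"
proof -
  obtain v v' where "lconst v" "\<forall>x\<in>S. u x = v (T 1 x) - v x" "lconst v'" "\<forall>x\<in>S. w x = v' (T 1 x) - v' x"
    using assms by (auto simp: cobound_def)
  then show ?thesis unfolding cobound_def
    by (intro exI[of _ "\<lambda>x. v x + v' x"]) (auto intro: lconst_comp2)
qed

lemma cobound_neg: assumes "cobound u" shows "cobound (\<lambda>x. - u x)"
proof -
  obtain v where "lconst v" "\<forall>x\<in>S. u x = v (T 1 x) - v x"
    using assms by (auto simp: cobound_def)
  then show ?thesis unfolding cobound_def
    by (intro exI[of _ "\<lambda>x. - v x"]) (auto intro: lconst_comp1)
qed

lemma cobound_diff: "cobound u \<Longrightarrow> cobound w \<Longrightarrow> cobound (\<lambda>x. u x - w x)"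
  using cobound_add[OF _ cobound_neg] by force

lemma cobound_0: "cobound (\<lambda>_. 0)"
  unfolding cobound_def by (intro exI[of _ "\<lambda>_. 0"]) (simp add: lconst_const)

lemma cobound_T: assumes u: "lconst u" shows "cobound (\<lambda>x. u (T n x) - u x)"
proof -
  have nat: "cobound (\<lambda>x. w (T (int k) x) - w x)" if w: "lconst w" for k w
  proof (induction k)
    case 0 then show ?case by (simp add: T_0 cobound_0)
  next
    case (Suc k)
    have "cobound (\<lambda>x. w (T (int k) (T 1 x)) - w (T (int k) x))"
      unfolding cobound_def using lconst_T[OF w, of "int k"] by (intro exI[of _ "\<lambda>x. w (T (int k) x)"]) simp
    from cobound_add[OF this Suc] show ?case by (rule cobound_cong) (simp add: T_add add.commute)
  qed
  show ?thesis
  proof (cases "n \<ge> 0")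
    case True then show ?thesis using nat[OF u, of "nat n"] by simp
  next
    case False
    have "cobound (\<lambda>x. u (T n (T (- n) x)) - u (T n x))" using nat[OF lconst_T[OF u, of n], of "nat (- n)"] False by simp
    from cobound_neg[OF this] show ?thesis by (rule cobound_cong) (simp add: T_add T_0)
  qed
qed

text \<open>Cut \<open>u\<close> into summands supported on small sets \<open>C\<close>. On the
  points that \<open>f\<close> sends into such a \<open>C\<close>, \<open>f\<close> is one power of
  the action, so composing the summand with \<open>f\<close> amounts to composing it with that
  power. The exponent is read off from the inverse of \<open>f\<close> because it is the image that
  lies in \<open>C\<close>.\<close>

lemma cobound_F: assumes f: "f \<in> F" and u: "lconst u" shows "cobound (\<lambda>x. u (f x) - u x)"
proof -
  define P where "P C \<longleftrightarrow> cobound (\<lambda>x. (if f x \<in> C then u (f x) else 0) - (if x \<in> C then u x else 0))" for C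
  have "P S"
  proof (rule local_induct[OF S_B])
    show "P {}" by (simp add: P_def cobound_0)
  next
    fix C1 C2 assume C: "C1 \<inter> C2 = {}" "P C1" "P C2"
    show "P (C1 \<union> C2)" unfolding P_def
      by (rule cobound_cong[OF cobound_add[OF C(2,3)[unfolded P_def]]]) (use C(1) in auto)
  next
    fix x assume x: "x \<in> S"
    define n where "n = disp (iv f) x"
    from F_near[OF F_inv[OF f] x] show "near x (\<lambda>C. C \<subseteq> S \<longrightarrow> P C)"
    proof (rule near_mono, intro impI)
      fix C assume C: "C \<in> B" "\<forall>z\<in>C. iv f z = T (disp (iv f) x) z"
      define w where "w z = (if z \<in> C then u z else 0)" for z
      have w: "lconst w" unfolding w_def
        by (rule lconst_comp2[OF lconst_mem[OF C(1)] u, of "\<lambda>b k. if b then k else 0"])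
      have 1: "f y = T (- n) y" if "f y \<in> C" for y
        using C(2) that iv_simps(2)[OF F_bij[OF f], of y] unfolding n_def[symmetric]
        by (metis T_add T_0 add.left_inverse)
      have 2: "f y = T (- n) y" if "T (- n) y \<in> C" for y
        using C(2) that iv_simps(1)[OF F_bij[OF f], of "T (- n) y"] unfolding n_def[symmetric]
        by (metis T_add T_0 add.right_inverse)
      have "w (T (- n) y) = (if f y \<in> C then u (f y) else 0)" for y
        unfolding w_def by (metis 1 2)
      then show "P C" using cobound_T[OF w, of "- n"] unfolding P_def w_def by simp
    qed
  qed
  then show ?thesis unfolding P_def by (rule cobound_cong) (simp add: F_S[OF f])
qed

text \<open>A transfer function for the constant \<open>c\<close> grows by \<open>c\<close> at each
  step along an orbit, yet locally constant functions are bounded.\<close>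

lemma cobound_const: assumes "cobound (\<lambda>_. c)" "S \<noteq> {}" shows "c = 0"
proof -
  obtain v where v: "lconst v" "\<forall>x\<in>S. c = v (T 1 x) - v x" using assms by (auto simp: cobound_def)
  obtain M where M: "\<forall>x\<in>S. \<bar>v x\<bar> \<le> M" using lconst_bounded[OF v(1)] by blast
  obtain x where x: "x \<in> S" using assms by auto
  have vn: "v (T (int k) x) = v x + int k * c" for k
  proof (induction k)
    case (Suc k)
    have "v (T 1 (T (int k) x)) = v (T (int k) x) + c" using v(2) T_S[OF x] by (metis add.commute diff_add_cancel)
    then show ?case using Suc by (simp add: T_add algebra_simps)
  qed (simp add: T_0)
  have "\<bar>int k * c\<bar> \<le> 2 * M" for k
    using vn[of k] M x T_S[OF x, of "int k"] by (smt (verit))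
  show "c = 0"
  proof (rule ccontr)
    assume "c \<noteq> 0"
    then have "int (nat (2 * M + 1)) * 1 \<le> int (nat (2 * M + 1)) * \<bar>c\<bar>"
      by (intro mult_left_mono) auto
    also have "\<dots> \<le> 2 * M" using \<open>\<And>k. \<bar>int k * c\<bar> \<le> 2 * M\<close>[of "nat (2 * M + 1)"] by (simp add: abs_mult)
    finally show False using M x by fastforce
  qed
qed

text \<open>The numbers \<open>k > 0\<close> such that \<open>f\<close> reverses the order of \<open>x\<close> and \<open>T k x\<close> on their common orbit.\<close>

definition inversions :: "('a \<Rightarrow> 'a) \<Rightarrow> 'a \<Rightarrow> int set" where
  "inversions f x = {k. 0 < k \<and> k + disp f (T k x) < disp f x}"

definition parity :: "('a \<Rightarrow> 'a) \<Rightarrow> 'a set" where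
  "parity f = {x\<in>S. odd (card (inversions f x))}"

lemma inversions_bound: assumes "f \<in> F" shows "\<exists>M. \<forall>x\<in>S. inversions f x \<subseteq> {1..M}"
proof -
  obtain M where M: "\<forall>x\<in>S. \<bar>disp f x\<bar> \<le> M" using lconst_bounded[OF lconst_disp[OF assms]] by blast
  have "inversions f x \<subseteq> {1..2 * M}" if "x \<in> S" for x
  proof
    fix k assume "k \<in> inversions f x"
    then show "k \<in> {1..2 * M}" using M that T_S[OF that, of k] by (auto simp: inversions_def) (smt (verit))
  qed
  then show ?thesis by blast
qed

lemma inversions_finite: assumes "f \<in> F" "x \<in> S" shows "finite (inversions f x)"
  using inversions_bound[OF assms(1)] assms(2) finite_subset by (metis finite_atLeastAtMost_int)

text \<open>The possible inversions lie in a finite set that does not depend on the point, so their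
  number is a finite sum of locally constant terms.\<close>

lemma parity_B: assumes "f \<in> F" shows "parity f \<in> B"
proof -
  obtain M where M: "\<forall>x\<in>S. inversions f x \<subseteq> {1..M}" using inversions_bound[OF assms] by blast
  define c :: "'a \<Rightarrow> nat" where "c x = (\<Sum>k\<in>{1..M}. of_bool (k + disp f (T k x) < disp f x))" for x
  have "lconst c" unfolding c_def
    by (intro lconst_sum lconst_comp2[OF lconst_T[OF lconst_disp[OF assms]] lconst_disp[OF assms]]) auto
  moreover have "c x = card (inversions f x)" if "x \<in> S" for x
  proof -
    have "inversions f x = {1..M} \<inter> {k. k + disp f (T k x) < disp f x}" using M that by (auto simp: inversions_def)
    then show ?thesis by (simp add: c_def sum_of_bool_eq)
  qed
  ultimately have "lconst (\<lambda>x. card (inversions f x))" by (rule lconst_cong)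
  then have "lconst (\<lambda>x. odd (card (inversions f x)))" by (rule lconst_comp1)
  then show ?thesis unfolding parity_def by (rule lconst_Collect)
qed

lemma parity_S: "parity f \<subseteq> S" by (auto simp: parity_def)

lemma inversions_T: assumes f: "f \<in> F" and x: "x \<in> S" shows "inversions (f \<circ> T c) x = inversions f (T c x)"
proof -
  have "disp (f \<circ> T c) z = c + disp f (T c z)" if "z \<in> S" for z
    using disp_comp[OF f T_F that] disp_T[OF that] by simp
  then show ?thesis using x T_S[OF x] by (auto simp: inversions_def T_add add.commute)
qed

text \<open>Precomposition with \<open>T c\<close> only moves the base point from which inversions
  are counted, so the parity set is replaced by a translate.\<close>

lemma parity_comp_T: assumes f: "f \<in> F" shows "cohom2 (parity (f \<circ> T c)) (parity f)"
proof -
  have "parity (f \<circ> T c) = T (- c) ` parity f"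
  proof (rule Set.set_eqI)
    fix x
    have "x \<in> T (- c) ` parity f \<longleftrightarrow> x \<in> S \<and> odd (card (inversions f (T c x)))"
      by (simp add: T_mem_iff parity_def T_in_iff)
    moreover have "x \<in> parity (f \<circ> T c) \<longleftrightarrow> x \<in> S \<and> odd (card (inversions (f \<circ> T c) x))"
      by (simp add: parity_def)
    ultimately show "x \<in> parity (f \<circ> T c) \<longleftrightarrow> x \<in> T (- c) ` parity f"
      using inversions_T[OF f, of x c] by metis
  qed
  then show ?thesis using cohom2_T[OF parity_B[OF f]] by simp
qed

lemma parity_T: "parity (T c) = {}"
proof -
  have "inversions (T c) x = {}" if "x \<in> S" for x using that by (auto simp: inversions_def disp_T T_S)
  then show ?thesis by (auto simp: parity_def)
qed

lemma disp_swap1_vals: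
  assumes A: "swappable A" and z: "z \<in> S"
  shows "disp (swap1 A) z \<in> {-1, 0, 1}" "disp (swap1 A) z = 1 \<longleftrightarrow> z \<in> A" "disp (swap1 A) z = - 1 \<longleftrightarrow> T (-1) z \<in> A"
  using disp_swap1[OF A z] swappable_T1'[OF A, of z] by auto

text \<open>Exchanging neighbours in a linear order keeps the order of every pair except the
  exchanged ones. The compared number is the signed distance between the images of \<open>x\<close>
  and \<open>T k x\<close>.\<close>

lemma swap_pairs:
  assumes A: "swappable A" and x: "x \<in> S" and k: "0 < k" "\<not> (x \<in> A \<and> k = 1)"
  shows "0 < k + disp (swap1 A) (T k x) - disp (swap1 A) x \<and> \<not> (swap1 A x \<in> A \<and> k + disp (swap1 A) (T k x) - disp (swap1 A) x = 1)"
proof -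
  note v = disp_swap1_vals[OF A x] disp_swap1_vals[OF A T_S[OF x, of k]]
  have k1: "disp (swap1 A) (T k x) \<noteq> - 1 \<or> x \<in> A" if "k = 1"
    using v(6) that by (auto simp: T_add T_0)
  have k2: "\<not> (disp (swap1 A) (T k x) = - 1 \<and> x \<in> A)" if "k = 2"
    using v(6) that swappable_T1[OF A, of x] by (auto simp: T_add)
  have pos: "0 < k + disp (swap1 A) (T k x) - disp (swap1 A) x"
  proof (cases "k \<ge> 3")
    case True
    then show ?thesis using v(1,4) by auto
  next
    case False
    then have "k = 1 \<or> k = 2" using k by auto
    then show ?thesis using v k k1 k2 by auto
  qed
  moreover have "\<not> (swap1 A x \<in> A \<and> k + disp (swap1 A) (T k x) - disp (swap1 A) x = 1)"
  proof
    assume a: "swap1 A x \<in> A \<and> k + disp (swap1 A) (T k x) - disp (swap1 A) x = 1"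
    have "x \<notin> A" using a swap1_in(1)[OF A, of x] swappable_T1[OF A, of x] by auto
    moreover have "T (-1) x \<in> A"
      using swap1_out[of x A] a \<open>x \<notin> A\<close> by fastforce
    ultimately have "disp (swap1 A) x = -1" using v by simp
    then have "disp (swap1 A) (T k x) = - k" using a by simp
    then have "k = 1" "disp (swap1 A) (T k x) = -1" using v(4) k by auto
    then show False using k1 \<open>x \<notin> A\<close> by auto
  qed
  ultimately show ?thesis by blast
qed

lemma swap1_invol: "swappable A \<Longrightarrow> swap1 A (swap1 A x) = x"
  using swap1_involutive[of A] by (metis comp_apply id_apply)

lemma swap1_T: assumes "swappable A" "x \<in> S"
  shows "swap1 A (T k x) = T (k + disp (swap1 A) (T k x) - disp (swap1 A) x) (swap1 A x)"
proof -
  have "T (k + disp (swap1 A) (T k x) - disp (swap1 A) x) (T (disp (swap1 A) x) x) = T (disp (swap1 A) (T k x)) (T k x)"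
    by (simp add: T_add algebra_simps)
  then show ?thesis
    using F_disp[OF swap1_F[OF assms(1)] assms(2)] F_disp[OF swap1_F[OF assms(1)] T_S[OF assms(2), of k]] by metis
qed

lemma disp_swap1_swap1: assumes "swappable A" "x \<in> S" shows "disp (swap1 A) (swap1 A x) = - disp (swap1 A) x"
proof -
  have "disp (swap1 A \<circ> swap1 A) x = 0" unfolding swap1_involutive[OF assms(1)] by (rule disp_eqI[OF assms(2)]) (simp add: T_0)
  then show ?thesis using disp_comp[OF swap1_F[OF assms(1)] swap1_F[OF assms(1)] assms(2)] by simp
qed

text \<open>The swap matches the pairs that it does not exchange with one another, and corresponding
  pairs are inverted simultaneously. The removed element 1 stands for the exchanged pair, present
  when the base point lies in \<open>A\<close>.\<close>

lemma inversions_swap1: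
  assumes f: "f \<in> F" and A: "swappable A" and x: "x \<in> S"
  shows "card (inversions (f \<circ> swap1 A) x - (if x \<in> A then {1} else {})) = card (inversions f (swap1 A x) - (if swap1 A x \<in> A then {1} else {}))"
proof (rule bij_betw_same_card)
  define m where "m = disp (swap1 A)"
  define y where "y = swap1 A x"
  have y: "y \<in> S" "swap1 A y = x" using F_S[OF swap1_F[OF A] x] swap1_invol[OF A] by (auto simp: y_def)
  \<comment> \<open>\<open>l k\<close> is the signed distance from \<open>swap1 A x\<close> to the
    image of \<open>T k x\<close>; \<open>l'\<close> is the same quantity for the way back, the swap
    being an involution.\<close>
  define l where "l k = k + m (T k x) - m x" for k
  define l' where "l' k = k + m (T k y) - m y" for k
  have Tl: "swap1 A (T k x) = T (l k) y" for k unfolding l_def m_def y_def by (rule swap1_T[OF A x])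
  have Tl': "swap1 A (T k y) = T (l' k) x" for k unfolding l'_def m_def using swap1_T[OF A y(1)] y(2) by simp
  have mm: "m (swap1 A z) = - m z" if "z \<in> S" for z unfolding m_def by (rule disp_swap1_swap1[OF A that])
  have ll': "l' (l k) = k" for k
    using mm[OF T_S[OF x, of k]] mm[OF x] Tl[of k] unfolding l'_def l_def y_def[symmetric] by simp
  have l'l: "l (l' k) = k" for k
    using mm[OF T_S[OF y(1), of k]] mm[OF y(1)] Tl'[of k] y(2) unfolding l'_def l_def by simp
  have ccf: "disp (f \<circ> swap1 A) z = m z + disp f (swap1 A z)" if "z \<in> S" for z
    unfolding m_def by (rule disp_comp[OF f swap1_F[OF A] that])
  have iff: "k + disp (f \<circ> swap1 A) (T k x) < disp (f \<circ> swap1 A) x \<longleftrightarrow> l k + disp f (T (l k) y) < disp f y" for k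
  proof -
    have "disp (f \<circ> swap1 A) x = m x + disp f y" using ccf[OF x] by (simp only: y_def)
    moreover have "disp (f \<circ> swap1 A) (T k x) = m (T k x) + disp f (T (l k) y)"
      using ccf[OF T_S[OF x, of k]] by (simp only: Tl)
    moreover have "l k = k + m (T k x) - m x" by (simp only: l_def)
    ultimately show ?thesis by linarith
  qed
  have p: "0 < l k \<and> \<not> (y \<in> A \<and> l k = 1)" if "0 < k" "\<not> (x \<in> A \<and> k = 1)" for k
    using swap_pairs[OF A x that] unfolding l_def m_def y_def .
  have p': "0 < l' k \<and> \<not> (x \<in> A \<and> l' k = 1)" if "0 < k" "\<not> (y \<in> A \<and> k = 1)" for k
    using swap_pairs[OF A y(1) that] unfolding l'_def m_def y(2) .
  show "bij_betw l (inversions (f \<circ> swap1 A) x - (if x \<in> A then {1} else {})) (inversions f (swap1 A x) - (if swap1 A x \<in> A then {1} else {}))"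
    unfolding y_def[symmetric]
  proof (rule bij_betwI[where g = l'])
    show "l \<in> inversions (f \<circ> swap1 A) x - (if x \<in> A then {1} else {}) \<rightarrow> inversions f y - (if y \<in> A then {1} else {})"
      using p iff by (auto simp: inversions_def)
    show "l' \<in> inversions f y - (if y \<in> A then {1} else {}) \<rightarrow> inversions (f \<circ> swap1 A) x - (if x \<in> A then {1} else {})"
    proof
      fix k assume "k \<in> inversions f y - (if y \<in> A then {1} else {})"
      then have k: "0 < k" "\<not> (y \<in> A \<and> k = 1)" "k + disp f (T k y) < disp f y" by (auto simp: inversions_def split: if_splits)
      then show "l' k \<in> inversions (f \<circ> swap1 A) x - (if x \<in> A then {1} else {})"
        using p'[OF k(1,2)] iff[of "l' k"] l'l[of k] by (auto simp: inversions_def)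
    qed
  qed (simp_all add: ll' l'l)
qed

text \<open>Apart from the exchanged pairs, the swap just moves the parity set. The set
  \<open>e\<close> records where \<open>f\<close> inverts an exchanged pair: before the swap these
  pairs contribute \<open>e\<close>, afterwards they contribute \<open>A - e\<close>. Modulo
  coboundaries moved sets may be put back, and \<open>A - e\<close> together with \<open>e\<close>
  gives \<open>A\<close>.\<close>

lemma parity_comp_swap1: assumes f: "f \<in> F" and A: "swappable A" shows "cohom2 (parity (f \<circ> swap1 A)) (symdiff (parity f) A)"
proof -
  have AB: "A \<in> B" and AS: "A \<subseteq> S" using A B_sub by (auto simp: swappable_def)
  define e where "e = {x\<in>S. x \<in> A \<and> 1 \<in> inversions f x}"
  have "lconst (\<lambda>x. x \<in> A \<and> 1 + disp f (T 1 x) < disp f x)"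
    by (rule lconst_comp2[OF lconst_mem[OF AB] lconst_comp2[OF lconst_T[OF lconst_disp[OF f], of 1] lconst_disp[OF f], of "\<lambda>a b. 1 + a < b"], of "(\<and>)"])
  then have eB: "e \<in> B" unfolding e_def inversions_def by (simp add: lconst_Collect)
  have eA: "e \<subseteq> A" by (auto simp: e_def)
  have inj: "inj f" using F_bij[OF f] bij_is_inj by blast
  have fF: "f \<circ> swap1 A \<in> F" by (intro F_comp f swap1_F A)
  \<comment> \<open>Exactly one of \<open>f\<close> and its composite with the swap inverts an
    exchanged pair, because injectivity forbids equal images.\<close>
  have 1: "1 \<in> inversions (f \<circ> swap1 A) x \<longleftrightarrow> 1 \<notin> inversions f x" if x: "x \<in> A" for x
  proof -
    have xS: "x \<in> S" using x AS by auto
    have "disp (f \<circ> swap1 A) x = 1 + disp f (T 1 x)"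
      using disp_comp[OF f swap1_F[OF A] xS] disp_swap1[OF A xS] swap1_in[OF A x] x by simp
    moreover have "disp (f \<circ> swap1 A) (T 1 x) = - 1 + disp f x"
      using disp_comp[OF f swap1_F[OF A] T_S[OF xS], of 1] disp_swap1[OF A T_S[OF xS], of 1] swap1_in[OF A x] x swappable_T1[OF A x]
      by (simp add: T_add T_0)
    moreover have "1 + disp f (T 1 x) \<noteq> disp f x"
    proof
      assume a: "1 + disp f (T 1 x) = disp f x"
      have "f (T 1 x) = T (disp f (T 1 x) + 1) x" using F_disp[OF f T_S[OF xS], of 1] by (simp add: T_add)
      also have "\<dots> = f x" using F_disp[OF f xS] a by (simp add: add.commute)
      finally have "T 1 x = T 0 x" using inj by (simp add: inj_eq T_0)
      then show False using T_inj[OF xS] by simp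
    qed
    ultimately show ?thesis by (auto simp: inversions_def)
  qed
  have pc: "odd (card X) \<longleftrightarrow> (odd (card (X - (if P then {1} else {}))) \<noteq> (P \<and> 1 \<in> X))" if "finite X" for X :: "int set" and P
  proof (cases "P \<and> 1 \<in> X")
    case True
    then have "card X = Suc (card (X - {1}))" using that by (metis card.remove)
    then show ?thesis using True by simp
  next
    case False
    then have "X - (if P then {1} else {}) = X" by auto
    then show ?thesis using False by simp
  qed
  have mem: "x \<in> swap1 A ` C \<longleftrightarrow> swap1 A x \<in> C" for x C by (metis swap1_invol[OF A] image_iff)
  have "parity (f \<circ> swap1 A) = symdiff (swap1 A ` parity f) (symdiff (A - e) (swap1 A ` e))"
  proof (rule Set.set_eqI)
    fix x
    show "x \<in> parity (f \<circ> swap1 A) \<longleftrightarrow> x \<in> symdiff (swap1 A ` parity f) (symdiff (A - e) (swap1 A ` e))"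
    proof (cases "x \<in> S")
      case True
      define y where "y = swap1 A x"
      have y: "y \<in> S" using F_S[OF swap1_F[OF A] True] by (simp add: y_def)
      have "x \<in> parity (f \<circ> swap1 A) \<longleftrightarrow> (odd (card (inversions (f \<circ> swap1 A) x - (if x \<in> A then {1} else {}))) \<noteq> (x \<in> A \<and> 1 \<in> inversions (f \<circ> swap1 A) x))"
        using True pc[OF inversions_finite[OF fF True], of "x \<in> A"] by (simp add: parity_def)
      moreover have "y \<in> parity f \<longleftrightarrow> (odd (card (inversions f y - (if y \<in> A then {1} else {}))) \<noteq> (y \<in> A \<and> 1 \<in> inversions f y))"
        using y pc[OF inversions_finite[OF f y], of "y \<in> A"] by (simp add: parity_def)
      moreover have "(x \<in> A \<and> 1 \<in> inversions (f \<circ> swap1 A) x) \<longleftrightarrow> x \<in> A - e" using 1 True by (auto simp: e_def)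
      moreover have "(y \<in> A \<and> 1 \<in> inversions f y) \<longleftrightarrow> y \<in> e" using y by (auto simp: e_def)
      ultimately show ?thesis using inversions_swap1[OF f A True] unfolding symdiff_mem mem y_def by auto
    next
      case False
      then have "swap1 A x = x" using F_out[OF swap1_F[OF A]] by simp
      moreover have "x \<notin> parity (f \<circ> swap1 A)" "x \<notin> parity f" "x \<notin> A" "x \<notin> e" using False parity_S AS eA by auto
      ultimately show ?thesis unfolding symdiff_mem mem by simp
    qed
  qed
  moreover have "cohom2 (symdiff (swap1 A ` parity f) (symdiff (A - e) (swap1 A ` e))) (symdiff (parity f) (symdiff (A - e) e))"
    by (intro cohom2_symdiff cohom2_refl cohom2_F swap1_F A eB parity_B f)
  moreover have "symdiff (A - e) e = A" using eA by (auto simp: symdiff_def)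
  ultimately show ?thesis by simp
qed

lemma parity_swap1: assumes "swappable A" shows "cohom2 (parity (swap1 A)) A"
  using parity_comp_swap1[OF T_F[of 0] assms] parity_T[of 0] T_comp
  by (metis T_0 comp_apply ext symdiff_empty(2))

text \<open>Induction on the normal form of \<open>g\<close>, so that only powers of the action and
  single swaps have to be appended.\<close>

lemma parity_comp: assumes f: "f \<in> F" and g: "g \<in> F" shows "cohom2 (parity (f \<circ> g)) (symdiff (parity f) (parity g))"
  using F_generated[OF g]
proof (induction rule: generated.induct)
  case (generated_T c)
  have "cohom2 (parity (f \<circ> T c)) (symdiff (parity f) (parity (T c)))" using parity_comp_T[OF f] by (simp only: parity_T symdiff_empty)
  then show ?case .
next
  case (generated_swap1 g A)
  have g: "g \<in> F" using generated_F generated_swap1 by blast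
  have "cohom2 (parity (f \<circ> g \<circ> swap1 A)) (symdiff (parity (f \<circ> g)) A)" by (intro parity_comp_swap1 F_comp f g generated_swap1)
  moreover have "cohom2 (symdiff (parity (f \<circ> g)) A) (symdiff (symdiff (parity f) (parity g)) A)" by (intro cohom2_symdiff cohom2_refl generated_swap1)
  moreover have "cohom2 (symdiff (parity f) (parity (g \<circ> swap1 A))) (symdiff (parity f) (symdiff (parity g) A))" by (intro cohom2_symdiff cohom2_refl parity_comp_swap1 g generated_swap1)
  ultimately have "cohom2 (parity (f \<circ> (g \<circ> swap1 A))) (symdiff (parity f) (parity (g \<circ> swap1 A)))"
    unfolding comp_assoc[symmetric] symdiff_assoc using cohom2_trans cohom2_sym by blast
  then show ?case .
qed

lemma disp_hom: assumes f: "f \<in> F" and g: "g \<in> F" shows "cobound (\<lambda>x. disp (f \<circ> g) x - (disp f x + disp g x))"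
  by (rule cobound_cong[OF cobound_F[OF g lconst_disp[OF f]]]) (simp add: disp_comp[OF f g])

section \<open>The common kernel of the two invariants\<close>

definition Ker :: "('a \<Rightarrow> 'a) set" where
  "Ker = {f\<in>F. cobound2 (parity f) \<and> cobound (disp f)}"

lemma id_T0: "id = T 0" by (auto simp: T_0)

lemma disp_id: "x \<in> S \<Longrightarrow> disp id x = 0" by (simp add: id_T0 disp_T)

lemma parity_iv: assumes f: "f \<in> F" shows "cohom2 (parity (iv f)) (parity f)"
proof -
  have "cohom2 (parity (f \<circ> iv f)) (symdiff (parity f) (parity (iv f)))" by (intro parity_comp f F_inv)
  then have "cobound2 (symdiff (parity f) (parity (iv f)))"
    using cohom2_cobound2 cobound2_empty iv_simps(3)[OF F_bij[OF f]] parity_T[of 0] id_T0 by metis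
  then show ?thesis by (simp add: cohom2_def symdiff_commute)
qed

lemma disp_iv: assumes f: "f \<in> F" shows "cobound (\<lambda>x. disp (iv f) x + disp f x)"
proof -
  have "cobound (\<lambda>x. disp (f \<circ> iv f) x - (disp f x + disp (iv f) x))" by (intro disp_hom f F_inv)
  from cobound_neg[OF this] show ?thesis
    by (rule cobound_cong) (simp add: iv_simps(3)[OF F_bij[OF f]] disp_id)
qed

lemma cobound2_eqI: "cobound2 C \<Longrightarrow> cohom2 C' C \<Longrightarrow> cobound2 C'" using cohom2_cobound2 by blast

lemma subgp_Ker: "subgp Ker"
  unfolding subgp_def
proof (intro conjI ballI)
  show "Ker \<subseteq> F" by (auto simp: Ker_def)
  have "cobound (disp id)" by (rule cobound_cong[OF cobound_0]) (simp add: disp_id)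
  then show "id \<in> Ker" using cobound2_empty parity_T[of 0] id_F unfolding Ker_def id_T0 by simp
  fix f assume "f \<in> Ker"
  then have f: "f \<in> F" "cobound2 (parity f)" "cobound (disp f)" by (auto simp: Ker_def)
  have "cobound (disp (iv f))" by (rule cobound_cong[OF cobound_diff[OF disp_iv[OF f(1)] f(3)]]) simp
  then show "iv f \<in> Ker" using cobound2_eqI[OF f(2) parity_iv[OF f(1)]] F_inv[OF f(1)] by (simp add: Ker_def)
  fix g assume "g \<in> Ker"
  then have g: "g \<in> F" "cobound2 (parity g)" "cobound (disp g)" by (auto simp: Ker_def)
  have "cobound (disp (f \<circ> g))" by (rule cobound_cong[OF cobound_add[OF disp_hom[OF f(1) g(1)] cobound_add[OF f(3) g(3)]]]) simp
  then show "f \<circ> g \<in> Ker" using cobound2_eqI[OF cobound2_symdiff[OF f(2) g(2)] parity_comp[OF f(1) g(1)]] F_comp[OF f(1) g(1)] by (simp add: Ker_def)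
qed

lemma commutator_Ker: assumes f: "f \<in> F" and g: "g \<in> F" shows "commutator f g \<in> Ker"
proof -
  have i: "iv f \<in> F" "iv g \<in> F" "f \<circ> g \<in> F" "f \<circ> g \<circ> iv f \<in> F" using f g F_inv F_comp by auto
  have "cohom2 (parity (f \<circ> g \<circ> iv f \<circ> iv g)) (symdiff (symdiff (symdiff (parity f) (parity g)) (parity f)) (parity g))"
    using cohom2_trans[OF parity_comp[OF i(4,2)] cohom2_symdiff[OF cohom2_trans[OF parity_comp[OF i(3,1)] cohom2_symdiff[OF parity_comp[OF f g] parity_iv[OF f]]] parity_iv[OF g]]] .
  moreover have "symdiff (symdiff (symdiff (parity f) (parity g)) (parity f)) (parity g) = {}" by (simp add: sd_ac)
  ultimately have "cobound2 (parity (f \<circ> g \<circ> iv f \<circ> iv g))" using cohom2_empty by simp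
  moreover have "cobound (disp (f \<circ> g \<circ> iv f \<circ> iv g))"
    by (rule cobound_cong[OF cobound_add[OF cobound_add[OF disp_hom[OF i(4,2)] disp_hom[OF i(3,1)]] cobound_add[OF disp_hom[OF f g] cobound_add[OF disp_iv[OF f] disp_iv[OF g]]]]]) simp
  ultimately show ?thesis using commutator_F[OF f g] by (simp add: Ker_def commutator_def)
qed

lemma D_Ker: "D \<subseteq> Ker" by (intro D_least subgp_Ker commutator_Ker)

text \<open>Represents \<open>swap1 C\<close> for sets \<open>C\<close> that meet their translate, by cutting \<open>C\<close> along a cover by swappable sets.\<close>

primrec swaps_over :: "'a set list \<Rightarrow> 'a set \<Rightarrow> 'a \<Rightarrow> 'a" where
  "swaps_over [] C = id"
| "swaps_over (P # Ps) C = swap1 (C \<inter> P) \<circ> swaps_over Ps (C - P)"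

lemma swappable_Int: "swappable P \<Longrightarrow> C \<in> B \<Longrightarrow> swappable (C \<inter> P)"
  using swappable_mono[of P "C \<inter> P"] B_Int by (auto simp: swappable_def)

lemma swaps_over_F: "\<forall>P\<in>set Ps. swappable P \<Longrightarrow> C \<in> B \<Longrightarrow> swaps_over Ps C \<in> F"
proof (induction Ps arbitrary: C)
  case Nil show ?case unfolding swaps_over.simps by (rule id_F)
next
  case (Cons P Ps)
  then have "swappable P" "C - P \<in> B" using B_Diff by (auto simp: swappable_def)
  then show ?case unfolding swaps_over.simps using Cons.prems by (intro F_comp swap1_F swappable_Int Cons.IH) simp_all
qed

text \<open>Over the common part of \<open>C\<close> and \<open>E\<close> the same involution is
  applied twice and cancels.\<close>

lemma swap1_symdiff: assumes P: "swappable P" and C: "C \<subseteq> P" "E \<subseteq> P"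
  shows "swap1 (symdiff C E) = swap1 C \<circ> swap1 E"
proof (rule level_swap_eqI[OF zero_neq_one swappable_tower[OF P], symmetric])
  show "symdiff C E \<subseteq> P" using C by (auto simp: symdiff_def)
  fix a assume a: "a \<in> P"
  note tC = level_swap_in[OF zero_neq_one swappable_tower[OF P] C(1) a] level_swap_in[OF zero_neq_one swappable_tower[OF P] C(2) a]
  show "(swap1 C \<circ> swap1 E) (T 0 a) = T (if a \<in> symdiff C E then 1 else 0) a"
    "(swap1 C \<circ> swap1 E) (T 1 a) = T (if a \<in> symdiff C E then 0 else 1) a"
    using tC by (auto simp: symdiff_mem)
next
  fix x assume "x \<notin> T 0 ` P" "x \<notin> T 1 ` P"
  then show "(swap1 C \<circ> swap1 E) x = x" using C level_swap_out[of x 0 C 1] level_swap_out[of x 0 E 1] by fastforce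
qed

text \<open>Within one set of the cover the formula is exact; factors that belong to different sets
  of the cover have to be reordered, which costs commutators.\<close>

lemma swaps_over_symdiff: "\<forall>P\<in>set Ps. swappable P \<Longrightarrow> C \<in> B \<Longrightarrow> E \<in> B \<Longrightarrow> eq_mod D (swaps_over Ps (symdiff C E)) (swaps_over Ps C \<circ> swaps_over Ps E)"
proof (induction Ps arbitrary: C E)
  case Nil
  show ?case unfolding swaps_over.simps id_comp by (rule eq_mod_refl[OF normal_subgp_D id_F])
next
  case (Cons P Ps)
  then have P: "swappable P" "C - P \<in> B" "E - P \<in> B" using B_Diff by (auto simp: swappable_def)
  define a b c d where "a = swap1 (C \<inter> P)" and "b = swap1 (E \<inter> P)" and "c = swaps_over Ps (C - P)" and "d = swaps_over Ps (E - P)"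
  have F: "a \<in> F" "b \<in> F" "c \<in> F" "d \<in> F"
    unfolding a_def b_def c_def d_def using P Cons by (auto intro!: swap1_F swappable_Int swaps_over_F)
  have "symdiff C E \<inter> P = symdiff (C \<inter> P) (E \<inter> P)" "symdiff C E - P = symdiff (C - P) (E - P)" by (auto simp: symdiff_def)
  then have 1: "swaps_over (P # Ps) (symdiff C E) = a \<circ> b \<circ> swaps_over Ps (symdiff (C - P) (E - P))"
    using swap1_symdiff[OF P(1), of "C \<inter> P" "E \<inter> P"] by (simp add: a_def b_def)
  have "eq_mod D (swaps_over Ps (symdiff (C - P) (E - P))) (c \<circ> d)" unfolding c_def d_def using Cons.prems(1) by (intro Cons.IH P) simp
  then have 2: "eq_mod D (a \<circ> b \<circ> swaps_over Ps (symdiff (C - P) (E - P))) (a \<circ> b \<circ> (c \<circ> d))"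
    by (intro eq_mod_comp[OF normal_subgp_D] eq_mod_refl[OF normal_subgp_D] F)
  have "eq_mod D (a \<circ> (b \<circ> c) \<circ> d) (a \<circ> (c \<circ> b) \<circ> d)"
    by (intro eq_mod_comp[OF normal_subgp_D] eq_mod_refl[OF normal_subgp_D] eq_mod_D_comm F)
  then have 3: "eq_mod D (a \<circ> b \<circ> (c \<circ> d)) ((a \<circ> c) \<circ> (b \<circ> d))" by (simp add: comp_assoc)
  have "swaps_over (P # Ps) C \<circ> swaps_over (P # Ps) E = (a \<circ> c) \<circ> (b \<circ> d)" by (simp add: a_def b_def c_def d_def)
  then show ?case using 1 eq_mod_trans[OF normal_subgp_D 2 3] by (simp only:)
qed

lemma swaps_over_swappable: "\<forall>P\<in>set Ps. swappable P \<Longrightarrow> swappable C \<Longrightarrow> C \<subseteq> \<Union>(set Ps) \<Longrightarrow> swaps_over Ps C = swap1 C"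
proof (induction Ps arbitrary: C)
  case Nil then show ?case by (simp add: level_swap_empty)
next
  case (Cons P Ps)
  have P: "P \<in> B" "C \<in> B" using Cons by (auto simp: swappable_def)
  have g: "swappable (C - P)" using B_Diff P by (intro swappable_mono[OF Cons(3)]) auto
  have "swaps_over Ps (C - P) = swap1 (C - P)" using Cons(2,4) by (intro Cons.IH g) auto
  moreover have "(C \<inter> P) \<union> (C - P) = C" by auto
  moreover have "swap1 ((C \<inter> P) \<union> (C - P)) = swap1 (C \<inter> P) \<circ> swap1 (C - P)"
    by (rule swap1_Un) (use Cons(3) \<open>(C \<inter> P) \<union> (C - P) = C\<close> in auto)
  ultimately show ?case unfolding swaps_over.simps by (simp only:)
qed

context
  fixes Ps :: "'a set list"
  assumes Ps: "\<forall>P\<in>set Ps. swappable P" and cov: "S \<subseteq> \<Union>(set Ps)"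
begin

text \<open>On swappable sets, translating the base is conjugation by \<open>T 1\<close>, which does
  not change the class modulo \<open>D\<close>.\<close>

lemma swaps_over_T1: assumes C: "C \<in> B" shows "eq_mod D (swaps_over Ps (T 1 ` C)) (swaps_over Ps C)"
proof (rule local_induct[OF C, of "\<lambda>C. eq_mod D (swaps_over Ps (T 1 ` C)) (swaps_over Ps C)"])
  show "eq_mod D (swaps_over Ps (T 1 ` {})) (swaps_over Ps {})" using eq_mod_refl[OF normal_subgp_D swaps_over_F[OF Ps B_empty]] by simp
next
  fix C1 C2 assume C: "C1 \<in> B" "C2 \<in> B" "C1 \<inter> C2 = {}"
    "eq_mod D (swaps_over Ps (T 1 ` C1)) (swaps_over Ps C1)" "eq_mod D (swaps_over Ps (T 1 ` C2)) (swaps_over Ps C2)"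
  have "T 1 ` (C1 \<union> C2) = symdiff (T 1 ` C1) (T 1 ` C2)" "C1 \<union> C2 = symdiff C1 C2"
    using C(3) image_symdiff[OF T_inj_on] by (metis symdiff_disjoint)+
  then show "eq_mod D (swaps_over Ps (T 1 ` (C1 \<union> C2))) (swaps_over Ps (C1 \<union> C2))"
    using eq_mod_trans[OF normal_subgp_D eq_mod_trans[OF normal_subgp_D swaps_over_symdiff[OF Ps T_B[OF C(1)] T_B[OF C(2)]] eq_mod_comp[OF normal_subgp_D C(4,5)]]
        eq_mod_sym[OF normal_subgp_D swaps_over_symdiff[OF Ps C(1,2)]]] by simp
next
  fix x assume "x \<in> C"
  then have "x \<in> S" using C B_sub by auto
  from near_swappable[OF this] show "near x (\<lambda>E. E \<subseteq> C \<longrightarrow> eq_mod D (swaps_over Ps (T 1 ` E)) (swaps_over Ps E))"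
  proof (rule near_mono, intro impI)
    fix E assume E: "E \<in> B" "swappable E"
    have "swaps_over Ps E = swap1 E" "swaps_over Ps (T 1 ` E) = swap1 (T 1 ` E)"
      using cov B_sub[OF E(1)] B_sub[OF T_B[OF E(1), of 1]] by (auto intro!: swaps_over_swappable Ps E swappable_shift)
    moreover have "eq_mod D (swap1 (T 1 ` E)) (swap1 E)"
      using eq_mod_D_conj[OF T_F swap1_F[OF E(2)]] T_conj_swap1[OF E(2)] by metis
    ultimately show "eq_mod D (swaps_over Ps (T 1 ` E)) (swaps_over Ps E)" by simp
  qed
qed

text \<open>For the coboundary of \<open>V\<close> one obtains, modulo \<open>D\<close>, the square
  of the element for \<open>V\<close>, which is the element for the symmetric difference of
  \<open>V\<close> with itself.\<close>

lemma swaps_over_cobound2: assumes "cobound2 C" shows "eq_mod D (swaps_over Ps C) id"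
proof -
  obtain V where V: "V \<in> B" "C = symdiff (T 1 ` V) V" using assms by (auto simp: cobound2_def)
  have tV: "swaps_over Ps V \<in> F" by (rule swaps_over_F[OF Ps V(1)])
  have "eq_mod D (swaps_over Ps (symdiff (T 1 ` V) V)) (swaps_over Ps (T 1 ` V) \<circ> swaps_over Ps V)" by (rule swaps_over_symdiff[OF Ps T_B[OF V(1)] V(1)])
  moreover have "eq_mod D (swaps_over Ps (T 1 ` V) \<circ> swaps_over Ps V) (swaps_over Ps V \<circ> swaps_over Ps V)"
    by (intro eq_mod_comp[OF normal_subgp_D] swaps_over_T1 V eq_mod_refl[OF normal_subgp_D tV])
  moreover have "eq_mod D (swaps_over Ps V \<circ> swaps_over Ps V) (swaps_over Ps {})"
    using eq_mod_sym[OF normal_subgp_D swaps_over_symdiff[OF Ps V(1) V(1)]] by (simp add: symdiff_self)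
  moreover have "swaps_over Ps {} = id" using swaps_over_swappable[OF Ps, of "{}"] B_empty by (simp add: level_swap_empty swappable_def)
  ultimately show ?thesis using V(2) eq_mod_trans[OF normal_subgp_D] by metis
qed

text \<open>A normal form modulo \<open>D\<close> whose two data, the exponent \<open>c\<close> and
  the set \<open>C\<close> up to coboundaries, are seen by the two invariants; so an element on
  which both vanish has to lie in \<open>D\<close>.\<close>

lemma swaps_over_rep: assumes "f \<in> F" shows "\<exists>c. \<exists>C\<in>B. eq_mod D f (T c \<circ> swaps_over Ps C) \<and> cohom2 (parity f) C \<and> cobound (\<lambda>x. disp f x - c)"
  using F_generated[OF assms]
proof (induction rule: generated.induct)
  case (generated_T c)
  have "swaps_over Ps {} = id" using swaps_over_swappable[OF Ps, of "{}"] B_empty by (simp add: level_swap_empty swappable_def)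
  then have "eq_mod D (T c) (T c \<circ> swaps_over Ps {})" using eq_mod_refl[OF normal_subgp_D T_F] by simp
  moreover have "cohom2 (parity (T c)) {}" by (simp add: parity_T cohom2_refl)
  moreover have "cobound (\<lambda>x. disp (T c) x - c)" by (rule cobound_cong[OF cobound_0]) (simp add: disp_T)
  ultimately show ?case using B_empty by (intro exI[of _ c] bexI[of _ "{}"] conjI)
next
  case (generated_swap1 f A)
  then obtain c C where C: "C \<in> B" "eq_mod D f (T c \<circ> swaps_over Ps C)" "cohom2 (parity f) C" "cobound (\<lambda>x. disp f x - c)" by metis
  have A: "A \<in> B" "swappable A" "A \<subseteq> \<Union>(set Ps)" using generated_swap1 cov B_sub by (auto simp: swappable_def)
  have f: "f \<in> F" using generated_F generated_swap1 by blast
  have 1: "eq_mod D (f \<circ> swap1 A) (T c \<circ> swaps_over Ps C \<circ> swaps_over Ps A)"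
    unfolding swaps_over_swappable[OF Ps A(2,3)] by (intro eq_mod_comp[OF normal_subgp_D] C eq_mod_refl[OF normal_subgp_D swap1_F[OF A(2)]])
  have "eq_mod D (T c \<circ> (swaps_over Ps C \<circ> swaps_over Ps A)) (T c \<circ> swaps_over Ps (symdiff C A))"
    by (intro eq_mod_comp[OF normal_subgp_D] eq_mod_refl[OF normal_subgp_D T_F] eq_mod_sym[OF normal_subgp_D swaps_over_symdiff[OF Ps C(1) A(1)]])
  then have 2: "eq_mod D (f \<circ> swap1 A) (T c \<circ> swaps_over Ps (symdiff C A))"
    using eq_mod_trans[OF normal_subgp_D 1] by (simp add: comp_assoc)
  have 3: "cohom2 (parity (f \<circ> swap1 A)) (symdiff C A)"
    using cohom2_trans[OF parity_comp_swap1[OF f A(2)] cohom2_symdiff[OF C(3) cohom2_refl]] .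
  have "cobound (disp (swap1 A))"
    unfolding cobound_def
  \<comment> \<open>The displacement of a swap is the indicator of \<open>A\<close> minus that of
    its translate by \<open>T 1\<close>. It is the coboundary of the indicator of this
    translate.\<close>
  proof (intro exI[of _ "\<lambda>x. if T (-1) x \<in> A then 1 else 0"] conjI ballI)
    show "lconst (\<lambda>x. if T (-1) x \<in> A then 1 else 0 :: int)"
      by (rule lconst_comp1[OF lconst_T[OF lconst_mem[OF A(1)], of "-1"], of "\<lambda>b. if b then 1 else 0"])
    fix x assume "x \<in> S"
    then show "disp (swap1 A) x = (if T (-1) (T 1 x) \<in> A then 1 else 0) - (if T (-1) x \<in> A then 1 else 0)"
      using disp_swap1[OF A(2)] swappable_T1'[OF A(2), of x] by (auto simp: T_add T_0)
  qed
  from cobound_add[OF cobound_add[OF this disp_hom[OF f swap1_F[OF A(2)]]] C(4)]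
  have 4: "cobound (\<lambda>x. disp (f \<circ> swap1 A) x - c)"
    by (rule cobound_cong) simp
  show ?case using 2 3 4 symdiff_B[OF C(1) A(1)] by (intro exI[of _ c] bexI[of _ "symdiff C A"] conjI)
qed

end

lemma swappable_cover: "\<exists>Ps. (\<forall>P\<in>set Ps. swappable P) \<and> S \<subseteq> \<Union>(set Ps)"
proof -
  define U where "U = {P. swappable P}"
  have "U \<subseteq> B" "S \<subseteq> \<Union>U" using near_swappable near_ex unfolding U_def swappable_def by blast+
  then obtain V where "V \<subseteq> U" "finite V" "S \<subseteq> \<Union>V" using cpt by meson
  moreover from this obtain Ps where "set Ps = V" using finite_list by blast
  ultimately show ?thesis unfolding U_def by blast
qed

text \<open>Swaps realise small clopen sets with displacement cohomologous to 0, and products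
  realise disjoint unions.\<close>

lemma realize_class: assumes C: "C \<in> B" shows "\<exists>h\<in>F. cohom2 (parity h) C \<and> cobound (disp h)"
proof -
  obtain Ps where Ps: "\<forall>P\<in>set Ps. swappable P" "S \<subseteq> \<Union>(set Ps)" using swappable_cover by blast
  show ?thesis
  proof (rule local_induct[OF C, of "\<lambda>C. \<exists>h\<in>F. cohom2 (parity h) C \<and> cobound (disp h)"])
    have "cobound (disp id)" by (rule cobound_cong[OF cobound_0]) (simp add: disp_id)
    moreover have "cohom2 (parity id) {}" using parity_T[of 0] id_T0 cohom2_refl by metis
    ultimately show "\<exists>h\<in>F. cohom2 (parity h) {} \<and> cobound (disp h)" using id_F by blast
  next
    fix C1 C2 assume C: "C1 \<inter> C2 = {}" "\<exists>h\<in>F. cohom2 (parity h) C1 \<and> cobound (disp h)" "\<exists>h\<in>F. cohom2 (parity h) C2 \<and> cobound (disp h)"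
    then obtain f g where fg: "f \<in> F" "cohom2 (parity f) C1" "cobound (disp f)" "g \<in> F" "cohom2 (parity g) C2" "cobound (disp g)" by blast
    have "cobound (disp (f \<circ> g))"
      by (rule cobound_cong[OF cobound_add[OF disp_hom[OF fg(1,4)] cobound_add[OF fg(3,6)]]]) simp
    moreover have "cohom2 (parity (f \<circ> g)) (C1 \<union> C2)"
      using cohom2_trans[OF parity_comp[OF fg(1,4)] cohom2_symdiff[OF fg(2,5)]] C(1) by (simp add: symdiff_disjoint)
    ultimately show "\<exists>h\<in>F. cohom2 (parity h) (C1 \<union> C2) \<and> cobound (disp h)" using F_comp[OF fg(1,4)] by blast
  next
    fix x assume "x \<in> C"
    then have "x \<in> S" using C B_sub by auto
    from near_swappable[OF this] show "near x (\<lambda>E. E \<subseteq> C \<longrightarrow> (\<exists>h\<in>F. cohom2 (parity h) E \<and> cobound (disp h)))"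
    proof (rule near_mono, intro impI)
      fix E assume E: "E \<in> B" "swappable E"
      have "cobound (disp (swap1 E))"
        unfolding cobound_def
      proof (intro exI[of _ "\<lambda>x. if T (-1) x \<in> E then 1 else 0"] conjI ballI)
        show "lconst (\<lambda>x. if T (-1) x \<in> E then 1 else 0 :: int)"
          by (rule lconst_comp1[OF lconst_T[OF lconst_mem[OF E(1)], of "-1"], of "\<lambda>b. if b then 1 else 0"])
        fix x assume "x \<in> S"
        then show "disp (swap1 E) x = (if T (-1) (T 1 x) \<in> E then 1 else 0) - (if T (-1) x \<in> E then 1 else 0)"
          using disp_swap1[OF E(2)] swappable_T1'[OF E(2), of x] by (auto simp: T_add T_0)
      qed
      then show "\<exists>h\<in>F. cohom2 (parity h) E \<and> cobound (disp h)" using swap1_F[OF E(2)] parity_swap1[OF E(2)] by blast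
    qed
  qed
qed

theorem D_eq_Ker: assumes "S \<noteq> {}" shows "D = Ker"
proof
  show "D \<subseteq> Ker" by (rule D_Ker)
  show "Ker \<subseteq> D"
  proof
    fix f assume "f \<in> Ker"
    then have f: "f \<in> F" "cobound2 (parity f)" "cobound (disp f)" by (auto simp: Ker_def)
    obtain Ps where Ps: "\<forall>P\<in>set Ps. swappable P" "S \<subseteq> \<Union>(set Ps)" using swappable_cover by blast
    obtain c C where C: "C \<in> B" "eq_mod D f (T c \<circ> swaps_over Ps C)" "cohom2 (parity f) C" "cobound (\<lambda>x. disp f x - c)"
      using swaps_over_rep[OF Ps f(1)] by blast
    \<comment> \<open>The exponent is cohomologous to the displacement, hence to 0, and a constant
      coboundary on a nonempty space vanishes.\<close>
    have "cobound (\<lambda>_. c)" by (rule cobound_cong[OF cobound_diff[OF f(3) C(4)]]) simp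
    then have "c = 0" using cobound_const assms by blast
    have "cobound2 C" using f(2) C(3) cohom2_cobound2 by blast
    then have "eq_mod D (swaps_over Ps C) id" by (rule swaps_over_cobound2[OF Ps])
    then have "eq_mod D f id" using C(2) \<open>c = 0\<close> eq_mod_trans[OF normal_subgp_D] id_T0 by (metis id_comp)
    then show "f \<in> D" using eq_mod_id_iff[OF f(1)] by blast
  qed
qed

end

section \<open>Auxiliary facts for commutator computations\<close>

lemma fresh: "finite (J :: int set) \<Longrightarrow> \<exists>s. s \<notin> J"
  using ex_new_if_finite infinite_UNIV_int by blast

text \<open>Serves to discard the part of a product of cycles that a chosen lifted cycle does not
  meet.\<close>

lemma commutator_commuting_factor:
  assumes "bij a" "bij f" "bij g" "a \<circ> f = f \<circ> a" "a \<circ> g = g \<circ> a"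
  shows "commutator (a \<circ> f) g = commutator f g"
proof -
  have e: "iv f \<circ> iv a = iv a \<circ> iv f"
    using iv_comp[OF assms(1,2)] iv_comp[OF assms(2,1)] unfolding assms(4) by (simp only:)
  have "commutator (a \<circ> f) g = a \<circ> (f \<circ> g \<circ> iv a) \<circ> iv f \<circ> iv g"
    unfolding commutator_def iv_comp[OF assms(1,2)] e by (simp only: comp_assoc)
  moreover have "a \<circ> (f \<circ> g \<circ> iv a) = f \<circ> g"
  proof -
    have "a \<circ> (f \<circ> g \<circ> iv a) = (a \<circ> f) \<circ> (g \<circ> iv a)" by (simp only: comp_assoc)
    also have "\<dots> = f \<circ> ((a \<circ> g) \<circ> iv a)" unfolding assms(4) by (simp only: comp_assoc)
    also have "\<dots> = f \<circ> (g \<circ> (a \<circ> iv a))" unfolding assms(5) by (simp only: comp_assoc)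
    finally show ?thesis by (simp only: iv_simps(3)[OF assms(1)] comp_id)
  qed
  ultimately show ?thesis unfolding commutator_def by (simp only:)
qed

context clopen_system begin

lemma level_cycle_commute:
  assumes "bij (level_cycle C p q r)" "bij (level_cycle C' p' q' r')"
    "\<And>i j. i \<in> {p,q,r} \<Longrightarrow> j \<in> {p',q',r'} \<Longrightarrow> T i ` C \<inter> T j ` C' = {}"
  shows "level_cycle C p q r \<circ> level_cycle C' p' q' r' = level_cycle C' p' q' r' \<circ> level_cycle C p q r"
proof (rule disjoint_support_commute[OF assms(1,2)])
  fix x show "level_cycle C p q r x = x \<or> level_cycle C' p' q' r' x = x"
  proof (cases "\<exists>i\<in>{p,q,r}. x \<in> T i ` C")
    case True
    then have "\<forall>j\<in>{p',q',r'}. x \<notin> T j ` C'" using assms(3) by blast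
    then show ?thesis by (auto intro!: level_cycle_out)
  next
    case False
    then show ?thesis by (auto intro!: level_cycle_out)
  qed
qed

definition maximal_in :: "('a \<Rightarrow> 'a) set \<Rightarrow> ('a \<Rightarrow> 'a) set \<Rightarrow> bool" where
  "maximal_in M G \<longleftrightarrow> subgp M \<and> M \<subseteq> G \<and> M \<noteq> G \<and> (\<forall>K. subgp K \<longrightarrow> M \<subseteq> K \<longrightarrow> K \<subseteq> G \<longrightarrow> K = M \<or> K = G)"

end

section \<open>Two-to-one prime factors\<close>

text \<open>Primeness is stated through Stone duality: an intermediate factor is an invariant Boolean algebra between the clopen
  algebras of \<open>Y\<close> and of \<open>X\<close>.\<close>

locale factor_system = X: clopen_system S T B + Y: clopen_system S' T' B'
  for S :: "'a set" and T B and S' :: "'b set" and T' B' +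
  fixes \<pi> :: "'a \<Rightarrow> 'b"
  assumes pi_S: "x \<in> S \<Longrightarrow> \<pi> x \<in> S'"
    and pi_onto: "y \<in> S' \<Longrightarrow> \<exists>x\<in>S. \<pi> x = y"
    and pi_T: "x \<in> S \<Longrightarrow> \<pi> (T n x) = T' n (\<pi> x)"
    and pi_B: "C \<in> B' \<Longrightarrow> {x\<in>S. \<pi> x \<in> C} \<in> B"
    and fibres: "x \<in> S \<Longrightarrow> x' \<in> S \<Longrightarrow> x'' \<in> S \<Longrightarrow> \<pi> x = \<pi> x' \<Longrightarrow> \<pi> x = \<pi> x'' \<Longrightarrow> x = x' \<or> x = x'' \<or> x' = x''"
    and not_inj: "\<exists>x\<in>S. \<exists>x'\<in>S. x \<noteq> x' \<and> \<pi> x = \<pi> x'"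
    and prime: "\<CC> \<subseteq> B \<Longrightarrow> S \<in> \<CC> \<Longrightarrow> (\<And>C E. C \<in> \<CC> \<Longrightarrow> E \<in> \<CC> \<Longrightarrow> C \<inter> E \<in> \<CC>) \<Longrightarrow>
      (\<And>C E. C \<in> \<CC> \<Longrightarrow> E \<in> \<CC> \<Longrightarrow> C - E \<in> \<CC>) \<Longrightarrow> (\<And>C n. C \<in> \<CC> \<Longrightarrow> T n ` C \<in> \<CC>) \<Longrightarrow>
      (\<And>C. C \<in> B' \<Longrightarrow> {x\<in>S. \<pi> x \<in> C} \<in> \<CC>) \<Longrightarrow>
      \<CC> = B \<or> (\<forall>C\<in>\<CC>. \<forall>x\<in>S. \<forall>x'\<in>S. \<pi> x = \<pi> x' \<longrightarrow> x \<in> C \<longrightarrow> x' \<in> C)"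
    and cobound2_descends: "C \<in> B' \<Longrightarrow> X.cobound2 {x\<in>S. \<pi> x \<in> C} \<Longrightarrow> Y.cobound2 C"
    and cobound_descends: "Y.lconst u \<Longrightarrow> X.cobound (\<lambda>x. u (\<pi> x)) \<Longrightarrow> Y.cobound u"
begin

section \<open>Preimages of clopen sets and lifts of full group elements\<close>

definition preim :: "'b set \<Rightarrow> 'a set" where "preim C = {x\<in>S. \<pi> x \<in> C}"

lemma preim_B: "C \<in> B' \<Longrightarrow> preim C \<in> B" unfolding preim_def by (rule pi_B)

lemma preim_simps: "preim (A \<inter> C) = preim A \<inter> preim C" "preim (A \<union> C) = preim A \<union> preim C" "preim (A - C) = preim A - preim C"
  "preim {} = {}" "preim S' = S" "preim (symdiff A C) = symdiff (preim A) (preim C)"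
  using pi_S by (auto simp: preim_def symdiff_def)

lemma preim_mono: "A \<subseteq> C \<Longrightarrow> preim A \<subseteq> preim C" by (auto simp: preim_def)

lemma preim_T: "preim (T' n ` A) = T n ` preim A"
proof (rule Set.set_eqI)
  fix x
  have "x \<in> preim (T' n ` A) \<longleftrightarrow> x \<in> S \<and> T' (- n) (\<pi> x) \<in> A"
    using Y.T_mem_iff[of "\<pi> x" n A] by (simp add: preim_def)
  moreover have "x \<in> T n ` preim A \<longleftrightarrow> x \<in> S \<and> \<pi> (T (- n) x) \<in> A"
    using X.T_mem_iff[of x n "preim A"] by (simp add: preim_def X.T_in_iff)
  ultimately show "x \<in> preim (T' n ` A) \<longleftrightarrow> x \<in> T n ` preim A" using pi_T by metis
qed

lemma preim_tower: "Y.tower A J \<Longrightarrow> X.tower (preim A) J"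
  unfolding X.tower_def Y.tower_def by (metis preim_T preim_simps(1,4))

text \<open>All points of a fibre receive the displacement of their common image. This is the
  induced homomorphism of full groups, written on points; \<open>full_group_pull_unit_map\<close>
  makes the identification.\<close>

definition lift :: "('b \<Rightarrow> 'b) \<Rightarrow> 'a \<Rightarrow> 'a" where
  "lift f x = (if x \<in> S then T (Y.disp f (\<pi> x)) x else x)"

lemma pi_lift: assumes "f \<in> Y.F" "x \<in> S" shows "\<pi> (lift f x) = f (\<pi> x)"
  using Y.F_disp[OF assms(1) pi_S[OF assms(2)]] assms(2) by (simp add: lift_def pi_T)

lemma lift_S: "x \<in> S \<Longrightarrow> lift f x \<in> S" by (simp add: lift_def X.T_S)

lemma lift_comp: assumes "f \<in> Y.F" "g \<in> Y.F" shows "lift (f \<circ> g) = lift f \<circ> lift g"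
proof
  fix x show "lift (f \<circ> g) x = (lift f \<circ> lift g) x"
  proof (cases "x \<in> S")
    case True
    then show ?thesis
      using Y.disp_comp[OF assms pi_S[OF True]] pi_lift[OF assms(2) True] lift_S[OF True, of g]
      by (simp add: lift_def X.T_add add.commute)
  qed (simp add: lift_def)
qed

lemma lift_id: "lift id = id"
  by (auto simp: lift_def Y.disp_id pi_S X.T_0)

lemma lift_bij: assumes "f \<in> Y.F" shows "bij (lift f)"
  by (rule o_bij[of "lift (iv f)"])
    (simp_all only: lift_comp[symmetric] assms Y.F_inv[OF assms] iv_simps[OF Y.F_bij[OF assms]] lift_id)

lemma near_preim: assumes "x \<in> S" "Y.near (\<pi> x) P" shows "\<exists>A\<in>B'. x \<in> preim A \<and> P A"
  using Y.near_ex[OF assms(2)] assms(1) by (auto simp: preim_def)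

lemma lift_F: assumes "f \<in> Y.F" shows "lift f \<in> X.F"
proof -
  have "X.near x (\<lambda>C. \<forall>z\<in>C. lift f z = T (Y.disp f (\<pi> x)) z)" if x: "x \<in> S" for x
  proof -
    obtain A where A: "A \<in> B'" "x \<in> preim A" "\<forall>z\<in>A. Y.disp f z = Y.disp f (\<pi> x)"
      using near_preim[OF x Y.F_near_disp[OF assms pi_S[OF x]]] by blast
    show ?thesis
      by (rule X.near_mono[OF X.near_subset[OF preim_B[OF A(1)] A(2)]]) (use A(3) in \<open>auto simp: preim_def lift_def\<close>)
  qed
  moreover have "lift f x = x" if "x \<notin> S" for x using that by (simp add: lift_def)
  ultimately show ?thesis unfolding X.F_def using lift_bij[OF assms] by blast
qed

lemma disp_lift: "x \<in> S \<Longrightarrow> X.disp (lift f) x = Y.disp f (\<pi> x)"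
  by (rule X.disp_eqI) (simp_all add: lift_def)

lemma lift_iv: assumes "f \<in> Y.F" shows "lift (iv f) = iv (lift f)"
  by (rule iv_eqI[OF lift_bij[OF assms], symmetric])
    (simp only: lift_comp[symmetric] assms Y.F_inv[OF assms] iv_simps[OF Y.F_bij[OF assms]] lift_id)

lemma lift_commutator: "f \<in> Y.F \<Longrightarrow> g \<in> Y.F \<Longrightarrow> lift (commutator f g) = commutator (lift f) (lift g)"
  unfolding commutator_def by (simp only: lift_comp lift_iv Y.F_comp Y.F_inv)

lemma lift_T: "lift (T' n) = T n"
  by (auto simp: lift_def Y.disp_T pi_S X.T_out)

lemma lift_image_subgp: assumes "Y.subgp K" shows "X.subgp (lift ` K)"
  unfolding X.subgp_def
proof (intro conjI ballI)
  show "lift ` K \<subseteq> X.F" using lift_F Y.subD(1)[OF assms] by auto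
  show "id \<in> lift ` K" using lift_id Y.subD(2)[OF assms] by (metis imageI)
  fix f assume "f \<in> lift ` K"
  then obtain f' where f: "f' \<in> K" "f = lift f'" by auto
  then have fF: "f' \<in> Y.F" using Y.subD(1)[OF assms] by auto
  show "iv f \<in> lift ` K" using lift_iv[OF fF] Y.subD(4)[OF assms f(1)] unfolding f(2) by (metis imageI)
  fix g assume "g \<in> lift ` K"
  then obtain g' where g: "g' \<in> K" "g = lift g'" by auto
  then have gF: "g' \<in> Y.F" using Y.subD(1)[OF assms] by auto
  show "f \<circ> g \<in> lift ` K" using lift_comp[OF fF gF] Y.subD(3)[OF assms f(1) g(1)] unfolding f(2) g(2) by (metis imageI)
qed

lemma lift_D_subset_D: "lift ` Y.D \<subseteq> X.D"
proof
  fix g assume "g \<in> lift ` Y.D"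
  then obtain f where f: "f \<in> Y.D" "g = lift f" by auto
  have "lift f \<in> X.D" using f(1)
  proof (induction rule: Y.D.induct)
    case D_id show ?case unfolding lift_id by (rule X.D_id)
  next
    case (D_step f g h)
    have "lift (commutator f g \<circ> h) = commutator (lift f) (lift g) \<circ> lift h"
      using D_step Y.commutator_F Y.D_F by (simp only: lift_comp lift_commutator)
    moreover have "commutator (lift f) (lift g) \<circ> lift h \<in> X.D" by (intro X.D_step lift_F D_step)
    ultimately show ?case by (simp only:)
  qed
  then show "g \<in> X.D" using f(2) by simp
qed

lemma lift_level_cycle:
  assumes d: "distinct [p,q,r]" and c: "Y.tower A {p,q,r}" and A: "A \<in> B'"
  shows "lift (Y.level_cycle A p q r) = X.level_cycle (preim A) p q r"
proof (rule X.level_cycle_eqI[OF d preim_tower[OF c] subset_refl])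
  have AS: "A \<subseteq> S'" using Y.B_sub A by simp
  note i = Y.level_cycle_in[OF d c subset_refl]
  have disp: "Y.disp (Y.level_cycle A p q r) (T' p a) = q - p" "Y.disp (Y.level_cycle A p q r) (T' q a) = r - q"
    "Y.disp (Y.level_cycle A p q r) (T' r a) = p - r" if "a \<in> A" for a
    using i[OF that] that AS Y.T_S by (auto intro!: Y.disp_eqI simp: Y.T_add)
  fix a assume "a \<in> preim A"
  then have a: "a \<in> S" "\<pi> a \<in> A" by (auto simp: preim_def)
  show "lift (Y.level_cycle A p q r) (T p a) = T (if a \<in> preim A then q else p) a"
    "lift (Y.level_cycle A p q r) (T q a) = T (if a \<in> preim A then r else q) a"
    "lift (Y.level_cycle A p q r) (T r a) = T (if a \<in> preim A then p else r) a"
    using a disp[OF a(2)] by (simp_all add: lift_def X.T_S pi_T X.T_add preim_def)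
next
  fix x assume x: "x \<notin> T p ` preim A" "x \<notin> T q ` preim A" "x \<notin> T r ` preim A"
  show "lift (Y.level_cycle A p q r) x = x"
  proof (cases "x \<in> S")
    case True
    then have "\<pi> x \<notin> T' p ` A" "\<pi> x \<notin> T' q ` A" "\<pi> x \<notin> T' r ` A"
      using x unfolding preim_T[symmetric] by (auto simp: preim_def)
    then have "Y.level_cycle A p q r (\<pi> x) = T' 0 (\<pi> x)" by (simp add: Y.level_cycle_out Y.T_0)
    then have "Y.disp (Y.level_cycle A p q r) (\<pi> x) = 0" using Y.disp_eqI pi_S True by blast
    then show ?thesis using True by (simp add: lift_def X.T_0)
  qed (simp add: lift_def)
qed

text \<open>The tube lemma for a fibre: preimages of clopen sets that avoid \<open>y\<close>,
  together with \<open>E\<close>, cover \<open>S\<close>. A neighbourhood of \<open>y\<close> that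
  avoids the finitely many sets of a subcover works.\<close>

lemma tube:
  assumes E: "E \<in> B" and y: "y \<in> S'" and fib: "\<And>x. x \<in> S \<Longrightarrow> \<pi> x = y \<Longrightarrow> x \<in> E"
  shows "Y.near y (\<lambda>A. preim A \<subseteq> E)"
proof -
  define U where "U = insert E (preim ` {A\<in>B'. y \<notin> A})"
  have "U \<subseteq> B" unfolding U_def using E preim_B by auto
  moreover have "S \<subseteq> \<Union>U"
  proof
    fix x assume x: "x \<in> S"
    show "x \<in> \<Union>U"
    proof (cases "\<pi> x = y")
      case True then show ?thesis using fib x by (auto simp: U_def)
    next
      case False
      then obtain A where "A \<in> B'" "\<pi> x \<in> A" "y \<notin> A" using Y.sep[OF pi_S[OF x] y] by blast
      then show ?thesis using x by (auto simp: U_def preim_def)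
    qed
  qed
  ultimately obtain V where V: "V \<subseteq> U" "finite V" "S \<subseteq> \<Union>V" using X.cpt by meson
  have "V - {E} \<subseteq> preim ` {A\<in>B'. y \<notin> A}" using V(1) by (auto simp: U_def)
  then obtain W where W: "W \<subseteq> {A\<in>B'. y \<notin> A}" "finite W" "V - {E} = preim ` W"
    using finite_subset_image[OF finite_Diff[OF V(2)]] by meson
  have "Y.near y (\<lambda>A. \<forall>C\<in>W. A \<subseteq> S' - C)"
  proof (rule Y.near_ball[OF W(2) y])
    fix C assume "C \<in> W"
    then have "C \<in> B'" "y \<notin> C" using W(1) by auto
    then show "Y.near y (\<lambda>A. A \<subseteq> S' - C)" using y by (intro Y.near_subset Y.B_Diff[OF Y.S_B]) auto
  qed
  then show ?thesis
  proof (rule Y.near_mono)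
    fix A assume A: "A \<in> B'" "\<forall>C\<in>W. A \<subseteq> S' - C"
    show "preim A \<subseteq> E"
    proof
      fix x assume x: "x \<in> preim A"
      then have "x \<in> \<Union>V" using V(3) by (auto simp: preim_def)
      then have "x \<in> E \<or> (\<exists>C\<in>W. x \<in> preim C)" using W(3) by blast
      then show "x \<in> E" using A(2) x by (auto simp: preim_def)
    qed
  qed
qed

text \<open>The common displacement on each fibre defines a map downstairs. The section
  \<open>s\<close> used to write it down may be discontinuous, so local constancy is obtained from
  \<open>tube\<close>, applied to the set where \<open>g\<close> has a given displacement.\<close>

lemma lift_characterization:
  assumes g: "g \<in> X.F" and c: "\<And>x x'. x \<in> S \<Longrightarrow> x' \<in> S \<Longrightarrow> \<pi> x = \<pi> x' \<Longrightarrow> X.disp g x = X.disp g x'"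
  shows "g \<in> lift ` Y.F"
proof -
  define s where "s y = (SOME x. x \<in> S \<and> \<pi> x = y)" for y
  have s: "s y \<in> S" "\<pi> (s y) = y" if "y \<in> S'" for y
    using someI_ex[of "\<lambda>x. x \<in> S \<and> \<pi> x = y"] pi_onto[OF that] unfolding s_def by blast+
  define f where "f y = (if y \<in> S' then T' (X.disp g (s y)) y else y)" for y
  have cs: "X.disp g (s (\<pi> x)) = X.disp g x" if "x \<in> S" for x
    using c[OF s(1)[OF pi_S[OF that]] that] s(2)[OF pi_S[OF that]] by simp
  have f: "f (\<pi> x) = \<pi> (g x)" if "x \<in> S" for x
    using cs[OF that] pi_S[OF that] X.F_disp[OF g that] pi_T[OF that] by (simp add: f_def)
  have ginj: "inj g" "surj g" using X.F_bij[OF g] by (auto simp: bij_def)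
  have fS: "f y \<in> S' \<longleftrightarrow> y \<in> S'" for y by (simp add: f_def Y.T_S)
  have "inj f"
  proof
    fix y y' assume e: "f y = f y'"
    show "y = y'"
    proof (cases "y \<in> S'")
      case False
      then show ?thesis using e fS by (metis f_def)
    next
      case True
      then have y: "y \<in> S'" "y' \<in> S'" using e fS by metis+
      define n n' where "n = X.disp g (s y)" and "n' = X.disp g (s y')"
      have "T' n y = T' n' y'" using e y by (simp add: f_def n_def n'_def)
      then have "T' (- n') (T' n y) = T' (- n') (T' n' y')" by simp
      then have y': "y' = T' (n - n') y" by (simp add: Y.T_add Y.T_0)
      \<comment> \<open>A point over \<open>y'\<close> on the orbit of \<open>s y\<close>;
        \<open>g\<close> sends both to the same point, so injectivity of \<open>g\<close> yields
        injectivity of \<open>f\<close>.\<close>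
      define x' where "x' = T (n - n') (s y)"
      have x': "x' \<in> S" "\<pi> x' = y'" using s[OF y(1)] y' by (auto simp: x'_def X.T_S pi_T)
      have "X.disp g x' = n'" using cs[OF x'(1)] x'(2) by (simp add: n'_def)
      then have "g x' = T n (s y)" using X.F_disp[OF g x'(1)] by (simp add: x'_def X.T_add)
      also have "\<dots> = g (s y)" using X.F_disp[OF g s(1)[OF y(1)]] by (simp add: n_def)
      finally have "x' = s y" using ginj by (simp add: inj_eq)
      then show ?thesis using x'(2) s(2)[OF y(1)] by simp
    qed
  qed
  moreover have "surj f"
    unfolding surj_def
  proof
    fix y show "\<exists>z. y = f z"
    proof (cases "y \<in> S'")
      case True
      obtain z where z: "g z = s y" using ginj(2) by (metis surjD)
      then have "z \<in> S" using X.F_S_iff[OF g, of z] s(1)[OF True] by simp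
      then show ?thesis using f z s(2)[OF True] by metis
    qed (auto simp: f_def)
  qed
  moreover have "\<exists>n. Y.near y (\<lambda>A. \<forall>z\<in>A. f z = T' n z)" if y: "y \<in> S'" for y
  proof -
    define n where "n = X.disp g (s y)"
    define E where "E = {x\<in>S. X.disp g x = n}"
    have "E \<in> B" unfolding E_def by (rule X.lconst_Collect[OF X.lconst_comp1[OF X.lconst_disp[OF g]]])
    then have "Y.near y (\<lambda>A. preim A \<subseteq> E)"
    proof (rule tube[OF _ y])
      fix x assume "x \<in> S" "\<pi> x = y"
      then show "x \<in> E" using cs[of x] by (simp add: E_def n_def)
    qed
    then have "Y.near y (\<lambda>A. \<forall>z\<in>A. f z = T' n z)"
    proof (rule Y.near_mono, intro ballI)
      fix A z assume A: "A \<in> B'" "preim A \<subseteq> E" "z \<in> A"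
      have zS: "z \<in> S'" using A Y.B_sub by auto
      have "s z \<in> preim A" using s[OF zS] A by (simp add: preim_def)
      then have "X.disp g (s z) = n" using A(2) by (auto simp: E_def)
      then show "f z = T' n z" using zS by (simp add: f_def)
    qed
    then show ?thesis by blast
  qed
  ultimately have fF: "f \<in> Y.F" unfolding Y.F_def by (auto simp: bij_def f_def)
  have "lift f = g"
  proof
    fix x show "lift f x = g x"
    proof (cases "x \<in> S")
      case True
      have "Y.disp f (\<pi> x) = X.disp g x"
        by (rule Y.disp_eqI[OF pi_S[OF True]]) (simp add: f_def pi_S[OF True] cs[OF True])
      then show ?thesis using True X.F_disp[OF g True] by (simp add: lift_def)
    qed (simp add: lift_def X.F_out[OF g])
  qed
  then show ?thesis using fF by blast
qed

lemma inversions_lift: assumes "f \<in> Y.F" "x \<in> S" shows "X.inversions (lift f) x = Y.inversions f (\<pi> x)"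
  unfolding X.inversions_def Y.inversions_def using assms by (simp add: disp_lift X.T_S pi_T)

lemma parity_lift: assumes "f \<in> Y.F" shows "X.parity (lift f) = preim (Y.parity f)"
  unfolding X.parity_def Y.parity_def preim_def using inversions_lift[OF assms] pi_S by auto

lemma nonempty: "S \<noteq> {}" "S' \<noteq> {}" using not_inj pi_S by auto

text \<open>This goes through the description of \<open>D\<close> as a kernel: commutators upstairs
  need not be lifts, so a factorisation of the lift cannot be pushed down directly.\<close>

lemma lift_D_descends: assumes "f \<in> Y.F" "lift f \<in> X.D" shows "f \<in> Y.D"
proof -
  have "lift f \<in> X.Ker" using assms(2) X.D_eq_Ker[OF nonempty(1)] by simp
  then have "X.cobound2 (X.parity (lift f))" "X.cobound (X.disp (lift f))" by (auto simp: X.Ker_def)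
  then have "X.cobound2 (preim (Y.parity f))" "X.cobound (\<lambda>x. Y.disp f (\<pi> x))"
    using parity_lift[OF assms(1)] X.cobound_cong[OF _ disp_lift] by auto
  then have "Y.cobound2 (Y.parity f)" "Y.cobound (Y.disp f)"
    using cobound2_descends[OF Y.parity_B[OF assms(1)]] cobound_descends[OF Y.lconst_disp[OF assms(1)]] by (auto simp: preim_def)
  then have "f \<in> Y.Ker" using assms(1) by (simp add: Y.Ker_def)
  then show ?thesis using Y.D_eq_Ker[OF nonempty(2)] by simp
qed

section \<open>Subgroups that contain the lifted commutator subgroup\<close>

context
  fixes K assumes K: "X.subgp K" and DK: "lift ` Y.D \<subseteq> K"
begin

text \<open>The base is cut down to the preimage of a small set around a point of \<open>S'\<close>,
  so that lifted cycles over the same small set are available as partners. No tower condition is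
  imposed, since small enough sets are bases of towers for any given levels.\<close>

definition full :: "'a set \<Rightarrow> bool" where
  "full C \<longleftrightarrow> C \<in> B \<and> (\<forall>y\<in>S'. \<forall>p q r. distinct [p,q,r] \<longrightarrow> Y.near y (\<lambda>A. X.level_cycle (C \<inter> preim A) p q r \<in> K))"

lemma fullD: "full C \<Longrightarrow> y \<in> S' \<Longrightarrow> distinct [p,q,r] \<Longrightarrow> Y.near y (\<lambda>A. X.level_cycle (C \<inter> preim A) p q r \<in> K)"
  by (simp add: full_def)

lemma level_cycle_preim_K: assumes "A \<in> B'" "distinct [p,q,r]" "Y.tower A {p,q,r}" shows "X.level_cycle (preim A) p q r \<in> K"
  using lift_level_cycle[OF assms(2,3,1)] Y.level_cycle_D[OF assms] DK by (metis image_subset_iff)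

lemma full_preim: assumes "C \<in> B'" shows "full (preim C)"
  unfolding full_def
proof (intro conjI ballI allI impI)
  fix y p q r assume y: "y \<in> S'" "distinct [p,q,r :: int]"
  have "Y.near y (\<lambda>A. Y.tower A {p,q,r})" using y by (intro Y.near_tower) auto
  then show "Y.near y (\<lambda>A. X.level_cycle (preim C \<inter> preim A) p q r \<in> K)"
  proof (rule Y.near_mono)
    fix A assume A: "A \<in> B'" "Y.tower A {p,q,r}"
    show "X.level_cycle (preim C \<inter> preim A) p q r \<in> K"
      unfolding preim_simps(1)[symmetric]
      by (intro level_cycle_preim_K Y.B_Int assms A y Y.tower_mono[OF A(2)]) auto
  qed
qed (rule preim_B[OF assms])

lemma full_T: assumes "full C" shows "full (T n ` C)"
  unfolding full_def
proof (intro conjI ballI allI impI)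
  show "T n ` C \<in> B" using assms X.T_B by (simp add: full_def)
  fix y p q r assume y: "y \<in> S'" "distinct [p,q,r :: int]"
  have "Y.near (T' (- n) y) (\<lambda>A. X.level_cycle (C \<inter> preim A) (p + n) (q + n) (r + n) \<in> K)"
    using y by (intro fullD assms Y.T_S) auto
  from Y.near_conj[OF Y.near_T[OF this] Y.near_tower[of y "{p,q,r}"]]
  show "Y.near y (\<lambda>A. X.level_cycle (T n ` C \<inter> preim A) p q r \<in> K)"
  proof (rule Y.near_mono)
    fix A assume A: "A \<in> B'" "X.level_cycle (C \<inter> preim (T' (- n) ` A)) (p + n) (q + n) (r + n) \<in> K \<and> Y.tower A {p,q,r}"
    have "T n ` (C \<inter> preim (T' (- n) ` A)) = T n ` C \<inter> preim A"
      unfolding preim_T by (simp add: image_Int[OF X.T_inj_on] X.T_image_image X.T_0_image)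
    moreover have "X.tower (T n ` C \<inter> preim A) {p,q,r}"
      using X.tower_mono[OF preim_tower] A(2) by blast
    ultimately show "X.level_cycle (T n ` C \<inter> preim A) p q r \<in> K"
      using X.level_cycle_shift[of p q r n "C \<inter> preim (T' (- n) ` A)"] A y by simp
  qed (use y in auto)
qed

text \<open>The cycle over the whole preimage is lifted, and it is the product of the cycles over
  the part in \<open>C\<close> and over the rest.\<close>

lemma full_compl: assumes "full C" shows "full (S - C)"
  unfolding full_def
proof (intro conjI ballI allI impI)
  have CB: "C \<in> B" using assms by (simp add: full_def)
  then show "S - C \<in> B" using X.B_Diff X.S_B by simp
  fix y p q r assume y: "y \<in> S'" "distinct [p,q,r :: int]"
  from Y.near_conj[OF fullD[OF assms y] Y.near_tower[of y "{p,q,r}"]]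
  show "Y.near y (\<lambda>A. X.level_cycle ((S - C) \<inter> preim A) p q r \<in> K)"
  proof (rule Y.near_mono)
    fix A assume A: "A \<in> B'" "X.level_cycle (C \<inter> preim A) p q r \<in> K \<and> Y.tower A {p,q,r}"
    have tower: "X.tower (preim A) {p,q,r}" using preim_tower A by simp
    have u: "(C \<inter> preim A) \<union> ((S - C) \<inter> preim A) = preim A" by (auto simp: preim_def)
    have "X.level_cycle (preim A) p q r = X.level_cycle (C \<inter> preim A) p q r \<circ> X.level_cycle ((S - C) \<inter> preim A) p q r"
      using X.level_cycle_Un[of "C \<inter> preim A" "(S - C) \<inter> preim A" p q r] tower unfolding u by auto
    moreover have "X.level_cycle (preim A) p q r \<in> K" using A y by (intro level_cycle_preim_K) auto
    ultimately have "X.level_cycle (C \<inter> preim A) p q r \<circ> X.level_cycle ((S - C) \<inter> preim A) p q r \<in> K" by (simp only:)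
    moreover have "X.level_cycle (C \<inter> preim A) p q r \<in> X.F"
      by (rule X.level_cycle_F[OF X.B_Int[OF CB preim_B[OF A(1)]] X.tower_mono[OF tower Int_lower2 subset_refl]])
    moreover have "X.level_cycle ((S - C) \<inter> preim A) p q r \<in> X.F"
      by (rule X.level_cycle_F[OF X.B_Int[OF X.B_Diff[OF X.S_B CB] preim_B[OF A(1)]] X.tower_mono[OF tower Int_lower2 subset_refl]])
    moreover have "X.level_cycle (C \<inter> preim A) p q r \<in> K" using A(2) by simp
    ultimately show "X.level_cycle ((S - C) \<inter> preim A) p q r \<in> K" by (rule X.subgp_cancel(1)[OF K])
  qed (use y in auto)
qed

text \<open>With two fresh levels \<open>s\<close> and \<open>u\<close> the cycles over
  \<open>C\<close> and \<open>E\<close> share only level \<open>p\<close>, and their commutator is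
  the required cycle over the intersection.\<close>

lemma full_Int: assumes "full C" "full E" shows "full (C \<inter> E)"
  unfolding full_def
proof (intro conjI ballI allI impI)
  show "C \<inter> E \<in> B" using assms X.B_Int by (simp add: full_def)
  fix y p q r assume y: "y \<in> S'" "distinct [p,q,r :: int]"
  obtain s where s: "s \<notin> {p,q,r}" using fresh[of "{p,q,r}"] by auto
  obtain u where u: "u \<notin> {p,q,r,s}" using fresh[of "{p,q,r,s}"] by auto
  have d: "distinct [p,q,s,r,u]" "distinct [p,q,s]" "distinct [p,r,u]" using y s u by auto
  from Y.near_conj[OF Y.near_conj[OF fullD[OF assms(1) y(1) d(2)] fullD[OF assms(2) y(1) d(3)]] Y.near_tower[of y "{p,q,s,r,u}"]]
  show "Y.near y (\<lambda>A. X.level_cycle (C \<inter> E \<inter> preim A) p q r \<in> K)"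
  proof (rule Y.near_mono)
    fix A assume A: "A \<in> B'"
      "(X.level_cycle (C \<inter> preim A) p q s \<in> K \<and> X.level_cycle (E \<inter> preim A) p r u \<in> K) \<and> Y.tower A {p,q,s,r,u}"
    have "commutator (X.level_cycle (C \<inter> preim A) p q s) (X.level_cycle (E \<inter> preim A) p r u) = X.level_cycle ((C \<inter> preim A) \<inter> (E \<inter> preim A)) p q r"
      by (rule X.commutator_level_cycle[OF d(1) preim_tower]) (use A in auto)
    moreover have "(C \<inter> preim A) \<inter> (E \<inter> preim A) = C \<inter> E \<inter> preim A" by auto
    ultimately show "X.level_cycle (C \<inter> E \<inter> preim A) p q r \<in> K"
      using X.subD(5)[OF K] A by metis
  qed (use y in auto)
qed

text \<open>The separating set \<open>C\<close> rules out the second alternative of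
  \<open>prime\<close>. As fullness only speaks of small pieces, arbitrary cycles are then assembled
  by compactness over \<open>S'\<close>.\<close>

lemma full_algebra:
  assumes C: "full C" and x: "x \<in> S" "x' \<in> S" "\<pi> x = \<pi> x'" "x \<in> C" "x' \<notin> C"
  shows "X.Alt \<subseteq> K"
proof -
  have "{C. full C} = B \<or> (\<forall>C\<in>{C. full C}. \<forall>x\<in>S. \<forall>x'\<in>S. \<pi> x = \<pi> x' \<longrightarrow> x \<in> C \<longrightarrow> x' \<in> C)"
  proof (rule prime)
    show "{C. full C} \<subseteq> B" by (auto simp: full_def)
    show "S \<in> {C. full C}" using full_preim[OF Y.S_B] by (simp add: preim_simps)
    fix C E assume CE: "C \<in> {C. full C}" "E \<in> {C. full C}"
    then show "C \<inter> E \<in> {C. full C}" using full_Int by simp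
    have "C \<inter> (S - E) = C - E" using CE X.B_sub by (auto simp: full_def)
    then show "C - E \<in> {C. full C}" using full_Int[OF _ full_compl, of C E] CE by simp
  next
    fix C n assume "C \<in> {C. full C}"
    then show "T n ` C \<in> {C. full C}" using full_T by simp
  next
    fix C assume "C \<in> B'"
    then show "{x \<in> S. \<pi> x \<in> C} \<in> {C. full C}" using full_preim by (simp add: preim_def)
  qed
  then have allfull: "{C. full C} = B" using C x by blast
  show ?thesis
  proof (rule X.Alt_least[OF K])
    fix C p q r assume C: "C \<in> B" "distinct [p,q,r]" "X.tower C {p,q,r}"
    have "X.level_cycle (C \<inter> preim S') p q r \<in> K"
    proof (rule Y.local_induct[OF Y.S_B])
      show "X.level_cycle (C \<inter> preim {}) p q r \<in> K" using X.subD(2)[OF K] by (simp only: preim_simps Int_empty_right X.level_cycle_empty)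
      fix A1 A2 assume A: "A1 \<inter> A2 = {}" "X.level_cycle (C \<inter> preim A1) p q r \<in> K" "X.level_cycle (C \<inter> preim A2) p q r \<in> K"
      have "X.level_cycle ((C \<inter> preim A1) \<union> (C \<inter> preim A2)) p q r = X.level_cycle (C \<inter> preim A1) p q r \<circ> X.level_cycle (C \<inter> preim A2) p q r"
        using A(1) by (intro X.level_cycle_Un X.tower_mono[OF C(3)]) (auto simp: preim_def)
      then have "X.level_cycle ((C \<inter> preim A1) \<union> (C \<inter> preim A2)) p q r \<in> K" using X.subD(3)[OF K A(2,3)] by (simp only:)
      then show "X.level_cycle (C \<inter> preim (A1 \<union> A2)) p q r \<in> K" by (simp only: preim_simps Int_Un_distrib)
    next
      fix y assume "y \<in> S'"
      moreover have "full C" using allfull C(1) by blast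
      ultimately have "Y.near y (\<lambda>A. X.level_cycle (C \<inter> preim A) p q r \<in> K)" using fullD C(2) by blast
      then show "Y.near y (\<lambda>A. A \<subseteq> S' \<longrightarrow> X.level_cycle (C \<inter> preim A) p q r \<in> K)"
        by (rule Y.near_mono) (rule impI)
    qed
    moreover have "C \<inter> preim S' = C" using X.B_sub[OF C(1)] by (auto simp: preim_simps)
    ultimately show "X.level_cycle C p q r \<in> K" by simp
  qed
qed

text \<open>A three-cycle on any single triple of levels yields all others by commutators with lifted three-cycles.\<close>

lemma replace_level:
  assumes "A \<in> B'" "C \<subseteq> preim A" "distinct [a,b,c,d,e]" "Y.tower A {a,b,c,d,e}" "X.level_cycle C a b c \<in> K"
  shows "X.level_cycle C a b d \<in> K"
proof -
  have "X.level_cycle (preim A) a d e \<in> K" using assms by (intro level_cycle_preim_K Y.tower_mono[OF assms(4)]) auto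
  moreover have "commutator (X.level_cycle C a b c) (X.level_cycle (preim A) a d e) = X.level_cycle (C \<inter> preim A) a b d"
    by (rule X.commutator_level_cycle[OF assms(3) preim_tower[OF assms(4)] assms(2) subset_refl])
  moreover have "C \<inter> preim A = C" using assms(2) by auto
  ultimately show ?thesis using X.subD(5)[OF K assms(5)] by metis
qed

text \<open>\<open>replace_level\<close> exchanges the last entry of a cycle; rotating between its
  uses exchanges \<open>c\<close>, \<open>a\<close>, \<open>b\<close> in turn for \<open>r\<close>,
  \<open>p\<close>, \<open>q\<close>. The level \<open>e\<close> is the spare fifth level of the
  commutator formula.\<close>

lemma replace_levels:
  assumes A: "A \<in> B'" "C \<subseteq> preim A" and d: "distinct [a,b,c,p,q,r,e]" "Y.tower A {a,b,c,p,q,r,e}"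
    and K: "X.level_cycle C a b c \<in> K"
  shows "X.level_cycle C p q r \<in> K"
proof -
  have "X.level_cycle C a b r \<in> K"
    using d by (intro replace_level[OF A _ _ K, of r e]) (auto intro: Y.tower_mono[OF d(2)])
  moreover have "X.level_cycle C a b r = X.level_cycle C b r a" using d by (intro X.level_cycle_rot) auto
  ultimately have "X.level_cycle C b r a \<in> K" by (simp only:)
  then have "X.level_cycle C b r p \<in> K"
    using d by (intro replace_level[OF A _ _ \<open>X.level_cycle C b r a \<in> K\<close>, of p e]) (auto intro: Y.tower_mono[OF d(2)])
  moreover have "X.level_cycle C b r p = X.level_cycle C r p b" using d by (intro X.level_cycle_rot) auto
  ultimately have "X.level_cycle C r p b \<in> K" by (simp only:)
  then have "X.level_cycle C r p q \<in> K"
    using d by (intro replace_level[OF A _ _ \<open>X.level_cycle C r p b \<in> K\<close>, of q e]) (auto intro: Y.tower_mono[OF d(2)])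
  moreover have "X.level_cycle C r p q = X.level_cycle C p q r" using d by (intro X.level_cycle_rot) auto
  ultimately show ?thesis by (simp only:)
qed

text \<open>The difficulty is to cut the base \<open>C\<close> down to a small piece
  \<open>C \<inter> preim A'\<close> inside \<open>K\<close>. A commutator with a lifted cycle over
  \<open>preim A'\<close> does this if that cycle meets the levels of \<open>C\<close> only at level
  \<open>a\<close>; its two other levels are therefore placed inside level \<open>u\<close> of
  \<open>A\<close>, which the given cycle leaves untouched.\<close>

lemma seed_full:
  assumes A: "A \<in> B'" and C: "C \<in> B" "C \<subseteq> preim A" and d: "distinct [a,b,c,u]" "Y.tower A {a,b,c,u}"
    and CK: "X.level_cycle C a b c \<in> K"
  shows "full C"
  unfolding full_def
proof (intro conjI ballI allI impI)
  show "C \<in> B" by fact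
  fix y p q r assume y: "y \<in> S'" "distinct [p,q,r :: int]"
  show "Y.near y (\<lambda>A'. X.level_cycle (C \<inter> preim A') p q r \<in> K)"
  proof (cases "y \<in> A")
    case False
    have "Y.near y (\<lambda>A'. A' \<subseteq> S' - A)" using False y A Y.B_Diff Y.S_B by (intro Y.near_subset) auto
    then show ?thesis
    proof (rule Y.near_mono)
      fix A' assume "A' \<subseteq> S' - A"
      then have "C \<inter> preim A' = {}" using C(2) by (auto simp: preim_def)
      then show "X.level_cycle (C \<inter> preim A') p q r \<in> K" using X.subD(2)[OF K] by (simp only: X.level_cycle_empty)
    qed
  next
    case True
    have uA: "T' u ` A \<in> B'" "T' u ` A \<noteq> {}" using A True Y.T_B by auto
    \<comment> \<open>Minimality puts levels \<open>s\<close> and \<open>w\<close> of a small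
      neighbourhood of \<open>y\<close> into level \<open>u\<close> of \<open>A\<close>, at times
      different from all levels in use.\<close>
    obtain s where s: "s \<notin> {a,b,c,p,q,r}" "T' s y \<in> T' u ` A"
      using Y.nonempty_open_infinitely_often[OF uA y(1), of "{a,b,c,p,q,r}"] by auto
    obtain w where w: "w \<notin> {a,b,c,p,q,r,s}" "T' w y \<in> T' u ` A"
      using Y.nonempty_open_infinitely_often[OF uA y(1), of "{a,b,c,p,q,r,s}"] by auto
    \<comment> \<open>The passage from \<open>a\<close>, \<open>b\<close>, \<open>s\<close> to
      \<open>p\<close>, \<open>q\<close>, \<open>r\<close> goes through fresh levels, because the
      two triples may overlap while \<open>replace_levels\<close> wants them disjoint.\<close>
    obtain f1 where f1: "f1 \<notin> {a,b,c,p,q,r,s,w}" using fresh[of "{a,b,c,p,q,r,s,w}"] by auto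
    obtain f2 where f2: "f2 \<notin> {a,b,c,p,q,r,s,w,f1}" using fresh[of "{a,b,c,p,q,r,s,w,f1}"] by auto
    obtain f3 where f3: "f3 \<notin> {a,b,c,p,q,r,s,w,f1,f2}" using fresh[of "{a,b,c,p,q,r,s,w,f1,f2}"] by auto
    define J where "J = {a,b,c,p,q,r,s,w,f1,f2,f3}"
    have "Y.near y (\<lambda>A'. Y.tower A' J)" unfolding J_def using y by (intro Y.near_tower) auto
    from Y.near_conj[OF Y.near_conj[OF Y.near_subset[OF A True] this]
        Y.near_conj[OF Y.near_T[OF Y.near_subset[OF uA(1) s(2)]] Y.near_T[OF Y.near_subset[OF uA(1) w(2)]]]]
    show ?thesis
    proof (rule Y.near_mono)
      fix A' assume A': "A' \<in> B'" "(A' \<subseteq> A \<and> Y.tower A' J) \<and> T' s ` A' \<subseteq> T' u ` A \<and> T' w ` A' \<subseteq> T' u ` A"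
      define C1 where "C1 = C \<inter> preim A'"
      define C2 where "C2 = C - preim A'"
      have CC: "C1 \<in> B" "C2 \<in> B" "C1 \<inter> C2 = {}" "C2 \<union> C1 = C" "C1 \<subseteq> preim A" "C2 \<subseteq> preim A" "C1 \<subseteq> preim A'"
        unfolding C1_def C2_def using X.B_Int X.B_Diff C preim_B A' by auto
      have colA: "X.tower (preim A) {a,b,c,u}" by (rule preim_tower[OF d(2)])
      have colC: "X.tower (C2 \<union> C1) {a,b,c}" using CC(4) C(2) by (intro X.tower_mono[OF colA]) auto
      have A'A: "preim A' \<subseteq> preim A" using A' by (intro preim_mono) auto
      have split: "X.level_cycle C a b c = X.level_cycle C2 a b c \<circ> X.level_cycle C1 a b c"
        using X.level_cycle_Un[OF colC] CC(3) unfolding CC(4) by auto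
      have jA: "T i ` preim A \<inter> T j ` preim A = {}" if "i \<in> {a,b,c,u}" "j \<in> {a,b,c,u}" "i \<noteq> j" for i j
        using colA that unfolding X.tower_def by blast
      have levels: "T i ` C2 \<subseteq> T i ` preim A" "T i ` C1 \<subseteq> T i ` preim A" for i using CC by blast+
      have b: "bij (X.level_cycle C2 a b c)" "bij (X.level_cycle C1 a b c)"
        by (rule X.level_cycle_bij[OF X.tower_mono[OF colC]]; auto)+
      have colJ: "Y.tower A' I" if "I \<subseteq> J" for I using Y.tower_mono[of A' J A' I] A' that by simp
      have dA': "distinct [a,s,w]" "Y.tower A' {a,s,w}"
        using s w by (auto intro!: colJ simp: J_def)
      have yK: "X.level_cycle (preim A') a s w \<in> K" by (rule level_cycle_preim_K[OF A'(1) dA'])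
      have yb: "bij (X.level_cycle (preim A') a s w)" by (rule X.level_cycle_bij[OF preim_tower[OF dA'(2)]])
      have com1: "X.level_cycle C2 a b c \<circ> X.level_cycle C1 a b c = X.level_cycle C1 a b c \<circ> X.level_cycle C2 a b c"
      proof (rule X.level_cycle_commute[OF b])
        fix i j assume ij: "i \<in> {a,b,c}" "j \<in> {a,b,c}"
        show "T i ` C2 \<inter> T j ` C1 = {}"
        proof (cases "i = j")
          case True
          then show ?thesis using CC(3) by (auto simp: X.T_eq_iff)
        next
          case False
          then show ?thesis using jA[of i j] levels(1)[of i] levels(2)[of j] ij by blast
        qed
      qed
      \<comment> \<open>The part over \<open>C2\<close> does not meet the lifted cycle: at level
        \<open>a\<close> the bases are disjoint, and levels \<open>s\<close> and \<open>w\<close>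
        lie in level \<open>u\<close> of \<open>A\<close>.\<close>
      have com2: "X.level_cycle C2 a b c \<circ> X.level_cycle (preim A') a s w = X.level_cycle (preim A') a s w \<circ> X.level_cycle C2 a b c"
      proof (rule X.level_cycle_commute[OF b(1) yb])
        fix i j assume i: "i \<in> {a,b,c}" and j: "j \<in> {a,s,w}"
        show "T i ` C2 \<inter> T j ` preim A' = {}"
        proof (cases "j = a")
          case True
          have "T j ` preim A' \<subseteq> T a ` preim A" using A'A True by (simp add: image_mono)
          moreover have "T a ` C2 \<inter> T a ` preim A' = {}" by (auto simp: X.T_eq_iff C2_def)
          ultimately show ?thesis using True jA[of i a] levels(1)[of i] i by blast
        next
          case False
          have "T' j ` A' \<subseteq> T' u ` A" using A' False j by auto
          then have "T j ` preim A' \<subseteq> T u ` preim A" using preim_mono unfolding preim_T[symmetric] by blast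
          moreover have "i \<noteq> u" using i d by auto
          ultimately show ?thesis using jA[of i u] levels(1)[of i] i by blast
        qed
      qed
      have "commutator (X.level_cycle C a b c) (X.level_cycle (preim A') a s w) = commutator (X.level_cycle C1 a b c) (X.level_cycle (preim A') a s w)"
        unfolding split by (rule commutator_commuting_factor[OF b yb com1 com2])
      also have "\<dots> = X.level_cycle (C1 \<inter> preim A') a b s"
      proof (rule X.commutator_level_cycle[OF _ preim_tower CC(7) subset_refl])
        show "distinct [a,b,c,s,w]" using d s w by auto
        show "Y.tower A' {a,b,c,s,w}" by (rule colJ) (auto simp: J_def)
      qed
      also have "C1 \<inter> preim A' = C1" using CC(7) by auto
      finally have C1K: "X.level_cycle C1 a b s \<in> K" using X.subD(5)[OF K CK yK] by (simp only:)
      have "X.level_cycle C1 f1 f2 f3 \<in> K"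
        by (rule replace_levels[OF A'(1) CC(7) _ _ C1K, of f1 f2 f3 w])
          (use d s w f1 f2 f3 in \<open>auto intro!: colJ simp: J_def\<close>)
      then have "X.level_cycle C1 p q r \<in> K"
        by (rule replace_levels[OF A'(1) CC(7), of f1 f2 f3 p q r w, rotated 2])
          (use d y s w f1 f2 f3 in \<open>auto intro!: colJ simp: J_def\<close>)
      then show "X.level_cycle (C \<inter> preim A') p q r \<in> K" by (simp only: C1_def)
    qed
  qed
qed

end

text \<open>Identifying the orbit of \<open>x\<close> with the integers, \<open>r\<close> is the
  injection of the integers that \<open>g\<close> induces there; it describes \<open>g\<close> on
  each level of a small tower around \<open>x\<close>.\<close>

lemma level_map:
  assumes g: "g \<in> X.F" and x: "x \<in> S"
  defines "r \<equiv> \<lambda>j. X.disp g (T j x) + j"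
  shows "g (T j x) = T (r j) x" "r i = r j \<longleftrightarrow> i = j" "X.near x (\<lambda>C. \<forall>z\<in>C. g (T j z) = T (r j) z)"
proof -
  show 1: "g (T j x) = T (r j) x" for j
    using X.F_disp[OF g X.T_S[OF x]] by (simp add: r_def X.T_add)
  show "r i = r j \<longleftrightarrow> i = j"
  proof
    assume "r i = r j"
    then have "g (T i x) = g (T j x)" using 1 by simp
    then have "T i x = T j x" using X.F_bij[OF g] by (simp add: bij_def inj_eq)
    then show "i = j" using X.T_inj[OF x] by simp
  qed simp
  have "X.near x (\<lambda>C. \<forall>z\<in>T j ` C. g z = T (X.disp g (T j x)) z)"
    by (rule X.near_T[OF X.F_near[OF g X.T_S[OF x]]])
  then show "X.near x (\<lambda>C. \<forall>z\<in>C. g (T j z) = T (r j) z)"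
    by (rule X.near_mono) (auto simp: r_def X.T_add)
qed

text \<open>In a fibre \<open>{x1, x2}\<close> on which \<open>g\<close> has different displacements, conjugation by \<open>g\<close> splits a lifted
  three-cycle \<open>a\<close> around the fibre into cycles \<open>z1\<close>, \<open>z2\<close> with different levels. A lifted cycle \<open>b\<close> meeting
  only the levels of \<open>z1\<close> then isolates the part near \<open>x1\<close> in the commutator of \<open>g a g\<inverse>\<close> and \<open>b\<close>.\<close>

lemma nonlift_generates:
  assumes K: "X.subgp K" "lift ` Y.D \<subseteq> K" and g: "g \<in> K" "g \<notin> lift ` Y.F"
  shows "X.Alt \<subseteq> K"
proof -
  have gF: "g \<in> X.F" using g X.subD(1)[OF K(1)] by auto
  obtain x1 x2 where x: "x1 \<in> S" "x2 \<in> S" "\<pi> x1 = \<pi> x2" "X.disp g x1 \<noteq> X.disp g x2"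
    using lift_characterization[OF gF] g(2) by blast
  define r1 where "r1 j = X.disp g (T j x1) + j" for j
  define r2 where "r2 j = X.disp g (T j x2) + j" for j
  note l1 = level_map[OF gF x(1), folded r1_def]
  note l2 = level_map[OF gF x(2), folded r2_def]
  have ne: "r1 0 \<noteq> r2 0" using x(4) by (simp add: r1_def r2_def X.T_0)
  \<comment> \<open>At most one level of the second point is sent to \<open>r1 0\<close>. Avoiding
    it in the choice of \<open>k\<close> and \<open>l\<close> keeps \<open>r2 0\<close>,
    \<open>r2 k\<close>, \<open>r2 l\<close> away from the only level that \<open>b\<close> shares
    with \<open>z1\<close>.\<close>
  have fin: "finite {j. r2 j = r1 0}"
  proof (cases "\<exists>j. r2 j = r1 0")
    case True
    then obtain j where "r2 j = r1 0" by auto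
    then have "{j. r2 j = r1 0} = {j}" using l2(2) by fastforce
    then show ?thesis by simp
  qed simp
  obtain k where k: "k \<notin> insert 0 {j. r2 j = r1 0}" using fresh[of "insert 0 {j. r2 j = r1 0}"] fin by auto
  obtain l where l: "l \<notin> insert k (insert 0 {j. r2 j = r1 0})"
    using fresh[of "insert k (insert 0 {j. r2 j = r1 0})"] fin by auto
  define J where "J = {0,k,l,r1 0,r1 k,r1 l,r2 0,r2 k,r2 l}"
  obtain k' where k': "k' \<notin> J" using fresh[of J] by (auto simp: J_def)
  obtain l' where l': "l' \<notin> insert k' J" using fresh[of "insert k' J"] by (auto simp: J_def)
  have d0: "distinct [0,k,l]" using k l by auto
  have d1: "distinct [r1 0, r1 k, r1 l]" "distinct [r2 0, r2 k, r2 l]" using l1(2) l2(2) d0 by auto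
  have d2: "distinct [r1 0, r1 k, r1 l, k', l']" using d1 k' l' by (auto simp: J_def)
  have apart: "i \<noteq> j" if "i \<in> {r2 0, r2 k, r2 l}" "j \<in> {r1 0, k', l'}" for i j
    using that k l k' l' ne by (auto simp: J_def)
  have "X.near x1 (\<lambda>C. \<forall>j\<in>{0,k,l}. \<forall>z\<in>C. g (T j z) = T (r1 j) z)"
    by (intro X.near_ball l1(3) x(1)) auto
  then obtain O1 where O1: "O1 \<in> B" "x1 \<in> O1" "\<forall>j\<in>{0,k,l}. \<forall>z\<in>O1. g (T j z) = T (r1 j) z"
    using X.near_ex by blast
  have "X.near x2 (\<lambda>C. \<forall>j\<in>{0,k,l}. \<forall>z\<in>C. g (T j z) = T (r2 j) z)"
    by (intro X.near_ball l2(3) x(2)) auto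
  then obtain O2 where O2: "O2 \<in> B" "x2 \<in> O2" "\<forall>j\<in>{0,k,l}. \<forall>z\<in>O2. g (T j z) = T (r2 j) z"
    using X.near_ex by blast
  have O12: "O1 \<inter> O2 = {}"
  proof (rule ccontr)
    assume "O1 \<inter> O2 \<noteq> {}"
    then obtain z where z: "z \<in> O1" "z \<in> O2" by auto
    then have "T (r1 0) z = T (r2 0) z" using O1(3) O2(3) by fastforce
    then show False using ne X.T_inj z(1) X.B_sub[OF O1(1)] by blast
  qed
  define y where "y = \<pi> x1"
  have y: "y \<in> S'" using x pi_S by (simp add: y_def)
  \<comment> \<open>The bound on fibres enters here: the fibre of \<open>y\<close> is just
    \<open>x1\<close> and \<open>x2\<close>, so a neighbourhood of it splits into one piece for each
    of them.\<close>
  have "Y.near y (\<lambda>A. preim A \<subseteq> O1 \<union> O2)"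
  proof (rule tube[OF X.B_Un[OF O1(1) O2(1)] y])
    fix z assume z: "z \<in> S" "\<pi> z = y"
    then have "x1 = x2 \<or> x1 = z \<or> x2 = z" using fibres[OF x(1,2) z(1) x(3)] by (simp add: y_def)
    then show "z \<in> O1 \<union> O2" using O1(2) O2(2) x(4) by auto
  qed
  from Y.near_ex[OF Y.near_conj[OF this Y.near_tower[OF y, of "insert l' (insert k' J)"]]]
  obtain A where A: "A \<in> B'" "y \<in> A" "preim A \<subseteq> O1 \<union> O2" "Y.tower A (insert l' (insert k' J))"
    by (auto simp: J_def)
  have colJ: "Y.tower A I" if "I \<subseteq> insert l' (insert k' J)" for I using Y.tower_mono[OF A(4) subset_refl that] .
  have colX: "X.tower C I" if "C \<subseteq> preim A" "I \<subseteq> insert l' (insert k' J)" for C I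
    using X.tower_mono[OF preim_tower[OF colJ[OF that(2)]] that(1) subset_refl] .
  define C1 where "C1 = O1 \<inter> preim A"
  define C2 where "C2 = O2 \<inter> preim A"
  have C: "C1 \<in> B" "C2 \<in> B" "C1 \<subseteq> preim A" "C2 \<subseteq> preim A" "C1 \<inter> C2 = {}" "C2 \<union> C1 = preim A"
    unfolding C1_def C2_def using A O12 O1(1) O2(1) X.B_Int preim_B[OF A(1)] by auto
  have gb: "bij g" using X.F_bij gF .
  define a where "a = X.level_cycle (preim A) 0 k l"
  have a: "a \<in> K" unfolding a_def by (rule level_cycle_preim_K[OF K A(1) d0 colJ]) (auto simp: J_def)
  define b where "b = X.level_cycle (preim A) (r1 0) k' l'"
  have b: "b \<in> K" unfolding b_def by (rule level_cycle_preim_K[OF K A(1) _ colJ]) (use d2 in \<open>auto simp: J_def\<close>)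
  define z1 where "z1 = X.level_cycle C1 (r1 0) (r1 k) (r1 l)"
  define z2 where "z2 = X.level_cycle C2 (r2 0) (r2 k) (r2 l)"
  have bij: "bij z1" "bij z2" "bij b"
    unfolding z1_def z2_def b_def by (rule X.level_cycle_bij[OF colX]; use C in \<open>auto simp: J_def\<close>)+
  have "a = X.level_cycle C2 0 k l \<circ> X.level_cycle C1 0 k l"
    unfolding a_def C(6)[symmetric] by (rule X.level_cycle_Un[OF colX]) (use C in \<open>auto simp: J_def\<close>)
  then have "g \<circ> a \<circ> iv g = (g \<circ> X.level_cycle C2 0 k l \<circ> iv g) \<circ> (g \<circ> X.level_cycle C1 0 k l \<circ> iv g)"
    using X.conj_comp[OF gb] by (simp only:)
  also have "g \<circ> X.level_cycle C1 0 k l \<circ> iv g = z1"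
    unfolding z1_def by (rule X.level_cycle_conj(2)[OF d0 colX d1(1) gb]) (use C O1(3) in \<open>auto simp: J_def C1_def\<close>)
  also have "g \<circ> X.level_cycle C2 0 k l \<circ> iv g = z2"
    unfolding z2_def by (rule X.level_cycle_conj(2)[OF d0 colX d1(2) gb]) (use C O2(3) in \<open>auto simp: J_def C2_def\<close>)
  finally have gag: "g \<circ> a \<circ> iv g = z2 \<circ> z1" .
  have zK: "z2 \<circ> z1 \<in> K"
    using X.subD(3)[OF K(1) X.subD(3)[OF K(1) g(1) a] X.subD(4)[OF K(1) g(1)]] unfolding gag .
  have jA: "T i ` preim A \<inter> T j ` preim A = {}" if "i \<in> insert l' (insert k' J)" "j \<in> insert l' (insert k' J)" "i \<noteq> j" for i j
    using colX[OF subset_refl subset_refl] that unfolding X.tower_def by blast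
  have com1: "z2 \<circ> z1 = z1 \<circ> z2"
    unfolding z1_def z2_def
  proof (rule X.level_cycle_commute[OF bij(2,1)[unfolded z1_def z2_def]])
    fix i j assume ij: "i \<in> {r2 0, r2 k, r2 l}" "j \<in> {r1 0, r1 k, r1 l}"
    show "T i ` C2 \<inter> T j ` C1 = {}"
    proof (cases "i = j")
      case True
      then show ?thesis using C(5) by (auto simp: X.T_eq_iff)
    next
      case False
      then have "T i ` preim A \<inter> T j ` preim A = {}" using ij by (intro jA) (auto simp: J_def)
      then show ?thesis using C(3,4) by blast
    qed
  qed
  have com2: "z2 \<circ> b = b \<circ> z2"
    unfolding b_def z2_def
  proof (rule X.level_cycle_commute[OF bij(2,3)[unfolded b_def z2_def]])
    fix i j assume ij: "i \<in> {r2 0, r2 k, r2 l}" "j \<in> {r1 0, k', l'}"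
    then have "T i ` preim A \<inter> T j ` preim A = {}" by (intro jA apart[OF ij]) (auto simp: J_def)
    then show "T i ` C2 \<inter> T j ` preim A = {}" using C(4) by blast
  qed
  have "commutator (z2 \<circ> z1) b = commutator z1 b" by (rule commutator_commuting_factor[OF bij(2,1,3) com1 com2])
  also have "\<dots> = X.level_cycle (C1 \<inter> preim A) (r1 0) (r1 k) k'"
    unfolding z1_def b_def
    by (rule X.commutator_level_cycle[OF d2 colX[OF subset_refl] C(3) subset_refl]) (auto simp: J_def)
  also have "C1 \<inter> preim A = C1" using C(3) by auto
  finally have CK: "X.level_cycle C1 (r1 0) (r1 k) k' \<in> K" using X.subD(5)[OF K(1) zK b] by (simp only:)
  have "full K C1"
    by (rule seed_full[OF K A(1) C(1,3) _ colJ CK, of l']) (use d2 in \<open>auto simp: J_def\<close>)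
  moreover have "x1 \<in> C1" using O1(2) A(2) x(1) by (simp add: C1_def preim_def y_def)
  moreover have "x2 \<notin> C1" using O2(2) O12 by (auto simp: C1_def)
  ultimately show ?thesis using full_algebra[OF K] x by blast
qed

section \<open>Maximality of the lifted groups\<close>

text \<open>A small three-cycle around one of two points of a fibre moves that point and fixes the
  other, so its displacement is not constant on the fibre.\<close>

lemma D_not_lifted: "\<exists>f\<in>X.D. f \<notin> lift ` Y.F"
proof -
  obtain x1 x2 where x: "x1 \<in> S" "x2 \<in> S" "x1 \<noteq> x2" "\<pi> x1 = \<pi> x2" using not_inj by blast
  \<comment> \<open>Two points of one fibre never lie on one orbit, because the action downstairs is
    free. This leaves room for a tower around \<open>x1\<close> that misses
    \<open>x2\<close>.\<close>
  have ne: "x1 \<noteq> T (- j) x2" for j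
  proof
    assume e: "x1 = T (- j) x2"
    then have "T' (- j) (\<pi> x2) = \<pi> x2" using x pi_T by metis
    then have "- j = 0" using Y.free[OF pi_S[OF x(2)]] by blast
    then show False using e x(3) by (simp add: X.T_0)
  qed
  have "X.near x1 (\<lambda>C. X.tower C {0,1,2} \<and> (\<forall>j\<in>{0,1,2}. T (- j) x2 \<notin> C))"
    using x by (intro X.near_conj X.near_tower X.near_ball X.near_sep ne X.T_S) auto
  from X.near_ex[OF this] obtain C where C: "C \<in> B" "x1 \<in> C" "X.tower C {0,1,2}" "\<forall>j\<in>{0,1,2}. T (- j) x2 \<notin> C" by blast
  have d: "distinct [0,1,2::int]" by simp
  have D: "X.level_cycle C 0 1 2 \<in> X.D" by (rule X.level_cycle_D[OF C(1) d C(3)])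
  have "X.level_cycle C 0 1 2 x1 = T 1 x1" using X.level_cycle_in(1)[OF d C(3) subset_refl C(2)] C(2) by (simp add: X.T_0)
  then have c1: "X.disp (X.level_cycle C 0 1 2) x1 = 1" by (rule X.disp_eqI[OF x(1)])
  have "X.level_cycle C 0 1 2 x2 = T 0 x2" unfolding X.T_0 by (rule X.level_cycle_out) (use C(4) X.T_mem_iff[of x2] in auto)
  then have c2: "X.disp (X.level_cycle C 0 1 2) x2 = 0" by (rule X.disp_eqI[OF x(2)])
  have "X.level_cycle C 0 1 2 \<notin> lift ` Y.F"
    using c1 c2 disp_lift[OF x(1)] disp_lift[OF x(2)] x(4) by auto
  then show ?thesis using D by blast
qed

theorem lift_D_maximal: "X.maximal_in (lift ` Y.D) X.D"
  unfolding X.maximal_in_def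
proof (intro conjI allI impI)
  show "X.subgp (lift ` Y.D)" by (rule lift_image_subgp[OF Y.subgp_D])
  show "lift ` Y.D \<subseteq> X.D" by (rule lift_D_subset_D)
  show "lift ` Y.D \<noteq> X.D" using D_not_lifted Y.D_F by blast
  fix K assume K: "X.subgp K" "lift ` Y.D \<subseteq> K" "K \<subseteq> X.D"
  show "K = lift ` Y.D \<or> K = X.D"
  proof (cases "K \<subseteq> lift ` Y.F")
    case True
    have "K \<subseteq> lift ` Y.D"
    proof
      fix g assume g: "g \<in> K"
      then obtain f where "f \<in> Y.F" "g = lift f" using True by auto
      then show "g \<in> lift ` Y.D" using lift_D_descends g K(3) by blast
    qed
    then show ?thesis using K(2) by blast
  next
    case False
    then have "X.Alt \<subseteq> K" using nonlift_generates[OF K(1,2)] by blast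
    then show ?thesis using K(3) X.D_eq_Alt by simp
  qed
qed

lemma D_subset_K:
  assumes "X.subgp K" "lift ` Y.F \<subseteq> K" "K \<noteq> lift ` Y.F" shows "X.D \<subseteq> K"
proof -
  have "lift ` Y.D \<subseteq> K" using assms(2) Y.D_F by blast
  moreover obtain g where "g \<in> K" "g \<notin> lift ` Y.F" using assms by blast
  ultimately show ?thesis using nonlift_generates[OF assms(1)] X.D_eq_Alt by simp
qed

text \<open>Modulo \<open>D\<close>, which \<open>K\<close> contains, an element is determined by
  its sign class and its mean displacement. Powers of the action are lifts and absorb the
  displacement; by assumption the sign class is that of a lift.\<close>

lemma lift_F_maximal_if:
  assumes "\<And>C. C \<in> B \<Longrightarrow> \<exists>E\<in>B'. X.cohom2 C (preim E)" shows "X.maximal_in (lift ` Y.F) X.F"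
  unfolding X.maximal_in_def
proof (intro conjI allI impI)
  show "X.subgp (lift ` Y.F)" by (rule lift_image_subgp[OF Y.subgp_F])
  show "lift ` Y.F \<subseteq> X.F" using lift_F by auto
  show "lift ` Y.F \<noteq> X.F" using D_not_lifted X.D_F by blast
  fix K assume K: "X.subgp K" "lift ` Y.F \<subseteq> K" "K \<subseteq> X.F"
  show "K = lift ` Y.F \<or> K = X.F"
  proof (cases "K = lift ` Y.F")
    case False
    then have D: "X.D \<subseteq> K" by (rule D_subset_K[OF K(1,2)])
    have "X.F \<subseteq> K"
    proof
      fix f assume f: "f \<in> X.F"
      obtain E where E: "E \<in> B'" "X.cohom2 (X.parity f) (preim E)" using assms[OF X.parity_B[OF f]] by blast
      obtain h where h: "h \<in> Y.F" "Y.cohom2 (Y.parity h) E" "Y.cobound (Y.disp h)" using Y.realize_class[OF E(1)] by blast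
      obtain Ps where Ps: "\<forall>P\<in>set Ps. X.swappable P" "S \<subseteq> \<Union>(set Ps)" using X.swappable_cover by blast
      obtain c where c: "X.cobound (\<lambda>x. X.disp f x - c)" using X.swaps_over_rep[OF Ps f] by blast
      have hF: "lift h \<in> X.F" "iv (lift h) \<in> X.F" using lift_F h X.F_inv by auto
      define f1 where "f1 = f \<circ> iv (lift h)"
      define f2 where "f2 = f1 \<circ> T (- c)"
      have f1: "f1 \<in> X.F" unfolding f1_def by (rule X.F_comp[OF f hF(2)])
      have f2: "f2 \<in> X.F" unfolding f2_def by (rule X.F_comp[OF f1 X.T_F])
      have pe: "X.cohom2 (preim (Y.parity h)) (preim E)"
      proof -
        obtain V where V: "V \<in> B'" "symdiff (Y.parity h) E = symdiff (T' 1 ` V) V"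
          using h(2) by (auto simp: Y.cohom2_def Y.cobound2_def)
        then have "symdiff (preim (Y.parity h)) (preim E) = symdiff (T 1 ` preim V) (preim V)" by (metis preim_simps(6) preim_T)
        then show ?thesis unfolding X.cohom2_def X.cobound2_def using preim_B[OF V(1)] by blast
      qed
      have "X.cohom2 (X.parity f1) (symdiff (X.parity f) (X.parity (iv (lift h))))" unfolding f1_def by (rule X.parity_comp[OF f hF(2)])
      moreover have "X.cohom2 (symdiff (X.parity f) (X.parity (iv (lift h)))) (symdiff (preim E) (preim E))"
        using X.cohom2_symdiff[OF E(2) X.cohom2_trans[OF X.parity_iv[OF hF(1)]]] pe unfolding parity_lift[OF h(1)] by blast
      ultimately have "X.cohom2 (X.parity f1) {}" using X.cohom2_trans unfolding symdiff_self by blast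
      then have "X.cobound2 (X.parity f2)" using X.cohom2_trans[OF X.parity_comp_T[OF f1]] X.cohom2_empty unfolding f2_def by blast
      moreover have "X.cobound (X.disp f2)"
      proof -
        have hc: "X.cobound (X.disp (lift h))"
        proof -
          obtain v where v: "Y.lconst v" "\<forall>x\<in>S'. Y.disp h x = v (T' 1 x) - v x" using h(3) by (auto simp: Y.cobound_def)
          have "X.lconst (\<lambda>x. v (\<pi> x))" unfolding X.lconst_def
          proof
            fix x assume x: "x \<in> S"
            have "Y.near (\<pi> x) (\<lambda>C. \<forall>z\<in>C. v z = v (\<pi> x))" using v(1) pi_S[OF x] by (simp add: Y.lconst_def)
            from near_preim[OF x this] obtain A where A: "A \<in> B'" "x \<in> preim A" "\<forall>z\<in>A. v z = v (\<pi> x)" by blast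
            show "X.near x (\<lambda>C. \<forall>z\<in>C. v (\<pi> z) = v (\<pi> x))"
              by (rule X.near_mono[OF X.near_subset[OF preim_B[OF A(1)] A(2)]]) (use A(3) in \<open>auto simp: preim_def\<close>)
          qed
          then show ?thesis unfolding X.cobound_def
            by (intro exI[of _ "\<lambda>x. v (\<pi> x)"]) (use v(2) in \<open>auto simp: disp_lift pi_T pi_S\<close>)
        qed
        have 1: "X.cobound (\<lambda>x. X.disp f1 x - (X.disp f x + X.disp (iv (lift h)) x))" unfolding f1_def by (rule X.disp_hom[OF f hF(2)])
        have 2: "X.cobound (\<lambda>x. X.disp f2 x - (X.disp f1 x + X.disp (T (- c)) x))" unfolding f2_def by (rule X.disp_hom[OF f1 X.T_F])
        have 3: "X.cobound (\<lambda>x. X.disp (iv (lift h)) x + X.disp (lift h) x)" by (rule X.disp_iv[OF hF(1)])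
        from X.cobound_add[OF X.cobound_add[OF 1 2] X.cobound_add[OF X.cobound_diff[OF 3 hc] c]]
        show ?thesis by (rule X.cobound_cong) (simp add: X.disp_T)
      qed
      ultimately have "f2 \<in> X.Ker" using f2 by (simp add: X.Ker_def)
      then have f2K: "f2 \<in> K" using D X.D_eq_Ker[OF nonempty(1)] by blast
      have "lift (T' c) \<in> K" by (rule subsetD[OF K(2) imageI[OF Y.T_F]])
      then have TK: "T c \<in> K" by (simp only: lift_T)
      have hK: "lift h \<in> K" using K(2) h(1) by blast
      have e1: "f2 \<circ> T c = f1"
      proof -
        have "T (- c) \<circ> T c = id" by (auto simp: X.T_add X.T_0)
        then show ?thesis unfolding f2_def comp_assoc by (simp only: comp_id)
      qed
      have e2: "f1 \<circ> lift h = f"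
        unfolding f1_def comp_assoc iv_simps(4)[OF lift_bij[OF h(1)]] comp_id ..
      have "(f2 \<circ> T c) \<circ> lift h \<in> K" by (intro X.subD(3)[OF K(1)] f2K TK hK)
      then show "f \<in> K" unfolding e1 e2 .
    qed
    then show ?thesis using K(3) by blast
  qed simp
qed

text \<open>The elements whose sign class comes from \<open>Y\<close> form a subgroup that contains
  the lifts and also \<open>D\<close>, hence is larger than the group of lifts. Maximality makes it
  everything, and every clopen set occurs as a sign by \<open>realize_class\<close>.\<close>

lemma lift_F_maximal_only_if:
  assumes m: "X.maximal_in (lift ` Y.F) X.F" and C: "C \<in> B" shows "\<exists>E\<in>B'. X.cohom2 C (preim E)"
proof -
  define N where "N = {f\<in>X.F. \<exists>E\<in>B'. X.cohom2 (X.parity f) (preim E)}"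
  have "X.subgp N" unfolding X.subgp_def
  proof (intro conjI ballI)
    show "N \<subseteq> X.F" by (auto simp: N_def)
    have "X.cohom2 (X.parity id) (preim {})" using X.parity_T[of 0] X.id_T0 X.cohom2_refl preim_simps(4) by metis
    then show "id \<in> N" using X.id_F Y.B_empty unfolding N_def by blast
    fix f assume "f \<in> N"
    then obtain E where f: "f \<in> X.F" "E \<in> B'" "X.cohom2 (X.parity f) (preim E)" by (auto simp: N_def)
    show "iv f \<in> N" using X.F_inv[OF f(1)] f(2) X.cohom2_trans[OF X.parity_iv[OF f(1)] f(3)] unfolding N_def by blast
    fix g assume "g \<in> N"
    then obtain E' where g: "g \<in> X.F" "E' \<in> B'" "X.cohom2 (X.parity g) (preim E')" by (auto simp: N_def)
    have "X.cohom2 (X.parity (f \<circ> g)) (preim (symdiff E E'))"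
      using X.cohom2_trans[OF X.parity_comp[OF f(1) g(1)] X.cohom2_symdiff[OF f(3) g(3)]] by (simp add: preim_simps)
    then show "f \<circ> g \<in> N" using X.F_comp[OF f(1) g(1)] Y.symdiff_B[OF f(2) g(2)] unfolding N_def by blast
  qed
  moreover have "lift ` Y.F \<subseteq> N"
  proof
    fix g assume "g \<in> lift ` Y.F"
    then obtain f where f: "f \<in> Y.F" "g = lift f" by auto
    then show "g \<in> N" using lift_F[OF f(1)] parity_lift[OF f(1)] Y.parity_B[OF f(1)] X.cohom2_refl unfolding N_def f(2) by auto
  qed
  moreover have "N \<noteq> lift ` Y.F"
  proof -
    obtain f where f: "f \<in> X.D" "f \<notin> lift ` Y.F" using D_not_lifted by blast
    then have "f \<in> X.Ker" using X.D_Ker by blast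
    then have "f \<in> X.F" "X.cohom2 (X.parity f) (preim {})" using X.cohom2_empty by (auto simp: X.Ker_def preim_simps)
    then have "f \<in> N" using Y.B_empty unfolding N_def by blast
    then show ?thesis using f by blast
  qed
  moreover have "N \<subseteq> X.F" by (auto simp: N_def)
  ultimately have "N = X.F" using m unfolding X.maximal_in_def by blast
  moreover obtain h where h: "h \<in> X.F" "X.cohom2 (X.parity h) C" using X.realize_class[OF C] by blast
  ultimately obtain E where "E \<in> B'" "X.cohom2 (X.parity h) (preim E)" by (auto simp: N_def)
  then show ?thesis using X.cohom2_trans[OF X.cohom2_sym[OF h(2)]] by blast
qed

end

section \<open>Cantor systems and their full groups\<close>

definition clopens :: "'a topology \<Rightarrow> 'a set set" where
  "clopens X = {C. openin X C \<and> closedin X C}"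

definition act :: "'a topology \<Rightarrow> ('a \<Rightarrow> 'a) \<Rightarrow> int \<Rightarrow> 'a \<Rightarrow> 'a" where
  "act X \<phi> n x = (if x \<in> topspace X then iter X \<phi> n x else x)"

lemma act_laws:
  assumes h: "homeomorphic_map X X \<phi>"
  shows "act X \<phi> 0 x = x" "x \<in> topspace X \<Longrightarrow> act X \<phi> n x \<in> topspace X"
    "act X \<phi> m (act X \<phi> n x) = act X \<phi> (m + n) x"
    "homeomorphic_map X X (act X \<phi> n)" "x \<in> topspace X \<Longrightarrow> act X \<phi> 1 x = \<phi> x"
proof -
  define S where "S = topspace X"
  define \<eta> where "\<eta> = inv_into S \<phi>"
  have bij: "bij_betw \<phi> S S"
    using homeomorphic_imp_injective_map[OF h] homeomorphic_imp_surjective_map[OF h] by (simp add: S_def bij_betw_def)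
  have in1: "\<phi> x \<in> S" "\<eta> x \<in> S" "\<phi> (\<eta> x) = x" "\<eta> (\<phi> x) = x" if "x \<in> S" for x
    using bij_betwE[OF bij] bij_betwE[OF bij_betw_inv_into[OF bij]] bij_betw_inv_into_right[OF bij that]
      bij_betw_inv_into_left[OF bij that] that unfolding \<eta>_def by blast+
  have pow: "(\<phi> ^^ k) x \<in> S" "(\<eta> ^^ k) x \<in> S" if "x \<in> S" for x k
    using that in1 by (induction k) auto
  have it: "iter X \<phi> n x = (if n \<ge> 0 then (\<phi> ^^ nat n) x else (\<eta> ^^ nat (- n)) x)" for n x
    by (simp add: iter_def \<eta>_def S_def)
  have itS: "iter X \<phi> n x \<in> S" if "x \<in> S" for n x using pow[OF that] by (simp add: it)
  then show "x \<in> topspace X \<Longrightarrow> act X \<phi> n x \<in> topspace X" for n x by (simp add: act_def S_def)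
  show "act X \<phi> 0 x = x" by (simp add: act_def it)
  show "x \<in> topspace X \<Longrightarrow> act X \<phi> 1 x = \<phi> x" by (simp add: act_def it)
  have suc: "iter X \<phi> (n + 1) x = \<phi> (iter X \<phi> n x)" if x: "x \<in> S" for n x
  proof (cases "n \<ge> 0")
    case True
    then have "nat (n + 1) = Suc (nat n)" by simp
    then show ?thesis using True by (simp add: it)
  next
    case False
    then have "nat (- n) = Suc (nat (- (n + 1)))" by simp
    then show ?thesis using False in1(3)[OF pow(2)[OF x]] by (auto simp: it)
  qed
  have pre: "iter X \<phi> (n - 1) x = \<eta> (iter X \<phi> n x)" if x: "x \<in> S" for n x
    using suc[OF x, of "n - 1"] in1(4)[OF itS[OF x, of "n - 1"]] by simp
  have add: "iter X \<phi> m (iter X \<phi> n x) = iter X \<phi> (m + n) x" if x: "x \<in> S" for m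
  proof (induction m rule: int_induct[of _ 0])
    case base show ?case by (simp add: it)
  next
    case (step1 i)
    then show ?case using suc[OF itS[OF x], of i] suc[OF x, of "i + n"] by (simp add: algebra_simps)
  next
    case (step2 i)
    then show ?case using pre[OF itS[OF x], of i] pre[OF x, of "i + n"] by (simp add: algebra_simps)
  qed
  show "act X \<phi> m (act X \<phi> n x) = act X \<phi> (m + n) x"
    using add itS by (simp add: act_def S_def)
  have hm: "homeomorphic_maps X X \<phi> \<eta>"
  proof -
    obtain g where g: "homeomorphic_maps X X \<phi> g" using h by (auto simp: homeomorphic_map_maps)
    have "g x = \<eta> x" if x: "x \<in> S" for x
    proof -
      have "g (\<phi> (\<eta> x)) = \<eta> x" using g in1(2)[OF x] by (simp add: homeomorphic_maps_def S_def)
      then show ?thesis using in1(3)[OF x] by simp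
    qed
    then show ?thesis using g homeomorphic_maps_eq[of X X \<phi> g \<phi> \<eta>] by (simp add: S_def)
  qed
  have hpow: "homeomorphic_map X X (f ^^ k)" if f: "homeomorphic_map X X f" for f k
  proof (induction k)
    case 0 then show ?case using homeomorphic_map_id by (simp add: id_def[symmetric])
  next
    case (Suc k) show ?case unfolding funpow.simps by (rule homeomorphic_map_compose[OF Suc f])
  qed
  have hc: "homeomorphic_map X X \<eta>" using hm homeomorphic_maps_sym homeomorphic_map_maps by blast
  have "homeomorphic_map X X (iter X \<phi> n)" for n
    using hpow[OF h, of "nat n"] hpow[OF hc, of "nat (- n)"] by (simp add: iter_def \<eta>_def S_def)
  then show "homeomorphic_map X X (act X \<phi> n)"
    by (rule homeomorphic_map_eq) (simp add: act_def)
qed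

lemma homeomorphic_image_clopen:
  assumes "homeomorphic_map X Y f" "C \<in> clopens X" shows "f ` C \<in> clopens Y"
  using assms homeomorphic_map_openness_eq homeomorphic_map_closedness_eq unfolding clopens_def by blast

section \<open>Topology of Cantor sets\<close>

abbreviation cantor_space :: "(nat \<Rightarrow> bool) topology" where
  "cantor_space \<equiv> product_topology (\<lambda>_ :: nat. discrete_topology (UNIV :: bool set)) UNIV"

text \<open>A basic open set restricts only finitely many coordinates; flipping one of the others at
  a time gives infinitely many points.\<close>

lemma cantor_space_open_infinite:
  assumes "openin cantor_space U" "z \<in> U" shows "infinite U"
proof -
  obtain W where W: "finite {i\<in>UNIV. W i \<noteq> topspace (discrete_topology (UNIV :: bool set))}" "z \<in> Pi\<^sub>E UNIV W" "Pi\<^sub>E UNIV W \<subseteq> U"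
    using assms unfolding openin_product_topology_alt by blast
  define J where "J = {i. W i = UNIV}"
  have "infinite J"
  proof
    assume "finite J"
    moreover have "- J = {i\<in>UNIV. W i \<noteq> topspace (discrete_topology (UNIV :: bool set))}" by (auto simp: J_def)
    ultimately have "finite (UNIV :: nat set)" using W(1) by (metis Compl_partition finite_UnI)
    then show False by simp
  qed
  moreover have "(\<lambda>i. z(i := \<not> z i)) ` J \<subseteq> U" using W(2,3) by (auto simp: J_def PiE_def Pi_def)
  moreover have "inj_on (\<lambda>i. z(i := \<not> z i)) J" by (rule inj_onI) (metis fun_upd_apply)
  ultimately show ?thesis using finite_imageD finite_subset by blast
qed

lemma cantor_set_props:
  assumes "cantor_set X"
  shows "compact_space X" "Hausdorff_space X" "countable (clopens X)"
    "x \<in> topspace X \<Longrightarrow> y \<in> topspace X \<Longrightarrow> x \<noteq> y \<Longrightarrow> \<exists>C\<in>clopens X. x \<in> C \<and> y \<notin> C"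
    "openin X U \<Longrightarrow> finite U \<Longrightarrow> U = {}"
proof -
  obtain h where h: "homeomorphic_map X cantor_space h"
    using assms unfolding cantor_set_def homeomorphic_space by blast
  note hs = assms[unfolded cantor_set_def]
  have cs: "compact_space cantor_space" "Hausdorff_space cantor_space"
    by (simp_all add: compact_space_product_topology compact_space_discrete_topology Hausdorff_space_product_topology)
  show comp: "compact_space X" using homeomorphic_compact_space[OF hs] cs by blast
  show "Hausdorff_space X" using homeomorphic_Hausdorff_space[OF hs] cs by blast
  have ch: "continuous_map X cantor_space h" using h homeomorphic_imp_continuous_map by blast
  have inj: "inj_on h (topspace X)" using h homeomorphic_imp_injective_map by blast
  have coord: "{x\<in>topspace X. h x i = b} \<in> clopens X" for i b
  proof -
    have "continuous_map X (discrete_topology UNIV) (\<lambda>x. h x i)"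
      using ch by (auto simp: continuous_map_componentwise_UNIV)
    then have "openin X {x\<in>topspace X. h x i \<in> {b}}" "closedin X {x\<in>topspace X. h x i \<in> {b}}"
      using openin_continuous_map_preimage[of X "discrete_topology UNIV" _ "{b}"]
        closedin_continuous_map_preimage[of X "discrete_topology UNIV" _ "{b}"] by auto
    then show ?thesis by (simp add: clopens_def)
  qed
  show "\<exists>C\<in>clopens X. x \<in> C \<and> y \<notin> C" if xy: "x \<in> topspace X" "y \<in> topspace X" "x \<noteq> y" for x y
  proof -
    have "h x \<noteq> h y" using inj xy by (auto dest: inj_onD)
    then have "\<exists>i. h x i \<noteq> h y i" unfolding fun_eq_iff by (rule contrapos_np) blast
    then obtain i where "h x i \<noteq> h y i" ..
    then show ?thesis using xy by (intro bexI[OF _ coord[of i "h x i"]]) auto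
  qed
  show "U = {}" if U: "openin X U" "finite U" for U
  proof (rule ccontr)
    assume "U \<noteq> {}"
    then obtain x where x: "x \<in> U" by auto
    have "openin cantor_space (h ` U)" using U h homeomorphic_map_openness_eq by blast
    then have "infinite (h ` U)" using x cantor_space_open_infinite by blast
    then show False using U by blast
  qed
  show "countable (clopens X)"
  proof -
    define cyl where "cyl = (\<lambda>F. {x\<in>topspace X. \<forall>(i,b)\<in>F. h x i = b}) ` {F :: (nat \<times> bool) set. finite F}"
    have "countable cyl" unfolding cyl_def by (intro countable_image countable_Collect_finite)
    have cylo: "openin X E" if E: "E \<in> cyl" for E
    proof -
      obtain F :: "(nat \<times> bool) set" where F: "finite F" "E = {x\<in>topspace X. \<forall>(i,b)\<in>F. h x i = b}" using E by (auto simp: cyl_def)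
      have "openin X {x\<in>topspace X. \<forall>(i,b)\<in>F. h x i = b}" using F(1)
      proof (induction rule: finite_induct)
        case (insert p F)
        have "{x\<in>topspace X. \<forall>(i,b)\<in>insert p F. h x i = b} =
          {x\<in>topspace X. h x (fst p) = snd p} \<inter> {x\<in>topspace X. \<forall>(i,b)\<in>F. h x i = b}" by auto
        then show ?case using insert coord[of "fst p" "snd p"] by (simp add: clopens_def openin_Int)
      qed simp
      then show ?thesis using F by simp
    qed
    have cylbase: "\<exists>E\<in>cyl. x \<in> E \<and> E \<subseteq> C" if C: "openin X C" "x \<in> C" for C x
    proof -
      have xS: "x \<in> topspace X" using C openin_subset by blast
      have "openin cantor_space (h ` C)" using C h homeomorphic_map_openness_eq by blast
      then obtain W where W: "finite {i\<in>UNIV. W i \<noteq> topspace (discrete_topology (UNIV :: bool set))}" "h x \<in> Pi\<^sub>E UNIV W" "Pi\<^sub>E UNIV W \<subseteq> h ` C"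
        using C(2) unfolding openin_product_topology_alt by blast
      define F where "F = (\<lambda>i. (i, h x i)) ` {i. W i \<noteq> UNIV}"
      have "finite F" unfolding F_def using W(1) by simp
      then have "{x\<in>topspace X. \<forall>(i,b)\<in>F. h x i = b} \<in> cyl" by (auto simp: cyl_def)
      moreover have "x \<in> {x\<in>topspace X. \<forall>(i,b)\<in>F. h x i = b}" using xS by (auto simp: F_def)
      moreover have "{x\<in>topspace X. \<forall>(i,b)\<in>F. h x i = b} \<subseteq> C"
      proof
        fix z assume z: "z \<in> {x\<in>topspace X. \<forall>(i,b)\<in>F. h x i = b}"
        have "h z i \<in> W i" for i
          using z W(2) by (cases "W i = UNIV") (auto simp: F_def PiE_def Pi_def)
        then have "h z \<in> h ` C" using W(3) by (auto simp: PiE_def Pi_def)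
        then show "z \<in> C" using z inj C openin_subset by (auto dest: inj_onD)
      qed
      ultimately show ?thesis by meson
    qed
    \<comment> \<open>A clopen set is compact, hence a finite union of cylinders, and there are only
      countably many cylinders.\<close>
    have "clopens X \<subseteq> (\<Union>) ` {V. V \<subseteq> cyl \<and> finite V}"
    proof
      fix C assume C: "C \<in> clopens X"
      have "compactin X C" using comp C closedin_compact_space by (auto simp: clopens_def)
      moreover have "\<forall>E\<in>{E\<in>cyl. E \<subseteq> C}. openin X E" using cylo by auto
      moreover have "C \<subseteq> \<Union>{E\<in>cyl. E \<subseteq> C}" using cylbase[of C] C by (fastforce simp: clopens_def)
      ultimately obtain V where V: "finite V" "V \<subseteq> {E\<in>cyl. E \<subseteq> C}" "C \<subseteq> \<Union>V" unfolding compactin_def by meson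
      then have "C = \<Union>V" by blast
      then show "C \<in> (\<Union>) ` {V. V \<subseteq> cyl \<and> finite V}" using V by blast
    qed
    moreover have "countable {V. V \<subseteq> cyl \<and> finite V}"
      using countable_Collect_finite_subset[OF \<open>countable cyl\<close>] by (simp add: conj_commute)
    ultimately show ?thesis by (meson countable_image countable_subset)
  qed
qed

lemma cantor_clopen_system:
  assumes c: "cantor_set X" and m: "minimal_action X \<phi>"
  shows "clopen_system (topspace X) (act X \<phi>) (clopens X)"
proof -
  note p = cantor_set_props[OF c]
  have h: "homeomorphic_map X X \<phi>" using m by (simp add: minimal_action_def)
  note a = act_laws[OF h]
  have min: "\<exists>n. act X \<phi> n x \<in> C" if C: "C \<in> clopens X" "C \<noteq> {}" and x: "x \<in> topspace X" for C x
  proof -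
    have dense: "X closure_of (range (\<lambda>n. iter X \<phi> n x)) = topspace X" using m x by (simp add: minimal_action_def)
    obtain z where z: "z \<in> C" using C by auto
    have oC: "openin X C" using C by (simp add: clopens_def)
    then have "z \<in> X closure_of (range (\<lambda>n. iter X \<phi> n x))" using z dense openin_subset by blast
    then obtain y where "y \<in> range (\<lambda>n. iter X \<phi> n x)" "y \<in> C" using z oC unfolding in_closure_of by blast
    then show ?thesis using x by (auto simp: act_def)
  qed
  show ?thesis
  proof
    fix C assume C: "C \<in> clopens X"
    show "C \<subseteq> topspace X" using C openin_subset by (auto simp: clopens_def)
    show "act X \<phi> n ` C \<in> clopens X" for n using homeomorphic_image_clopen[OF a(4) C] .
    show "finite C \<Longrightarrow> C = {}" using p(5) C by (auto simp: clopens_def)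
    show "C \<noteq> {} \<Longrightarrow> x \<in> topspace X \<Longrightarrow> \<exists>n. act X \<phi> n x \<in> C" for x using min[OF C] .
    fix D assume D: "D \<in> clopens X"
    show "C \<inter> D \<in> clopens X" "C - D \<in> clopens X" using C D by (auto simp: clopens_def)
  next
    show "topspace X \<in> clopens X" by (auto simp: clopens_def)
    show "act X \<phi> m (act X \<phi> n x) = act X \<phi> (m + n) x" for m n x by (rule a(3))
    show "act X \<phi> 0 x = x" for x by (rule a(1))
    show "x \<in> topspace X \<Longrightarrow> act X \<phi> n x \<in> topspace X" for x n by (rule a(2))
    show "x \<notin> topspace X \<Longrightarrow> act X \<phi> n x = x" for x n by (simp add: act_def)
    show "x \<in> topspace X \<Longrightarrow> y \<in> topspace X \<Longrightarrow> x \<noteq> y \<Longrightarrow> \<exists>C\<in>clopens X. x \<in> C \<and> y \<notin> C" for x y by (rule p(4))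
  next
    fix U assume U: "U \<subseteq> clopens X" "topspace X \<subseteq> \<Union>U"
    then have "\<forall>E\<in>U. openin X E" by (auto simp: clopens_def)
    moreover have "\<Union>U = topspace X" using U openin_subset by (force simp: clopens_def)
    ultimately obtain V where "finite V" "V \<subseteq> U" "topspace X \<subseteq> \<Union>V"
      using p(1) unfolding compact_space_def compactin_def by (metis U(2))
    then show "\<exists>V\<subseteq>U. finite V \<and> topspace X \<subseteq> \<Union>V" by blast
  next
    \<comment> \<open>A nonzero period would make the orbit finite, hence closed. Being dense it
      would be the whole space, which has no finite nonempty open subset.\<close>
    fix x n assume x: "x \<in> topspace X" and e: "act X \<phi> n x = x"
    show "n = 0"
    proof (rule ccontr)
      assume n: "n \<noteq> 0"
      have nat: "act X \<phi> (int k * n) x = x" for k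
      proof (induction k)
        case 0 then show ?case by (simp add: a(1))
      next
        case (Suc k)
        then show ?case using a(3)[of n "int k * n" x] e by (simp add: algebra_simps)
      qed
      have mult: "act X \<phi> (k * n) x = x" for k
      proof (cases "k \<ge> 0")
        case True then show ?thesis using nat[of "nat k"] by simp
      next
        case False
        then have "act X \<phi> (- k * n) x = x" using nat[of "nat (- k)"] by simp
        then have "act X \<phi> (k * n) x = act X \<phi> (k * n) (act X \<phi> (- k * n) x)" by simp
        then show ?thesis using a(1) by (simp add: a(3))
      qed
      define O' where "O' = (\<lambda>k. act X \<phi> k x) ` {0..<\<bar>n\<bar>}"
      have orb: "act X \<phi> k x \<in> O'" for k
      proof -
        have "k = k mod \<bar>n\<bar> + k div \<bar>n\<bar> * \<bar>n\<bar>" by simp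
        also have "k div \<bar>n\<bar> * \<bar>n\<bar> = (k div \<bar>n\<bar> * sgn n) * n" by (simp only: abs_sgn ac_simps)
        finally have "k = k mod \<bar>n\<bar> + (k div \<bar>n\<bar> * sgn n) * n" .
        then have "act X \<phi> k x = act X \<phi> (k mod \<bar>n\<bar>) (act X \<phi> ((k div \<bar>n\<bar> * sgn n) * n) x)" by (metis a(3))
        then have "act X \<phi> k x = act X \<phi> (k mod \<bar>n\<bar>) x" using mult by simp
        moreover have "k mod \<bar>n\<bar> \<in> {0..<\<bar>n\<bar>}" using n by simp
        ultimately show ?thesis unfolding O'_def by blast
      qed
      have fin: "finite O'" by (simp add: O'_def)
      have OS: "O' \<subseteq> topspace X" using x a(2) by (auto simp: O'_def)
      have "closedin X O'" using t1_space_closedin_finite Hausdorff_imp_t1_space[OF p(2)] fin OS by blast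
      then have "X closure_of (range (\<lambda>n. iter X \<phi> n x)) \<subseteq> O'"
        by (intro closure_of_minimal) (use orb x in \<open>auto simp: act_def\<close>)
      then have "O' = topspace X" using m x OS by (auto simp: minimal_action_def)
      then have "topspace X = {}" using p(5)[of "topspace X"] fin by simp
      then show False using x by simp
    qed
  qed
qed

lemma clopen_base:
  assumes "compact_space X" and sep: "\<And>x y. x \<in> topspace X \<Longrightarrow> y \<in> topspace X \<Longrightarrow> x \<noteq> y \<Longrightarrow> \<exists>C\<in>clopens X. x \<in> C \<and> y \<notin> C"
    and V: "openin X V" "x \<in> V"
  shows "\<exists>C\<in>clopens X. x \<in> C \<and> C \<subseteq> V"
proof -
  have xS: "x \<in> topspace X" using V openin_subset by blast
  define U where "U = {C\<in>clopens X. x \<notin> C}"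
  have "compactin X (topspace X - V)" using assms(1) V closedin_compact_space by blast
  moreover have "\<forall>C\<in>U. openin X C" by (auto simp: U_def clopens_def)
  moreover have "topspace X - V \<subseteq> \<Union>U" using sep xS V(2) unfolding U_def by blast
  ultimately obtain W where W: "finite W" "W \<subseteq> U" "topspace X - V \<subseteq> \<Union>W" unfolding compactin_def by meson
  have "\<Union>W \<in> clopens X" using W(1,2) by (auto simp: clopens_def U_def intro!: closedin_Union)
  then have "topspace X - \<Union>W \<in> clopens X" by (auto simp: clopens_def)
  moreover have "x \<in> topspace X - \<Union>W" using xS W(2) by (auto simp: U_def)
  moreover have "topspace X - \<Union>W \<subseteq> V" using W(3) by auto
  ultimately show ?thesis by blast
qed

section \<open>Full bisections as graphs of full group elements\<close>

locale cantor_system =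
  fixes X :: "'a topology" and \<phi> :: "'a \<Rightarrow> 'a"
  assumes cantor: "cantor_set X" and minimal_act: "minimal_action X \<phi>"

sublocale cantor_system \<subseteq> clopen_system "topspace X" "act X \<phi>" "clopens X"
  by (rule cantor_clopen_system[OF cantor minimal_act])

context cantor_system begin

abbreviation GX :: "('a \<times> int) groupoid" where "GX \<equiv> transformation_groupoid X \<phi>"
abbreviation SX :: "'a set" where "SX \<equiv> topspace X"
abbreviation TX :: "int \<Rightarrow> 'a \<Rightarrow> 'a" where "TX \<equiv> act X \<phi>"

lemma gtop_GX: "gtop GX = prod_topology X (discrete_topology UNIV)"
  by (simp add: transformation_groupoid_def)

lemma arr_GX: "arr GX = SX \<times> UNIV"
  by (simp add: arr_def gtop_GX)

lemma units_GX: "units GX = SX \<times> {0}"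
  by (rule units_transformation_groupoid)

lemma rng_GX: "rng GX (x, n) = (x, 0)"
  by (rule rng_transformation_groupoid)

lemma src_GX: "x \<in> SX \<Longrightarrow> src GX (x, n) = (TX (- n) x, 0)"
  by (simp add: src_transformation_groupoid act_def)

lemma base: "openin X V \<Longrightarrow> x \<in> V \<Longrightarrow> \<exists>C\<in>clopens X. x \<in> C \<and> C \<subseteq> V"
  using clopen_base cantor_set_props(1,4)[OF cantor] by metis

lemma open_near: "C \<in> clopens X \<Longrightarrow> openin X C" by (simp add: clopens_def)

lemma cont_F: assumes f: "f \<in> F" shows "continuous_map X X f"
  unfolding continuous_map_def
proof (intro conjI allI impI)
  show "f \<in> SX \<rightarrow> SX" using F_S[OF f] by auto
  fix U assume U: "openin X U"
  show "openin X {x \<in> SX. f x \<in> U}"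
  proof (subst openin_subopen, intro ballI)
    fix x assume x: "x \<in> {x \<in> SX. f x \<in> U}"
    then obtain C where C: "C \<in> clopens X" "f x \<in> C" "C \<subseteq> U" using base[OF U, of "f x"] by auto
    have "iv f ` C \<in> clopens X" by (rule F_image_B[OF F_inv[OF f] C(1)])
    moreover have "x \<in> iv f ` C" using C(2) iv_simps(2)[OF F_bij[OF f], of x] by (metis imageI)
    moreover have "iv f ` C \<subseteq> {x \<in> SX. f x \<in> U}"
      using C B_sub[OF C(1)] iv_simps(1)[OF F_bij[OF f]] F_S[OF F_inv[OF f]] by auto
    ultimately show "\<exists>V. openin X V \<and> x \<in> V \<and> V \<subseteq> {x \<in> SX. f x \<in> U}" using open_near by blast
  qed
qed

lemma lconst_continuous: assumes "lconst u" shows "continuous_map X (discrete_topology UNIV) u"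
  unfolding continuous_map_def
proof (intro conjI allI impI)
  fix U
  have "{x\<in>SX. u x \<in> U} \<in> clopens X" by (rule lconst_Collect[OF lconst_comp1[OF assms]])
  then show "openin X {x\<in>SX. u x \<in> U}" by (rule open_near)
qed simp

lemma continuous_lconst: assumes "continuous_map X (discrete_topology UNIV) u" shows "lconst u"
  unfolding lconst_def
proof
  fix x assume x: "x \<in> SX"
  have "openin X {z\<in>SX. u z \<in> {u x}}"
    using openin_continuous_map_preimage[OF assms, of "{u x}"] by simp
  moreover have "closedin X {z\<in>SX. u z \<in> {u x}}"
    using closedin_continuous_map_preimage[OF assms, of "{u x}"] by simp
  ultimately have "{z\<in>SX. u z \<in> {u x}} \<in> clopens X" by (simp add: clopens_def)
  then have "near x (\<lambda>C. C \<subseteq> {z\<in>SX. u z \<in> {u x}})" using x by (intro near_subset) auto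
  then show "near x (\<lambda>C. \<forall>z\<in>C. u z = u x)" by (rule near_mono) auto
qed

text \<open>The arrow \<open>(f x, disp f x)\<close> has source \<open>x\<close> and range
  \<open>f x\<close>, so this is the bisection whose homeomorphism is \<open>f\<close>.\<close>

definition graph :: "('a \<Rightarrow> 'a) \<Rightarrow> ('a \<times> int) set" where
  "graph f = (\<lambda>x. (f x, disp f x)) ` SX"

text \<open>The units of the transformation groupoid are the pairs \<open>(x, 0)\<close>.\<close>

definition unit_map :: "('a \<Rightarrow> 'a) \<Rightarrow> 'a \<times> int \<Rightarrow> 'a \<times> int" where
  "unit_map f = (\<lambda>u\<in>SX \<times> {0}. (f (fst u), 0))"

lemma src_graph: assumes "f \<in> F" "x \<in> SX" shows "src GX (f x, disp f x) = (x, 0)"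
proof -
  have "TX (- disp f x) (f x) = x" using F_disp[OF assms] by (metis T_add T_0 add.left_inverse)
  then show ?thesis using src_GX[OF F_S[OF assms]] by simp
qed

lemma graph_full: assumes f: "f \<in> F" shows "full_bisection GX (graph f)" "theta GX (graph f) = unit_map f"
proof -
  have S: "f ` SX = SX"
  proof
    show "SX \<subseteq> f ` SX"
    proof
      fix y assume "y \<in> SX"
      then have "iv f y \<in> SX" "f (iv f y) = y" using F_S[OF F_inv[OF f]] iv_simps(1)[OF F_bij[OF f]] by auto
      then show "y \<in> f ` SX" by (metis imageI)
    qed
  qed (use F_S[OF f] in auto)
  have inj: "f x = f y \<longleftrightarrow> x = y" for x y using F_bij[OF f] by (simp add: bij_def inj_eq)
  have injs: "inj_on (src GX) (graph f)"
    unfolding graph_def by (rule inj_onI) (auto simp: src_graph[OF f])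
  show "full_bisection GX (graph f)"
    unfolding full_bisection_def
  proof (intro conjI)
    have "continuous_map X (gtop GX) (\<lambda>x. (f x, disp f x))"
      unfolding gtop_GX by (simp add: continuous_map_pairwise o_def cont_F[OF f] lconst_continuous[OF lconst_disp[OF f]])
    moreover have "compactin X SX" using cantor_set_props(1)[OF cantor] by (simp add: compact_space_def)
    ultimately show "compactin (gtop GX) (graph f)" unfolding graph_def by (intro image_compactin)
    show "openin (gtop GX) (graph f)"
      unfolding gtop_GX openin_prod_topology_alt
    proof (intro allI impI)
      fix y n assume "(y, n) \<in> graph f"
      then obtain x where x: "x \<in> SX" "y = f x" "n = disp f x" by (auto simp: graph_def)
      obtain C where C: "C \<in> clopens X" "x \<in> C" "\<forall>z\<in>C. disp f z = disp f x" using near_ex[OF F_near_disp[OF f x(1)]] by blast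
      have "openin X (f ` C)" by (rule open_near[OF F_image_B[OF f C(1)]])
      moreover have "y \<in> f ` C" unfolding x(2) using C(2) by (rule imageI)
      moreover have "f ` C \<times> {n} \<subseteq> graph f"
      proof -
        have "(f z, n) \<in> graph f" if z: "z \<in> C" for z
        proof -
          have "n = disp f z" using C(3) z x(3) by simp
          then show ?thesis unfolding graph_def using B_sub[OF C(1)] z by blast
        qed
        then show ?thesis by auto
      qed
      ultimately show "\<exists>U V. openin X U \<and> openin (discrete_topology UNIV) V \<and> y \<in> U \<and> n \<in> V \<and> U \<times> V \<subseteq> graph f"
        by (intro exI[of _ "f ` C"] exI[of _ "{n}"]) simp
    qed
    show "inj_on (rng GX) (graph f)"
      unfolding graph_def by (rule inj_onI) (auto simp: rng_GX inj)
    show "rng GX ` graph f = units GX"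
      using S unfolding graph_def units_GX by (auto simp: image_image rng_GX)
    show "src GX ` graph f = units GX"
      unfolding graph_def units_GX image_image using src_graph[OF f] by force
  qed (rule injs)
  show "theta GX (graph f) = unit_map f"
  proof
    fix u show "theta GX (graph f) u = unit_map f u"
    proof (cases "u \<in> SX \<times> {0}")
      case True
      then obtain x where x: "x \<in> SX" "u = (x, 0)" by auto
      have "inv_into (graph f) (src GX) u = (f x, disp f x)"
        using inv_into_f_f[OF injs, of "(f x, disp f x)"] src_graph[OF f x(1)] x by (simp add: graph_def)
      then show ?thesis using x by (simp add: theta_def unit_map_def units_GX rng_GX)
    next
      case False
      then show ?thesis unfolding theta_def unit_map_def units_GX by (simp only: restrict_def if_False)
    qed
  qed
qed

text \<open>A full bisection contains exactly one arrow with source \<open>(x, 0)\<close>; its two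
  components are \<open>f x\<close> and the displacement. Openness of the bisection makes the
  integer component locally constant.\<close>

lemma full_graph: assumes U: "full_bisection GX U" shows "\<exists>f\<in>F. U = graph f"
proof -
  have injr: "inj_on (rng GX) U" and injs: "inj_on (src GX) U" and rU: "rng GX ` U = SX \<times> {0}"
    and sU: "src GX ` U = SX \<times> {0}" and oU: "openin (prod_topology X (discrete_topology UNIV)) U"
    using U by (auto simp: full_bisection_def units_GX gtop_GX)
  have US: "U \<subseteq> SX \<times> UNIV" using openin_subset[OF oU] by simp
  define u where "u x = inv_into U (src GX) (x, 0)" for x
  have u: "u x \<in> U" "src GX (u x) = (x, 0)" if "x \<in> SX" for x
    unfolding u_def using that sU by (auto intro!: inv_into_into f_inv_into_f)
  have uu: "u x = g" if "g \<in> U" "src GX g = (x, 0)" for g x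
    unfolding u_def using inv_into_f_f[OF injs that(1)] that(2) by simp
  define f where "f x = (if x \<in> SX then fst (u x) else x)" for x
  define n where "n x = snd (u x)" for x
  have un: "u x = (f x, n x)" if "x \<in> SX" for x using that by (simp add: f_def n_def)
  have fS: "f x \<in> SX" if "x \<in> SX" for x using u(1)[OF that] un[OF that] US by auto
  have fT: "TX (- n x) (f x) = x" "f x = TX (n x) x" if "x \<in> SX" for x
  proof -
    show 1: "TX (- n x) (f x) = x" using u(2)[OF that] un[OF that] src_GX[OF fS[OF that], of "n x"] by simp
    show "f x = TX (n x) x" by (subst 1[symmetric]) (simp add: T_add T_0)
  qed
  have disp: "disp f x = n x" if "x \<in> SX" for x using fT(2) disp_eqI that by metis
  have inj: "inj f"
  proof
    fix x y assume e: "f x = f y"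
    show "x = y"
    proof (cases "x \<in> SX")
      case True
      then have y: "y \<in> SX" using e fS by (metis f_def)
      have "rng GX (u x) = rng GX (u y)" using un[OF True] un[OF y] e by (simp add: rng_GX)
      then have "u x = u y" using injr u(1)[OF True] u(1)[OF y] by (auto dest: inj_onD)
      then show ?thesis using u(2)[OF True] u(2)[OF y] by (metis prod.inject)
    next
      case False
      then show ?thesis using e fS by (metis f_def)
    qed
  qed
  have surj: "surj f"
    unfolding surj_def
  proof
    fix y show "\<exists>x. y = f x"
    proof (cases "y \<in> SX")
      case True
      then have "(y, 0) \<in> rng GX ` U" using rU by simp
      then obtain w m where g: "(w, m) \<in> U" "w = y" by (auto simp: rng_GX)
      have "src GX (y, m) \<in> SX \<times> {0}" using g sU by blast
      then obtain x where x: "x \<in> SX" "src GX (y, m) = (x, 0)" by auto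
      then have "u x = (y, m)" using uu g by simp
      then show ?thesis using un[OF x(1)] by auto
    qed (auto simp: f_def)
  qed
  have "\<exists>k. near x (\<lambda>C. \<forall>z\<in>C. f z = TX k z)" if x: "x \<in> SX" for x
  proof -
    have "(f x, n x) \<in> U" using u(1)[OF x] un[OF x] by simp
    then obtain V W where V: "openin X V" "f x \<in> V" "n x \<in> W" "V \<times> W \<subseteq> U"
      using oU unfolding openin_prod_topology_alt by blast
    obtain C where C: "C \<in> clopens X" "f x \<in> C" "C \<subseteq> V" using base[OF V(1,2)] by auto
    have "near x (\<lambda>E. TX (n x) ` E \<subseteq> C)" using C fT(2)[OF x] by (intro near_T near_subset) auto
    then have "near x (\<lambda>E. \<forall>z\<in>E. f z = TX (n x) z)"
    proof (rule near_mono, intro ballI)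
      fix E z assume E: "E \<in> clopens X" "TX (n x) ` E \<subseteq> C" "z \<in> E"
      have zS: "z \<in> SX" using B_sub[OF E(1)] E(3) by auto
      have "(TX (n x) z, n x) \<in> U" using E(2,3) C(3) V(3,4) by blast
      moreover have "src GX (TX (n x) z, n x) = (z, 0)" using src_GX[OF T_S[OF zS]] by (simp add: T_add T_0)
      ultimately have "u z = (TX (n x) z, n x)" by (rule uu)
      then show "f z = TX (n x) z" using un[OF zS] by simp
    qed
    then show ?thesis by blast
  qed
  then have fF: "f \<in> F" unfolding F_def using inj surj by (auto simp: bij_def f_def)
  have "U = graph f"
  proof
    show "graph f \<subseteq> U" using u(1) un disp by (auto simp: graph_def)
    show "U \<subseteq> graph f"
    proof
      fix g assume g: "g \<in> U"
      then have "src GX g \<in> SX \<times> {0}" using sU by blast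
      then obtain x where x: "x \<in> SX" "src GX g = (x, 0)" by auto
      then have "g = (f x, n x)" using uu[OF g x(2)] un[OF x(1)] by simp
      then show "g \<in> graph f" using x(1) disp[OF x(1)] by (auto simp: graph_def)
    qed
  qed
  then show ?thesis using fF by blast
qed

lemma unit_map_inj: assumes "f \<in> F" "g \<in> F" "unit_map f = unit_map g" shows "f = g"
proof
  fix x show "f x = g x"
  proof (cases "x \<in> SX")
    case True
    then show ?thesis using fun_cong[OF assms(3), of "(x, 0)"] by (simp add: unit_map_def)
  next
    case False
    then show ?thesis using F_out assms(1,2) by metis
  qed
qed

lemma full_group_carrier: "carrier (full_group GX) = unit_map ` F"
proof -
  have "{theta GX U | U. full_bisection GX U} = unit_map ` F"
  proof
    show "{theta GX U | U. full_bisection GX U} \<subseteq> unit_map ` F"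
    proof
      fix h assume "h \<in> {theta GX U | U. full_bisection GX U}"
      then obtain U where U: "h = theta GX U" "full_bisection GX U" by auto
      then obtain f where "f \<in> F" "U = graph f" using full_graph by blast
      then show "h \<in> unit_map ` F" using U(1) graph_full(2) by auto
    qed
    show "unit_map ` F \<subseteq> {theta GX U | U. full_bisection GX U}"
    proof
      fix h assume "h \<in> unit_map ` F"
      then obtain f where f: "f \<in> F" "h = unit_map f" by auto
      then show "h \<in> {theta GX U | U. full_bisection GX U}" using graph_full[OF f(1)] f(2) by force
    qed
  qed
  then show ?thesis by (simp add: full_group_def)
qed

text \<open>Evaluates the definite description in \<open>full_group_pull\<close>.\<close>

lemma theta_inverse: assumes f: "f \<in> F" shows "(THE V. full_bisection GX V \<and> theta GX V = unit_map f) = graph f"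
proof (rule the_equality)
  show "full_bisection GX (graph f) \<and> theta GX (graph f) = unit_map f" using graph_full[OF f] by simp
  fix V assume V: "full_bisection GX V \<and> theta GX V = unit_map f"
  then obtain g where g: "g \<in> F" "V = graph g" using full_graph by blast
  then show "V = graph f" using unit_map_inj[OF g(1) f] V graph_full(2)[OF g(1)] by simp
qed

section \<open>Transfer of subgroups and of maximality to the groupoid full groups\<close>

abbreviation BG :: "('a \<times> int \<Rightarrow> 'a \<times> int) monoid" where "BG \<equiv> BijGroup (SX \<times> {0})"

lemma full_group_eq: "full_group GX = BG\<lparr>carrier := unit_map ` F\<rparr>"
  using full_group_carrier by (simp add: full_group_def units_GX)

lemma unit_map_Bij: assumes f: "f \<in> F" shows "unit_map f \<in> carrier BG"
proof -
  have "bij_betw (unit_map f) (SX \<times> {0}) (SX \<times> {0})"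
  proof (rule bij_betwI[where g = "unit_map (iv f)"])
    show "unit_map f \<in> SX \<times> {0} \<rightarrow> SX \<times> {0}" "unit_map (iv f) \<in> SX \<times> {0} \<rightarrow> SX \<times> {0}"
      using F_S[OF f] F_S[OF F_inv[OF f]] by (auto simp: unit_map_def)
  qed (use F_S[OF f] F_S[OF F_inv[OF f]] iv_simps[OF F_bij[OF f]] in \<open>auto simp: unit_map_def\<close>)
  then show ?thesis by (simp add: BijGroup_def Bij_def) (simp add: unit_map_def)
qed

lemma unit_map_mult: assumes "f \<in> F" "g \<in> F" shows "unit_map f \<otimes>\<^bsub>BG\<^esub> unit_map g = unit_map (f \<circ> g)"
proof -
  have "unit_map f \<otimes>\<^bsub>BG\<^esub> unit_map g = compose (SX \<times> {0}) (unit_map f) (unit_map g)"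
    using unit_map_Bij assms by (simp add: BijGroup_def)
  also have "\<dots> = unit_map (f \<circ> g)"
    using F_S[OF assms(2)] by (auto simp: compose_def unit_map_def restrict_def fun_eq_iff)
  finally show ?thesis .
qed

lemma unit_map_one: "\<one>\<^bsub>BG\<^esub> = unit_map id"
  by (auto simp: BijGroup_def unit_map_def restrict_def fun_eq_iff)

lemma unit_map_inv: assumes "f \<in> F" shows "inv\<^bsub>BG\<^esub> unit_map f = unit_map (iv f)"
proof (rule group.inv_equality[OF group_BijGroup])
  show "unit_map (iv f) \<otimes>\<^bsub>BG\<^esub> unit_map f = \<one>\<^bsub>BG\<^esub>"
    unfolding unit_map_mult[OF F_inv[OF assms] assms] unit_map_one iv_simps(4)[OF F_bij[OF assms]] ..
qed (rule unit_map_Bij[OF assms] unit_map_Bij[OF F_inv[OF assms]])+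

lemma subgroup_unit_map: assumes K: "subgp K" shows "subgroup (unit_map ` K) BG"
proof
  note KF = subsetD[OF subD(1)[OF K]]
  show "unit_map ` K \<subseteq> carrier BG" using unit_map_Bij KF by blast
  show "\<one>\<^bsub>BG\<^esub> \<in> unit_map ` K" unfolding unit_map_one using subD(2)[OF K] by (rule imageI)
  fix x assume "x \<in> unit_map ` K"
  then obtain f where f: "f \<in> K" "x = unit_map f" by auto
  show "inv\<^bsub>BG\<^esub> x \<in> unit_map ` K" unfolding f(2) unit_map_inv[OF KF[OF f(1)]] using subD(4)[OF K f(1)] by (rule imageI)
  fix y assume "y \<in> unit_map ` K"
  then obtain g where g: "g \<in> K" "y = unit_map g" by auto
  show "x \<otimes>\<^bsub>BG\<^esub> y \<in> unit_map ` K"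
    unfolding f(2) g(2) unit_map_mult[OF KF[OF f(1)] KF[OF g(1)]] using subD(3)[OF K f(1) g(1)] by (rule imageI)
qed

lemma subgroup_unit_map_conv: assumes H: "subgroup H BG" "H \<subseteq> unit_map ` F" shows "\<exists>K. subgp K \<and> H = unit_map ` K"
proof -
  define K where "K = {f\<in>F. unit_map f \<in> H}"
  have "H = unit_map ` K" using H(2) by (auto simp: K_def)
  moreover have "subgp K" unfolding subgp_def
  proof (intro conjI ballI)
    show "K \<subseteq> F" by (auto simp: K_def)
    show "id \<in> K" using id_F subgroup.one_closed[OF H(1)] unfolding K_def unit_map_one by blast
    fix f assume "f \<in> K"
    then have f: "f \<in> F" "unit_map f \<in> H" by (auto simp: K_def)
    show "iv f \<in> K" using F_inv[OF f(1)] subgroup.m_inv_closed[OF H(1) f(2)] unfolding K_def unit_map_inv[OF f(1)] by blast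
    fix g assume "g \<in> K"
    then have g: "g \<in> F" "unit_map g \<in> H" by (auto simp: K_def)
    show "f \<circ> g \<in> K"
      using F_comp[OF f(1) g(1)] subgroup.m_closed[OF H(1) f(2) g(2)] unfolding K_def unit_map_mult[OF f(1) g(1)] by blast
  qed
  ultimately show ?thesis by blast
qed

lemma unit_map_image_subset: "K \<subseteq> F \<Longrightarrow> L \<subseteq> F \<Longrightarrow> unit_map ` K \<subseteq> unit_map ` L \<longleftrightarrow> K \<subseteq> L"
  using unit_map_inj by (smt (verit) image_iff image_subset_iff subset_iff)

lemma unit_map_image_eq: "K \<subseteq> F \<Longrightarrow> L \<subseteq> F \<Longrightarrow> unit_map ` K = unit_map ` L \<longleftrightarrow> K = L"
  using unit_map_image_subset[of K L] unit_map_image_subset[of L K] by (simp only: set_eq_subset)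

lemma subgroup_restrict_iff:
  assumes "subgp E" shows "subgroup H (BG\<lparr>carrier := unit_map ` E\<rparr>) \<longleftrightarrow> subgroup H BG \<and> H \<subseteq> unit_map ` E"
proof
  assume H: "subgroup H (BG\<lparr>carrier := unit_map ` E\<rparr>)"
  then show "subgroup H BG \<and> H \<subseteq> unit_map ` E"
    using group.incl_subgroup[OF group_BijGroup subgroup_unit_map[OF assms] H] subgroup.subset[OF H] by simp
next
  assume "subgroup H BG \<and> H \<subseteq> unit_map ` E"
  then show "subgroup H (BG\<lparr>carrier := unit_map ` E\<rparr>)"
    using group.subgroup_incl[OF group_BijGroup _ subgroup_unit_map[OF assms]] by blast
qed

text \<open>\<open>unit_map\<close> is an injective homomorphism on \<open>F\<close>, so it
  identifies the subgroups of \<open>E\<close> with the subgroups of its image.\<close>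

lemma maximal_transfer:
  assumes E: "subgp E" and M: "M \<subseteq> F"
  shows "maximal_subgroup (unit_map ` M) (BG\<lparr>carrier := unit_map ` E\<rparr>) \<longleftrightarrow> maximal_in M E"
proof -
  note EF = subD(1)[OF E]
  have sM: "subgroup (unit_map ` M) BG \<longleftrightarrow> subgp M"
  proof
    assume "subgroup (unit_map ` M) BG"
    then obtain K where K: "subgp K" "unit_map ` M = unit_map ` K" using subgroup_unit_map_conv M by blast
    then show "subgp M" using unit_map_image_eq[OF M subD(1)[OF K(1)]] by simp
  qed (rule subgroup_unit_map)
  have q: "(\<forall>H. subgroup H (BG\<lparr>carrier := unit_map ` E\<rparr>) \<longrightarrow> unit_map ` M \<subseteq> H \<longrightarrow> H = unit_map ` M \<or> H = unit_map ` E) \<longleftrightarrow>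
    (\<forall>K. subgp K \<longrightarrow> M \<subseteq> K \<longrightarrow> K \<subseteq> E \<longrightarrow> K = M \<or> K = E)"
  proof (intro iffI allI impI)
    fix K assume a: "\<forall>H. subgroup H (BG\<lparr>carrier := unit_map ` E\<rparr>) \<longrightarrow> unit_map ` M \<subseteq> H \<longrightarrow> H = unit_map ` M \<or> H = unit_map ` E"
      and K: "subgp K" "M \<subseteq> K" "K \<subseteq> E"
    have "subgroup (unit_map ` K) (BG\<lparr>carrier := unit_map ` E\<rparr>)"
      using subgroup_restrict_iff[OF E] subgroup_unit_map[OF K(1)] K(3) by (simp add: image_mono)
    then have "unit_map ` K = unit_map ` M \<or> unit_map ` K = unit_map ` E" using a K(2) by (meson image_mono)
    then show "K = M \<or> K = E" using unit_map_image_eq[OF subD(1)[OF K(1)] M] unit_map_image_eq[OF subD(1)[OF K(1)] EF] by simp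
  next
    fix H assume a: "\<forall>K. subgp K \<longrightarrow> M \<subseteq> K \<longrightarrow> K \<subseteq> E \<longrightarrow> K = M \<or> K = E"
      and H: "subgroup H (BG\<lparr>carrier := unit_map ` E\<rparr>)" "unit_map ` M \<subseteq> H"
    have H': "subgroup H BG" "H \<subseteq> unit_map ` E" using H(1) subgroup_restrict_iff[OF E] by auto
    then obtain K where K: "subgp K" "H = unit_map ` K" using subgroup_unit_map_conv EF by (meson image_mono subset_trans)
    note KF = subD(1)[OF K(1)]
    have "M \<subseteq> K" "K \<subseteq> E" using H(2) H'(2) unit_map_image_subset[OF M KF] unit_map_image_subset[OF KF EF] unfolding K(2) by auto
    then show "H = unit_map ` M \<or> H = unit_map ` E" using a K by blast
  qed
  have "maximal_subgroup (unit_map ` M) (BG\<lparr>carrier := unit_map ` E\<rparr>) \<longleftrightarrow> subgroup (unit_map ` M) (BG\<lparr>carrier := unit_map ` E\<rparr>) \<and> unit_map ` M \<noteq> unit_map ` E \<and>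
    (\<forall>H. subgroup H (BG\<lparr>carrier := unit_map ` E\<rparr>) \<longrightarrow> unit_map ` M \<subseteq> H \<longrightarrow> H = unit_map ` M \<or> H = unit_map ` E)"
    by (simp add: maximal_subgroup_def)
  also have "\<dots> \<longleftrightarrow> (subgp M \<and> M \<subseteq> E) \<and> M \<noteq> E \<and> (\<forall>K. subgp K \<longrightarrow> M \<subseteq> K \<longrightarrow> K \<subseteq> E \<longrightarrow> K = M \<or> K = E)"
    unfolding q unfolding subgroup_restrict_iff[OF E] sM unit_map_image_eq[OF M EF] unit_map_image_subset[OF M EF] ..
  also have "\<dots> \<longleftrightarrow> maximal_in M E" unfolding maximal_in_def by blast
  finally show ?thesis .
qed

lemma maximal_full_group:
  "M \<subseteq> F \<Longrightarrow> maximal_subgroup (unit_map ` M) (full_group GX) \<longleftrightarrow> maximal_in M F"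
  unfolding full_group_eq by (rule maximal_transfer[OF subgp_F])

text \<open>\<open>generate\<close> also adjoins inverses; nothing new arises because
  \<open>D\<close> is closed under them.\<close>

lemma derived_full_group: "derived (full_group GX) (carrier (full_group GX)) = unit_map ` D"
proof -
  have G: "group (full_group GX)"
    unfolding full_group_eq by (rule subgroup.subgroup_is_group[OF subgroup_unit_map[OF subgp_F] group_BijGroup])
  have mult: "unit_map f \<otimes>\<^bsub>full_group GX\<^esub> unit_map g = unit_map (f \<circ> g)" if "f \<in> F" "g \<in> F" for f g
    using unit_map_mult[OF that] by (simp add: full_group_eq)
  have one: "\<one>\<^bsub>full_group GX\<^esub> = unit_map id" using unit_map_one by (simp add: full_group_eq)
  have inv: "inv\<^bsub>full_group GX\<^esub> unit_map f = unit_map (iv f)" if f: "f \<in> F" for f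
  proof (rule group.inv_equality[OF G])
    show "unit_map (iv f) \<otimes>\<^bsub>full_group GX\<^esub> unit_map f = \<one>\<^bsub>full_group GX\<^esub>"
      unfolding mult[OF F_inv[OF f] f] one iv_simps(4)[OF F_bij[OF f]] ..
  qed (use f F_inv[OF f] full_group_carrier in blast)+
  define pr where "pr a b = a \<otimes>\<^bsub>full_group GX\<^esub> b \<otimes>\<^bsub>full_group GX\<^esub> inv\<^bsub>full_group GX\<^esub> a \<otimes>\<^bsub>full_group GX\<^esub> inv\<^bsub>full_group GX\<^esub> b" for a b
  have com: "pr (unit_map f) (unit_map g) = unit_map (commutator f g)" if "f \<in> F" "g \<in> F" for f g
    unfolding pr_def using that F_inv F_comp by (simp only: inv mult commutator_def)
  define Q where "Q = (\<Union>a\<in>carrier (full_group GX). \<Union>b\<in>carrier (full_group GX). {pr a b})"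
  have der: "derived (full_group GX) (carrier (full_group GX)) = generate (full_group GX) Q"
    by (simp only: derived_def Q_def pr_def)
  have QD: "Q \<subseteq> unit_map ` D"
  proof
    fix h assume "h \<in> Q"
    then obtain f g where "f \<in> F" "g \<in> F" "h = unit_map (commutator f g)"
      unfolding Q_def full_group_carrier using com by auto
    then show "h \<in> unit_map ` D" using D_commutator by blast
  qed
  have subD': "subgroup (unit_map ` D) (full_group GX)"
    unfolding full_group_eq subgroup_restrict_iff[OF subgp_F]
    using subgroup_unit_map[OF subgp_D] D_F by blast
  show ?thesis unfolding der
  proof
    show "generate (full_group GX) Q \<subseteq> unit_map ` D" by (rule group.generate_subgroup_incl[OF G QD subD'])
    show "unit_map ` D \<subseteq> generate (full_group GX) Q"
    proof
      fix h assume "h \<in> unit_map ` D"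
      then obtain d where d: "d \<in> D" "h = unit_map d" by auto
      have "unit_map d \<in> generate (full_group GX) Q" using d(1)
      proof (induction rule: D.induct)
        case D_id
        show ?case unfolding one[symmetric] by (rule generate.one)
      next
        case (D_step f g d)
        have "unit_map f \<in> carrier (full_group GX)" "unit_map g \<in> carrier (full_group GX)"
          using D_step(1,2) full_group_carrier by auto
        then have "pr (unit_map f) (unit_map g) \<in> Q" unfolding Q_def by blast
        then have "unit_map (commutator f g) \<in> Q" by (simp only: com[OF D_step(1,2)])
        then have "unit_map (commutator f g) \<otimes>\<^bsub>full_group GX\<^esub> unit_map d \<in> generate (full_group GX) Q"
          by (intro generate.eng generate.incl D_step)
        then show ?case unfolding mult[OF commutator_F[OF D_step(1,2)] D_F[OF D_step(3)]] .
      qed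
      then show "h \<in> generate (full_group GX) Q" using d(2) by simp
    qed
  qed
qed

lemma commutator_full_group_eq: "commutator_full_group GX = BG\<lparr>carrier := unit_map ` D\<rparr>"
  unfolding commutator_full_group_def derived_full_group by (simp add: full_group_eq)

lemma maximal_commutator_full_group:
  "M \<subseteq> F \<Longrightarrow> maximal_subgroup (unit_map ` M) (commutator_full_group GX) \<longleftrightarrow> maximal_in M D"
  unfolding commutator_full_group_eq by (rule maximal_transfer[OF subgp_D])

end

section \<open>Intermediate factors\<close>

lemma second_countable_prod:
  assumes "second_countable X" "second_countable Y" shows "second_countable (prod_topology X Y)"
proof -
  obtain A where A: "countable A" "\<And>V. V \<in> A \<Longrightarrow> openin X V" "\<And>U x. openin X U \<Longrightarrow> x \<in> U \<Longrightarrow> \<exists>V\<in>A. x \<in> V \<and> V \<subseteq> U"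
    using assms(1) unfolding second_countable_def by metis
  obtain C where C: "countable C" "\<And>V. V \<in> C \<Longrightarrow> openin Y V" "\<And>U x. openin Y U \<Longrightarrow> x \<in> U \<Longrightarrow> \<exists>V\<in>C. x \<in> V \<and> V \<subseteq> U"
    using assms(2) unfolding second_countable_def by metis
  show ?thesis unfolding second_countable_def
  proof (intro exI[of _ "(\<lambda>(U, V). U \<times> V) ` (A \<times> C)"] conjI allI impI ballI)
    show "countable ((\<lambda>(U, V). U \<times> V) ` (A \<times> C))" using A(1) C(1) by simp
    show "openin (prod_topology X Y) V" if "V \<in> (\<lambda>(U, V). U \<times> V) ` (A \<times> C)" for V
      using that A(2) C(2) by (auto simp: openin_prod_Times_iff)
    fix U x assume U: "openin (prod_topology X Y) U \<and> x \<in> U"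
    obtain a b where x: "x = (a, b)" by (cases x)
    obtain V W where V: "openin X V" "openin Y W" "a \<in> V" "b \<in> W" "V \<times> W \<subseteq> U"
      using U x unfolding openin_prod_topology_alt by blast
    obtain V' where V': "V' \<in> A" "a \<in> V'" "V' \<subseteq> V" using A(3)[OF V(1,3)] by auto
    obtain W' where W': "W' \<in> C" "b \<in> W'" "W' \<subseteq> W" using C(3)[OF V(2,4)] by auto
    have "V' \<times> W' \<in> (\<lambda>(U, V). U \<times> V) ` (A \<times> C)" using V' W' by auto
    moreover have "x \<in> V' \<times> W'" "V' \<times> W' \<subseteq> U" using x V' W' V by auto
    ultimately show "\<exists>V\<in>(\<lambda>(U, V). U \<times> V) ` (A \<times> C). x \<in> V \<and> V \<subseteq> U" by blast
  qed
qed

text \<open>Phrased for a compact space with enough clopen sets because it will be applied to a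
  quotient of \<open>X\<close>. Freeness makes the isotropy equal to the unit space, which is open;
  this is effectiveness.\<close>

lemma transformation_groupoid_ample:
  fixes W :: "'a topology" and \<phi> :: "'a \<Rightarrow> 'a"
  assumes comp: "compact_space W" and haus: "Hausdorff_space W" and sc: "second_countable W"
    and sep: "\<And>x y. x \<in> topspace W \<Longrightarrow> y \<in> topspace W \<Longrightarrow> x \<noteq> y \<Longrightarrow> \<exists>C\<in>clopens W. x \<in> C \<and> y \<notin> C"
    and h: "homeomorphic_map W W \<phi>" and free: "\<And>x n. x \<in> topspace W \<Longrightarrow> act W \<phi> n x = x \<Longrightarrow> n = 0"
  shows "ample_groupoid (transformation_groupoid W \<phi>)"
proof -
  note a = act_laws[OF h]
  define S where "S = topspace W"
  define T where "T = act W \<phi>"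
  let ?G = "transformation_groupoid W \<phi>"
  let ?Z = "discrete_topology (UNIV :: int set)"
  have gtop: "gtop ?G = prod_topology W ?Z" by (simp add: transformation_groupoid_def)
  have arr: "arr ?G = S \<times> UNIV" by (simp add: arr_def gtop S_def)
  have un: "units ?G = S \<times> {0}" unfolding S_def by (rule units_transformation_groupoid)
  have gi: "ginv ?G (x, n) = (T (- n) x, - n)" if "x \<in> S" for x n
    using that by (simp add: transformation_groupoid_def T_def act_def S_def)
  have gm: "gmul ?G (x, n) (y, m) = (x, n + m)" for x y n m by (simp add: transformation_groupoid_def)
  have rn: "rng ?G (x, n) = (x, 0)" for x n by (rule rng_transformation_groupoid)
  have sr: "src ?G (x, n) = (T (- n) x, 0)" if "x \<in> S" for x n
    using that by (simp add: src_transformation_groupoid T_def act_def S_def)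
  have TS: "T n x \<in> S" if "x \<in> S" for n x using a(2) that by (simp add: T_def S_def)
  have TT: "T m (T n x) = T (m + n) x" for m n x unfolding T_def by (rule a(3))
  have T0: "T 0 x = x" for x unfolding T_def by (rule a(1))
  have com: "((x, n), (y, m)) \<in> composable ?G \<longleftrightarrow> x \<in> S \<and> y \<in> S \<and> y = T (- n) x" for x n y m
    using sr rn by (auto simp: composable_def arr)
  have alg: "algebraic_groupoid ?G"
    unfolding algebraic_groupoid_def
  proof (intro conjI ballI allI impI)
    fix g assume "g \<in> arr ?G"
    then obtain x n where g: "g = (x, n)" "x \<in> S" by (auto simp: arr)
    show "ginv ?G g \<in> arr ?G" using g gi TS by (simp add: arr)
    show "ginv ?G (ginv ?G g) = g" using g gi TS by (simp add: TT T0)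
  next
    fix p assume "p \<in> composable ?G"
    moreover obtain g h where p: "p = (g, h)" by (cases p)
    moreover obtain x n where g: "g = (x, n)" by (cases g)
    moreover obtain y m where h: "h = (y, m)" by (cases h)
    ultimately have c: "x \<in> S" "y \<in> S" "y = T (- n) x" using com by auto
    show "case p of (g, h) \<Rightarrow> gmul ?G g h \<in> arr ?G \<and> src ?G (gmul ?G g h) = src ?G h \<and>
        rng ?G (gmul ?G g h) = rng ?G g \<and> gmul ?G (ginv ?G g) (gmul ?G g h) = h \<and> gmul ?G (gmul ?G g h) (ginv ?G h) = g"
      using c by (simp add: p g h gm gi sr rn arr TT add.commute TS)
  next
    fix g h k assume "(g, h) \<in> composable ?G" "(h, k) \<in> composable ?G"
    then show "gmul ?G (gmul ?G g h) k = gmul ?G g (gmul ?G h k)"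
      by (cases g; cases h; cases k) (simp add: gm)
  qed
  have cT: "continuous_map W W (T n)" for n
    using a(4) homeomorphic_imp_continuous_map unfolding T_def by blast
  have cinv: "continuous_map (gtop ?G) (gtop ?G) (ginv ?G)"
    unfolding continuous_map_def
  proof (intro conjI allI impI)
    show "ginv ?G \<in> topspace (gtop ?G) \<rightarrow> topspace (gtop ?G)" using gi TS by (auto simp: gtop S_def[symmetric])
    fix U assume U: "openin (gtop ?G) U"
    show "openin (gtop ?G) {g \<in> topspace (gtop ?G). ginv ?G g \<in> U}"
      unfolding gtop openin_prod_topology_alt
    proof (intro allI impI)
      fix x n assume xn: "(x, n) \<in> {g \<in> topspace (prod_topology W ?Z). ginv ?G g \<in> U}"
      then have x: "x \<in> S" "(T (- n) x, - n) \<in> U" using gi by (auto simp: S_def)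
      then obtain V V' where V: "openin W V" "T (- n) x \<in> V" "- n \<in> V'" "V \<times> V' \<subseteq> U"
        using U unfolding gtop openin_prod_topology_alt by blast
      have "openin W {z \<in> topspace W. T (- n) z \<in> V}" by (rule openin_continuous_map_preimage[OF cT V(1)])
      moreover have "{z \<in> topspace W. T (- n) z \<in> V} \<times> {n} \<subseteq> {g \<in> topspace (prod_topology W ?Z). ginv ?G g \<in> U}"
        using V gi by (auto simp: S_def)
      ultimately show "\<exists>A C. openin W A \<and> openin ?Z C \<and> x \<in> A \<and> n \<in> C \<and> A \<times> C \<subseteq> {g \<in> topspace (prod_topology W ?Z). ginv ?G g \<in> U}"
        using x V(2) by (intro exI[of _ "{z \<in> topspace W. T (- n) z \<in> V}"] exI[of _ "{n}"]) (simp add: S_def)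
    qed
  qed
  have "continuous_map (prod_topology (gtop ?G) (gtop ?G)) (gtop ?G) (\<lambda>(g, h). gmul ?G g h)"
  proof -
    have "(\<lambda>(g, h). gmul ?G g h) = (\<lambda>p. (fst (fst p), snd (fst p) + snd (snd p)))"
      by (auto simp: fun_eq_iff gm)
    moreover have "continuous_map (prod_topology (gtop ?G) (gtop ?G)) W (\<lambda>p. fst (fst p))"
      using continuous_map_compose[OF continuous_map_fst continuous_map_fst] by (simp add: gtop o_def)
    moreover have "continuous_map (prod_topology (gtop ?G) (gtop ?G)) ?Z (\<lambda>p. snd (fst p) + snd (snd p))"
    proof -
      have 1: "continuous_map (prod_topology (gtop ?G) (gtop ?G)) (prod_topology ?Z ?Z) (\<lambda>p. (snd (fst p), snd (snd p)))"
      proof -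
        have "continuous_map (prod_topology (gtop ?G) (gtop ?G)) ?Z (\<lambda>p. snd (fst p))"
          using continuous_map_compose[OF continuous_map_fst continuous_map_snd] by (simp add: gtop o_def)
        moreover have "continuous_map (prod_topology (gtop ?G) (gtop ?G)) ?Z (\<lambda>p. snd (snd p))"
          using continuous_map_compose[OF continuous_map_snd continuous_map_snd] by (simp add: gtop o_def)
        ultimately show ?thesis by (simp add: continuous_map_pairwise o_def)
      qed
      have 2: "continuous_map (prod_topology ?Z ?Z) ?Z (\<lambda>(i, j). i + j)"
        by (simp add: prod_topology_discrete_topology[symmetric])
      from continuous_map_compose[OF 1 2] show ?thesis by (simp add: o_def)
    qed
    ultimately show ?thesis by (simp add: gtop continuous_map_pairwise o_def)
  qed
  then have top: "topological_groupoid ?G"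
    unfolding topological_groupoid_def using alg cinv continuous_map_from_subtopology by blast
  have lh: "local_homeomorphism (gtop ?G) (unit_space ?G) (rng ?G)"
    unfolding local_homeomorphism_def
  proof
    fix g assume "g \<in> topspace (gtop ?G)"
    then obtain x n where g: "g = (x, n)" "x \<in> S" by (auto simp: gtop S_def)
    have img: "rng ?G ` (S \<times> {n}) = S \<times> {0}" by (auto simp: rn image_iff)
    have us: "unit_space ?G = subtopology (prod_topology W ?Z) (S \<times> {0})" by (simp add: unit_space_def gtop un)
    have o0: "openin (prod_topology W ?Z) (S \<times> {k})" for k by (simp add: S_def openin_prod_Times_iff)
    have "homeomorphic_map (subtopology (gtop ?G) (S \<times> {n})) (subtopology (unit_space ?G) (S \<times> {0})) (rng ?G)"
      unfolding homeomorphic_map_maps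
    proof (intro exI)
      have "continuous_map (prod_topology W ?Z) (prod_topology W ?Z) (\<lambda>p. (fst p, k))" for k
        by (simp add: continuous_map_pairwise o_def continuous_map_fst)
      then have c: "continuous_map (subtopology (prod_topology W ?Z) (S \<times> {i})) (subtopology (prod_topology W ?Z) (S \<times> {k})) (\<lambda>p. (fst p, k))" for i k
        by (auto simp: continuous_map_in_subtopology continuous_map_from_subtopology)
      have "rng ?G = (\<lambda>p. (fst p, 0))" by (auto simp: fun_eq_iff rn)
      then show "homeomorphic_maps (subtopology (gtop ?G) (S \<times> {n})) (subtopology (unit_space ?G) (S \<times> {0})) (rng ?G) (\<lambda>p. (fst p, n))"
        unfolding homeomorphic_maps_def us gtop subtopology_subtopology Int_absorb using c by auto
    qed
    then show "\<exists>U. openin (gtop ?G) U \<and> g \<in> U \<and> openin (unit_space ?G) (rng ?G ` U) \<and>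
        homeomorphic_map (subtopology (gtop ?G) U) (subtopology (unit_space ?G) (rng ?G ` U)) (rng ?G)"
      using o0 g us by (intro exI[of _ "S \<times> {n}"]) (auto simp: img gtop openin_subtopology)
  qed
  have et: "etale_groupoid ?G"
    unfolding etale_groupoid_def
  proof (intro conjI top lh)
    show "second_countable (gtop ?G)"
      unfolding gtop by (intro second_countable_prod sc) (simp add: second_countable_discrete_topology)
    show "locally_compact_space (gtop ?G)"
      unfolding gtop using compact_imp_locally_compact_space[OF comp] by (simp add: locally_compact_space_prod_topology locally_compact_space_discrete_topology)
    show "Hausdorff_space (gtop ?G)" unfolding gtop using haus by (simp add: Hausdorff_space_prod_topology)
  qed
  have td: "totally_disconnected (unit_space ?G)"
    unfolding totally_disconnected_def
  proof (intro allI impI)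
    fix C assume C: "connectedin (unit_space ?G) C"
    then have CS: "C \<subseteq> S \<times> {0}" using connectedin_subset_topspace[OF C] un by (auto simp: unit_space_def)
    have Cf: "connectedin W (fst ` C)"
    proof -
      have "connectedin (prod_topology W ?Z) C" using C by (simp add: unit_space_def gtop connectedin_subtopology)
      then show ?thesis using connectedin_continuous_map_image[OF continuous_map_fst] by blast
    qed
    have "x = y" if "x \<in> fst ` C" "y \<in> fst ` C" for x y
    proof (rule ccontr)
      assume "x \<noteq> y"
      moreover have "x \<in> topspace W" "y \<in> topspace W" using that CS by (auto simp: S_def)
      ultimately obtain E where E: "E \<in> clopens W" "x \<in> E" "y \<notin> E" using sep by blast
      then have "openin W E" "openin W (topspace W - E)" by (auto simp: clopens_def)
      moreover have "fst ` C \<subseteq> E \<union> (topspace W - E)" using CS by (auto simp: S_def)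
      ultimately show False using Cf that E unfolding connectedin by blast
    qed
    then have "\<And>u v. u \<in> C \<Longrightarrow> v \<in> C \<Longrightarrow> u = v" using CS by (metis image_eqI mem_Sigma_iff prod.collapse singletonD subset_iff)
    then show "\<exists>a. C \<subseteq> {a}" by blast
  qed
  have eff: "effective ?G"
  proof -
    have "{g \<in> arr ?G. rng ?G g = src ?G g} = S \<times> {0}"
    proof -
      have fr: "T (- n) x = x \<longleftrightarrow> n = 0" if "x \<in> S" for x n
        using free[of x "- n"] that T0 unfolding T_def S_def by auto
      have "(x, n) \<in> {g \<in> arr ?G. rng ?G g = src ?G g} \<longleftrightarrow> (x, n) \<in> S \<times> {0}" for x n
      proof (cases "x \<in> S")
        case True
        then show ?thesis using fr[OF True, of n] by (auto simp: arr rn sr)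
      qed (simp add: arr)
      then show ?thesis by auto
    qed
    moreover have "openin (gtop ?G) (S \<times> {0})" by (simp add: gtop S_def openin_prod_Times_iff)
    ultimately show ?thesis unfolding effective_def un by (simp add: interior_of_openin)
  qed
  show ?thesis unfolding ample_groupoid_def using et td eff by simp
qed

text \<open>A continuous map from a compact space to a Hausdorff space is proper, and the integer
  component is left untouched; the latter also gives the bijection on range fibres.\<close>

lemma factor_map_transformation_groupoid:
  assumes W: "compact_space W" "Hausdorff_space V" and h: "homeomorphic_map W W \<phi>" "homeomorphic_map V V \<psi>"
    and f: "continuous_map W V f" "f ` topspace W = topspace V"
    and eq: "\<And>x n. x \<in> topspace W \<Longrightarrow> f (act W \<phi> n x) = act V \<psi> n (f x)"
  shows "factor_map (transformation_groupoid W \<phi>) (transformation_groupoid V \<psi>) (\<lambda>(x, n). (f x, n))"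
proof -
  let ?G = "transformation_groupoid W \<phi>" and ?H = "transformation_groupoid V \<psi>"
  let ?Z = "discrete_topology (UNIV :: int set)" and ?p = "\<lambda>(x, n). (f x, n)"
  have gt: "gtop ?G = prod_topology W ?Z" "gtop ?H = prod_topology V ?Z" by (simp_all add: transformation_groupoid_def)
  have ar: "arr ?G = topspace W \<times> UNIV" "arr ?H = topspace V \<times> UNIV" by (simp_all add: arr_def gt)
  have gm: "gmul ?G (x, n) (y, m) = (x, n + m)" "gmul ?H (u, n) (v, m) = (u, n + m)" for x y n m u v
    by (simp_all add: transformation_groupoid_def)
  have sr: "x \<in> topspace W \<Longrightarrow> src ?G (x, n) = (act W \<phi> (- n) x, 0)" "u \<in> topspace V \<Longrightarrow> src ?H (u, n) = (act V \<psi> (- n) u, 0)" for x u n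
    by (simp_all add: src_transformation_groupoid act_def)
  have fS: "f x \<in> topspace V" if "x \<in> topspace W" for x using f(2) that by auto
  show ?thesis
    unfolding factor_map_def
  proof (intro conjI ballI)
    show "groupoid_hom ?G ?H ?p"
      unfolding groupoid_hom_def
    proof (intro conjI ballI)
      show "?p \<in> arr ?G \<rightarrow> arr ?H" using fS by (auto simp: ar)
      fix c assume "c \<in> composable ?G"
      moreover obtain x n y m where c: "c = ((x, n), (y, m))" by (metis surj_pair)
      ultimately have xy: "x \<in> topspace W" "y \<in> topspace W" "y = act W \<phi> (- n) x"
        by (auto simp: composable_def ar sr rng_transformation_groupoid)
      show "case c of (g, h) \<Rightarrow> (?p g, ?p h) \<in> composable ?H \<and> ?p (gmul ?G g h) = gmul ?H (?p g) (?p h)"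
      proof -
        have "f y = act V \<psi> (- n) (f x)" unfolding xy(3) by (rule eq[OF xy(1)])
        then show ?thesis
          using xy(1,2) fS[OF xy(1)] fS[OF xy(2)] by (simp add: c composable_def ar sr rng_transformation_groupoid gm)
      qed
    qed
    show "continuous_map (gtop ?G) (gtop ?H) ?p"
    proof -
      have "?p = (\<lambda>p. (f (fst p), snd p))" by auto
      moreover have "continuous_map (gtop ?G) V (\<lambda>p. f (fst p))"
        using continuous_map_compose[OF continuous_map_fst f(1)] by (simp add: gt o_def)
      moreover have "continuous_map (gtop ?G) ?Z (\<lambda>p. snd p)" using continuous_map_snd by (simp add: gt)
      ultimately have "continuous_map (gtop ?G) (gtop ?H) (\<lambda>p. (f (fst p), snd p))"
        unfolding gt(2) continuous_map_pairwise by (simp add: o_def)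
      then show ?thesis by (simp only: \<open>?p = (\<lambda>p. (f (fst p), snd p))\<close>)
    qed
    show "proper_map (gtop ?G) (gtop ?H) ?p"
    proof -
      have "proper_map W V f" using continuous_imp_proper_map[OF W(1) Hausdorff_imp_kc_space[OF W(2)] f(1)] .
      moreover have "proper_map ?Z ?Z (\<lambda>n. n)" using proper_map_id by (simp add: id_def)
      ultimately show ?thesis unfolding gt by (subst proper_map_prod) simp
    qed
    show "?p ` arr ?G = arr ?H" using f(2) by (force simp: ar)
    fix u assume "u \<in> units ?G"
    then obtain x where u: "u = (x, 0)" "x \<in> topspace W" by (auto simp: units_transformation_groupoid)
    have "{g \<in> arr ?G. rng ?G g = u} = {x} \<times> UNIV" using u by (auto simp: ar rng_transformation_groupoid)
    moreover have "{g \<in> arr ?H. rng ?H g = ?p u} = {f x} \<times> UNIV" using u fS by (auto simp: ar rng_transformation_groupoid)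
    ultimately show "bij_betw ?p {g \<in> arr ?G. rng ?G g = u} {g \<in> arr ?H. rng ?H g = ?p u}"
      by (auto simp: bij_betw_def inj_on_def)
  qed
qed

lemma groupoid_iso_inj:
  assumes "groupoid_iso (transformation_groupoid W \<phi>) H (\<lambda>(x, n). (f x, n))"
  shows "inj_on f (topspace W)"
proof (rule inj_onI)
  fix x y assume xy: "x \<in> topspace W" "y \<in> topspace W" "f x = f y"
  have "inj_on (\<lambda>(x, n). (f x, n)) (topspace (gtop (transformation_groupoid W \<phi>)))"
    using assms homeomorphic_imp_injective_map unfolding groupoid_iso_def by blast
  then have "inj_on (\<lambda>(x, n :: int). (f x, n)) (topspace W \<times> UNIV)" by (simp add: transformation_groupoid_def)
  from inj_onD[OF this, of "(x, 0)" "(y, 0)"] xy show "x = y" by simp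
qed

section \<open>From prime factor maps to invariant clopen algebras\<close>

locale cantor_factor = A: cantor_system X \<phi> + C: cantor_system Y \<psi>
  for X :: "'a topology" and \<phi> and Y :: "'b topology" and \<psi> +
  fixes \<pi> :: "'a \<Rightarrow> 'b"
  assumes equi: "equivariant_map X \<phi> Y \<psi> \<pi>"
    and prime_fm: "prime_factor_map (transformation_groupoid X \<phi>) (transformation_groupoid Y \<psi>) (induced_factor_map \<pi>)"
    and two: "at_most_two_to_one (transformation_groupoid X \<phi>) (transformation_groupoid Y \<psi>) (induced_factor_map \<pi>)"
begin

abbreviation "GY \<equiv> transformation_groupoid Y \<psi>"
abbreviation "\<pi>G \<equiv> induced_factor_map \<pi> :: 'a \<times> int \<Rightarrow> 'b \<times> int"

lemma induced_map_eq: "\<pi>G = (\<lambda>(x, n). (\<pi> x, n))" by (simp add: induced_factor_map_def)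

lemma cont_pi: "continuous_map X Y \<pi>" using equi by (simp add: equivariant_map_def)

lemma c_pi_S: "x \<in> topspace X \<Longrightarrow> \<pi> x \<in> topspace Y"
  using cont_pi by (auto simp: continuous_map_def)

lemma pi_factor: "factor_map A.GX GY \<pi>G" using prime_fm by (simp add: prime_factor_map_def)

lemma c_pi_onto: assumes "y \<in> topspace Y" shows "\<exists>x\<in>topspace X. \<pi> x = y"
proof -
  have "(y, 0) \<in> \<pi>G ` arr A.GX" using pi_factor assms by (simp add: factor_map_def C.arr_GX)
  then show ?thesis by (auto simp: induced_map_eq A.arr_GX)
qed

lemma homeomorphisms: "homeomorphic_map X X \<phi>" "homeomorphic_map Y Y \<psi>"
  using A.minimal_act C.minimal_act by (simp_all add: minimal_action_def)

lemma c_pi_T: assumes "x \<in> topspace X" shows "\<pi> (act X \<phi> n x) = act Y \<psi> n (\<pi> x)"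
proof -
  have 1: "\<pi> (act X \<phi> 1 z) = act Y \<psi> 1 (\<pi> z)" if "z \<in> topspace X" for z
    using that c_pi_S[OF that] equi act_laws(5)[OF homeomorphisms(1)] act_laws(5)[OF homeomorphisms(2)] by (simp add: equivariant_map_def)
  show ?thesis
  proof (induction n rule: int_induct[of _ 0])
    case base show ?case by (simp add: A.T_0 C.T_0)
  next
    case (step1 i)
    then show ?case using 1[OF A.T_S[OF assms, of i]] by (simp add: A.T_add C.T_add add.commute)
  next
    case (step2 i)
    have "act Y \<psi> 1 (\<pi> (act X \<phi> (i - 1) x)) = act Y \<psi> i (\<pi> x)"
      using 1[OF A.T_S[OF assms, of "i - 1"]] step2 by (simp add: A.T_add)
    then have "act Y \<psi> (-1) (act Y \<psi> 1 (\<pi> (act X \<phi> (i - 1) x))) = act Y \<psi> (-1) (act Y \<psi> i (\<pi> x))" by simp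
    then show ?case by (simp add: C.T_add C.T_0)
  qed
qed

lemma c_pi_B: "E \<in> clopens Y \<Longrightarrow> {x\<in>topspace X. \<pi> x \<in> E} \<in> clopens X"
  using openin_continuous_map_preimage[OF cont_pi] closedin_continuous_map_preimage[OF cont_pi] by (auto simp: clopens_def)

lemma c_fibres:
  assumes x: "x \<in> topspace X" "x' \<in> topspace X" "x'' \<in> topspace X" "\<pi> x = \<pi> x'" "\<pi> x = \<pi> x''"
  shows "x = x' \<or> x = x'' \<or> x' = x''"
proof (rule ccontr)
  assume n: "\<not> ?thesis"
  define U where "U = {u \<in> units A.GX. \<pi>G u = (\<pi> x, 0)}"
  have "(\<pi> x, 0) \<in> units GY" using c_pi_S x by (simp add: C.units_GX)
  then have U: "finite U" "card U \<le> 2" using two by (auto simp: at_most_two_to_one_def U_def)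
  have "{(x, 0), (x', 0), (x'', 0)} \<subseteq> U" using x by (auto simp: U_def A.units_GX induced_map_eq)
  then have "card {(x, 0 :: int), (x', 0), (x'', 0)} \<le> 2" using card_mono[OF U(1)] U(2) by (meson order_trans)
  then show False using n by simp
qed

text \<open>An injective factor map is a closed continuous bijection, hence an isomorphism, which a
  prime map is not.\<close>

lemma c_not_inj: "\<exists>x\<in>topspace X. \<exists>x'\<in>topspace X. x \<noteq> x' \<and> \<pi> x = \<pi> x'"
proof (rule ccontr)
  assume n: "\<not> ?thesis"
  have "inj_on \<pi>G (topspace (gtop A.GX))" using n by (auto simp: inj_on_def induced_map_eq A.gtop_GX)
  moreover have "closed_map (gtop A.GX) (gtop GY) \<pi>G" "continuous_map (gtop A.GX) (gtop GY) \<pi>G"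
    "\<pi>G ` topspace (gtop A.GX) = topspace (gtop GY)"
    using pi_factor proper_imp_closed_map by (auto simp: factor_map_def arr_def)
  ultimately have "homeomorphic_map (gtop A.GX) (gtop GY) \<pi>G"
    using bijective_closed_imp_homeomorphic_map by blast
  then have "groupoid_iso A.GX GY \<pi>G" using pi_factor by (simp add: groupoid_iso_def factor_map_def)
  then show False using prime_fm by (simp add: prime_factor_map_def)
qed

text \<open>The intermediate groupoid is realised on a set \<open>Z\<close> of representatives of the points of \<open>X\<close> that the Boolean
  algebra does not separate, because \<open>prime_factor_map\<close> only quantifies over groupoids on the arrow type of its domain.\<close>

lemma c_prime:
  assumes CB: "\<CC> \<subseteq> clopens X" and S: "topspace X \<in> \<CC>"
    and Int: "\<And>C E. C \<in> \<CC> \<Longrightarrow> E \<in> \<CC> \<Longrightarrow> C \<inter> E \<in> \<CC>" and Diff: "\<And>C E. C \<in> \<CC> \<Longrightarrow> E \<in> \<CC> \<Longrightarrow> C - E \<in> \<CC>"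
    and inv: "\<And>C n. C \<in> \<CC> \<Longrightarrow> act X \<phi> n ` C \<in> \<CC>"
    and preim: "\<And>C. C \<in> clopens Y \<Longrightarrow> {x\<in>topspace X. \<pi> x \<in> C} \<in> \<CC>"
  shows "\<CC> = clopens X \<or> (\<forall>C\<in>\<CC>. \<forall>x\<in>topspace X. \<forall>x'\<in>topspace X. \<pi> x = \<pi> x' \<longrightarrow> x \<in> C \<longrightarrow> x' \<in> C)"
proof -
  define S where "S = topspace X"
  define T where "T = act X \<phi>"
  have CS: "C \<subseteq> S" if "C \<in> \<CC>" for C using CB that A.B_sub by (auto simp: S_def)
  define E where "E x z \<longleftrightarrow> (\<forall>C\<in>\<CC>. x \<in> C \<longleftrightarrow> z \<in> C)" for x z
  \<comment> \<open>Equivalent points satisfy the same predicate, so the choice operator gives them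
    the same representative.\<close>
  define \<rho> where "\<rho> x = (SOME z. z \<in> S \<and> E x z)" for x
  have \<rho>: "\<rho> x \<in> S" "E x (\<rho> x)" if "x \<in> S" for x
  proof -
    have "x \<in> S \<and> E x x" using that by (simp add: E_def)
    from someI[of "\<lambda>z. z \<in> S \<and> E x z", OF this] show "\<rho> x \<in> S" "E x (\<rho> x)" unfolding \<rho>_def by blast+
  qed
  have E\<rho>: "\<rho> x = \<rho> z" if "E x z" for x z
    using that unfolding \<rho>_def E_def by (metis (no_types, lifting))
  have EI: "E x z" if "x \<in> S" "z \<in> S" "\<rho> x = \<rho> z" for x z
    using \<rho>(2)[OF that(1)] \<rho>(2)[OF that(2)] that(3) unfolding E_def by metis
  have \<rho>\<rho>: "\<rho> (\<rho> x) = \<rho> x" if "x \<in> S" for x using E\<rho>[OF \<rho>(2)[OF that]] by simp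
  have mem: "\<rho> x \<in> C \<longleftrightarrow> x \<in> C" if "x \<in> S" "C \<in> \<CC>" for x C
    using \<rho>(2)[OF that(1)] that(2) by (simp add: E_def)
  have ET: "E (T n x) (T n z)" if "E x z" for n x z
    unfolding E_def
  proof
    fix C assume "C \<in> \<CC>"
    then have "T (- n) ` C \<in> \<CC>" using inv by (simp add: T_def)
    then show "T n x \<in> C \<longleftrightarrow> T n z \<in> C"
      using that A.T_mem_iff[of x "- n" C] A.T_mem_iff[of z "- n" C] by (simp add: E_def T_def)
  qed
  have TS: "T n x \<in> S" if "x \<in> S" for n x using A.T_S that by (simp add: T_def S_def)
  have \<rho>T: "\<rho> (T m (\<rho> (T n x))) = \<rho> (T (m + n) x)" if "x \<in> S" for m n x
  proof -
    have "E (T m (T n x)) (T m (\<rho> (T n x)))" by (rule ET[OF \<rho>(2)[OF TS[OF that]]])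
    then show ?thesis using E\<rho> A.T_add unfolding T_def by metis
  qed
  define Z where "Z = \<rho> ` S"
  have ZS: "Z \<subseteq> S" using \<rho> by (auto simp: Z_def)
  have Z\<rho>: "\<rho> z = z" if "z \<in> Z" for z using that \<rho>\<rho> by (auto simp: Z_def)
  have \<rho>Z: "\<rho> x \<in> Z" if "x \<in> S" for x using that by (simp add: Z_def)
  \<comment> \<open>The traces of the members of the algebra serve as a base. As \<rho> becomes a
    continuous surjection from a compact onto a Hausdorff space, this is the quotient topology of
    \<open>X\<close>.\<close>
  define opn where "opn U \<longleftrightarrow> U \<subseteq> Z \<and> (\<forall>z\<in>U. \<exists>C\<in>\<CC>. z \<in> C \<and> C \<inter> Z \<subseteq> U)" for U
  have "istopology opn" unfolding istopology_def
  proof (intro conjI allI impI)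
    fix U V assume U: "opn U" "opn V"
    show "opn (U \<inter> V)" unfolding opn_def
    proof (intro conjI ballI)
      fix z assume "z \<in> U \<inter> V"
      then obtain C C' where "C \<in> \<CC>" "z \<in> C" "C \<inter> Z \<subseteq> U" "C' \<in> \<CC>" "z \<in> C'" "C' \<inter> Z \<subseteq> V"
        using U unfolding opn_def by blast
      then show "\<exists>C\<in>\<CC>. z \<in> C \<and> C \<inter> Z \<subseteq> U \<inter> V" using Int[of C C'] by (intro bexI[of _ "C \<inter> C'"]) auto
    qed (use U in \<open>auto simp: opn_def\<close>)
  next
    fix \<U> assume "\<forall>K\<in>\<U>. opn K"
    then have K: "K \<subseteq> Z" "z \<in> K \<Longrightarrow> \<exists>C\<in>\<CC>. z \<in> C \<and> C \<inter> Z \<subseteq> K" if "K \<in> \<U>" for K z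
      using that unfolding opn_def by blast+
    show "opn (\<Union>\<U>)" unfolding opn_def
    proof (intro conjI ballI)
      show "\<Union>\<U> \<subseteq> Z" using K(1) by blast
      fix z assume "z \<in> \<Union>\<U>"
      then obtain K0 where "K0 \<in> \<U>" "z \<in> K0" by blast
      then show "\<exists>C\<in>\<CC>. z \<in> C \<and> C \<inter> Z \<subseteq> \<Union>\<U>" using K(2)[of K0 z] by blast
    qed
  qed
  define W where "W = topology opn"
  have oW: "openin W = opn" unfolding W_def using \<open>istopology opn\<close> by (rule topology_inverse')
  have tW: "topspace W = Z"
  proof -
    have "opn Z" unfolding opn_def using S ZS by (auto simp: S_def)
    moreover have "U \<subseteq> Z" if "opn U" for U using that by (simp add: opn_def)
    ultimately show ?thesis unfolding topspace_def oW by blast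
  qed
  have oC: "openin W (C \<inter> Z)" if "C \<in> \<CC>" for C using that by (auto simp: oW opn_def)
  have cC: "C \<inter> Z \<in> clopens W" if "C \<in> \<CC>" for C
  proof -
    have "Z - C \<inter> Z = (topspace X - C) \<inter> Z" using ZS by (auto simp: S_def)
    then have "openin W (topspace W - C \<inter> Z)" using oC[OF Diff[OF S that]] by (simp add: tW)
    then show ?thesis using oC[OF that] by (simp add: clopens_def closedin_def tW)
  qed
  have contW: "continuous_map V W f"
    if "f \<in> topspace V \<rightarrow> Z" "\<And>C. C \<in> \<CC> \<Longrightarrow> openin V {x\<in>topspace V. f x \<in> C}" for V :: "'a topology" and f
    unfolding continuous_map_def
  proof (intro conjI allI impI)
    show "f \<in> topspace V \<rightarrow> topspace W" using that(1) tW by simp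
    fix U assume "openin W U"
    then have U: "opn U" by (simp add: oW)
    show "openin V {x \<in> topspace V. f x \<in> U}"
    proof (subst openin_subopen, intro ballI)
      fix x assume x: "x \<in> {x \<in> topspace V. f x \<in> U}"
      then obtain C where C: "C \<in> \<CC>" "f x \<in> C" "C \<inter> Z \<subseteq> U" using U unfolding opn_def by blast
      then show "\<exists>O'. openin V O' \<and> x \<in> O' \<and> O' \<subseteq> {x \<in> topspace V. f x \<in> U}"
        using that x by (intro exI[of _ "{x\<in>topspace V. f x \<in> C}"]) auto
    qed
  qed
  have c\<rho>: "continuous_map X W \<rho>"
  proof (rule contW)
    show "\<rho> \<in> topspace X \<rightarrow> Z" using \<rho>Z by (simp add: S_def)
    fix C assume C: "C \<in> \<CC>"
    have "{x\<in>topspace X. \<rho> x \<in> C} = C" using mem[OF _ C] CS[OF C] by (auto simp: S_def)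
    then show "openin X {x\<in>topspace X. \<rho> x \<in> C}" using CB C by (auto simp: clopens_def)
  qed
  have comp: "compact_space W"
    using image_compactin[OF _ c\<rho>, of "topspace X"] cantor_set_props(1)[OF A.cantor]
    by (simp add: compact_space_def tW Z_def S_def)
  have sep: "\<exists>C\<in>clopens W. x \<in> C \<and> y \<notin> C" if xy: "x \<in> topspace W" "y \<in> topspace W" "x \<noteq> y" for x y
  proof -
    have Zxy: "x \<in> Z" "y \<in> Z" using xy tW by auto
    have "\<not> E x y" using E\<rho>[of x y] Z\<rho> Zxy xy(3) by auto
    then obtain C where C: "C \<in> \<CC>" "(x \<in> C) \<noteq> (y \<in> C)" by (auto simp: E_def)
    show ?thesis
    proof (cases "x \<in> C")
      case True
      then show ?thesis using C cC[OF C(1)] Zxy by (intro bexI[of _ "C \<inter> Z"]) auto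
    next
      case False
      then show ?thesis using C cC[OF Diff[OF S C(1)]] Zxy ZS by (intro bexI[of _ "(topspace X - C) \<inter> Z"]) (auto simp: S_def)
    qed
  qed
  have haus: "Hausdorff_space W" unfolding Hausdorff_space_def
  proof (intro allI impI)
    fix x y assume "x \<in> topspace W \<and> y \<in> topspace W \<and> x \<noteq> y"
    then obtain C where C: "C \<in> clopens W" "x \<in> C" "y \<notin> C" "y \<in> topspace W" using sep by blast
    then show "\<exists>U V. openin W U \<and> openin W V \<and> x \<in> U \<and> y \<in> V \<and> disjnt U V"
      by (intro exI[of _ C] exI[of _ "topspace W - C"]) (auto simp: clopens_def disjnt_def)
  qed
  have sc: "second_countable W" unfolding second_countable_def
  proof (intro exI[of _ "(\<lambda>C. C \<inter> Z) ` \<CC>"] conjI allI impI ballI)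
    show "countable ((\<lambda>C. C \<inter> Z) ` \<CC>)"
      by (intro countable_image countable_subset[OF CB cantor_set_props(3)[OF A.cantor]])
    show "openin W V" if "V \<in> (\<lambda>C. C \<inter> Z) ` \<CC>" for V using that oC by auto
    fix U x assume U: "openin W U \<and> x \<in> U"
    then have "opn U" by (simp add: oW)
    then obtain C where C: "C \<in> \<CC>" "x \<in> C" "C \<inter> Z \<subseteq> U" "x \<in> Z" using U unfolding opn_def by blast
    then show "\<exists>V\<in>(\<lambda>C. C \<inter> Z) ` \<CC>. x \<in> V \<and> V \<subseteq> U" by (intro bexI[of _ "C \<inter> Z"]) auto
  qed
  have cT: "continuous_map W W (\<lambda>z. \<rho> (T n z))" for n
  proof (rule contW)
    show "(\<lambda>z. \<rho> (T n z)) \<in> topspace W \<rightarrow> Z" using \<rho>Z TS ZS tW by auto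
    fix C assume C: "C \<in> \<CC>"
    have "\<rho> (T n z) \<in> C \<longleftrightarrow> z \<in> T (- n) ` C" if "z \<in> Z" for z
      using mem[OF TS C, of z n] that ZS A.T_mem_iff[of z "- n" C] unfolding T_def by auto
    then have "{z\<in>Z. \<rho> (T n z) \<in> C} = T (- n) ` C \<inter> Z" by blast
    moreover have "T (- n) ` C \<in> \<CC>" using inv[OF C] by (simp add: T_def)
    ultimately show "openin W {z\<in>topspace W. \<rho> (T n z) \<in> C}" using oC tW by simp
  qed
  \<comment> \<open>The action need not preserve the chosen representatives, so it is followed by
    \<rho>.\<close>
  define \<zeta> where "\<zeta> z = \<rho> (T 1 z)" for z
  have T0: "T 0 x = x" for x unfolding T_def by (rule A.T_0)
  have hW: "homeomorphic_map W W \<zeta>" unfolding homeomorphic_map_maps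
  proof (intro exI)
    show "homeomorphic_maps W W \<zeta> (\<lambda>z. \<rho> (T (-1) z))"
      unfolding homeomorphic_maps_def \<zeta>_def tW
    proof (intro conjI ballI cT)
      fix z assume z: "z \<in> Z"
      then have "z \<in> S" using ZS by auto
      then show "\<rho> (T (- 1) (\<rho> (T 1 z))) = z" "\<rho> (T 1 (\<rho> (T (- 1) z))) = z"
        using \<rho>T[of z "-1" 1] \<rho>T[of z 1 "-1"] Z\<rho>[OF z] T0[of z] by simp_all
    qed
  qed
  note aW = act_laws[OF hW]
  have actW: "act W \<zeta> n z = \<rho> (T n z)" if z: "z \<in> Z" for n z
  proof -
    have zS: "z \<in> S" using z ZS by auto
    show ?thesis
  proof (induction n rule: int_induct[of _ 0])
    case base show ?case using aW(1) Z\<rho>[OF z] T0 by simp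
  next
    case (step1 i)
    have "act W \<zeta> (1 + i) z = \<zeta> (act W \<zeta> i z)" using aW(3)[of 1 i z] aW(5)[OF aW(2)[of z i]] z tW by simp
    then have "act W \<zeta> (1 + i) z = \<rho> (T 1 (\<rho> (T i z)))" using step1(2) by (simp only: \<zeta>_def)
    also have "\<dots> = \<rho> (T (1 + i) z)" by (rule \<rho>T[OF zS])
    finally show ?case by (simp only: add.commute)
  next
    case (step2 i)
    have w: "act W \<zeta> (i - 1) z \<in> Z" using aW(2) z tW by simp
    have "\<zeta> (act W \<zeta> (i - 1) z) = act W \<zeta> i z" using aW(3)[of 1 "i - 1" z] aW(5)[of "act W \<zeta> (i - 1) z"] w tW by simp
    then have "\<rho> (T (-1) (\<rho> (T 1 (act W \<zeta> (i - 1) z)))) = \<rho> (T (-1) (\<rho> (T i z)))" using step2 by (simp add: \<zeta>_def)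
    moreover have "act W \<zeta> (i - 1) z \<in> S" using w ZS by auto
    ultimately have "\<rho> (T (- 1 + 1) (act W \<zeta> (i - 1) z)) = \<rho> (T (- 1 + i) z)" by (simp only: \<rho>T zS)
    then show ?case by (simp add: T0 Z\<rho>[OF w])
  qed
  qed
  \<comment> \<open>The algebra contains the preimages of all clopen sets of \<open>Y\<close>, so
    \<pi> is constant on its classes and factors through the quotient.\<close>
  have pE: "\<pi> x = \<pi> z" if xz: "E x z" "x \<in> S" "z \<in> S" for x z
  proof (rule ccontr)
    assume "\<pi> x \<noteq> \<pi> z"
    then obtain V where V: "V \<in> clopens Y" "\<pi> x \<in> V" "\<pi> z \<notin> V"
      using C.sep[OF c_pi_S c_pi_S, of x z] xz(2,3) unfolding S_def by blast
    have "x \<in> {x\<in>topspace X. \<pi> x \<in> V} \<longleftrightarrow> z \<in> {x\<in>topspace X. \<pi> x \<in> V}"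
      using bspec[OF xz(1)[unfolded E_def] preim[OF V(1)]] .
    then show False using V(2,3) xz(2,3) by (simp add: S_def)
  qed
  have p\<rho>: "\<pi> (\<rho> x) = \<pi> x" if "x \<in> S" for x using pE[OF \<rho>(2)[OF that] that \<rho>(1)[OF that]] by simp
  \<comment> \<open>Freeness comes from \<open>Y\<close>: a period in the quotient would be a period
    of the image under \<pi>.\<close>
  have free: "n = 0" if z: "z \<in> topspace W" "act W \<zeta> n z = z" for z n
  proof -
    have zS: "z \<in> Z" "z \<in> S" using z(1) tW ZS by auto
    have "\<rho> (T n z) = z" using z(2) actW[OF zS(1)] by simp
    then have "\<pi> (T n z) = \<pi> z" using p\<rho>[OF TS[OF zS(2)]] by metis
    then have "act Y \<psi> n (\<pi> z) = \<pi> z" using c_pi_T zS(2) by (simp add: T_def S_def)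
    then show ?thesis using C.free c_pi_S zS(2) unfolding S_def by blast
  qed
  have ample: "ample_groupoid (transformation_groupoid W \<zeta>)"
    by (rule transformation_groupoid_ample[OF comp haus sc sep hW free])
  have f1: "factor_map A.GX (transformation_groupoid W \<zeta>) (\<lambda>(x, n). (\<rho> x, n))"
  proof (rule factor_map_transformation_groupoid[OF cantor_set_props(1)[OF A.cantor] haus homeomorphisms(1) hW c\<rho>])
    show "\<rho> ` topspace X = topspace W" by (simp add: tW Z_def S_def)
    fix x n assume x: "x \<in> topspace X"
    have "act W \<zeta> n (\<rho> x) = \<rho> (T n (\<rho> (T 0 x)))" using actW[OF \<rho>Z] x T0 by (simp add: S_def)
    also have "\<dots> = \<rho> (T n x)" using \<rho>T[of x n 0] x by (simp add: S_def)
    finally show "\<rho> (act X \<phi> n x) = act W \<zeta> n (\<rho> x)" by (simp add: T_def)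
  qed
  have c2: "continuous_map W Y \<pi>" unfolding continuous_map_def
  proof (intro conjI allI impI)
    show "\<pi> \<in> topspace W \<rightarrow> topspace Y" using c_pi_S tW ZS by (auto simp: S_def)
    fix U assume U: "openin Y U"
    show "openin W {x \<in> topspace W. \<pi> x \<in> U}"
      unfolding oW opn_def
    proof (intro conjI ballI)
      fix z assume z: "z \<in> {x \<in> topspace W. \<pi> x \<in> U}"
      then obtain V where V: "V \<in> clopens Y" "\<pi> z \<in> V" "V \<subseteq> U" using C.base[OF U] by auto
      then show "\<exists>C\<in>\<CC>. z \<in> C \<and> C \<inter> Z \<subseteq> {x \<in> topspace W. \<pi> x \<in> U}"
        using preim[OF V(1)] z tW ZS by (intro bexI[of _ "{x \<in> topspace X. \<pi> x \<in> V}"]) (auto simp: S_def)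
    qed (simp add: tW)
  qed
  have f2: "factor_map (transformation_groupoid W \<zeta>) GY (\<lambda>(x, n). (\<pi> x, n))"
  proof (rule factor_map_transformation_groupoid[OF comp cantor_set_props(2)[OF C.cantor] hW homeomorphisms(2) c2])
    show "\<pi> ` topspace W = topspace Y"
    proof
      show "\<pi> ` topspace W \<subseteq> topspace Y" using c_pi_S tW ZS by (auto simp: S_def)
      show "topspace Y \<subseteq> \<pi> ` topspace W"
      proof
        fix y assume "y \<in> topspace Y"
        then obtain x where x: "x \<in> S" "\<pi> x = y" using c_pi_onto by (auto simp: S_def)
        then have "y = \<pi> (\<rho> x)" using p\<rho> by simp
        then show "y \<in> \<pi> ` topspace W" using \<rho>Z[OF x(1)] tW by simp
      qed
    qed
    fix z n assume "z \<in> topspace W"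
    then have z: "z \<in> Z" "z \<in> S" using tW ZS by auto
    show "\<pi> (act W \<zeta> n z) = act Y \<psi> n (\<pi> z)"
      using actW[OF z(1)] p\<rho>[OF TS[OF z(2)]] c_pi_T[of z n] z(2) by (simp add: T_def S_def)
  qed
  have "\<forall>g\<in>arr A.GX. \<pi>G g = (\<lambda>(x, n). (\<pi> x, n)) ((\<lambda>(x, n). (\<rho> x, n)) g)"
    using p\<rho> by (auto simp: induced_map_eq A.arr_GX S_def)
  then have "groupoid_iso A.GX (transformation_groupoid W \<zeta>) (\<lambda>(x, n). (\<rho> x, n)) \<or>
      groupoid_iso (transformation_groupoid W \<zeta>) GY (\<lambda>(x, n). (\<pi> x, n))"
    using prime_fm ample f1 f2 unfolding prime_factor_map_def by blast
  then show ?thesis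
  proof
    \<comment> \<open>If the quotient map is injective, the algebra separates points, and two
      applications of compactness show that it contains every clopen set.\<close>
    assume "groupoid_iso A.GX (transformation_groupoid W \<zeta>) (\<lambda>(x, n). (\<rho> x, n))"
    then have inj: "inj_on \<rho> S" using groupoid_iso_inj by (simp add: S_def)
    have Un: "C \<union> D \<in> \<CC>" if "C \<in> \<CC>" "D \<in> \<CC>" for C D
    proof -
      have "C \<union> D = topspace X - ((topspace X - C) \<inter> (topspace X - D))" using CS[OF that(1)] CS[OF that(2)] by (auto simp: S_def)
      then show ?thesis using Diff[OF S Int[OF Diff[OF S that(1)] Diff[OF S that(2)]]] by simp
    qed
    have empty: "{} \<in> \<CC>" using Diff[OF S S] by simp
    have FUn: "\<Union>V \<in> \<CC>" if "finite V" "V \<subseteq> \<CC>" for V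
      using that by (induction rule: finite_induct) (auto simp: empty Un)
    have "clopens X \<subseteq> \<CC>"
    proof
      fix D assume D: "D \<in> clopens X"
      have DS: "D \<subseteq> S" using A.B_sub[OF D] by (simp add: S_def)
      have near: "\<exists>C\<in>\<CC>. x \<in> C \<and> C \<subseteq> D" if x: "x \<in> D" for x
      proof -
        define U where "U = insert D {C\<in>\<CC>. x \<notin> C}"
        have "topspace X \<subseteq> \<Union>U"
        proof
          fix z assume z: "z \<in> topspace X"
          show "z \<in> \<Union>U"
          proof (cases "z \<in> D")
            case False
            have "\<not> E x z"
            proof
              assume "E x z"
              then have "x = z" using inj_onD[OF inj E\<rho>] x z DS by (auto simp: S_def)
              then show False using x False by simp
            qed
            then obtain C where C: "C \<in> \<CC>" "(x \<in> C) \<noteq> (z \<in> C)" by (auto simp: E_def)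
            show ?thesis
            proof (cases "z \<in> C")
              case True then show ?thesis using C by (auto simp: U_def)
            next
              case False
              then show ?thesis using C Diff[OF S C(1)] z by (auto simp: U_def)
            qed
          qed (auto simp: U_def)
        qed
        moreover have "U \<subseteq> clopens X" using D CB by (auto simp: U_def)
        ultimately obtain V where V: "V \<subseteq> U" "finite V" "topspace X \<subseteq> \<Union>V" using A.cpt by meson
        have "V - {D} \<subseteq> \<CC>" using V(1) by (auto simp: U_def)
        then have "topspace X - \<Union>(V - {D}) \<in> \<CC>" using Diff[OF S FUn] V(2) by simp
        moreover have "x \<in> topspace X - \<Union>(V - {D})" using V(1) x DS by (auto simp: U_def S_def)
        moreover have "topspace X - \<Union>(V - {D}) \<subseteq> D" using V(3) by auto
        ultimately show ?thesis by blast
      qed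
      define U where "U = insert (topspace X - D) {C\<in>\<CC>. C \<subseteq> D}"
      have "topspace X - D \<in> clopens X" using A.B_Diff[OF A.S_B D] .
      then have "U \<subseteq> clopens X" using CB by (auto simp: U_def)
      moreover have "topspace X \<subseteq> \<Union>U"
      proof
        fix z assume z: "z \<in> topspace X"
        show "z \<in> \<Union>U"
        proof (cases "z \<in> D")
          case True
          then obtain C where "C \<in> \<CC>" "z \<in> C" "C \<subseteq> D" using near by blast
          then show ?thesis unfolding U_def by blast
        qed (use z in \<open>auto simp: U_def\<close>)
      qed
      ultimately obtain V where V: "V \<subseteq> U" "finite V" "topspace X \<subseteq> \<Union>V" using A.cpt by meson
      have "\<Union>(V \<inter> {C\<in>\<CC>. C \<subseteq> D}) = D"
      proof
        show "D \<subseteq> \<Union>(V \<inter> {C\<in>\<CC>. C \<subseteq> D})"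
        proof
          fix z assume z: "z \<in> D"
          then obtain C where C: "C \<in> V" "z \<in> C" using V(3) DS by (auto simp: S_def)
          then have "C \<in> \<CC> \<and> C \<subseteq> D" using V(1) z unfolding U_def by blast
          then show "z \<in> \<Union>(V \<inter> {C\<in>\<CC>. C \<subseteq> D})" using C by blast
        qed
      qed blast
      moreover have "\<Union>(V \<inter> {C\<in>\<CC>. C \<subseteq> D}) \<in> \<CC>" using V(2) by (intro FUn) auto
      ultimately show "D \<in> \<CC>" by simp
    qed
    then show ?thesis using CB by blast
  next
    \<comment> \<open>If the second map is injective, two points of one fibre have the same
      representative and so lie in the same members of the algebra.\<close>
    assume "groupoid_iso (transformation_groupoid W \<zeta>) GY (\<lambda>(x, n). (\<pi> x, n))"
    then have inj: "inj_on \<pi> Z" using groupoid_iso_inj tW by metis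
    have "x' \<in> C" if "C \<in> \<CC>" "x \<in> S" "x' \<in> S" "\<pi> x = \<pi> x'" "x \<in> C" for C x x'
    proof -
      have "\<rho> x = \<rho> x'" using inj_onD[OF inj, of "\<rho> x" "\<rho> x'"] p\<rho> \<rho>Z that by simp
      then show ?thesis using EI that unfolding E_def by blast
    qed
    then show ?thesis unfolding S_def by blast
  qed
qed

end

section \<open>Dimension groups and the tensor product\<close>

text \<open>Tensoring with the integers modulo 2 is reduction modulo 2; in multiplicative notation
  doubles are squares. In one direction, sending \<open>(a, 1)\<close> to \<open>a\<close> and
  \<open>(a, 0)\<close> to the identity maps the relations into the squares. In the other, twice the
  generator \<open>(b, 1)\<close> is equivalent both to \<open>(a, 1)\<close> for the square
  \<open>a\<close> of \<open>b\<close> and to \<open>(b, 0)\<close>, which is trivial.\<close>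

lemma trivial_tensor_iff:
  assumes Q: "comm_group Q"
  shows "trivial_group (tensor_group Q (integer_mod_group 2)) \<longleftrightarrow>
    (\<forall>a\<in>carrier Q. \<exists>b\<in>carrier Q. a = b \<otimes>\<^bsub>Q\<^esub> b)"
proof -
  interpret Q: comm_group Q by fact
  define Z where "Z = integer_mod_group 2"
  define F where "F = free_Abelian_group (carrier Q \<times> carrier Z)"
  define R where "R = tensor_relations Q Z"
  define N where "N = generate F R"
  interpret F: comm_group F unfolding F_def by (rule abelian_free_Abelian_group)
  have Z: "carrier Z = {0, 1}" "\<And>x y. x \<otimes>\<^bsub>Z\<^esub> y = (x + y) mod 2"
    unfolding Z_def by (auto simp: carrier_integer_mod_group)
  have fr: "frag_of p \<in> carrier F" if "p \<in> carrier Q \<times> carrier Z" for p using that by (simp add: F_def)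
  have Fd: "x - y \<in> carrier F" if "x \<in> carrier F" "y \<in> carrier F" for x y
    using that keys_diff[of x y] by (auto simp: F_def)
  have RF: "R \<subseteq> carrier F"
    unfolding R_def tensor_relations_def
    by (auto intro!: Fd fr Q.m_closed) (auto simp: Z)
  have N: "subgroup N F" unfolding N_def by (rule F.generate_is_subgroup[OF RF])
  have RN: "r \<in> N" if "r \<in> R" for r unfolding N_def using that by (rule generate.incl)
  have N0: "0 \<in> N" using subgroup.one_closed[OF N] by (simp add: F_def)
  have Nadd: "x + y \<in> N" if "x \<in> N" "y \<in> N" for x y using subgroup.m_closed[OF N that] by (simp add: F_def)
  have Nneg: "- x \<in> N" if "x \<in> N" for x
  proof -
    have "x \<in> carrier F" using subgroup.subset[OF N] that by auto
    then show ?thesis using subgroup.m_inv_closed[OF N that] by (simp add: F_def)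
  qed
  have Ndiff: "x - y \<in> N" if "x \<in> N" "y \<in> N" for x y using Nadd[OF that(1) Nneg[OF that(2)]] by simp
  have normal: "N \<lhd> F" by (rule F.subgroup_imp_normal[OF N])
  have "trivial_group (F Mod N) \<longleftrightarrow> carrier F \<subseteq> N"
  proof
    assume "trivial_group (F Mod N)"
    then have triv: "rcosets\<^bsub>F\<^esub> N = {N}" by (simp add: trivial_group_def FactGroup_def)
    show "carrier F \<subseteq> N"
    proof
      fix x assume x: "x \<in> carrier F"
      then have "N #>\<^bsub>F\<^esub> x = N" using triv by (auto simp: RCOSETS_def)
      then show "x \<in> N" using F.rcos_self[OF x N] by simp
    qed
  next
    assume s: "carrier F \<subseteq> N"
    then have "N = carrier F" using subgroup.subset[OF N] by auto
    then have "rcosets\<^bsub>F\<^esub> N = {N}"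
      using F.coset_join2[OF _ N] F.one_closed unfolding RCOSETS_def by auto
    then show "trivial_group (F Mod N)"
      using normal.factorgroup_is_group[OF normal] by (simp add: trivial_group_def FactGroup_def)
  qed
  moreover have "tensor_group Q (integer_mod_group 2) = F Mod N"
    by (simp add: tensor_group_def F_def N_def R_def Z_def Let_def)
  moreover have "carrier F \<subseteq> N \<longleftrightarrow> (\<forall>a\<in>carrier Q. \<exists>b\<in>carrier Q. a = b \<otimes>\<^bsub>Q\<^esub> b)"
  proof
    assume F: "carrier F \<subseteq> N"
    define f where "f p = (if snd p = 0 then \<one>\<^bsub>Q\<^esub> else fst p)" for p :: "'a \<times> int"
    have "f ` (carrier Q \<times> carrier Z) \<subseteq> carrier Q" by (auto simp: f_def)
    then obtain h where h: "h \<in> hom F Q" "\<And>x. x \<in> carrier Q \<times> carrier Z \<Longrightarrow> h (frag_of x) = f x"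
      unfolding F_def using Q.free_Abelian_group_universal by metis
    interpret h: group_hom F Q h using h(1) by (simp add: group_hom_def group_hom_axioms_def F.is_group Q.is_group)
    have hd: "h (x - y) = h x \<otimes>\<^bsub>Q\<^esub> inv\<^bsub>Q\<^esub> h y" if "x \<in> carrier F" "y \<in> carrier F" for x y
    proof -
      have "x - y = x \<otimes>\<^bsub>F\<^esub> inv\<^bsub>F\<^esub> y" using that by (simp add: F_def)
      then show ?thesis using that h.hom_mult[of x "inv\<^bsub>F\<^esub> y"] h.hom_inv[of y] by simp
    qed
    define Q2 where "Q2 = {b \<otimes>\<^bsub>Q\<^esub> b | b. b \<in> carrier Q}"
    have Q2: "subgroup Q2 Q"
    proof (rule Q.subgroupI)
      show "Q2 \<subseteq> carrier Q" by (auto simp: Q2_def)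
      show "Q2 \<noteq> {}" by (auto simp: Q2_def)
      fix a assume "a \<in> Q2"
      then obtain b where b: "b \<in> carrier Q" "a = b \<otimes>\<^bsub>Q\<^esub> b" by (auto simp: Q2_def)
      then have "inv\<^bsub>Q\<^esub> a = inv\<^bsub>Q\<^esub> b \<otimes>\<^bsub>Q\<^esub> inv\<^bsub>Q\<^esub> b" by (simp add: Q.inv_mult)
      then show "inv\<^bsub>Q\<^esub> a \<in> Q2" using b by (auto simp: Q2_def)
      fix a' assume "a' \<in> Q2"
      then obtain b' where b': "b' \<in> carrier Q" "a' = b' \<otimes>\<^bsub>Q\<^esub> b'" by (auto simp: Q2_def)
      have "a \<otimes>\<^bsub>Q\<^esub> a' = (b \<otimes>\<^bsub>Q\<^esub> b') \<otimes>\<^bsub>Q\<^esub> (b \<otimes>\<^bsub>Q\<^esub> b')" using b b' by (simp add: Q.m_ac)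
      then show "a \<otimes>\<^bsub>Q\<^esub> a' \<in> Q2" using b b' by (auto simp: Q2_def)
    qed
    have hR: "h r \<in> Q2" if "r \<in> R" for r
    proof -
      have one: "\<one>\<^bsub>Q\<^esub> \<in> Q2" using subgroup.one_closed[OF Q2] .
      from that consider
        (l) a a' b where "r = frag_of (a \<otimes>\<^bsub>Q\<^esub> a', b) - frag_of (a, b) - frag_of (a', b)" "a \<in> carrier Q" "a' \<in> carrier Q" "b \<in> carrier Z"
      | (r) a b b' where "r = frag_of (a, b \<otimes>\<^bsub>Z\<^esub> b') - frag_of (a, b) - frag_of (a, b')" "a \<in> carrier Q" "b \<in> carrier Z" "b' \<in> carrier Z"
        unfolding R_def tensor_relations_def by blast
      then show ?thesis
      proof cases
        case l
        then have "h r = f (a \<otimes>\<^bsub>Q\<^esub> a', b) \<otimes>\<^bsub>Q\<^esub> inv\<^bsub>Q\<^esub> f (a, b) \<otimes>\<^bsub>Q\<^esub> inv\<^bsub>Q\<^esub> f (a', b)"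
          by (simp add: hd Fd fr h(2))
        also have "\<dots> = \<one>\<^bsub>Q\<^esub>"
        proof (cases "b = 0")
          case False
          have "a \<otimes>\<^bsub>Q\<^esub> a' \<otimes>\<^bsub>Q\<^esub> inv\<^bsub>Q\<^esub> a \<otimes>\<^bsub>Q\<^esub> inv\<^bsub>Q\<^esub> a' = (a \<otimes>\<^bsub>Q\<^esub> inv\<^bsub>Q\<^esub> a) \<otimes>\<^bsub>Q\<^esub> (a' \<otimes>\<^bsub>Q\<^esub> inv\<^bsub>Q\<^esub> a')"
            using l(2,3) by (simp only: Q.m_ac Q.inv_closed Q.m_closed)
          then show ?thesis using False l(2,3) by (simp add: f_def)
        qed (simp add: f_def)
        finally show ?thesis using one by simp
      next
        case r
        have bb: "b \<otimes>\<^bsub>Z\<^esub> b' \<in> carrier Z" using r(3,4) by (auto simp: Z)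
        have "h r = f (a, b \<otimes>\<^bsub>Z\<^esub> b') \<otimes>\<^bsub>Q\<^esub> inv\<^bsub>Q\<^esub> f (a, b) \<otimes>\<^bsub>Q\<^esub> inv\<^bsub>Q\<^esub> f (a, b')"
          using r bb by (simp add: hd Fd fr h(2))
        also have "\<dots> \<in> Q2"
        proof (cases "b = 1 \<and> b' = 1")
          \<comment> \<open>Here the second components add up to 0 modulo 2, and the relation is
            sent to the inverse of the square of \<open>a\<close>; in all other cases it is sent to
            the identity.\<close>
          case True
          have "inv\<^bsub>Q\<^esub> a \<otimes>\<^bsub>Q\<^esub> inv\<^bsub>Q\<^esub> a \<in> Q2" using r(2) by (auto simp: Q2_def)
          then show ?thesis using True r(2) by (simp add: f_def Z)
        next
          case False
          then show ?thesis using r one by (auto simp: f_def Z)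
        qed
        finally show ?thesis .
      qed
    qed
    have "N \<subseteq> {x \<in> carrier F. h x \<in> Q2}" unfolding N_def
    proof (rule F.generate_subgroup_incl)
      show "R \<subseteq> {x \<in> carrier F. h x \<in> Q2}" using RF hR by auto
      show "subgroup {x \<in> carrier F. h x \<in> Q2} F"
        by (rule F.subgroupI) (use subgroup.one_closed[OF Q2] subgroup.m_closed[OF Q2] subgroup.m_inv_closed[OF Q2] F.one_closed h.hom_one in auto)
    qed
    then show "\<forall>a\<in>carrier Q. \<exists>b\<in>carrier Q. a = b \<otimes>\<^bsub>Q\<^esub> b"
    proof (intro ballI)
      fix a assume a: "a \<in> carrier Q"
      have "frag_of (a, 1) \<in> carrier F" using a by (intro fr) (simp add: Z)
      then have "h (frag_of (a, 1)) \<in> Q2" using F \<open>N \<subseteq> _\<close> by auto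
      then have "a \<in> Q2" using h(2)[of "(a, 1)"] a by (simp add: Z f_def)
      then show "\<exists>b\<in>carrier Q. a = b \<otimes>\<^bsub>Q\<^esub> b" by (auto simp: Q2_def)
    qed
  next
    assume Q2: "\<forall>a\<in>carrier Q. \<exists>b\<in>carrier Q. a = b \<otimes>\<^bsub>Q\<^esub> b"
    have Zr: "frag_of (a, (b + b') mod 2) - frag_of (a, b) - frag_of (a, b') \<in> N"
      if "a \<in> carrier Q" "b \<in> {0,1}" "b' \<in> {0,1}" for a b b'
    proof -
      have "frag_of (a, b \<otimes>\<^bsub>Z\<^esub> b') - frag_of (a, b) - frag_of (a, b') \<in> R"
        unfolding R_def tensor_relations_def using that Z(1) by blast
      then show ?thesis using RN by (simp add: Z(2))
    qed
    \<comment> \<open>The relation with both second components 0 is minus the generator.\<close>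
    have z: "frag_of (a, 0) \<in> N" if "a \<in> carrier Q" for a
      using Nneg[OF Zr[OF that, of 0 0]] by simp
    have o: "frag_of (a, 1) \<in> N" if a: "a \<in> carrier Q" for a
    proof -
      obtain b where b: "b \<in> carrier Q" "a = b \<otimes>\<^bsub>Q\<^esub> b" using Q2 a by blast
      have "frag_of (b \<otimes>\<^bsub>Q\<^esub> b, 1) - frag_of (b, 1) - frag_of (b, 1) \<in> N"
      proof (rule RN)
        show "frag_of (b \<otimes>\<^bsub>Q\<^esub> b, 1) - frag_of (b, 1) - frag_of (b, 1) \<in> R"
          unfolding R_def tensor_relations_def using b(1) Z(1) by blast
      qed
      note 1 = this
      have 2: "frag_of (b, 0) - frag_of (b, 1) - frag_of (b, 1) \<in> N" using Zr[OF b(1), of 1 1] by simp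
      show ?thesis using Nadd[OF Ndiff[OF 1 2] z[OF b(1)]] b(2) by simp
    qed
    show "carrier F \<subseteq> N"
    proof
      fix x assume "x \<in> carrier F"
      then have "Poly_Mapping.keys x \<subseteq> carrier Q \<times> carrier Z" by (simp add: F_def)
      then show "x \<in> N"
      proof (induction rule: frag_induction)
        case (one p)
        then show ?case using z o Z(1) by (cases p) auto
      qed (auto intro: N0 Ndiff)
    qed
  qed
  ultimately show ?thesis by simp
qed

section \<open>Cohomology modulo 2 in terms of integer functions\<close>

context clopen_system begin

lemma lconst_of_bool: "C \<in> B \<Longrightarrow> lconst (\<lambda>x. of_bool (x \<in> C) :: int)"
  by (rule lconst_comp1[OF lconst_mem])

text \<open>The coboundary of a set lifts to the integer coboundary of an indicator, and two integer
  functions of equal parity differ by a double. Conversely, the odd values of an integer transfer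
  function form a set with the wanted coboundary.\<close>

lemma cohom2_iff:
  assumes C: "C \<in> B" "C' \<in> B"
  shows "cohom2 C C' \<longleftrightarrow> (\<exists>v :: 'a \<Rightarrow> int. lconst v \<and> cobound (\<lambda>x. of_bool (x \<in> C) - of_bool (x \<in> C') - 2 * v x))"
proof
  assume "cohom2 C C'"
  then obtain V where V: "V \<in> B" "symdiff C C' = symdiff (T 1 ` V) V" by (auto simp: cohom2_def cobound2_def)
  define w :: "'a \<Rightarrow> int" where "w x = of_bool (x \<in> T 1 ` V) - of_bool (x \<in> V)" for x
  define v where "v x = (of_bool (x \<in> C) - of_bool (x \<in> C') - w x) div 2" for x
  have w: "lconst w" unfolding w_def by (intro lconst_comp2[where h = "(-)"] lconst_of_bool V T_B)
  have "lconst v" unfolding v_def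
    by (intro lconst_comp2[where h = "\<lambda>a b. (a - b) div 2"] lconst_comp2[where h = "(-)"] lconst_of_bool C w)
  moreover have "of_bool (x \<in> C) - of_bool (x \<in> C') - 2 * v x = w x" for x
  proof -
    have "(x \<in> symdiff C C') = (x \<in> symdiff (T 1 ` V) V)" using V(2) by simp
    then have "even (of_bool (x \<in> C) - of_bool (x \<in> C') - w x)" by (auto simp: w_def symdiff_mem)
    then show ?thesis by (simp add: v_def)
  qed
  moreover have "cobound w" unfolding cobound_def
  proof (intro exI conjI ballI)
    show "lconst (\<lambda>x. - of_bool (T (-1) x \<in> V) :: int)" by (rule lconst_comp1[OF lconst_T[OF lconst_mem[OF V(1)], of "-1"]])
    fix x show "w x = - of_bool (T (-1) (T 1 x) \<in> V) - - of_bool (T (-1) x \<in> V)"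
      using T_mem_iff[of x 1 V] by (simp add: w_def T_add T_0)
  qed
  ultimately show "\<exists>v :: 'a \<Rightarrow> int. lconst v \<and> cobound (\<lambda>x. of_bool (x \<in> C) - of_bool (x \<in> C') - 2 * v x)" by auto
next
  assume "\<exists>v :: 'a \<Rightarrow> int. lconst v \<and> cobound (\<lambda>x. of_bool (x \<in> C) - of_bool (x \<in> C') - 2 * v x)"
  then obtain v h :: "'a \<Rightarrow> int" where v: "lconst v" "lconst h" "\<forall>x\<in>S. of_bool (x \<in> C) - of_bool (x \<in> C') - 2 * v x = h (T 1 x) - h x"
    by (auto simp: cobound_def)
  define V where "V = {x\<in>S. odd (h x)}"
  have V: "V \<in> B" unfolding V_def by (rule lconst_Collect[OF lconst_comp1[OF v(2)]])
  have "symdiff C C' = symdiff (T (-1) ` V) V"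
  proof (rule Set.set_eqI)
    fix x
    show "x \<in> symdiff C C' \<longleftrightarrow> x \<in> symdiff (T (-1) ` V) V"
    proof (cases "x \<in> S")
      case True
      have "x \<in> T (-1) ` V \<longleftrightarrow> odd (h (T 1 x))" using T_mem_iff[of x "-1" V] True by (simp add: V_def T_S)
      moreover have "x \<in> V \<longleftrightarrow> odd (h x)" using True by (simp add: V_def)
      moreover have "odd (h (T 1 x) - h x) \<longleftrightarrow> x \<in> symdiff C C'"
        using bspec[OF v(3) True, symmetric] by (auto simp: symdiff_mem)
      ultimately show ?thesis by (auto simp: symdiff_mem)
    next
      case False
      then show ?thesis using B_sub[OF C(1)] B_sub[OF C(2)] B_sub[OF V] B_sub[OF T_B[OF V, of "-1"]] by (auto simp: symdiff_mem)
    qed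
  qed
  \<comment> \<open>The value \<open>h (T 1 x)\<close> is odd on the inverse translate of
    \<open>V\<close>, whereas \<open>cobound2\<close> uses the forward translate; so this inverse
    translate is the witness.\<close>
  moreover have "symdiff (T (-1) ` V) V = symdiff (T 1 ` T (-1) ` V) (T (-1) ` V)"
    by (simp add: T_image_image T_0_image symdiff_commute)
  ultimately show "cohom2 C C'" unfolding cohom2_def cobound2_def using T_B[OF V] by metis
qed

end

section \<open>The group \<open>H0\<close> in terms of locally constant functions\<close>

context cantor_system begin

text \<open>Locally constant functions are total here; the restriction turns them into the
  extensional representatives of \<open>CXZ\<close>.\<close>

definition H0_of :: "('a \<Rightarrow> int) \<Rightarrow> ('a \<Rightarrow> int) set" where
  "H0_of u = H0_class X \<phi> (restrict u SX)"

lemma lconst_restrict: "lconst u \<Longrightarrow> lconst (restrict u SX)"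
  by (erule lconst_cong) simp

lemma CXZ_carrier: "f \<in> carrier (CXZ X) \<longleftrightarrow> f \<in> extensional SX \<and> lconst f"
  using lconst_continuous continuous_lconst by (auto simp: CXZ_def)

lemma phi_act: "x \<in> SX \<Longrightarrow> \<phi> x = TX 1 x"
  using act_laws(5) minimal_act by (metis minimal_action_def)

lemma coboundaries_iff: "f \<in> coboundaries X \<phi> \<longleftrightarrow> f \<in> extensional SX \<and> cobound f"
proof
  assume "f \<in> coboundaries X \<phi>"
  then obtain v where v: "v \<in> carrier (CXZ X)" "f = (\<lambda>x\<in>SX. v (\<phi> x) - v x)" by (auto simp: coboundaries_def)
  then show "f \<in> extensional SX \<and> cobound f"
    unfolding cobound_def using CXZ_carrier phi_act by (auto intro!: exI[of _ v])
next
  assume f: "f \<in> extensional SX \<and> cobound f"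
  then obtain v where v: "lconst v" "\<forall>x\<in>SX. f x = v (TX 1 x) - v x" by (auto simp: cobound_def)
  have "restrict v SX \<in> carrier (CXZ X)" using CXZ_carrier lconst_restrict[OF v(1)] by simp
  moreover have "f = (\<lambda>x\<in>SX. restrict v SX (\<phi> x) - restrict v SX x)"
    by (rule extensionalityI[of _ SX]) (use f v(2) phi_act T_S in auto)
  ultimately show "f \<in> coboundaries X \<phi>" unfolding coboundaries_def by blast
qed

lemma H0_class_eq: "H0_class X \<phi> u = {g \<in> extensional SX. cobound (\<lambda>x. g x - u x)}"
proof
  show "H0_class X \<phi> u \<subseteq> {g \<in> extensional SX. cobound (\<lambda>x. g x - u x)}"
  proof
    fix g assume "g \<in> H0_class X \<phi> u"
    then obtain h where h: "h \<in> coboundaries X \<phi>" "g = (\<lambda>x\<in>SX. h x + u x)"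
      by (auto simp: H0_class_def r_coset_def CXZ_def)
    then have "cobound h" by (simp add: coboundaries_iff)
    then have "cobound (\<lambda>x. g x - u x)" by (rule cobound_cong) (simp add: h(2))
    then show "g \<in> {g \<in> extensional SX. cobound (\<lambda>x. g x - u x)}" by (simp add: h(2))
  qed
  show "{g \<in> extensional SX. cobound (\<lambda>x. g x - u x)} \<subseteq> H0_class X \<phi> u"
  proof
    fix g assume g: "g \<in> {g \<in> extensional SX. cobound (\<lambda>x. g x - u x)}"
    define h where "h = (\<lambda>x\<in>SX. g x - u x)"
    have "cobound (\<lambda>x. g x - u x)" using g by simp
    then have "cobound h" by (rule cobound_cong) (simp add: h_def)
    then have "h \<in> coboundaries X \<phi>" by (simp add: coboundaries_iff h_def)
    moreover have "g = (\<lambda>x\<in>SX. h x + u x)"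
      by (rule extensionalityI[of _ SX]) (use g in \<open>auto simp: h_def\<close>)
    ultimately show "g \<in> H0_class X \<phi> u" by (auto simp: H0_class_def r_coset_def CXZ_def)
  qed
qed

lemma H0_of_eq: "H0_of u = {g \<in> extensional SX. cobound (\<lambda>x. g x - u x)}"
  unfolding H0_of_def H0_class_eq by (auto elim!: cobound_cong)

lemma H0_class_H0_of: "H0_class X \<phi> u = H0_of u"
  unfolding H0_of_eq H0_class_eq ..

lemma H0_of_eq_iff: "H0_of u = H0_of w \<longleftrightarrow> cobound (\<lambda>x. u x - w x)"
proof
  assume e: "H0_of u = H0_of w"
  have "cobound (\<lambda>x. restrict u SX x - u x)" by (rule cobound_cong[OF cobound_0]) simp
  then have "restrict u SX \<in> H0_of u" by (simp add: H0_of_eq)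
  then have "cobound (\<lambda>x. restrict u SX x - w x)" unfolding e by (simp add: H0_of_eq)
  then show "cobound (\<lambda>x. u x - w x)" by (rule cobound_cong) simp
next
  assume c: "cobound (\<lambda>x. u x - w x)"
  have "cobound (\<lambda>x. g x - u x) \<longleftrightarrow> cobound (\<lambda>x. g x - w x)" for g
  proof
    assume "cobound (\<lambda>x. g x - u x)"
    from cobound_add[OF this c] show "cobound (\<lambda>x. g x - w x)" by simp
  next
    assume "cobound (\<lambda>x. g x - w x)"
    from cobound_diff[OF this c] show "cobound (\<lambda>x. g x - u x)" by simp
  qed
  then show "H0_of u = H0_of w" by (simp add: H0_of_eq)
qed

lemma H0_of_carrier: "carrier (H0 X \<phi>) = {H0_of u | u. lconst u}"
proof -
  have "carrier (H0 X \<phi>) = {H0_class X \<phi> f | f. f \<in> carrier (CXZ X)}"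
    unfolding H0_simps RCOSETS_def H0_class_def by blast
  also have "\<dots> = {H0_of u | u. lconst u}"
  proof (intro subset_antisym subsetI)
    fix c assume "c \<in> {H0_class X \<phi> f | f. f \<in> carrier (CXZ X)}"
    then show "c \<in> {H0_of u | u. lconst u}" using CXZ_carrier H0_class_H0_of by blast
  next
    fix c assume "c \<in> {H0_of u | u. lconst u}"
    then obtain u where u: "lconst u" "c = H0_class X \<phi> (restrict u SX)" by (auto simp: H0_of_def)
    have "restrict u SX \<in> carrier (CXZ X)" using CXZ_carrier lconst_restrict[OF u(1)] by simp
    then show "c \<in> {H0_class X \<phi> f | f. f \<in> carrier (CXZ X)}" using u(2) by blast
  qed
  finally show ?thesis .
qed

lemma H0_of_mult: "H0_of u \<otimes>\<^bsub>H0 X \<phi>\<^esub> H0_of w = H0_of (\<lambda>x. u x + w x)"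
  unfolding H0_simps
proof
  show "H0_of u <#>\<^bsub>CXZ X\<^esub> H0_of w \<subseteq> H0_of (\<lambda>x. u x + w x)"
  proof
    fix g assume "g \<in> H0_of u <#>\<^bsub>CXZ X\<^esub> H0_of w"
    then obtain h k where hk: "h \<in> H0_of u" "k \<in> H0_of w" "g = (\<lambda>x\<in>SX. h x + k x)"
      by (auto simp: set_mult_def CXZ_def)
    then have "cobound (\<lambda>x. h x - u x + (k x - w x))" by (intro cobound_add) (simp_all add: H0_of_eq)
    then have "cobound (\<lambda>x. g x - (u x + w x))" by (rule cobound_cong) (simp add: hk(3))
    then show "g \<in> H0_of (\<lambda>x. u x + w x)" by (simp add: H0_of_eq hk(3))
  qed
  show "H0_of (\<lambda>x. u x + w x) \<subseteq> H0_of u <#>\<^bsub>CXZ X\<^esub> H0_of w"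
  proof
    fix g assume g: "g \<in> H0_of (\<lambda>x. u x + w x)"
    define h where "h = (\<lambda>x\<in>SX. g x - w x)"
    define k where "k = (\<lambda>x\<in>SX. w x)"
    have "cobound (\<lambda>x. g x - (u x + w x))" using g by (simp add: H0_of_eq)
    then have "cobound (\<lambda>x. h x - u x)" by (rule cobound_cong) (simp add: h_def)
    moreover have "cobound (\<lambda>x. k x - w x)" by (rule cobound_cong[OF cobound_0]) (simp add: k_def)
    ultimately have "h \<in> H0_of u" "k \<in> H0_of w" by (simp_all add: H0_of_eq h_def k_def)
    moreover have "g = (\<lambda>x\<in>SX. h x + k x)"
      by (rule extensionalityI[of _ SX]) (use g in \<open>auto simp: H0_of_eq h_def k_def\<close>)
    then have "g = h \<otimes>\<^bsub>CXZ X\<^esub> k" by (simp add: CXZ_def)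
    ultimately show "g \<in> H0_of u <#>\<^bsub>CXZ X\<^esub> H0_of w" unfolding set_mult_def by blast
  qed
qed

end

context cantor_factor begin

lemma lconst_pull: assumes "C.lconst u" shows "A.lconst (\<lambda>x. u (\<pi> x))"
  unfolding A.lconst_def
proof
  fix x assume x: "x \<in> topspace X"
  obtain E where E: "E \<in> clopens Y" "\<pi> x \<in> E" "\<forall>z\<in>E. u z = u (\<pi> x)"
    using assms c_pi_S[OF x] C.near_ex unfolding C.lconst_def by blast
  have "A.near x (\<lambda>D. D \<subseteq> {x\<in>topspace X. \<pi> x \<in> E})" using E x by (intro A.near_subset c_pi_B) auto
  then show "A.near x (\<lambda>D. \<forall>z\<in>D. u (\<pi> z) = u (\<pi> x))" by (rule A.near_mono) (use E(3) in auto)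
qed

lemma cobound_pull: assumes "C.cobound u" shows "A.cobound (\<lambda>x. u (\<pi> x))"
proof -
  obtain v where v: "C.lconst v" "\<forall>x\<in>topspace Y. u x = v (act Y \<psi> 1 x) - v x" using assms by (auto simp: C.cobound_def)
  show ?thesis unfolding A.cobound_def
    by (intro exI[of _ "\<lambda>x. v (\<pi> x)"] conjI lconst_pull v(1)) (use v(2) c_pi_S c_pi_T in auto)
qed

lemma H0_pull_H0_of: "H0_pull X \<phi> \<pi> (C.H0_of u) = A.H0_of (\<lambda>x. u (\<pi> x))"
proof -
  have 1: "H0_class X \<phi> (\<lambda>x\<in>topspace X. f (\<pi> x)) = A.H0_of (\<lambda>x. u (\<pi> x))" if f: "f \<in> C.H0_of u" for f
  proof -
    have "C.cobound (\<lambda>x. f x - u x)" using f by (simp add: C.H0_of_eq)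
    then have "A.cobound (\<lambda>x. f (\<pi> x) - u (\<pi> x))" by (rule cobound_pull)
    then have "A.H0_of (\<lambda>x. f (\<pi> x)) = A.H0_of (\<lambda>x. u (\<pi> x))" by (simp add: A.H0_of_eq_iff)
    then show ?thesis by (simp add: A.H0_of_def)
  qed
  have "C.cobound (\<lambda>x. restrict u (topspace Y) x - u x)" by (rule C.cobound_cong[OF C.cobound_0]) simp
  then have "restrict u (topspace Y) \<in> C.H0_of u" by (simp add: C.H0_of_eq)
  then show ?thesis unfolding H0_pull_def using 1 by auto
qed

end

section \<open>The extension by \<open>Q\<close> and its meaning for functions\<close>

locale extension_realization = cantor_factor X \<phi> Y \<psi> \<pi>
  for X :: "'a topology" and \<phi> and Y :: "'b topology" and \<psi> and \<pi> +
  fixes G :: "('g, 'm) monoid_scheme" and Q :: "('q, 'n) monoid_scheme"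
    and i :: "('b \<Rightarrow> int) set \<Rightarrow> 'g" and q :: "'g \<Rightarrow> 'q" and \<alpha> :: "('a \<Rightarrow> int) set \<Rightarrow> 'g"
  assumes exact: "exact_sequence (H0 Y \<psi>) G Q i q"
    and torsion_free: "torsion_free_group Q"
    and iso: "\<alpha> \<in> iso (H0 X \<phi>) G"
    and compatible: "c \<in> carrier (H0 Y \<psi>) \<Longrightarrow> \<alpha> (H0_pull X \<phi> \<pi> c) = i c"
begin

sublocale G: comm_group G using exact by (simp add: exact_sequence_def)
sublocale Q: comm_group Q using exact by (simp add: exact_sequence_def)

text \<open>The composite of the class map, \<alpha> and \<open>q\<close>, by which statements about
  \<open>Q\<close> become statements about functions on \<open>X\<close>.\<close>

definition Q_class :: "('a \<Rightarrow> int) \<Rightarrow> 'q" where "Q_class u = q (\<alpha> (A.H0_of u))"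

lemma alpha_closed: "A.lconst u \<Longrightarrow> \<alpha> (A.H0_of u) \<in> carrier G"
  using iso A.H0_of_carrier by (auto simp: iso_def hom_def)

lemma alpha_add: "A.lconst u \<Longrightarrow> A.lconst w \<Longrightarrow> \<alpha> (A.H0_of (\<lambda>x. u x + w x)) = \<alpha> (A.H0_of u) \<otimes>\<^bsub>G\<^esub> \<alpha> (A.H0_of w)"
  using iso A.H0_of_carrier unfolding A.H0_of_mult[symmetric] iso_def hom_def by blast

lemma alpha_eq_iff:
  assumes u: "A.lconst u" and w: "A.lconst w"
  shows "\<alpha> (A.H0_of u) = \<alpha> (A.H0_of w) \<longleftrightarrow> A.cobound (\<lambda>x. u x - w x)"
proof -
  have c: "A.H0_of u \<in> carrier (H0 X \<phi>)" "A.H0_of w \<in> carrier (H0 X \<phi>)" using A.H0_of_carrier u w by blast+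
  have inj: "inj_on \<alpha> (carrier (H0 X \<phi>))" using iso by (simp add: iso_def bij_betw_def)
  show ?thesis unfolding inj_on_eq_iff[OF inj c] by (rule A.H0_of_eq_iff)
qed

lemma alpha_onto: assumes "g \<in> carrier G" shows "\<exists>u. A.lconst u \<and> g = \<alpha> (A.H0_of u)"
proof -
  have "g \<in> \<alpha> ` carrier (H0 X \<phi>)" using iso assms by (simp add: iso_def bij_betw_def)
  then show ?thesis using A.H0_of_carrier by auto
qed

lemma i_alpha: assumes w: "C.lconst w" shows "i (C.H0_of w) = \<alpha> (A.H0_of (\<lambda>x. w (\<pi> x)))"
proof -
  have "C.H0_of w \<in> carrier (H0 Y \<psi>)" using C.H0_of_carrier w by blast
  from compatible[OF this] show ?thesis unfolding H0_pull_H0_of by (rule sym)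
qed

lemma i_eq_iff:
  assumes u: "C.lconst u" and w: "C.lconst w"
  shows "i (C.H0_of u) = i (C.H0_of w) \<longleftrightarrow> C.cobound (\<lambda>x. u x - w x)"
proof -
  have c: "C.H0_of u \<in> carrier (H0 Y \<psi>)" "C.H0_of w \<in> carrier (H0 Y \<psi>)" using C.H0_of_carrier u w by blast+
  have inj: "inj_on i (carrier (H0 Y \<psi>))" using exact by (simp add: exact_sequence_def mon_def)
  show ?thesis unfolding inj_on_eq_iff[OF inj c] by (rule C.H0_of_eq_iff)
qed

lemma q_hom: "g \<in> carrier G \<Longrightarrow> q g \<in> carrier Q"
  "g \<in> carrier G \<Longrightarrow> h \<in> carrier G \<Longrightarrow> q (g \<otimes>\<^bsub>G\<^esub> h) = q g \<otimes>\<^bsub>Q\<^esub> q h"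
  using exact by (auto simp: exact_sequence_def epi_def hom_def)

lemma Q_class_closed: "A.lconst u \<Longrightarrow> Q_class u \<in> carrier Q"
  unfolding Q_class_def by (intro q_hom alpha_closed)

lemma Q_class_add: "A.lconst u \<Longrightarrow> A.lconst w \<Longrightarrow> Q_class (\<lambda>x. u x + w x) = Q_class u \<otimes>\<^bsub>Q\<^esub> Q_class w"
  unfolding Q_class_def by (simp add: alpha_add q_hom alpha_closed)

lemma Q_class_onto: assumes "a \<in> carrier Q" shows "\<exists>u. A.lconst u \<and> a = Q_class u"
proof -
  have "a \<in> q ` carrier G" using exact assms by (simp add: exact_sequence_def epi_def)
  then show ?thesis unfolding Q_class_def using alpha_onto by blast
qed

lemma Q_class_cong: "A.lconst u \<Longrightarrow> A.lconst w \<Longrightarrow> A.cobound (\<lambda>x. u x - w x) \<Longrightarrow> Q_class u = Q_class w"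
  unfolding Q_class_def using alpha_eq_iff by metis

text \<open>Exactness in terms of functions: through \<alpha>, the image of \<open>i\<close>
  consists of the classes of functions pulled back from \<open>Y\<close>.\<close>

lemma Q_class_one_iff: assumes u: "A.lconst u"
  shows "Q_class u = \<one>\<^bsub>Q\<^esub> \<longleftrightarrow> (\<exists>w. C.lconst w \<and> A.cobound (\<lambda>x. u x - w (\<pi> x)))"
proof -
  have ker: "i ` carrier (H0 Y \<psi>) = {g \<in> carrier G. q g = \<one>\<^bsub>Q\<^esub>}"
    using exact by (simp add: exact_sequence_def kernel_def)
  have "Q_class u = \<one>\<^bsub>Q\<^esub> \<longleftrightarrow> \<alpha> (A.H0_of u) \<in> i ` carrier (H0 Y \<psi>)"
    unfolding ker Q_class_def using alpha_closed[OF u] by simp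
  also have "\<dots> \<longleftrightarrow> (\<exists>w. C.lconst w \<and> \<alpha> (A.H0_of u) = i (C.H0_of w))"
    unfolding C.H0_of_carrier by blast
  also have "\<dots> \<longleftrightarrow> (\<exists>w. C.lconst w \<and> A.cobound (\<lambda>x. u x - w (\<pi> x)))"
    using i_alpha alpha_eq_iff[OF u lconst_pull] by metis
  finally show ?thesis .
qed

lemma Q_class_pull: "C.lconst w \<Longrightarrow> Q_class (\<lambda>x. w (\<pi> x)) = \<one>\<^bsub>Q\<^esub>"
  using Q_class_one_iff[OF lconst_pull, of w] A.cobound_0 by auto

lemma Q_class_double: assumes "A.lconst u" shows "Q_class (\<lambda>x. 2 * u x) = Q_class u \<otimes>\<^bsub>Q\<^esub> Q_class u"
  unfolding Q_class_add[OF assms assms, symmetric] mult_2 by (rule refl)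

lemma double_injective:
  assumes "A.lconst u" "Q_class (\<lambda>x. 2 * u x) = \<one>\<^bsub>Q\<^esub>" shows "Q_class u = \<one>\<^bsub>Q\<^esub>"
proof -
  have "Q_class u [^]\<^bsub>Q\<^esub> (2::nat) = \<one>\<^bsub>Q\<^esub>"
    using assms(2) Q_class_double[OF assms(1)] Q_class_closed[OF assms(1)] by (simp add: numeral_2_eq_2)
  then show ?thesis using torsion_free Q_class_closed[OF assms(1)] unfolding torsion_free_group_def by (metis zero_less_numeral)
qed

text \<open>Injectivity of \<open>i\<close>, transported through \<alpha>, says that pulling back is
  injective on integer cohomology.\<close>

lemma c_cobound_descends: assumes u: "C.lconst u" and c: "A.cobound (\<lambda>x. u (\<pi> x))" shows "C.cobound u"
proof -
  have z: "C.lconst (\<lambda>_. 0 :: int)" by (rule C.lconst_const)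
  have "\<alpha> (A.H0_of (\<lambda>x. u (\<pi> x))) = \<alpha> (A.H0_of (\<lambda>x. 0))"
    using alpha_eq_iff[OF lconst_pull[OF u] A.lconst_const, of 0] c by simp
  then have "i (C.H0_of u) = i (C.H0_of (\<lambda>_. 0))" using i_alpha[OF u] i_alpha[OF z] by simp
  then show ?thesis using i_eq_iff[OF u z] by simp
qed

text \<open>Upstairs the pulled back indicator of \<open>E\<close> is cohomologous to a double
  \<open>2 * v\<close>, so the class of \<open>v\<close> in \<open>Q\<close> is killed by 2 and
  vanishes. Then \<open>v\<close> is cohomologous to a pulled back \<open>w\<close>; the indicator
  of \<open>E\<close> minus \<open>2 * w\<close> is a coboundary upstairs, hence downstairs.\<close>

lemma c_cobound2_descends: assumes E: "E \<in> clopens Y" and e: "A.cobound2 {x\<in>topspace X. \<pi> x \<in> E}" shows "C.cobound2 E"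
proof -
  define e1 :: "'b \<Rightarrow> int" where "e1 y = of_bool (y \<in> E)" for y
  have e1: "C.lconst e1" unfolding e1_def by (rule C.lconst_of_bool[OF E])
  obtain v :: "'a \<Rightarrow> int" where v: "A.lconst v" "A.cobound (\<lambda>x. of_bool (x \<in> {x\<in>topspace X. \<pi> x \<in> E}) - of_bool (x \<in> {}) - 2 * v x)"
    using A.cohom2_iff[OF c_pi_B[OF E] A.B_empty] e A.cohom2_empty by blast
  from v(2) have c1: "A.cobound (\<lambda>x. e1 (\<pi> x) - 2 * v x)" by (rule A.cobound_cong) (simp add: e1_def)
  have v2: "A.lconst (\<lambda>x. 2 * v x)" by (rule A.lconst_comp1[OF v(1)])
  have "Q_class (\<lambda>x. 2 * v x) = \<one>\<^bsub>Q\<^esub>" using Q_class_cong[OF lconst_pull[OF e1] v2 c1] Q_class_pull[OF e1] by simp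
  then have "Q_class v = \<one>\<^bsub>Q\<^esub>" using double_injective v(1) by blast
  then obtain w where w: "C.lconst w" "A.cobound (\<lambda>x. v x - w (\<pi> x))" using Q_class_one_iff[OF v(1)] by blast
  from A.cobound_add[OF c1 A.cobound_add[OF w(2) w(2)]]
  have "A.cobound (\<lambda>x. (\<lambda>y. e1 y - 2 * w y) (\<pi> x))" by (rule A.cobound_cong) simp
  moreover have "C.lconst (\<lambda>y. e1 y - 2 * w y)" by (rule C.lconst_comp2[OF e1 w(1), of "\<lambda>a b. a - 2 * b"])
  ultimately have "C.cobound (\<lambda>y. e1 y - 2 * w y)" by (intro c_cobound_descends)
  then have "C.cobound (\<lambda>y. of_bool (y \<in> E) - of_bool (y \<in> {}) - 2 * w y)" by (rule C.cobound_cong) (simp add: e1_def)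
  then have "C.cohom2 E {}" using C.cohom2_iff[OF E C.B_empty] w(1) by blast
  then show ?thesis by (simp add: C.cohom2_empty)
qed

sublocale factor_system "topspace X" "act X \<phi>" "clopens X" "topspace Y" "act Y \<psi>" "clopens Y" \<pi>
proof
  show "x \<in> topspace X \<Longrightarrow> \<pi> x \<in> topspace Y" for x by (rule c_pi_S)
  show "y \<in> topspace Y \<Longrightarrow> \<exists>x\<in>topspace X. \<pi> x = y" for y by (rule c_pi_onto)
  show "x \<in> topspace X \<Longrightarrow> \<pi> (act X \<phi> n x) = act Y \<psi> n (\<pi> x)" for x n by (rule c_pi_T)
  show "E \<in> clopens Y \<Longrightarrow> {x \<in> topspace X. \<pi> x \<in> E} \<in> clopens X" for E by (rule c_pi_B)
  show "x \<in> topspace X \<Longrightarrow> x' \<in> topspace X \<Longrightarrow> x'' \<in> topspace X \<Longrightarrow> \<pi> x = \<pi> x' \<Longrightarrow> \<pi> x = \<pi> x'' \<Longrightarrow>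
    x = x' \<or> x = x'' \<or> x' = x''" for x x' x'' by (rule c_fibres)
  show "\<exists>x\<in>topspace X. \<exists>x'\<in>topspace X. x \<noteq> x' \<and> \<pi> x = \<pi> x'" by (rule c_not_inj)
  show "E \<in> clopens Y \<Longrightarrow> A.cobound2 {x \<in> topspace X. \<pi> x \<in> E} \<Longrightarrow> C.cobound2 E" for E by (rule c_cobound2_descends)
  show "C.lconst u \<Longrightarrow> A.cobound (\<lambda>x. u (\<pi> x)) \<Longrightarrow> C.cobound u" for u by (rule c_cobound_descends)
qed (rule c_prime)

lemma of_bool_odd: fixes k :: int shows "k = of_bool (odd k) + 2 * (k div 2)"
  by (cases "odd k") (auto elim!: oddE evenE)

text \<open>An integer function is the indicator of its odd values plus a double, so clopen sets
  represent all classes modulo doubles. Since pulled back functions are trivial in \<open>Q\<close>,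
  agreeing with a preimage modulo 2 corresponds to being a square in \<open>Q\<close>.\<close>

lemma halving_iff:
  "(\<forall>C\<in>clopens X. \<exists>E\<in>clopens Y. A.cohom2 C (preim E)) \<longleftrightarrow> (\<forall>a\<in>carrier Q. \<exists>b\<in>carrier Q. a = b \<otimes>\<^bsub>Q\<^esub> b)"
proof (intro iffI ballI)
  fix a assume h: "\<forall>C\<in>clopens X. \<exists>E\<in>clopens Y. A.cohom2 C (preim E)" and a: "a \<in> carrier Q"
  obtain u where u: "A.lconst u" "a = Q_class u" using Q_class_onto a by blast
  define C where "C = {x\<in>topspace X. odd (u x)}"
  have C: "C \<in> clopens X" unfolding C_def by (rule A.lconst_Collect[OF A.lconst_comp1[OF u(1)]])
  obtain E where E: "E \<in> clopens Y" "A.cohom2 C (preim E)" using h C by blast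
  obtain v :: "'a \<Rightarrow> int" where v: "A.lconst v" "A.cobound (\<lambda>x. of_bool (x \<in> C) - of_bool (x \<in> preim E) - 2 * v x)"
    using A.cohom2_iff[OF C preim_B[OF E(1)]] E(2) by blast
  define e1 :: "'b \<Rightarrow> int" where "e1 y = of_bool (y \<in> E)" for y
  have e1: "C.lconst e1" unfolding e1_def by (rule C.lconst_of_bool[OF E(1)])
  define w where "w x = u x div 2 + v x" for x
  have w: "A.lconst w" unfolding w_def by (rule A.lconst_comp2[OF u(1) v(1), of "\<lambda>a b. a div 2 + b"])
  from v(2) have "A.cobound (\<lambda>x. u x - (e1 (\<pi> x) + 2 * w x))"
  proof (rule A.cobound_cong)
    fix x assume x: "x \<in> topspace X"
    have "u x = of_bool (x \<in> C) + 2 * (u x div 2)" using of_bool_odd[of "u x"] x by (simp add: C_def)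
    then show "of_bool (x \<in> C) - of_bool (x \<in> preim E) - 2 * v x = u x - (e1 (\<pi> x) + 2 * w x)"
      using x by (simp add: e1_def w_def preim_def)
  qed
  moreover have w2: "A.lconst (\<lambda>x. 2 * w x)" by (rule A.lconst_comp1[OF w])
  moreover have "A.lconst (\<lambda>x. e1 (\<pi> x) + 2 * w x)" by (rule A.lconst_comp2[OF lconst_pull[OF e1] w2])
  ultimately have "Q_class u = Q_class (\<lambda>x. e1 (\<pi> x) + 2 * w x)" using Q_class_cong u(1) by blast
  also have "\<dots> = Q_class w \<otimes>\<^bsub>Q\<^esub> Q_class w"
    using Q_class_add[OF lconst_pull[OF e1] w2] Q_class_pull[OF e1] Q_class_double[OF w] Q_class_closed[OF w] by simp
  finally show "\<exists>b\<in>carrier Q. a = b \<otimes>\<^bsub>Q\<^esub> b" using u(2) Q_class_closed[OF w] by blast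
next
  fix C assume h: "\<forall>a\<in>carrier Q. \<exists>b\<in>carrier Q. a = b \<otimes>\<^bsub>Q\<^esub> b" and C: "C \<in> clopens X"
  define u :: "'a \<Rightarrow> int" where "u x = of_bool (x \<in> C)" for x
  have u: "A.lconst u" unfolding u_def by (rule A.lconst_of_bool[OF C])
  obtain b where b: "b \<in> carrier Q" "Q_class u = b \<otimes>\<^bsub>Q\<^esub> b" using h Q_class_closed[OF u] by blast
  obtain w where w: "A.lconst w" "b = Q_class w" using Q_class_onto b by blast
  \<comment> \<open>\<open>d\<close> is trivial in \<open>Q\<close>, hence cohomologous to a pulled
    back function \<open>v\<close>; the odd values of \<open>v\<close> give the required clopen
    set.\<close>
  define d where "d x = u x - 2 * w x" for x
  have d: "A.lconst d" unfolding d_def by (rule A.lconst_comp2[OF u w(1), of "\<lambda>a b. a - 2 * b"])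
  have w2: "A.lconst (\<lambda>x. 2 * w x)" by (rule A.lconst_comp1[OF w(1)])
  have "Q_class u = Q_class d \<otimes>\<^bsub>Q\<^esub> Q_class (\<lambda>x. 2 * w x)" using Q_class_add[OF d w2] by (simp add: d_def)
  then have "Q_class d \<otimes>\<^bsub>Q\<^esub> (b \<otimes>\<^bsub>Q\<^esub> b) = b \<otimes>\<^bsub>Q\<^esub> b" using Q_class_double[OF w(1)] w(2) b(2) by simp
  then have "Q_class d = \<one>\<^bsub>Q\<^esub>" using Q_class_closed[OF d] b(1) by (simp add: Q.r_cancel_one)
  then obtain v where v: "C.lconst v" "A.cobound (\<lambda>x. d x - v (\<pi> x))" using Q_class_one_iff[OF d] by blast
  define E where "E = {y\<in>topspace Y. odd (v y)}"
  have E: "E \<in> clopens Y" unfolding E_def by (rule C.lconst_Collect[OF C.lconst_comp1[OF v(1)]])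
  define k where "k x = w x + v (\<pi> x) div 2" for x
  have k: "A.lconst k" unfolding k_def by (rule A.lconst_comp2[OF w(1) lconst_pull[OF v(1)], of "\<lambda>a b. a + b div 2"])
  from v(2) have "A.cobound (\<lambda>x. of_bool (x \<in> C) - of_bool (x \<in> preim E) - 2 * k x)"
  proof (rule A.cobound_cong)
    fix x assume x: "x \<in> topspace X"
    have "v (\<pi> x) = of_bool (x \<in> preim E) + 2 * (v (\<pi> x) div 2)"
      using of_bool_odd[of "v (\<pi> x)"] x c_pi_S[OF x] by (simp add: E_def preim_def)
    then show "d x - v (\<pi> x) = of_bool (x \<in> C) - of_bool (x \<in> preim E) - 2 * k x"
      by (simp add: d_def u_def k_def)
  qed
  then have "A.cohom2 C (preim E)" using A.cohom2_iff[OF C preim_B[OF E]] k by blast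
  then show "\<exists>E\<in>clopens Y. A.cohom2 C (preim E)" using E by blast
qed

text \<open>An arrow \<open>(x, n)\<close> over an arrow of the graph of \<open>f\<close> has its
  source over the source of that arrow, and \<open>n\<close> is the displacement there; so the
  preimage of the graph of \<open>f\<close> is the graph of the lift.\<close>

lemma full_group_pull_unit_map:
  assumes f: "f \<in> C.F" shows "full_group_pull A.GX GY \<pi>G (C.unit_map f) = A.unit_map (lift f)"
proof -
  have "{g \<in> arr A.GX. \<pi>G g \<in> C.graph f} = A.graph (lift f)"
  proof (intro subset_antisym subsetI)
    fix g assume "g \<in> {g \<in> arr A.GX. \<pi>G g \<in> C.graph f}"
    then obtain x n where g: "g = (x, n)" "x \<in> topspace X" "(\<pi> x, n) \<in> C.graph f" by (auto simp: A.arr_GX induced_map_eq)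
    then obtain y where y: "y \<in> topspace Y" "\<pi> x = f y" "n = C.disp f y" by (auto simp: C.graph_def)
    define z where "z = act X \<phi> (- n) x"
    have z: "z \<in> topspace X" using A.T_S g(2) by (simp add: z_def)
    have "\<pi> z = act Y \<psi> (- n) (act Y \<psi> n y)" using c_pi_T[OF g(2)] y C.F_disp[OF f y(1)] by (simp add: z_def)
    then have pz: "\<pi> z = y" by (simp add: C.T_add C.T_0)
    have "lift f z = x" using z pz y(3) by (simp add: lift_def z_def A.T_add A.T_0)
    moreover have "A.disp (lift f) z = n" using disp_lift[OF z] pz y(3) by simp
    ultimately show "g \<in> A.graph (lift f)" using z g(1) unfolding A.graph_def by blast
  next
    fix g assume "g \<in> A.graph (lift f)"
    then obtain z where z: "z \<in> topspace X" "g = (lift f z, A.disp (lift f) z)" by (auto simp: A.graph_def)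
    have "\<pi>G g = (f (\<pi> z), C.disp f (\<pi> z))" using z pi_lift[OF f z(1)] disp_lift[OF z(1)] by (simp add: induced_map_eq)
    then show "g \<in> {g \<in> arr A.GX. \<pi>G g \<in> C.graph f}"
      using z(2) lift_S[OF z(1)] c_pi_S[OF z(1)] by (auto simp: A.arr_GX C.graph_def)
  qed
  then show ?thesis
    unfolding full_group_pull_def C.theta_inverse[OF f] using A.graph_full(2)[OF lift_F[OF f]] by simp
qed

lemma pull_image: "K \<subseteq> C.F \<Longrightarrow> full_group_pull A.GX GY \<pi>G ` (C.unit_map ` K) = A.unit_map ` (lift ` K)"
  unfolding image_image using full_group_pull_unit_map by (intro image_cong) auto

theorem full_group_maximal_iff:
  "maximal_subgroup (full_group_pull A.GX GY \<pi>G ` carrier (full_group GY)) (full_group A.GX) \<longleftrightarrow>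
    trivial_group (tensor_group Q (integer_mod_group 2))"
proof -
  have "lift ` C.F \<subseteq> A.F" using lift_F by auto
  then have "maximal_subgroup (full_group_pull A.GX GY \<pi>G ` carrier (full_group GY)) (full_group A.GX) \<longleftrightarrow>
      A.maximal_in (lift ` C.F) A.F"
    unfolding C.full_group_carrier pull_image[OF subset_refl] by (rule A.maximal_full_group)
  also have "\<dots> \<longleftrightarrow> (\<forall>C\<in>clopens X. \<exists>E\<in>clopens Y. A.cohom2 C (preim E))"
    using lift_F_maximal_if lift_F_maximal_only_if by blast
  also have "\<dots> \<longleftrightarrow> trivial_group (tensor_group Q (integer_mod_group 2))"
    unfolding halving_iff trivial_tensor_iff[OF Q.comm_group_axioms] ..
  finally show ?thesis .
qed

theorem commutator_maximal:
  "maximal_subgroup (full_group_pull A.GX GY \<pi>G ` carrier (commutator_full_group GY)) (commutator_full_group A.GX)"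
proof -
  have DF: "C.D \<subseteq> C.F" using C.D_F by blast
  have D: "carrier (commutator_full_group GY) = C.unit_map ` C.D"
    by (simp add: commutator_full_group_def C.derived_full_group)
  have "lift ` C.D \<subseteq> A.F" using DF lift_F by auto
  from A.maximal_commutator_full_group[OF this] show ?thesis
    unfolding D pull_image[OF DF] using lift_D_maximal by (rule iffD2)
qed

end

theorem theorem4p2:
  fixes X :: "'a topology" and \<phi> :: "'a \<Rightarrow> 'a"
    and Y :: "'b topology" and \<psi> :: "'b \<Rightarrow> 'b"
    and G :: "'g ordered_group" and Q :: "'q monoid"
    and i :: "('b \<Rightarrow> int) set \<Rightarrow> 'g" and q :: "'g \<Rightarrow> 'q"
    and \<pi> :: "'a \<Rightarrow> 'b" and \<alpha> :: "('a \<Rightarrow> int) set \<Rightarrow> 'g"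
  defines "GX \<equiv> transformation_groupoid X \<phi>"
    and "GY \<equiv> transformation_groupoid Y \<psi>"
    and "\<pi>G \<equiv> induced_factor_map \<pi>"
  assumes "cantor_set Y" and "minimal_action Y \<psi>"
    and "exact_sequence (H0 Y \<psi>) G Q i q"
    and "\<not> trivial_group Q" and "countable (carrier Q)" and "torsion_free_group Q"
    and "simple_dimension_group G"
    and "order_embedding (H0 Y \<psi>) G i"
    and "order_dense G (i ` carrier (H0 Y \<psi>))"
    and "cantor_set X" and "minimal_action X \<phi>"
    and "equivariant_map X \<phi> Y \<psi> \<pi>" and "almost_one_to_one X Y \<pi>"
    and "order_isomorphism (H0 X \<phi>) G \<alpha>"
    and "\<forall>c\<in>carrier (H0 Y \<psi>). \<alpha> (H0_pull X \<phi> \<pi> c) = i c"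
    and "prime_factor_map GX GY \<pi>G" and "at_most_two_to_one GX GY \<pi>G"
  shows "(maximal_subgroup (full_group_pull GX GY \<pi>G ` carrier (full_group GY)) (full_group GX)
            \<longleftrightarrow> trivial_group (tensor_group Q (integer_mod_group 2)))
       \<and> maximal_subgroup (full_group_pull GX GY \<pi>G ` carrier (commutator_full_group GY))
            (commutator_full_group GX)"
proof -
  interpret extension_realization X \<phi> Y \<psi> \<pi> G Q i q \<alpha>
    by unfold_locales (use assms in \<open>auto simp: order_isomorphism_def\<close>)
  show ?thesis unfolding GX_def GY_def \<pi>G_def
    using full_group_maximal_iff commutator_maximal by blast
qed

end
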